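(* Let $\Lambda$ be a stationary point process in $\mathbb C$ having a finite second moment, defined on $(\Omega,\mathcal F,\mathbb P)$, with spectral measure $\rho_\Lambda$ and conditional intensity $\mathfrak c_\Lambda=\pi^{-1}\mathbb E[n_\Lambda(\mathbb D)\mid\mathcal F_{\sf inv}]$. Let $\zeta_\Lambda$ be the random meromorphic function \[ \zeta_\Lambda(z)=\sum_{|\lambda|<1}\frac1{z-\lambda}+\sum_{|\lambda|\ge 1}\Big(\frac1{z-\lambda}+\frac1\lambda+\frac{z}{\lambda^2}\Big)-\Psi_2(\infty)\,z, \] where the sums are over $\lambda\in\Lambda$ and $\Psi_2(\infty)$ is the $L^2(\Omega,\mathbb P)$-limit of $\sum_{\lambda\in\Lambda,\,1\le|\lambda|\le R}\lambda^{-2}$ as $R\to\infty$. Then the following are equivalent: (a) $\int_{\{0<|\xi|\le1\}}|\xi|^{-2}\,{\rm d}\rho_\Lambda(\xi)<\infty$; (b) the sums $\Psi_1(R)=\sum_{\lambda\in\Lambda,\,1\le|\lambda|\le R}\lambda^{-1}$ converge in $L^2(\Omega,\mathbb P)$, as $R\to\infty$, to a limit $\Psi_1(\infty)$; (c) for some random constant $\Psi\in L^2(\Omega,\mathbb P)$, the random field $z\mapsto\zeta_\Lambda(z)-\Psi-\pi\mathfrak c_\Lambda\bar z$ is stationary.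
   Context: A point process $\Lambda$ in $\mathbb C$ is stationary if its distribution is invariant under translations; it has finite second moment if $\mathbb E[n_\Lambda(B)^2]<\infty$ for every bounded Borel $B$, where $n_\Lambda=\sum_{\lambda\in\Lambda}\delta_\lambda$; $n_\Lambda(\varphi)=\sum_{\lambda}\varphi(\lambda)$. The spectral measure $\rho_\Lambda$ is the non-negative locally finite measure with ${\sf Cov}[n_\Lambda(\varphi),n_\Lambda(\psi)]=\int\widehat\varphi\,\overline{\widehat\psi}\,{\rm d}\rho_\Lambda$ for all compactly supported smooth $\varphi,\psi$, with $\widehat\varphi(\xi)=\int_{\mathbb C}e^{-2\pi{\rm i}\,\xi\cdot x}\varphi(x)\,{\rm d}m(x)$. $\mathbb D$ is the unit disk and $\mathcal F_{\sf inv}$ the sigma-algebra of translation-invariant events. Under the hypotheses, $\Psi_2(R)$ converges in $L^2$ and $\zeta_\Lambda$ is well defined. A random field is stationary if its finite-dimensional distributions are translation invariant. *)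

theory Defs
  imports "HOL-Probability.Probability"
begin

text \<open>A (not necessarily simple) configuration of points in the complex plane is encoded
  by its multiplicity function \<open>\<mu> :: complex \<Rightarrow> nat\<close>; a point process is a random
  configuration \<open>N :: 'w \<Rightarrow> complex \<Rightarrow> nat\<close> on a probability space.\<close>

definition supp_cfg :: "(complex \<Rightarrow> nat) \<Rightarrow> complex set" where
  "supp_cfg \<mu> = {z. 0 < \<mu> z}"

definition cnt :: "(complex \<Rightarrow> nat) \<Rightarrow> complex set \<Rightarrow> nat" where
  "cnt \<mu> B = (\<Sum>z\<in>supp_cfg \<mu> \<inter> B. \<mu> z)"

definition lin_stat :: "(complex \<Rightarrow> nat) \<Rightarrow> (complex \<Rightarrow> complex) \<Rightarrow> complex" where
  "lin_stat \<mu> \<phi> = (\<Sum>z\<in>{z\<in>supp_cfg \<mu>. \<phi> z \<noteq> 0}. of_nat (\<mu> z) * \<phi> z)"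

definition locally_finite_cfg :: "(complex \<Rightarrow> nat) \<Rightarrow> bool" where
  "locally_finite_cfg \<mu> \<longleftrightarrow> (\<forall>r. finite (supp_cfg \<mu> \<inter> cball 0 r))"

definition point_process :: "'w measure \<Rightarrow> ('w \<Rightarrow> complex \<Rightarrow> nat) \<Rightarrow> bool" where
  "point_process M N \<longleftrightarrow> prob_space M \<and>
     (\<forall>\<omega>\<in>space M. locally_finite_cfg (N \<omega>)) \<and>
     (\<forall>B. B \<in> sets borel \<and> bounded B \<longrightarrow>
        (\<lambda>\<omega>. cnt (N \<omega>) B) \<in> measurable M (count_space UNIV))"

text \<open>stationarity: the joint laws of counts are invariant under translation
  (the law of \<open>\<Lambda>+w\<close> equals that of \<open>\<Lambda>\<close>; note \<open>n_{\<Lambda>}((+) w ` B) = n_{\<Lambda>-w}(B)\<close>).\<close>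
definition stationary_pp :: "'w measure \<Rightarrow> ('w \<Rightarrow> complex \<Rightarrow> nat) \<Rightarrow> bool" where
  "stationary_pp M N \<longleftrightarrow>
     (\<forall>(k::nat) (B::nat \<Rightarrow> complex set) (w::complex).
        (\<forall>i<k. B i \<in> sets borel \<and> bounded (B i)) \<longrightarrow>
        distr M (PiM {..<k} (\<lambda>_. count_space UNIV)) (\<lambda>\<omega>. \<lambda>i\<in>{..<k}. cnt (N \<omega>) (B i))
      = distr M (PiM {..<k} (\<lambda>_. count_space UNIV)) (\<lambda>\<omega>. \<lambda>i\<in>{..<k}. cnt (N \<omega>) ((+) w ` B i)))"

definition finite_second_moment :: "'w measure \<Rightarrow> ('w \<Rightarrow> complex \<Rightarrow> nat) \<Rightarrow> bool" where
  "finite_second_moment M N \<longleftrightarrow>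
     (\<forall>B. B \<in> sets borel \<and> bounded B \<longrightarrow> integrable M (\<lambda>\<omega>. (real (cnt (N \<omega>) B))\<^sup>2))"

fun iter_pd :: "complex list \<Rightarrow> (complex \<Rightarrow> complex) \<Rightarrow> complex \<Rightarrow> complex" where
  "iter_pd [] f = f"
| "iter_pd (v # vs) f = (\<lambda>x. vector_derivative (\<lambda>t::real. iter_pd vs f (x + of_real t * v)) (at 0))"

definition smooth_fun :: "(complex \<Rightarrow> complex) \<Rightarrow> bool" where
  "smooth_fun f \<longleftrightarrow>
     (\<forall>vs. set vs \<subseteq> {1, \<i>} \<longrightarrow> continuous_on UNIV (iter_pd vs f)) \<and>
     (\<forall>vs v x. set vs \<subseteq> {1, \<i>} \<longrightarrow> v \<in> {1, \<i>} \<longrightarrow>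
        ((\<lambda>t::real. iter_pd vs f (x + of_real t * v)) has_vector_derivative iter_pd (v # vs) f x) (at 0))"

definition test_fun :: "(complex \<Rightarrow> complex) \<Rightarrow> bool" where
  "test_fun f \<longleftrightarrow> smooth_fun f \<and> bounded {x. f x \<noteq> 0}"

definition fourier :: "(complex \<Rightarrow> complex) \<Rightarrow> complex \<Rightarrow> complex" where
  "fourier \<phi> \<xi> = (\<integral>x. exp (- 2 * pi * \<i> * of_real (\<xi> \<bullet> x)) * \<phi> x \<partial>lborel)"

definition ccov :: "'w measure \<Rightarrow> ('w \<Rightarrow> complex) \<Rightarrow> ('w \<Rightarrow> complex) \<Rightarrow> complex" where
  "ccov M X Y = (\<integral>\<omega>. (X \<omega> - (\<integral>\<omega>'. X \<omega>' \<partial>M)) * cnj (Y \<omega> - (\<integral>\<omega>'. Y \<omega>' \<partial>M)) \<partial>M)"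

definition spectral_measure :: "'w measure \<Rightarrow> ('w \<Rightarrow> complex \<Rightarrow> nat) \<Rightarrow> complex measure \<Rightarrow> bool" where
  "spectral_measure M N \<rho> \<longleftrightarrow> sets \<rho> = sets borel \<and>
     (\<forall>K. compact K \<longrightarrow> emeasure \<rho> K < \<infinity>) \<and>
     (\<forall>\<phi> \<psi>. test_fun \<phi> \<longrightarrow> test_fun \<psi> \<longrightarrow>
        integrable \<rho> (\<lambda>\<xi>. fourier \<phi> \<xi> * cnj (fourier \<psi> \<xi>)) \<and>
        ccov M (\<lambda>\<omega>. lin_stat (N \<omega>) \<phi>) (\<lambda>\<omega>. lin_stat (N \<omega>) \<psi>)
          = (\<integral>\<xi>. fourier \<phi> \<xi> * cnj (fourier \<psi> \<xi>) \<partial>\<rho>))"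

definition cfg_sets :: "(complex \<Rightarrow> nat) set set" where
  "cfg_sets = sigma_sets UNIV {{\<mu>. cnt \<mu> B = k} | B k. B \<in> sets borel \<and> bounded B}"

definition shift_cfg :: "complex \<Rightarrow> (complex \<Rightarrow> nat) \<Rightarrow> complex \<Rightarrow> nat" where
  "shift_cfg w \<mu> = (\<lambda>z. \<mu> (z - w))"

definition F_inv :: "'w measure \<Rightarrow> ('w \<Rightarrow> complex \<Rightarrow> nat) \<Rightarrow> 'w measure" where
  "F_inv M N = sigma (space M)
     {{\<omega>\<in>space M. N \<omega> \<in> A} | A. A \<in> cfg_sets \<and> (\<forall>w \<mu>. shift_cfg w \<mu> \<in> A \<longleftrightarrow> \<mu> \<in> A)}"

definition cond_intensity :: "'w measure \<Rightarrow> ('w \<Rightarrow> complex \<Rightarrow> nat) \<Rightarrow> 'w \<Rightarrow> real" where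
  "cond_intensity M N \<omega> = real_cond_exp M (F_inv M N) (\<lambda>\<omega>. real (cnt (N \<omega>) (ball 0 1))) \<omega> / pi"

definition Psi :: "nat \<Rightarrow> ('w \<Rightarrow> complex \<Rightarrow> nat) \<Rightarrow> real \<Rightarrow> 'w \<Rightarrow> complex" where
  "Psi k N R \<omega> = (\<Sum>z\<in>{z\<in>supp_cfg (N \<omega>). 1 \<le> norm z \<and> norm z \<le> R}. of_nat (N \<omega> z) / z ^ k)"

definition L2 :: "'w measure \<Rightarrow> ('w \<Rightarrow> complex) \<Rightarrow> bool" where
  "L2 M Y \<longleftrightarrow> Y \<in> borel_measurable M \<and> integrable M (\<lambda>\<omega>. (norm (Y \<omega>))\<^sup>2)"

definition L2_tendsto :: "'w measure \<Rightarrow> (real \<Rightarrow> 'w \<Rightarrow> complex) \<Rightarrow> ('w \<Rightarrow> complex) \<Rightarrow> bool" where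
  "L2_tendsto M X Y \<longleftrightarrow> L2 M Y \<and>
     (\<forall>\<^sub>F R in at_top. L2 M (X R)) \<and>
     ((\<lambda>R. \<integral>\<omega>. (norm (X R \<omega> - Y \<omega>))\<^sup>2 \<partial>M) \<longlongrightarrow> 0) at_top"

text \<open>\<open>\<zeta>_\<Lambda>\<close>, given (a version of) the \<open>L^2\<close>-limit \<open>\<Psi>_2(\<infinity>)\<close>\<close>
definition zeta :: "('w \<Rightarrow> complex \<Rightarrow> nat) \<Rightarrow> ('w \<Rightarrow> complex) \<Rightarrow> complex \<Rightarrow> 'w \<Rightarrow> complex" where
  "zeta N Psi2 z \<omega> =
     (\<Sum>l\<in>{l\<in>supp_cfg (N \<omega>). norm l < 1}. of_nat (N \<omega> l) / (z - l))
   + (\<Sum>\<^sub>\<infinity>l\<in>{l. 1 \<le> norm l}. of_nat (N \<omega> l) * (1 / (z - l) + 1 / l + z / l\<^sup>2))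
   - Psi2 \<omega> * z"

definition stationary_field :: "'w measure \<Rightarrow> (complex \<Rightarrow> 'w \<Rightarrow> complex) \<Rightarrow> bool" where
  "stationary_field M F \<longleftrightarrow>
     (\<forall>(k::nat) (zs::nat \<Rightarrow> complex) (w::complex).
        distr M (PiM {..<k} (\<lambda>_. borel)) (\<lambda>\<omega>. \<lambda>i\<in>{..<k}. F (zs i) \<omega>)
      = distr M (PiM {..<k} (\<lambda>_. borel)) (\<lambda>\<omega>. \<lambda>i\<in>{..<k}. F (zs i + w) \<omega>))"

end

(*
  (a) implies (b): Psi_1(R) - Psi_1(S) is the linear statistic of 1/x on an annulus, whose Fourier
  transform is (i/xi) (J_0(2 pi R |xi|) - J_0(2 pi S |xi|)), so the Cauchy property in L^2 is read off
  the spectral measure.  (b) implies (c): cut the series for zeta off with (1 - |x|^2/R^2)_+; under a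
  translation by w the cutoff changes the sum by an average over a large disc, which the mean ergodic
  theorem sends to - pi c cnj w.  (c) implies (a): the average of the stationary field over a disc of
  radius R is bounded in L^2 uniformly in R, and the difference of two such averages is a linear
  statistic whose Fourier transform behaves like 1/|xi| near 0; Fatou's lemma gives (a).
*)
theory Submission
  imports Defs
begin

text \<open>The spectral identity is given for smooth test functions only, while the kernels that
  matter jump at circles. It is extended to bounded Borel functions of bounded support by
  approximating at once in the second moment of the linear statistic and in \<open>L1\<close> of the
  plane: the latter makes Fourier transforms converge pointwise, so that Fatou applies on the
  spectral side. The mean ergodic theorem comes from the same identity, because dilation of a kernel
  concentrates its Fourier transform at frequency 0. To recognise its limit as a conditional
  expectation, a version is built that is invariant on every configuration and not only almost
  surely. The second obstacle is the pole: the Cauchy kernel is locally integrable in the plane but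
  not locally square integrable. Hence the field is approximated in \<open>L1\<close> through
  Campbell's formula, and in the converse direction second moments are taken only after integration
  over a unit disc. The parabolic cutoff is the weight produced by averaging the Cauchy kernel over
  a disc. It is also an average of sharp cutoffs, which links it to the sums in (b) and to the
  kernels on annuli.\<close>

abbreviation bmeas :: "'a measure => ('a => 'b::topological_space) set" where
 "bmeas K == borel_measurable K"

lemmas BI_integrable_add = Bochner_Integration.integrable_add
 and BI_integrable_bound = Bochner_Integration.integrable_bound
 and BI_integrable_cong = Bochner_Integration.integrable_cong
 and BI_integrable_diff = Bochner_Integration.integrable_diff
 and BI_integral_add = Bochner_Integration.integral_add
 and BI_integral_cnj = Bochner_Integration.integral_cnj
 and BI_integral_cong = Bochner_Integration.integral_cong
 and BI_integral_diff = Bochner_Integration.integral_diff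
 and BI_integral_sum = Bochner_Integration.integral_sum

abbreviation (input) seq_lim :: "(nat => 'a::topological_space) => 'a => bool" (infixr "---->" 60) where
 "X ----> L == (X \<longlongrightarrow> L) sequentially"

section \<open>Lebesgue measure on the plane: translations, rotations, polar coordinates\<close>

lemma emeasure_disc:
 "r >= 0 ==> emeasure lborel (cball (c::complex) r) = ennreal (pi * r\<^sup>2)"
 by (simp add: emeasure_cball unit_ball_vol_numeral)

lemma nn_integral_lborel_translate:
 fixes f :: "'a::euclidean_space => ennreal"
 assumes [measurable]: "f : bmeas borel"
 shows "(\<integral>\<^sup>+x. f (a + x) \<partial>lborel) = (\<integral>\<^sup>+x. f x \<partial>lborel)"
proof -
 have "(\<integral>\<^sup>+x. f x \<partial>lborel) = (\<integral>\<^sup>+x. f x \<partial>distr lborel borel ((+) a))"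
 by (simp add: lborel_distr_plus)
 also have "... = (\<integral>\<^sup>+x. f (a + x) \<partial>lborel)"
 by (subst nn_integral_distr) auto
 finally show ?thesis by simp
qed

lemma lborel_distr_reflect:
 "distr lborel borel (%x. a - x) = (lborel :: 'a::euclidean_space measure)"
 using lborel_affine[of "-1" a] by (simp add: density_1)

lemma nn_integral_lborel_reflect:
 fixes f :: "'a::euclidean_space => ennreal"
 assumes [measurable]: "f : bmeas borel"
 shows "(\<integral>\<^sup>+x. f (a - x) \<partial>lborel) = (\<integral>\<^sup>+x. f x \<partial>lborel)"
proof -
 have "(\<integral>\<^sup>+x. f x \<partial>lborel) = (\<integral>\<^sup>+x. f x \<partial>distr lborel borel (%x. a - x))"
 by (simp add: lborel_distr_reflect)
 also have "... = (\<integral>\<^sup>+x. f (a - x) \<partial>lborel)"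
 by (subst nn_integral_distr) auto
 finally show ?thesis by simp
qed

text \<open>Uniqueness of Lebesgue measure up to a factor, in a form that avoids division.\<close>
lemma translation_invariant_nn_integral:
 fixes \<nu> :: "'a::euclidean_space measure"
 assumes "sigma_finite_measure \<nu>" and [measurable_cong]: "sets \<nu> = sets borel"
 and inv: "!!a. distr \<nu> borel ((+) a) = \<nu>"
 and [measurable]: "f : bmeas borel" "g : bmeas borel"
 shows "(\<integral>\<^sup>+x. f x \<partial>\<nu>) * (\<integral>\<^sup>+x. g x \<partial>lborel) = (\<integral>\<^sup>+x. g x \<partial>\<nu>) * (\<integral>\<^sup>+x. f x \<partial>lborel)"
proof -
 interpret \<nu>: sigma_finite_measure \<nu> by fact
 interpret pair_sigma_finite \<nu> lborel ..
 have shift: "(\<integral>\<^sup>+x. h x \<partial>\<nu>) = (\<integral>\<^sup>+x. h (a + x) \<partial>\<nu>)"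
 if [measurable]: "h : bmeas borel" for h :: "'a => ennreal" and a
 proof -
 have "(\<integral>\<^sup>+x. h x \<partial>\<nu>) = (\<integral>\<^sup>+x. h x \<partial>distr \<nu> borel ((+) a))" by (simp add: inv)
 also have "... = (\<integral>\<^sup>+x. h (a + x) \<partial>\<nu>)" by (subst nn_integral_distr) auto
 finally show ?thesis .
 qed
 have "(\<integral>\<^sup>+x. f x \<partial>\<nu>) * (\<integral>\<^sup>+x. g x \<partial>lborel) = (\<integral>\<^sup>+x. f x * (\<integral>\<^sup>+y. g y \<partial>lborel) \<partial>\<nu>)"
 by (simp add: nn_integral_multc)
 \<comment> \<open>The constant integral of \<open>g\<close> is written as an integral over all
   translates of \<open>g\<close>; after the exchange of integrals the translation can be moved from
   \<open>g\<close> to \<open>f\<close>.\<close>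
 also have "... = (\<integral>\<^sup>+x. (\<integral>\<^sup>+y. f x * g (x + y) \<partial>lborel) \<partial>\<nu>)"
 by (intro nn_integral_cong) (simp add: nn_integral_cmult nn_integral_lborel_translate)
 also have "... = (\<integral>\<^sup>+y. (\<integral>\<^sup>+x. f x * g (x + y) \<partial>\<nu>) \<partial>lborel)"
 by (rule Fubini'[symmetric]) measurable
 also have "... = (\<integral>\<^sup>+y. (\<integral>\<^sup>+x. f (x - y) * g x \<partial>\<nu>) \<partial>lborel)"
 proof (rule nn_integral_cong)
 fix y :: 'a
 show "(\<integral>\<^sup>+x. f x * g (x + y) \<partial>\<nu>) = (\<integral>\<^sup>+x. f (x - y) * g x \<partial>\<nu>)"
 using shift[of "%x. f x * g (x + y)" "- y"] by (simp add: algebra_simps)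
 qed
 also have "... = (\<integral>\<^sup>+x. (\<integral>\<^sup>+y. f (x - y) * g x \<partial>lborel) \<partial>\<nu>)"
 by (rule Fubini') measurable
 also have "... = (\<integral>\<^sup>+x. g x * (\<integral>\<^sup>+y. f y \<partial>lborel) \<partial>\<nu>)"
 by (intro nn_integral_cong, subst nn_integral_multc)
 (simp_all add: nn_integral_lborel_reflect mult.commute)
 also have "... = (\<integral>\<^sup>+x. g x \<partial>\<nu>) * (\<integral>\<^sup>+x. f x \<partial>lborel)"
 by (simp add: nn_integral_multc)
 finally show ?thesis .
qed

lemma sigma_finite_cballs:
 fixes \<nu> :: "complex measure"
 assumes "sets \<nu> = sets borel" "!!r. emeasure \<nu> (cball 0 r) ~= \<infinity>"
 shows "sigma_finite_measure \<nu>"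
proof
 have "space \<nu> = UNIV" using sets_eq_imp_space_eq[OF assms(1)] by simp
 moreover have "(\<Union>n. cball (0::complex) (real n)) = UNIV"
 using real_arch_simple by auto
 ultimately show "\<exists>A. countable A \<and> A \<subseteq> sets \<nu> \<and> \<Union> A = space \<nu> \<and> (\<forall>a\<in>A. emeasure \<nu> a ~= \<infinity>)"
 using assms by (intro exI[of _ "range (%n. cball 0 (real n))"]) auto
qed

text \<open>The image measure is again translation invariant, hence proportional to Lebesgue
  measure, and the factor is 1 because the unit disc is mapped to itself. No determinant is
  computed.\<close>

lemma lborel_distr_rotate:
 fixes u :: complex
 assumes u: "norm u = 1"
 shows "distr lborel borel (%x. u * x) = lborel"
proof -
 let ?\<nu> = "distr lborel borel (%x. u * x)"
 have u0: "u ~= 0" using u by auto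
 have ball: "emeasure ?\<nu> (cball 0 r) = emeasure lborel (cball (0::complex) r)" for r
 by (subst emeasure_distr) (auto simp: vimage_def norm_mult u cball_def)
 have sf: "sigma_finite_measure ?\<nu>"
 by (rule sigma_finite_cballs) (use emeasure_lborel_cball_finite[of "0::complex"] in \<open>auto simp: ball less_top[symmetric]\<close>)
 have inv: "distr ?\<nu> borel ((+) a) = ?\<nu>" for a
 proof -
 have "distr ?\<nu> borel ((+) a) = distr lborel borel (%x. a + u * x)"
 by (subst distr_distr) (auto simp: comp_def)
 also have "... = distr lborel borel ((%x. u * x) \<circ> (+) (a / u))"
 by (rule distr_cong) (auto simp: u0 field_simps)
 also have "... = distr (distr lborel borel ((+) (a / u))) borel (%x. u * x)"
 by (subst distr_distr) auto
 finally show ?thesis by (simp add: lborel_distr_plus)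
 qed
 show ?thesis
 proof (rule measure_eqI)
 fix A :: "complex set" assume "A : sets ?\<nu>"
 then have A[measurable]: "A : sets borel" by simp
 have "(\<integral>\<^sup>+x. indicator A x \<partial>?\<nu>) * (\<integral>\<^sup>+x. indicator (cball (0::complex) 1) x \<partial>lborel)
 = (\<integral>\<^sup>+x. indicator (cball 0 1) x \<partial>?\<nu>) * (\<integral>\<^sup>+x. indicator A x \<partial>lborel)"
 by (rule translation_invariant_nn_integral) (auto simp: sf inv intro!: borel_measurable_indicator)
 then have "emeasure ?\<nu> A * ennreal pi = ennreal pi * emeasure lborel A"
 by (simp add: ball emeasure_disc)
 then show "emeasure ?\<nu> A = emeasure lborel A"
 unfolding mult.commute[of "emeasure ?\<nu> A"] by (simp add: ennreal_mult_cancel_left)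
 qed simp
qed

lemma nn_integral_lborel_rotate:
 fixes u :: complex
 assumes [measurable]: "f : bmeas borel" and u: "norm u = 1"
 shows "(\<integral>\<^sup>+x. f (u * x) \<partial>lborel) = (\<integral>\<^sup>+x. f x \<partial>lborel)"
proof -
 have "(\<integral>\<^sup>+x. f x \<partial>lborel) = (\<integral>\<^sup>+x. f x \<partial>distr lborel borel (%x. u * x))"
 by (simp add: lborel_distr_rotate u)
 also have "... = (\<integral>\<^sup>+x. f (u * x) \<partial>lborel)"
 by (subst nn_integral_distr) auto
 finally show ?thesis by simp
qed

text \<open>Half-lines are a generator stable under intersection, and on \<open>{..a}\<close> both
  measures give the area of a disc; \<open>max a 0\<close> covers the empty disc of negative
  radius.\<close>

lemma lborel_distr_norm_complex:
 "distr lborel borel (norm :: complex => real)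
 = density lborel (%r. ennreal (2 * pi * r) * indicator {0..} r)"  (is "?mu = ?\<nu>")
proof (rule measure_eqI_generator_eq[where E="range (%a::real. {..a})" and \<Omega>=UNIV and A="%n. {..real n}"])
 show "Int_stable (range (%a::real. {..a}))"
 by (auto simp: Int_stable_def)
 show "sets ?mu = sigma_sets UNIV (range (%a::real. {..a}))"
 by (simp add: borel_eq_atMost)
 show "sets ?\<nu> = sigma_sets UNIV (range (%a::real. {..a}))"
 by (simp add: borel_eq_atMost)
 have mu: "emeasure ?mu {..a} = ennreal (pi * (max a 0)\<^sup>2)" for a
 proof -
 have "emeasure ?mu {..a} = emeasure lborel (cball (0::complex) a)"
 by (subst emeasure_distr) (auto simp: vimage_def cball_def)
 then show ?thesis by (cases "a >= 0") (auto simp: emeasure_disc max_def)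
 qed
 have nu: "emeasure ?\<nu> {..a} = ennreal (pi * (max a 0)\<^sup>2)" for a
 proof -
 have "emeasure ?\<nu> {..a} = (\<integral>\<^sup>+r. ennreal (2 * pi * r) * indicator {0..a} r \<partial>lborel)"
 by (subst emeasure_density) (auto intro!: nn_integral_cong simp: indicator_def)
 also have "... = ennreal (pi * (max a 0)\<^sup>2)"
 proof (cases "a >= 0")
 case True
 then have "(\<integral>\<^sup>+r. ennreal (2 * pi * r) * indicator {0..a} r \<partial>lborel) = ennreal (pi * a\<^sup>2 - pi * 0\<^sup>2)"
 by (intro nn_integral_FTC_Icc) (auto intro!: derivative_eq_intros)
 then show ?thesis using True by (simp add: max_def)
 qed auto
 finally show ?thesis .
 qed
 show "!!X. X : range (%a::real. {..a}) ==> emeasure ?mu X = emeasure ?\<nu> X"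
 by (auto simp: mu nu)
 show "(\<Union>i. {..real i}) = UNIV" using real_arch_simple by auto
 show "!!i. emeasure ?mu {..real i} ~= \<infinity>" by (simp add: mu)
qed auto

lemma nn_integral_radial:
 fixes g :: "real => ennreal"
 assumes [measurable]: "g : bmeas borel"
 shows "(\<integral>\<^sup>+x. g (norm (x::complex)) \<partial>lborel) = (\<integral>\<^sup>+r. ennreal (2 * pi * r) * indicator {0..} r * g r \<partial>lborel)"
proof -
 have "(\<integral>\<^sup>+x. g (norm (x::complex)) \<partial>lborel) = (\<integral>\<^sup>+r. g r \<partial>distr lborel borel (norm :: complex => real))"
 by (subst nn_integral_distr) auto
 also have "... = (\<integral>\<^sup>+r. ennreal (2 * pi * r) * indicator {0..} r * g r \<partial>lborel)"
 unfolding lborel_distr_norm_complex by (subst nn_integral_density) auto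
 finally show ?thesis .
qed

text \<open>The part of the shifted interval beyond \<open>p\<close> is moved back by one period. In
  polar coordinates this absorbs the argument of a point into the angular average.\<close>

lemma nn_integral_periodic_shift:
 fixes F :: "real => ennreal"
 assumes [measurable]: "F : bmeas borel" and per: "!!t. F (t + p) = F t"
 and \<alpha>: "0 <= \<alpha>" "\<alpha> <= p"
 shows "(\<integral>\<^sup>+t\<in>{0..<p}. F (\<alpha> + t) \<partial>lborel) = (\<integral>\<^sup>+t\<in>{0..<p}. F t \<partial>lborel)"
proof -
 have "(\<integral>\<^sup>+t\<in>{0..<p}. F (\<alpha> + t) \<partial>lborel) = (\<integral>\<^sup>+t. F (\<alpha> + t) * indicator {\<alpha>..<\<alpha> + p} (\<alpha> + t) \<partial>lborel)"
 by (intro nn_integral_cong) (auto simp: indicator_def)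
 also have "... = (\<integral>\<^sup>+t. F t * indicator {\<alpha>..<\<alpha> + p} t \<partial>lborel)"
 by (rule nn_integral_lborel_translate[of "%t. F t * indicator {\<alpha>..<\<alpha> + p} t"]) measurable
 also have "... = (\<integral>\<^sup>+t. F t * indicator {\<alpha>..<p} t + F t * indicator {p..<p + \<alpha>} t \<partial>lborel)"
 using \<alpha> by (intro nn_integral_cong) (auto simp: indicator_def)
 also have "... = (\<integral>\<^sup>+t. F t * indicator {\<alpha>..<p} t \<partial>lborel) + (\<integral>\<^sup>+t. F t * indicator {p..<p + \<alpha>} t \<partial>lborel)"
 by (rule nn_integral_add) measurable
 also have "(\<integral>\<^sup>+t. F t * indicator {p..<p + \<alpha>} t \<partial>lborel)
 = (\<integral>\<^sup>+t. F (p + t) * indicator {p..<p + \<alpha>} (p + t) \<partial>lborel)"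
 by (rule nn_integral_lborel_translate[of "%t. F t * indicator {p..<p + \<alpha>} t", symmetric]) measurable
 also have "... = (\<integral>\<^sup>+t. F t * indicator {0..<\<alpha>} t \<partial>lborel)"
 using per by (intro nn_integral_cong) (auto simp: indicator_def add.commute)
 also have "(\<integral>\<^sup>+t. F t * indicator {\<alpha>..<p} t \<partial>lborel) + (\<integral>\<^sup>+t. F t * indicator {0..<\<alpha>} t \<partial>lborel)
 = (\<integral>\<^sup>+t. F t * indicator {\<alpha>..<p} t + F t * indicator {0..<\<alpha>} t \<partial>lborel)"
 by (rule nn_integral_add[symmetric]) measurable
 also have "... = (\<integral>\<^sup>+t\<in>{0..<p}. F t \<partial>lborel)"
 using \<alpha> by (intro nn_integral_cong) (auto simp: indicator_def)
 finally show ?thesis .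
qed

lemma nn_integral_Ico_eq_Icc:
 fixes g :: "real => ennreal"
 shows "(\<integral>\<^sup>+t\<in>{a..<b}. g t \<partial>lborel) = (\<integral>\<^sup>+t\<in>{a..b}. g t \<partial>lborel)"
proof (rule nn_integral_cong_AE)
 show "AE t in lborel. g t * indicator {a..<b} t = g t * indicator {a..b} t"
 using AE_lborel_singleton[of b] by eventually_elim (auto simp: indicator_def)
qed

text \<open>The measure \<open>r dr dth\<close>, given as a density so that its image in the plane
  can be formed. The closed angular interval counts the positive real axis twice, which is a null
  set.\<close>

definition polar_measure :: "(real \<times> real) measure" where
 "polar_measure = density (lborel \<Otimes>\<^sub>M lborel)
 (%(r, th). ennreal r * indicator {0..} r * indicator {0..2 * pi} th)"

text \<open>Instead of a Jacobian, rotation invariance is used: the integral is averaged over all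
  rotations, and after exchanging the integrals the inner angular average depends on the modulus of
  \<open>x\<close> only, so the radial formula applies.\<close>

lemma nn_integral_polar:
 fixes f :: "complex => ennreal"
 assumes [measurable]: "f : bmeas borel"
 shows "(\<integral>\<^sup>+x. f x \<partial>lborel)
 = (\<integral>\<^sup>+r. ennreal r * indicator {0..} r * (\<integral>\<^sup>+th\<in>{0..2*pi}. f (of_real r * cis th) \<partial>lborel) \<partial>lborel)"
proof -
 define H where "H r = (\<integral>\<^sup>+th\<in>{0..<2*pi}. f (of_real r * cis th) \<partial>lborel)" for r :: real
 have [measurable]: "cis : bmeas borel"
 by (intro borel_measurable_continuous_onI continuous_intros)
 have [measurable]: "H : bmeas borel" unfolding H_def by measurable
 have "ennreal (2 * pi) * (\<integral>\<^sup>+x. f x \<partial>lborel)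
 = (\<integral>\<^sup>+th\<in>{0..<2*pi}. (\<integral>\<^sup>+x. f x \<partial>lborel) \<partial>lborel)"
 by (simp add: nn_integral_cmult_indicator mult.commute)
 also have "... = (\<integral>\<^sup>+th. (\<integral>\<^sup>+x. f (cis th * x) * indicator {0..<2*pi} th \<partial>lborel) \<partial>lborel)"
 by (intro nn_integral_cong) (simp add: nn_integral_multc nn_integral_lborel_rotate)
 also have "... = (\<integral>\<^sup>+x. (\<integral>\<^sup>+th. f (cis th * x) * indicator {0..<2*pi} th \<partial>lborel) \<partial>lborel)"
 by (rule lborel_pair.Fubini') measurable
 also have "... = (\<integral>\<^sup>+x. H (norm (x::complex)) \<partial>lborel)"
 proof (rule nn_integral_cong)
 fix x :: complex
 have x: "x = of_real (norm x) * cis (Arg2pi x)"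
 using Arg2pi_eq[of x] by (simp add: cis_conv_exp)
 have "(\<integral>\<^sup>+th. f (cis th * x) * indicator {0..<2*pi} th \<partial>lborel)
 = (\<integral>\<^sup>+th\<in>{0..<2*pi}. f (of_real (norm x) * cis (Arg2pi x + th)) \<partial>lborel)"
 by (subst (1) x) (simp add: cis_mult[symmetric] mult_ac)
 also have "... = H (norm x)"
 unfolding H_def
 by (rule nn_integral_periodic_shift[of "%th. f (of_real (norm x) * cis th)"])
 (use Arg2pi_ge_0[of x] Arg2pi_lt_2pi[of x] in \<open>auto simp flip: cis_mult\<close>)
 finally show "(\<integral>\<^sup>+th. f (cis th * x) * indicator {0..<2*pi} th \<partial>lborel) = H (norm x)" .
 qed
 also have "... = (\<integral>\<^sup>+r. ennreal (2 * pi) * (ennreal r * indicator {0..} r * H r) \<partial>lborel)"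
 by (subst nn_integral_radial) (auto intro!: nn_integral_cong simp: indicator_def ennreal_mult' mult_ac)
 also have "... = ennreal (2 * pi) * (\<integral>\<^sup>+r. ennreal r * indicator {0..} r * H r \<partial>lborel)"
 by (rule nn_integral_cmult) measurable
 finally show ?thesis
 unfolding H_def nn_integral_Ico_eq_Icc by (simp add: ennreal_mult_cancel_left)
qed

lemma measurable_cis [measurable]: "cis : bmeas borel"
 by (intro borel_measurable_continuous_onI continuous_intros)

text \<open>As an identity of measures, the formula for nonnegative functions carries over to
  complex Bochner integrals.\<close>

lemma lborel_eq_distr_polar:
 "lborel = distr polar_measure borel (%(r, th). of_real r * cis th :: complex)"
proof (rule measure_eqI)
 fix A :: "complex set" assume "A : sets lborel"
 then have [measurable]: "A : sets borel" by simp
 have [measurable_cong]: "sets polar_measure = sets (lborel \<Otimes>\<^sub>M lborel)"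
 by (simp add: polar_measure_def)
 have "emeasure (distr polar_measure borel (%(r, th). of_real r * cis th :: complex)) A
 = (\<integral>\<^sup>+x. indicator A x \<partial>distr polar_measure borel (%(r, th). of_real r * cis th :: complex))"
 by simp
 also have "... = (\<integral>\<^sup>+z. (case z of (r, th) => indicator A (of_real r * cis th)) \<partial>polar_measure)"
 by (subst nn_integral_distr) (auto simp: case_prod_unfold)
 also have "... = (\<integral>\<^sup>+z. (case z of (r, th) => ennreal r * indicator {0..} r * indicator {0..2 * pi} th *
 indicator A (of_real r * cis th)) \<partial>(lborel \<Otimes>\<^sub>M lborel))"
 unfolding polar_measure_def by (subst nn_integral_density) (auto simp: case_prod_unfold)
 also have "... = (\<integral>\<^sup>+r. \<integral>\<^sup>+th. ennreal r * indicator {0..} r * indicator {0..2 * pi} th *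
 indicator A (of_real r * cis th) \<partial>lborel \<partial>lborel)"
 by (subst lborel.nn_integral_fst[symmetric]) auto
 also have "... = (\<integral>\<^sup>+r. ennreal r * indicator {0..} r * (\<integral>\<^sup>+th\<in>{0..2*pi}. indicator A (of_real r * cis th) \<partial>lborel) \<partial>lborel)"
 by (intro nn_integral_cong, subst nn_integral_cmult[symmetric]) (auto intro!: nn_integral_cong simp: mult_ac)
 also have "... = (\<integral>\<^sup>+x. indicator A x \<partial>lborel)"
 by (rule nn_integral_polar[symmetric]) measurable
 finally show "emeasure lborel A = emeasure (distr polar_measure borel (%(r, th). of_real r * cis th :: complex)) A"
 by simp
qed simp

lemma integral_lborel_rotate:
 fixes f :: "complex => complex"
 assumes u: "norm u = 1" and [measurable]: "f : bmeas borel"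
 shows "(\<integral>x. f (u * x) \<partial>lborel) = (\<integral>x. f x \<partial>lborel)"
proof -
 have "(\<integral>x. f x \<partial>lborel) = (\<integral>x. f x \<partial>distr lborel borel (%x. u * x))"
 by (simp add: lborel_distr_rotate u)
 also have "... = (\<integral>x. f (u * x) \<partial>lborel)"
 by (subst integral_distr) auto
 finally show ?thesis by simp
qed

abbreviation polar_density :: "real => real => real" where
 "polar_density r th \<equiv> r * indicator {0..} r * indicator {0..2 * pi} th"

lemma polar_measure_real:
 "polar_measure = density (lborel \<Otimes>\<^sub>M lborel) (%z. ennreal (polar_density (fst z) (snd z)))"
 unfolding polar_measure_def
 by (rule arg_cong2[where f=density]) (auto simp: fun_eq_iff indicator_def)

lemma integrable_polar:
 fixes f :: "complex => complex"
 assumes "integrable lborel f"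
 shows "integrable (lborel \<Otimes>\<^sub>M lborel) (%z. polar_density (fst z) (snd z) *\<^sub>R f (of_real (fst z) * cis (snd z)))"
proof -
 have f[measurable]: "f : bmeas borel" using assms by auto
 have "integrable (distr polar_measure borel (%(r, th). of_real r * cis th :: complex)) f"
 using assms lborel_eq_distr_polar by simp
 then have "integrable polar_measure (%z. f (of_real (fst z) * cis (snd z)))"
 by (subst (asm) integrable_distr_eq) (auto simp: polar_measure_def case_prod_unfold)
 then show ?thesis
 unfolding polar_measure_real by (subst (asm) integrable_density) (auto simp: indicator_def)
qed

lemma integral_polar:
 fixes f :: "complex => complex"
 assumes [measurable]: "f : bmeas borel"
 shows "(\<integral>x. f x \<partial>lborel)
 = (\<integral>z. polar_density (fst z) (snd z) *\<^sub>R f (of_real (fst z) * cis (snd z)) \<partial>(lborel \<Otimes>\<^sub>M lborel))"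
proof -
 have "(\<integral>x. f x \<partial>lborel) = (\<integral>x. f x \<partial>distr polar_measure borel (%(r, th). of_real r * cis th :: complex))"
 using lborel_eq_distr_polar by simp
 also have "... = (\<integral>z. f (of_real (fst z) * cis (snd z)) \<partial>polar_measure)"
 by (subst integral_distr) (auto simp: polar_measure_def case_prod_unfold)
 also have "... = (\<integral>z. polar_density (fst z) (snd z) *\<^sub>R f (of_real (fst z) * cis (snd z)) \<partial>(lborel \<Otimes>\<^sub>M lborel))"
 unfolding polar_measure_real by (subst integral_density) (auto simp: indicator_def)
 finally show ?thesis .
qed

section \<open>The Bessel function J_0 at 2 pi t as an angular average, and Cauchy kernels on
  circles and discs\<close>

definition bessel0 :: "real => complex" where
 "bessel0 t = (\<integral>th. indicator {0..2*pi} th *\<^sub>R cis (- (2 * pi * t * cos th)) \<partial>lborel) / (2 * pi)"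

lemma integrable_Icc_bounded:
 fixes f :: "real => complex"
 assumes "f : bmeas borel" "!!t. norm (f t) <= B"
 shows "integrable lborel (%t. indicator {a..b} t *\<^sub>R f t)"
 by (rule integrableI_bounded_set_indicator[where B=B])
 (use assms in \<open>auto simp: emeasure_lborel_Icc_eq\<close>)

lemma norm_integral_Icc_le:
 fixes f :: "real => complex"
 assumes [measurable]: "f : bmeas borel" and B: "!!t. t : {a..b} ==> norm (f t) <= B" and "a <= b" "0 <= B"
 shows "norm (\<integral>t. indicator {a..b} t *\<^sub>R f t \<partial>lborel) <= B * (b - a)"
proof -
 have i: "integrable lborel (%t. indicator {a..b} t *\<^sub>R f t)"
 by (rule integrableI_bounded_set_indicator[where B=B])
 (use B in \<open>auto simp: emeasure_lborel_Icc_eq\<close>)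
 have "norm (\<integral>t. indicator {a..b} t *\<^sub>R f t \<partial>lborel) <= (\<integral>t. norm (indicator {a..b} t *\<^sub>R f t) \<partial>lborel)"
 by (rule integral_norm_bound)
 also have "... <= (\<integral>t. B * indicator {a..b} t \<partial>lborel)"
 proof (rule integral_mono[OF integrable_norm[OF i]])
 show "integrable lborel (%t. B * indicator {a..b} t)"
 by (intro integrable_mult_right integrable_real_indicator) (auto simp: emeasure_lborel_Icc_eq)
 qed (use B in \<open>auto simp: indicator_def\<close>)
 also have "... = B * (b - a)" using assms by simp
 finally show ?thesis .
qed

lemma measurable_bessel0 [measurable]: "bessel0 : bmeas borel"
 unfolding bessel0_def by measurable

lemma norm_bessel0_le_1: "norm (bessel0 t) <= 1"
 using norm_integral_Icc_le[of "%th. cis (- (2 * pi * t * cos th))" 0 "2*pi" 1]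
 by (simp add: bessel0_def norm_divide divide_le_eq)

lemma norm_cis_minus_1_le: "norm (cis x - 1) <= \<bar>x\<bar>"
proof -
 have "norm (iexp x - (\<Sum>k\<le>0. (\<i> * x) ^ k / fact k)) <= \<bar>x\<bar> ^ Suc 0 / fact (Suc 0)"
 by (rule iexp_approx1)
 then show ?thesis by (simp add: cis_conv_exp)
qed

lemma norm_bessel0_minus_1_le: "norm (bessel0 t - 1) <= 2 * pi * \<bar>t\<bar>"
proof -
 have "bessel0 t - 1 = (\<integral>th. indicator {0..2*pi} th *\<^sub>R (cis (- (2 * pi * t * cos th)) - 1) \<partial>lborel) / (2 * pi)"
 proof -
 have "(\<integral>th. indicator {0..2*pi} th *\<^sub>R (cis (- (2 * pi * t * cos th)) - 1) \<partial>lborel)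
 = (\<integral>th. indicator {0..2*pi} th *\<^sub>R cis (- (2 * pi * t * cos th)) \<partial>lborel)
 - (\<integral>th. indicator {0..2*pi} th *\<^sub>R 1 \<partial>lborel)"
 unfolding scaleR_diff_right
 by (intro BI_integral_diff integrable_Icc_bounded[where B=1]) auto
 also have "(\<integral>th. indicator {0..2*pi} th *\<^sub>R (1::complex) \<partial>lborel) = 2 * pi"
 by (subst integral_scaleR_left) (auto simp: scaleR_conv_of_real)
 finally show ?thesis by (simp add: bessel0_def diff_divide_distrib)
 qed
 moreover have "norm (cis (- (2 * pi * t * cos th)) - 1) <= 2 * pi * \<bar>t\<bar>" for th
 proof -
 have "\<bar>2 * pi * t * cos th\<bar> <= 2 * pi * \<bar>t\<bar> * 1"
 unfolding abs_mult by (intro mult_mono) auto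
 then show ?thesis using norm_cis_minus_1_le[of "- (2 * pi * t * cos th)"] by simp
 qed
 ultimately show ?thesis
 using norm_integral_Icc_le[of "%th. cis (- (2 * pi * t * cos th)) - 1" 0 "2*pi" "2 * pi * \<bar>t\<bar>"]
 by (simp add: norm_divide divide_le_eq)
qed

lemma integral_cis_multiple:
 assumes "k ~= 0"
 shows "(\<integral>th. indicator {0..2*pi} th *\<^sub>R cis (of_int k * th) \<partial>lborel) = 0"
proof -
 have "(\<integral>th. indicator {0..2*pi} th *\<^sub>R cis (of_int k * th) \<partial>lborel)
 = cis (of_int k * (2*pi)) / (\<i> * of_int k) - cis (of_int k * 0) / (\<i> * of_int k)"
 proof (rule integral_FTC_Icc)
 show "((%th. cis (of_int k * th) / (\<i> * of_int k)) has_vector_derivative cis (of_int k * x)) (at x within {0..2*pi})" for x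
 unfolding cis_conv_exp using assms
 by (auto intro!: derivative_eq_intros has_vector_derivative_real_field simp: field_simps)
 qed (auto intro!: continuous_intros)
 also have "cis (of_int k * (2*pi)) = 1"
 using cis_multiple_2pi[of "of_int k"] by (simp add: mult.commute)
 finally show ?thesis by simp
qed


text \<open>A geometric sum stopped at \<open>n\<close> leaves an explicit remainder of size
  \<open>norm a ^ Suc n / (1 - norm a)\<close>, and only the constant term survives the integration;
  no infinite sum is exchanged with the integral.\<close>

lemma integral_cis_geometric:
 fixes a :: complex
 assumes na: "norm a < 1"
 shows "(\<integral>th. indicator {0..2*pi} th *\<^sub>R (1 / (1 - a * cis th)) \<partial>lborel) = 2 * pi"
proof -
 have ne: "norm (1 - a * cis th) >= 1 - norm a" for th
 using norm_triangle_ineq2[of 1 "a * cis th"] by (simp add: norm_mult)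
 have ne0: "1 - a * cis th ~= 0" for th
 using ne[of th] na by auto
 let ?I = "%f. \<integral>th. indicator {0..2*pi} th *\<^sub>R f th \<partial>lborel :: complex"
 have bound: "norm (?I (%th. 1 / (1 - a * cis th)) - 2 * pi) <= norm a ^ Suc n / (1 - norm a) * (2 * pi)" for n
 proof -
 have geo: "1 / (1 - a * cis th) = (\<Sum>k<Suc n. a ^ k * cis (of_int (int k) * th)) + a ^ Suc n * cis (real (Suc n) * th) / (1 - a * cis th)" for th
 proof -
 have "(\<Sum>k<Suc n. a ^ k * cis (of_int (int k) * th)) = (\<Sum>k<Suc n. (a * cis th) ^ k)"
 by (simp only: power_mult_distrib Complex.DeMoivre of_int_of_nat_eq)
 also have "... = (1 - (a * cis th) ^ Suc n) / (1 - a * cis th)"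
 using ne0[of th] by (subst sum_gp_strict) auto
 finally show ?thesis using ne0[of th]
 by (simp only: power_mult_distrib Complex.DeMoivre) (simp add: field_simps)
 qed
 have "?I (%th. 1 / (1 - a * cis th)) = ?I (%th. \<Sum>k<Suc n. a ^ k * cis (of_int (int k) * th))
 + ?I (%th. a ^ Suc n * cis (real (Suc n) * th) / (1 - a * cis th))"
 unfolding geo scaleR_add_right
 proof (rule BI_integral_add)
 show "integrable lborel (%th. indicator {0..2*pi} th *\<^sub>R (\<Sum>k<Suc n. a ^ k * cis (of_int (int k) * th)))"
 by (rule integrable_Icc_bounded[where B="\<Sum>k<Suc n. norm a ^ k"], measurable)
 (rule order_trans[OF norm_sum], simp add: norm_mult norm_power)
 show "integrable lborel (%th. indicator {0..2*pi} th *\<^sub>R (a ^ Suc n * cis (real (Suc n) * th) / (1 - a * cis th)))"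
 using na ne by (intro integrable_Icc_bounded[where B="norm a ^ Suc n / (1 - norm a)"])
 (auto simp: norm_divide norm_mult norm_power intro!: frac_le)
 qed
 also have "?I (%th. \<Sum>k<Suc n. a ^ k * cis (of_int (int k) * th))
 = (\<Sum>k<Suc n. a ^ k * ?I (%th. cis (of_int (int k) * th)))"
 unfolding scaleR_sum_right mult_scaleR_right[symmetric]
 by (subst BI_integral_sum)
 (simp_all only: mult_scaleR_right integral_mult_right_zero flip: mult_scaleR_right,
 intro integrable_mult_right integrable_Icc_bounded[where B=1], auto)
 also have "... = (\<Sum>k<Suc n. if k = 0 then complex_of_real (2 * pi) else 0)"
 proof (intro sum.cong refl)
 fix k
 show "a ^ k * ?I (%th. cis (of_int (int k) * th)) = (if k = 0 then complex_of_real (2 * pi) else 0)"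
 proof (cases "k = 0")
 case True
 have "?I (%th. 1) = 2 * pi"
 by (subst integral_scaleR_left) (auto simp: scaleR_conv_of_real)
 then show ?thesis using True by simp
 next
 case False
 then show ?thesis using integral_cis_multiple[of "int k"] by simp
 qed
 qed
 also have "... = 2 * pi" by (subst sum.delta) auto
 finally have "norm (?I (%th. 1 / (1 - a * cis th)) - 2 * pi)
 = norm (?I (%th. a ^ Suc n * cis (real (Suc n) * th) / (1 - a * cis th)))" by simp
 also have "... <= norm a ^ Suc n / (1 - norm a) * (2 * pi - 0)"
 using na ne by (intro norm_integral_Icc_le)
 (auto simp: norm_divide norm_mult norm_power intro!: frac_le)
 finally show ?thesis by simp
 qed
 have "(%n. norm a ^ Suc n / (1 - norm a) * (2 * pi)) ----> 0 / (1 - norm a) * (2 * pi)"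
 using na by (intro tendsto_intros LIMSEQ_Suc LIMSEQ_power_zero) auto
 then have "norm (?I (%th. 1 / (1 - a * cis th)) - 2 * pi) <= 0"
 using bound by (intro LIMSEQ_le_const) auto
 then show ?thesis by simp
qed

text \<open>Off \<open>a = 0\<close> the integrand is
  \<open>(1 / a) * (1 / (1 - a * cis th) - 1)\<close>, and both terms have integral
  \<open>2 * pi\<close>.\<close>

lemma integral_cis_geometric_shifted:
 fixes a :: complex
 assumes na: "norm a < 1"
 shows "(\<integral>th. indicator {0..2*pi} th *\<^sub>R (cis th / (1 - a * cis th)) \<partial>lborel) = 0"
proof (cases "a = 0")
 case True
 then show ?thesis using integral_cis_multiple[of 1] by simp
next
 case False
 have ne: "norm (1 - a * cis th) >= 1 - norm a" for th
 using norm_triangle_ineq2[of 1 "a * cis th"] by (simp add: norm_mult)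
 have ne0: "1 - a * cis th ~= 0" for th
 using ne[of th] na by auto
 have "(\<integral>th. indicator {0..2*pi} th *\<^sub>R (cis th / (1 - a * cis th)) \<partial>lborel)
 = (\<integral>th. (1 / a) * (indicator {0..2*pi} th *\<^sub>R (1 / (1 - a * cis th)) - indicator {0..2*pi} th *\<^sub>R 1) \<partial>lborel)"
 proof (rule BI_integral_cong[OF refl])
 fix th show "indicator {0..2*pi} th *\<^sub>R (cis th / (1 - a * cis th))
 = (1 / a) * (indicator {0..2*pi} th *\<^sub>R (1 / (1 - a * cis th)) - indicator {0..2*pi} th *\<^sub>R 1)"
 using ne0[of th] False by (auto simp: indicator_def field_simps)
 qed
 also have "... = (1 / a) * ((\<integral>th. indicator {0..2*pi} th *\<^sub>R (1 / (1 - a * cis th)) \<partial>lborel)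
 - (\<integral>th. indicator {0..2*pi} th *\<^sub>R 1 \<partial>lborel))"
 proof (subst integral_mult_right_zero, subst BI_integral_diff)
 show "integrable lborel (%th. indicator {0..2*pi} th *\<^sub>R (1 / (1 - a * cis th)))"
 using na ne by (intro integrable_Icc_bounded[where B="1 / (1 - norm a)"])
 (auto simp: norm_divide norm_mult norm_power intro!: frac_le)
 show "integrable lborel (%th. indicator {0..2*pi} th *\<^sub>R (1::complex))"
 by (intro integrable_Icc_bounded[where B=1]) auto
 qed simp
 also have "(\<integral>th. indicator {0..2*pi} th *\<^sub>R (1::complex) \<partial>lborel) = 2 * pi"
 by (subst integral_scaleR_left) (auto simp: scaleR_conv_of_real)
 finally show ?thesis by (simp add: integral_cis_geometric[OF na])
qed

lemma integral_cis_pole_less: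
 fixes l :: complex
 assumes "0 <= r" "r < norm l"
 shows "(\<integral>th. indicator {0..2*pi} th *\<^sub>R (1 / (of_real r * cis th - l)) \<partial>lborel) = - 2 * pi / l"
proof -
 define a where "a = of_real r / l"
 have l: "l ~= 0" using assms by auto
 have na: "norm a < 1" using assms l by (simp add: a_def norm_divide)
 have "(\<integral>th. indicator {0..2*pi} th *\<^sub>R (1 / (of_real r * cis th - l)) \<partial>lborel)
 = (\<integral>th. (- 1 / l) * (indicator {0..2*pi} th *\<^sub>R (1 / (1 - a * cis th))) \<partial>lborel)"
 proof (intro BI_integral_cong refl)
 fix th
 have "of_real r * cis th - l = (- l) * (1 - a * cis th)"
 using l by (simp add: a_def field_simps)
 then show "indicator {0..2*pi} th *\<^sub>R (1 / (of_real r * cis th - l))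
 = (- 1 / l) * (indicator {0..2*pi} th *\<^sub>R (1 / (1 - a * cis th)))"
 by simp
 qed
 also have "... = (- 1 / l) * (2 * pi)"
 using integral_cis_geometric[OF na] by (subst integral_mult_right_zero) simp
 finally show ?thesis by simp
qed

text \<open>Conjugation reflects the pole in the circle: as
  \<open>1 / cis th = cnj (cis th)\<close>, the integrand is, up to the factor \<open>1 / r\<close>,
  the conjugate of \<open>cis th / (1 - a * cis th)\<close> with \<open>a = cnj l / r\<close> inside
  the unit disc.\<close>

lemma integral_cis_pole_greater:
 fixes l :: complex
 assumes "norm l < r"
 shows "(\<integral>th. indicator {0..2*pi} th *\<^sub>R (1 / (of_real r * cis th - l)) \<partial>lborel) = 0"
proof -
 define a where "a = cnj l / of_real r"
 have r: "r > 0" using assms norm_ge_zero[of l] by linarith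
 have na: "norm a < 1" using assms r by (simp add: a_def norm_divide)
 have "(\<integral>th. indicator {0..2*pi} th *\<^sub>R (1 / (of_real r * cis th - l)) \<partial>lborel)
 = (\<integral>th. (1 / r) * cnj (indicator {0..2*pi} th *\<^sub>R (cis th / (1 - a * cis th))) \<partial>lborel)"
 proof (intro BI_integral_cong refl)
 fix th
 have "of_real r * cis th - l = (of_real r * cis th) * cnj (1 - a * cis th)"
 using r by (simp add: a_def field_simps cis_cnj cis_mult)
 moreover have "1 / cis th = cnj (cis th)" by (simp add: cis_cnj divide_inverse)
 ultimately have "1 / (of_real r * cis th - l) = (1 / r) * cnj (cis th / (1 - a * cis th))"
 by (simp add: divide_simps)
 then show "indicator {0..2*pi} th *\<^sub>R (1 / (of_real r * cis th - l))
 = (1 / r) * cnj (indicator {0..2*pi} th *\<^sub>R (cis th / (1 - a * cis th)))"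
 by simp
 qed
 also have "... = 0"
 unfolding integral_mult_right_zero BI_integral_cnj integral_cis_geometric_shifted[OF na] by simp
 finally show ?thesis .
qed

lemma measurable_ball_sets [measurable]:
 "cball a r : sets (borel :: 'a::metric_space measure)" "ball a r : sets (borel :: 'a::metric_space measure)"
 by auto

lemma nn_integral_inverse_norm_disc:
 assumes "R >= 0"
 shows "(\<integral>\<^sup>+z\<in>cball 0 R. ennreal (1 / norm (z::complex)) \<partial>lborel) = ennreal (2 * pi * R)"
proof -
 have "(\<integral>\<^sup>+z\<in>cball 0 R. ennreal (1 / norm (z::complex)) \<partial>lborel)
 = (\<integral>\<^sup>+z. ennreal (1 / norm (z::complex)) * indicator {..R} (norm z) \<partial>lborel)"
 by (intro nn_integral_cong) (auto simp: indicator_def)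
 also have "... = (\<integral>\<^sup>+r. ennreal (2 * pi * r) * indicator {0..} r * (ennreal (1 / r) * indicator {..R} r) \<partial>lborel)"
 by (rule nn_integral_radial) measurable
 \<comment> \<open>The weight \<open>r\<close> cancels \<open>1 / r\<close> except at
   \<open>r = 0\<close>, where \<open>1 / 0 = 0\<close>; hence the half-open interval.\<close>
 also have "... = (\<integral>\<^sup>+r. ennreal (2 * pi) * indicator {0<..R} r \<partial>lborel)"
 by (intro nn_integral_cong) (auto simp: indicator_def ennreal_mult[symmetric])
 also have "... = ennreal (2 * pi * R)"
 using assms by (simp add: nn_integral_cmult_indicator ennreal_mult)
 finally show ?thesis .
qed

text \<open>The bound is uniform in the position of the pole.\<close>
lemma nn_integral_inverse_dist_disc_le:
 fixes l :: complex
 assumes "R >= 0"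
 shows "(\<integral>\<^sup>+z\<in>cball 0 R. ennreal (1 / norm (z - l)) \<partial>lborel) <= ennreal (2 * pi + pi * R\<^sup>2)" (is "?L <= _")
proof -
 \<comment> \<open>Within distance 1 of the pole a translation reduces to the unit disc about the
   origin; farther away the integrand is at most 1.\<close>
 have "?L <= (\<integral>\<^sup>+z. ennreal (1 / norm (z - l)) * indicator (cball 0 1) (z - l) + indicator (cball 0 R) z \<partial>lborel)"
 by (rule nn_integral_mono) (auto simp: indicator_def divide_le_eq_1)
 also have "... = (\<integral>\<^sup>+z. ennreal (1 / norm (z - l)) * indicator (cball 0 1) (z - l) \<partial>lborel) + ennreal (pi * R\<^sup>2)"
 using assms by (subst nn_integral_add) (auto simp: emeasure_disc)
 also have "(\<integral>\<^sup>+z. ennreal (1 / norm (z - l)) * indicator (cball 0 1) (z - l) \<partial>lborel)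
 = (\<integral>\<^sup>+z\<in>cball 0 1. ennreal (1 / norm (z::complex)) \<partial>lborel)"
 using nn_integral_lborel_translate[of "%z. ennreal (1 / norm (z::complex)) * indicator (cball 0 1) z" "- l"]
 by simp
 also have "... = ennreal (2 * pi)" by (simp add: nn_integral_inverse_norm_disc)
 finally show ?thesis using assms by (simp add: ennreal_plus[symmetric] del: ennreal_plus)
qed

lemma integrable_pole_disc:
 fixes l :: complex
 assumes "R >= 0"
 shows "integrable lborel (%z. indicator (cball 0 R) z *\<^sub>R (1 / (z - l)))"
proof (rule integrableI_bounded)
 have "(\<integral>\<^sup>+z. norm (indicator (cball 0 R) z *\<^sub>R (1 / (z - l))) \<partial>lborel)
 = (\<integral>\<^sup>+z\<in>cball 0 R. ennreal (1 / norm (z - l)) \<partial>lborel)"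
 by (intro nn_integral_cong) (auto simp: indicator_def norm_divide)
 also have "... < \<infinity>"
 using nn_integral_inverse_dist_disc_le[OF assms, of l] by (rule le_less_trans) simp
 finally show "(\<integral>\<^sup>+z. norm (indicator (cball 0 R) z *\<^sub>R (1 / (z - l))) \<partial>lborel) < \<infinity>" .
qed measurable

text \<open>A circle contributes \<open>- 2 * pi / l\<close> as long as the pole lies outside it and
  nothing afterwards, so the radial integral stops at \<open>min R (norm l)\<close>. Divided by the
  area of the disc, this is where the weight \<open>1 - theta R l\<close> comes from.\<close>

lemma integral_pole_disc:
 fixes l :: complex
 assumes R: "R >= 0"
 shows "(\<integral>z. indicator (cball 0 R) z *\<^sub>R (1 / (z - l)) \<partial>lborel)
 = - pi * (min R (norm l))\<^sup>2 / l"
proof -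
 define f where "f z = indicator (cball 0 R) z *\<^sub>R (1 / (z - l))" for z
 have [measurable]: "f : bmeas borel" unfolding f_def by measurable
 have pull: "(\<integral>th. polar_density r th *\<^sub>R f (of_real r * cis th) \<partial>lborel)
 = (r * indicator {0..R} r) *\<^sub>R (\<integral>th. indicator {0..2*pi} th *\<^sub>R (1 / (of_real r * cis th - l)) \<partial>lborel)" for r
 by (subst integral_scaleR_right[symmetric])
 (auto intro!: BI_integral_cong simp: f_def indicator_def norm_mult)
 have I: "integrable lborel f" unfolding f_def by (rule integrable_pole_disc[OF R])
 have "(\<integral>z. f z \<partial>lborel) = (\<integral>z. polar_density (fst z) (snd z) *\<^sub>R f (of_real (fst z) * cis (snd z)) \<partial>(lborel \<Otimes>\<^sub>M lborel))"
 by (rule integral_polar) measurable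
 also have "... = (\<integral>r. (\<integral>th. polar_density r th *\<^sub>R f (of_real r * cis th) \<partial>lborel) \<partial>lborel)"
 using lborel_pair.integral_fst'[OF integrable_polar[OF I]] unfolding fst_conv snd_conv by (rule sym)
 also have "... = (\<integral>r. indicator {0..min R (norm l)} r *\<^sub>R (of_real r * (- 2 * pi / l)) \<partial>lborel)"
 proof (rule integral_cong_AE)
 \<comment> \<open>The circle through the pole is a single radius and is discarded as a null
   set.\<close>
 show "AE r in lborel. (\<integral>th. polar_density r th *\<^sub>R f (of_real r * cis th) \<partial>lborel)
 = indicator {0..min R (norm l)} r *\<^sub>R (of_real r * (- 2 * pi / l))"
 using AE_lborel_singleton[of "norm l"]
 proof eventually_elim
 case (elim r)
 then show ?case
 unfolding pull using integral_cis_pole_less[of r l] integral_cis_pole_greater[of l r]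
 by (cases "r : {0..R}"; cases "r < norm l") (auto simp: indicator_def scaleR_conv_of_real)
 qed
 qed measurable
 also have "... = of_real ((min R (norm l))\<^sup>2 / 2) * (- 2 * pi / l) - of_real (0\<^sup>2 / 2) * (- 2 * pi / l)"
 proof (rule integral_FTC_Icc)
 fix x :: real
 have "((%r::real. r\<^sup>2 / 2) has_real_derivative x) (at x within {0..min R (norm l)})"
 by (auto intro!: derivative_eq_intros)
 then show "((%r. of_real (r\<^sup>2 / 2) * (- 2 * pi / l)) has_vector_derivative of_real x * (- 2 * pi / l))
 (at x within {0..min R (norm l)})"
 by (intro has_vector_derivative_mult_left has_vector_derivative_of_real)
 show "continuous_on {0..min R (norm l)} (%r. of_real r * (- 2 * pi / l))"
 by (intro continuous_on_mult continuous_on_const continuous_on_of_real continuous_on_id)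
 qed (use R in auto)
 finally show ?thesis unfolding f_def by simp
qed


section \<open>The Fourier transform of 1/x on an annulus and the decay of J_0\<close>

definition annulus_kernel :: "real => real => complex => complex" where
 "annulus_kernel S R x = (if S < norm x \<and> norm x <= R then 1 / x else 0)"

lemma measurable_annulus_kernel [measurable]:
 "(%z. annulus_kernel (f z) (g z) (h z)) : bmeas M"
 if [measurable]: "f : bmeas M" "g : bmeas M" "h : bmeas M"
 unfolding annulus_kernel_def by measurable

lemma fourier_cis: "fourier \<phi> xi = (\<integral>x. cis (- (2 * pi * (xi \<bullet> x))) * \<phi> x \<partial>lborel)"
 unfolding fourier_def cis_conv_exp by (simp add: algebra_simps)

text \<open>Rotating the plane by the direction of the frequency leaves a phase that depends on the
  real part only.\<close>

lemma inner_complex_rotate: "(of_real k * u) \<bullet> (u * x) = k * (norm u)\<^sup>2 * Re x" for u x :: complex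
 unfolding inner_complex_def cmod_power2 by (simp add: algebra_simps power2_eq_square)

text \<open>The factor \<open>cos th\<close>, which stems from the real part of
  \<open>1 / x\<close>, is up to a constant the derivative of the phase in \<open>r\<close>. Hence
  the antiderivative has no denominator that vanishes with \<open>cos th\<close>.\<close>

lemma integral_cis_cos_radial:
 assumes k: "k > 0" and "0 <= S" "S <= R"
 shows "(\<integral>r. indicator {S<..R} r *\<^sub>R (of_real (cos th) * cis (- (2 * pi * (k * (r * cos th))))) \<partial>lborel)
 = \<i> / (2 * pi * k) * (cis (- (2 * pi * (R * k) * cos th)) - cis (- (2 * pi * (S * k) * cos th)))" (is "?L = ?R")
proof -
 have "?L = (\<integral>r. indicator {S..R} r *\<^sub>R (of_real (cos th) * cis (- (2 * pi * (k * (r * cos th))))) \<partial>lborel)"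
 proof (rule integral_cong_AE)
 show "AE r in lborel. indicator {S<..R} r *\<^sub>R (of_real (cos th) * cis (- (2 * pi * (k * (r * cos th)))))
 = indicator {S..R} r *\<^sub>R (of_real (cos th) * cis (- (2 * pi * (k * (r * cos th)))))"
 using AE_lborel_singleton[of S] by eventually_elim (auto simp: indicator_def)
 qed measurable
 also have "... = \<i> / (2 * pi * k) * cis (- (2 * pi * (R * k) * cos th)) - \<i> / (2 * pi * k) * cis (- (2 * pi * (S * k) * cos th))"
 proof (rule integral_FTC_Icc)
 fix r :: real
 show "((%r. \<i> / (2 * pi * k) * cis (- (2 * pi * (r * k) * cos th))) has_vector_derivative
 of_real (cos th) * cis (- (2 * pi * (k * (r * cos th))))) (at r within {S..R})"
 unfolding cis_conv_exp using k
 by (auto intro!: derivative_eq_intros has_vector_derivative_real_field simp: field_simps)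
 qed (use assms in \<open>auto intro!: continuous_intros\<close>)
 finally show ?thesis by (simp add: algebra_simps)
qed

text \<open>The integrand is the derivative of a function of \<open>cos th\<close>, which returns to
  its value after a full period; \<open>c = 0\<close> is apart because the antiderivative divides by
  \<open>c\<close>.\<close>

lemma integral_sin_cis_cos_period:
 "(\<integral>th. indicator {0..2*pi} th *\<^sub>R (of_real (sin th) * cis (- (c * cos th))) \<partial>lborel) = 0"
proof (cases "c = 0")
 case True
 have "(\<integral>th. indicator {0..2*pi} th *\<^sub>R (of_real (sin th) * cis (- (c * cos th))) \<partial>lborel)
 = - of_real (cos (2 * pi)) - - of_real (cos 0)"
 proof (rule integral_FTC_Icc)
 fix x :: real
 have "((%th. - cos th) has_real_derivative sin x) (at x within {0..2*pi})"
 by (auto intro!: derivative_eq_intros)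
 from has_vector_derivative_of_real[OF this, where 'a=complex]
 show "((%th. - of_real (cos th)) has_vector_derivative of_real (sin x) * cis (- (c * cos x))) (at x within {0..2*pi})"
 using True by simp
 qed (auto intro!: continuous_intros)
 then show ?thesis by simp
next
 case False
 have "(\<integral>th. indicator {0..2*pi} th *\<^sub>R (of_real (sin th) * cis (- (c * cos th))) \<partial>lborel)
 = cis (- (c * cos (2*pi))) / (\<i> * c) - cis (- (c * cos 0)) / (\<i> * c)"
 proof (rule integral_FTC_Icc)
 fix x :: real
 have d: "((%th. - (c * cos th)) has_real_derivative c * sin x) (at x within {0..2*pi})"
 by (auto intro!: derivative_eq_intros)
 have "((%th. exp (\<i> * of_real (- (c * cos th)))) has_vector_derivative (\<i> * of_real (c * sin x)) * exp (\<i> * of_real (- (c * cos x)))) (at x within {0..2*pi})"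
 using field_vector_diff_chain_within[OF has_vector_derivative_mult_right[OF has_vector_derivative_of_real[OF d], of \<i>]
 has_field_derivative_at_within[OF DERIV_exp]]
 by (simp add: o_def)
 from has_vector_derivative_mult_right[OF this, of "1 / (\<i> * c)"]
 show "((%th. cis (- (c * cos th)) / (\<i> * c)) has_vector_derivative of_real (sin x) * cis (- (c * cos x))) (at x within {0..2*pi})"
 using False by (simp add: cis_conv_exp field_simps)
 qed (auto intro!: continuous_intros)
 then show ?thesis by simp
qed


text \<open>In polar coordinates the Jacobian cancels the modulus of \<open>1 / x\<close> and leaves
  \<open>cis (- th)\<close>. Its sine part vanishes by integrating over the angle first, its cosine
  part is integrated exactly in the radius and leaves the two angular averages.\<close>

theorem fourier_annulus_kernel:
 assumes xi: "xi ~= 0" and SR: "0 <= S" "S <= R"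
 shows "fourier (annulus_kernel S R) xi = \<i> / xi * (bessel0 (R * norm xi) - bessel0 (S * norm xi))"
proof -
 define k where "k = norm xi"
 define u where "u = xi / of_real k"
 have k: "k > 0" using xi by (simp add: k_def)
 have u: "norm u = 1" "xi = of_real k * u" using k by (simp_all add: u_def k_def norm_divide)
 then have u0: "u ~= 0" by auto
 define e where "e c th = cis (- (2 * pi * (k * (c * cos th))))" for c th
 have [measurable]: "(%z. e (f z) (g z)) : bmeas M"
 if [measurable]: "f : bmeas M" "g : bmeas M" for f g and M :: "'z measure"
 unfolding e_def by measurable
 have ne: "norm (e c th) = 1" for c th by (simp add: e_def)
 define F where "F x = cis (- (2 * pi * (k * Re x))) * annulus_kernel S R x" for x
 have [measurable]: "F : bmeas borel" unfolding F_def by measurable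
 let ?C0 = "%z. (indicator {S<..R} (fst z) * indicator {0..2*pi} (snd z)) *\<^sub>R (of_real (cos (snd z)) * e (fst z) (snd z))"
 let ?S0 = "%z. (indicator {S<..R} (fst z) * indicator {0..2*pi} (snd z)) *\<^sub>R (of_real (sin (snd z)) * e (fst z) (snd z))"
 \<comment> \<open>After the cancellation the integrand is bounded on a rectangle, so both orders of
   integration are available, also for \<open>S = 0\<close>.\<close>
 have b: "integrable (lborel \<Otimes>\<^sub>M lborel) (%z. (indicator {S<..R} (fst z) * indicator {0..2*pi} (snd z)) *\<^sub>R g z)"
 if "g : bmeas (lborel \<Otimes>\<^sub>M lborel)" "!!z. norm (g z) <= 1" for g :: "real \<times> real => complex"
 proof -
 have "integrable (lborel \<Otimes>\<^sub>M lborel) (%z. indicator ({S<..R} \<times> {0..2*pi}) z *\<^sub>R g z)"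
 by (rule integrableI_bounded_set_indicator[where B=1])
 (use that SR in \<open>auto simp: lborel.emeasure_pair_measure_Times ennreal_mult[symmetric]\<close>)
 then show ?thesis by (rule BI_integrable_cong[THEN iffD1, rotated 2]) (auto simp: indicator_def)
 qed
 have C: "integrable (lborel \<Otimes>\<^sub>M lborel) ?C0" and S: "integrable (lborel \<Otimes>\<^sub>M lborel) ?S0"
 by (rule b; simp add: norm_mult ne)+
 \<comment> \<open>Rotation by \<open>u\<close> makes the frequency a positive real number; the
   kernel contributes the factor \<open>1 / u\<close>.\<close>
 have "fourier (annulus_kernel S R) xi
 = (\<integral>x. cis (- (2 * pi * (xi \<bullet> (u * x)))) * annulus_kernel S R (u * x) \<partial>lborel)"
 unfolding fourier_cis by (rule integral_lborel_rotate[symmetric]) (use u in auto)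
 also have "... = (\<integral>x. (1 / u) * F x \<partial>lborel)"
 by (rule BI_integral_cong)
 (auto simp: F_def u(2) inner_complex_rotate u(1) annulus_kernel_def norm_mult)
 also have "... = (1 / u) * (\<integral>x. F x \<partial>lborel)" by (rule integral_mult_right_zero)
 also have "(\<integral>x. F x \<partial>lborel)
 = (\<integral>z. polar_density (fst z) (snd z) *\<^sub>R F (of_real (fst z) * cis (snd z)) \<partial>(lborel \<Otimes>\<^sub>M lborel))"
 by (rule integral_polar) measurable
 also have "... = (\<integral>z. (indicator {S<..R} (fst z) * indicator {0..2*pi} (snd z)) *\<^sub>R
 (e (fst z) (snd z) * cis (- snd z)) \<partial>(lborel \<Otimes>\<^sub>M lborel))"
 proof (rule BI_integral_cong[OF refl])
 fix z :: "real \<times> real"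
 have "1 / cis (snd z) = cis (- snd z)" by (simp add: divide_inverse cis_cnj)
 then show "polar_density (fst z) (snd z) *\<^sub>R F (of_real (fst z) * cis (snd z))
 = (indicator {S<..R} (fst z) * indicator {0..2*pi} (snd z)) *\<^sub>R (e (fst z) (snd z) * cis (- snd z))"
 using SR by (auto simp: indicator_def F_def annulus_kernel_def norm_mult e_def scaleR_conv_of_real mult_ac)
 qed
 also have "... = (\<integral>z. (indicator {S<..R} (fst z) * indicator {0..2*pi} (snd z)) *\<^sub>R (of_real (cos (snd z)) * e (fst z) (snd z))
 - \<i> * ((indicator {S<..R} (fst z) * indicator {0..2*pi} (snd z)) *\<^sub>R (of_real (sin (snd z)) * e (fst z) (snd z))) \<partial>(lborel \<Otimes>\<^sub>M lborel))"
 proof (rule BI_integral_cong[OF refl])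
 fix z :: "real \<times> real"
 have c: "cis (- snd z) = of_real (cos (snd z)) - \<i> * of_real (sin (snd z))"
 by (simp add: complex_eq_iff)
 show "(indicator {S<..R} (fst z) * indicator {0..2*pi} (snd z)) *\<^sub>R (e (fst z) (snd z) * cis (- snd z))
 = (indicator {S<..R} (fst z) * indicator {0..2*pi} (snd z)) *\<^sub>R (of_real (cos (snd z)) * e (fst z) (snd z))
 - \<i> * ((indicator {S<..R} (fst z) * indicator {0..2*pi} (snd z)) *\<^sub>R (of_real (sin (snd z)) * e (fst z) (snd z)))"
 unfolding c by (simp add: algebra_simps scaleR_conv_of_real)
 qed
 also have "... = (\<integral>z. (indicator {S<..R} (fst z) * indicator {0..2*pi} (snd z)) *\<^sub>R (of_real (cos (snd z)) * e (fst z) (snd z)) \<partial>(lborel \<Otimes>\<^sub>M lborel))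
 - \<i> * (\<integral>z. (indicator {S<..R} (fst z) * indicator {0..2*pi} (snd z)) *\<^sub>R (of_real (sin (snd z)) * e (fst z) (snd z)) \<partial>(lborel \<Otimes>\<^sub>M lborel))"
 (is "_ = integral\<^sup>L _ ?C - \<i> * integral\<^sup>L _ ?S")
 proof -
 have "integral\<^sup>L (lborel \<Otimes>\<^sub>M lborel) (%z. ?C z - \<i> * ?S z)
 = integral\<^sup>L (lborel \<Otimes>\<^sub>M lborel) ?C - integral\<^sup>L (lborel \<Otimes>\<^sub>M lborel) (%z. \<i> * ?S z)"
 by (rule BI_integral_diff[OF C integrable_mult_right[OF S]])
 also have "integral\<^sup>L (lborel \<Otimes>\<^sub>M lborel) (%z. \<i> * ?S z) = \<i> * integral\<^sup>L (lborel \<Otimes>\<^sub>M lborel) ?S"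
 by (rule integral_mult_right_zero)
 finally show ?thesis .
 qed
 also have "integral\<^sup>L (lborel \<Otimes>\<^sub>M lborel) ?S = 0"
 proof -
 have "integral\<^sup>L (lborel \<Otimes>\<^sub>M lborel) ?S
 = (\<integral>r. (\<integral>th. (indicator {S<..R} r * indicator {0..2*pi} th) *\<^sub>R (of_real (sin th) * e r th) \<partial>lborel) \<partial>lborel)"
 using lborel_pair.integral_fst'[OF S] unfolding fst_conv snd_conv by (rule sym)
 also have "... = (\<integral>r. indicator {S<..R} r *\<^sub>R (\<integral>th. indicator {0..2*pi} th *\<^sub>R (of_real (sin th) * cis (- ((2 * pi * k * r) * cos th))) \<partial>lborel) \<partial>lborel)"
 by (subst integral_scaleR_right[symmetric]) (auto simp: e_def mult_ac)
 finally show ?thesis unfolding integral_sin_cis_cos_period by simp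
 qed
 also have "integral\<^sup>L (lborel \<Otimes>\<^sub>M lborel) ?C = \<i> / k * (bessel0 (R * k) - bessel0 (S * k))"
 proof -
 have "integral\<^sup>L (lborel \<Otimes>\<^sub>M lborel) ?C
 = (\<integral>th. (\<integral>r. (indicator {S<..R} r * indicator {0..2*pi} th) *\<^sub>R (of_real (cos th) * e r th) \<partial>lborel) \<partial>lborel)"
 using lborel_pair.integral_snd[of "%r th. ?C0 (r, th)"] C
 unfolding fst_conv snd_conv case_prod_unfold prod.collapse by (rule sym[OF mp[OF impI]])
 also have "... = (\<integral>th. indicator {0..2*pi} th *\<^sub>R (\<integral>r. indicator {S<..R} r *\<^sub>R (of_real (cos th) * cis (- (2 * pi * (k * (r * cos th))))) \<partial>lborel) \<partial>lborel)"
 by (subst integral_scaleR_right[symmetric]) (auto simp: e_def mult_ac)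
 also have "... = (\<integral>th. (\<i> / (2 * pi * k)) * (indicator {0..2*pi} th *\<^sub>R cis (- (2 * pi * (R * k) * cos th))
 - indicator {0..2*pi} th *\<^sub>R cis (- (2 * pi * (S * k) * cos th))) \<partial>lborel)"
 unfolding integral_cis_cos_radial[OF k SR]
 by (rule BI_integral_cong) (auto simp: indicator_def)
 also have "... = (\<i> / (2 * pi * k)) * ((\<integral>th. indicator {0..2*pi} th *\<^sub>R cis (- (2 * pi * (R * k) * cos th)) \<partial>lborel)
 - (\<integral>th. indicator {0..2*pi} th *\<^sub>R cis (- (2 * pi * (S * k) * cos th)) \<partial>lborel))"
 unfolding integral_mult_right_zero
 by (subst BI_integral_diff) (auto intro!: integrable_Icc_bounded[where B=1])
 also have "... = \<i> / k * (bessel0 (R * k) - bessel0 (S * k))"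
 using k by (simp add: bessel0_def field_simps)
 finally show ?thesis .
 qed
 finally show ?thesis using u0 k unfolding u(2) by (simp add: norm_mult u(1))
qed

text \<open>Where \<open>(sin th)\<^sup>2\<close> is at least 1/2 the integrand is at most 2.
  Elsewhere the modulus of the cosine is at least 1/2, so the integrand is at most
  \<open>2 * g th\<close>, and \<open>g\<close> has the antiderivative
  \<open>arctan (sin th / de) / de\<close> up to the sign of the cosine. The three intervals are
  those of constant sign; 100 is a crude total.\<close>

lemma nn_integral_inverse_sin_sq_le:
 assumes de: "0 < de" "de <= 1"
 shows "(\<integral>\<^sup>+th\<in>{0..2*pi}. ennreal (1 / ((sin th)\<^sup>2 + de\<^sup>2)) \<partial>lborel) <= ennreal (100 / de)"
proof -
 define g where "g th = \<bar>cos th\<bar> / ((sin th)\<^sup>2 + de\<^sup>2)" for th :: real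
 have pos: "(sin th)\<^sup>2 + de\<^sup>2 > 0" for th using de by (simp add: add_nonneg_pos)
 have [measurable]: "g : bmeas borel" unfolding g_def by measurable
 have de0: "de ~= 0" using de by simp
 have deriv: "((%th. s * (arctan (sin th / de) / de)) has_real_derivative g x) (at x)"
 if "s * cos x = \<bar>cos x\<bar>" for s x
 proof -
 have "((%th. s * (arctan (sin th / de) / de)) has_real_derivative s * (inverse (1 + (sin x / de)\<^sup>2) * (cos x / de) / de)) (at x)"
 using de0 by (auto intro!: derivative_eq_intros)
 also have "s * (inverse (1 + (sin x / de)\<^sup>2) * (cos x / de) / de) = s * cos x / (de\<^sup>2 * (1 + (sin x / de)\<^sup>2))"
 using de by (simp add: divide_inverse power2_eq_square)
 also have "de\<^sup>2 * (1 + (sin x / de)\<^sup>2) = (sin x)\<^sup>2 + de\<^sup>2"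
 using de by (simp add: field_simps)
 finally show ?thesis unfolding that g_def .
 qed
 have piece: "(\<integral>\<^sup>+th\<in>{a..b}. ennreal (g th) \<partial>lborel) <= ennreal (4 / de)"
 if "a <= b" and s: "!!x. x : {a..b} ==> s * cos x = \<bar>cos x\<bar>" and "\<bar>s\<bar> = 1" for a b s
 proof -
 have "(\<integral>\<^sup>+th\<in>{a..b}. ennreal (g th) \<partial>lborel) = ennreal (s * (arctan (sin b / de) / de) - s * (arctan (sin a / de) / de))"
 proof (rule nn_integral_FTC_Icc)
 show "((%th. s * (arctan (sin th / de) / de)) has_real_derivative g x) (at x)" if "x : {a..b}" for x
 by (rule deriv) (rule s[OF that])
 qed (use \<open>a <= b\<close> in \<open>auto simp: g_def\<close>)
 also have "... <= ennreal (4 / de)"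
 proof (rule ennreal_leI)
 have "\<bar>arctan y\<bar> <= 2" for y using arctan_bounded[of y] pi_less_4 by auto
 then have "\<bar>s * arctan y\<bar> <= 2" for y using that(3) by (simp add: abs_mult)
 then have "s * arctan (sin b / de) - s * arctan (sin a / de) <= 4"
 by (smt (verit, best))
 from divide_right_mono[OF this, of de]
 show "s * (arctan (sin b / de) / de) - s * (arctan (sin a / de) / de) <= 4 / de"
 using de by (simp add: diff_divide_distrib)
 qed
 finally show ?thesis .
 qed
 have "(\<integral>\<^sup>+th\<in>{0..2*pi}. ennreal (1 / ((sin th)\<^sup>2 + de\<^sup>2)) \<partial>lborel)
 <= (\<integral>\<^sup>+th. 2 * indicator {0..2*pi} th + 2 * (ennreal (g th) * indicator {0..pi/2} th + ennreal (g th) * indicator {pi/2..3*pi/2} th + ennreal (g th) * indicator {3*pi/2..2*pi} th) \<partial>lborel)"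
 proof (rule nn_integral_mono)
 fix th :: real
 have "1 / ((sin th)\<^sup>2 + de\<^sup>2) <= 2 + 2 * g th"
 proof (cases "(sin th)\<^sup>2 >= 1/2")
 case True
 then have "1 <= 2 * ((sin th)\<^sup>2 + de\<^sup>2)" by (simp add: distrib_left add_increasing2)
 then have "1 / ((sin th)\<^sup>2 + de\<^sup>2) <= 2" using pos[of th] by (simp only: pos_divide_le_eq)
 moreover have "g th >= 0" by (simp add: g_def)
 ultimately show ?thesis by simp
 next
 case False
 then have "(cos th)\<^sup>2 >= (1/2)\<^sup>2" using sin_cos_squared_add[of th] by (simp add: power2_eq_square)
 then have "\<bar>cos th\<bar> >= 1/2" by (metis abs_le_square_iff abs_of_pos half_gt_zero_iff zero_less_one)
 then have "1 / ((sin th)\<^sup>2 + de\<^sup>2) <= 2 * g th" using pos[of th] by (simp add: g_def divide_right_mono)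
 then show ?thesis by simp
 qed
 then have "ennreal (1 / ((sin th)\<^sup>2 + de\<^sup>2)) <= 2 + 2 * ennreal (g th)"
 proof -
 have g0: "g th >= 0" by (simp add: g_def)
 assume "1 / ((sin th)\<^sup>2 + de\<^sup>2) <= 2 + 2 * g th"
 then have "ennreal (1 / ((sin th)\<^sup>2 + de\<^sup>2)) <= ennreal (2 + 2 * g th)" by (rule ennreal_leI)
 also have "... = 2 + 2 * ennreal (g th)" using g0 by (simp add: ennreal_mult')
 finally show ?thesis .
 qed
 then have *: "ennreal (1 / ((sin th)\<^sup>2 + de\<^sup>2)) <= 2 + 2 * ennreal (g th) * 1" by simp
 show "ennreal (1 / ((sin th)\<^sup>2 + de\<^sup>2)) * indicator {0..2*pi} th
 <= 2 * indicator {0..2*pi} th + 2 * (ennreal (g th) * indicator {0..pi/2} th + ennreal (g th) * indicator {pi/2..3*pi/2} th + ennreal (g th) * indicator {3*pi/2..2*pi} th)"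
 proof (cases "th : {0..2*pi}")
 case True
 let ?I = "indicator {0..pi/2} th + indicator {pi/2..3*pi/2} th + indicator {3*pi/2..2*pi} th :: ennreal"
 have "1 <= ?I" using True by (auto simp: indicator_def)
 then have "2 * ennreal (g th) * 1 <= 2 * ennreal (g th) * ?I" by (rule mult_left_mono) simp
 then have "ennreal (1 / ((sin th)\<^sup>2 + de\<^sup>2)) <= 2 + 2 * ennreal (g th) * ?I"
 by (rule order_trans[OF * add_left_mono])
 then show ?thesis using True by (simp add: distrib_left mult.assoc)
 qed simp
 qed
 also have "... = 2 * ennreal (2 * pi) + 2 * ((\<integral>\<^sup>+th\<in>{0..pi/2}. ennreal (g th) \<partial>lborel) + (\<integral>\<^sup>+th\<in>{pi/2..3*pi/2}. ennreal (g th) \<partial>lborel) + (\<integral>\<^sup>+th\<in>{3*pi/2..2*pi}. ennreal (g th) \<partial>lborel))"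
 by (simp add: nn_integral_add nn_integral_cmult)
 also have "... <= 2 * ennreal (2 * pi) + 2 * (ennreal (4 / de) + ennreal (4 / de) + ennreal (4 / de))"
 proof (intro add_left_mono mult_left_mono add_mono)
 show "(\<integral>\<^sup>+th\<in>{0..pi/2}. ennreal (g th) \<partial>lborel) <= ennreal (4 / de)"
 proof (rule piece[where s=1])
 fix x assume "x : {0..pi/2}"
 then have "cos x >= 0" by (intro cos_ge_zero) auto
 then show "1 * cos x = \<bar>cos x\<bar>" by simp
 qed auto
 show "(\<integral>\<^sup>+th\<in>{pi/2..3*pi/2}. ennreal (g th) \<partial>lborel) <= ennreal (4 / de)"
 proof (rule piece[where s="-1"])
 fix x assume "x : {pi/2..3*pi/2}"
 then have "cos (x - pi) >= 0" by (intro cos_ge_zero) auto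
 then show "- 1 * cos x = \<bar>cos x\<bar>" by (simp add: cos_diff)
 qed auto
 show "(\<integral>\<^sup>+th\<in>{3*pi/2..2*pi}. ennreal (g th) \<partial>lborel) <= ennreal (4 / de)"
 proof (rule piece[where s=1])
 fix x assume "x : {3*pi/2..2*pi}"
 then have "cos (x - 2 * pi) >= 0" by (intro cos_ge_zero) auto
 then show "1 * cos x = \<bar>cos x\<bar>" by (simp add: cos_diff)
 qed auto
 qed auto
 also have "... = ennreal (4 * pi + 24 / de)"
 using de by (simp add: ennreal_plus[symmetric] ennreal_mult'[symmetric] ennreal_numeral[symmetric] del: ennreal_plus ennreal_numeral)
 also have "... <= ennreal (100 / de)"
 proof (rule ennreal_leI)
 have "4 * pi <= 16 / de" using de pi_less_4 by (simp add: field_simps) (smt (verit) mult_left_le pi_gt_zero)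
 then show "4 * pi + 24 / de <= 100 / de" using de by (simp add: field_simps)
 qed
 finally show ?thesis .
qed


text \<open>Decay by one integration by parts; the stationary points of the cosine are cut out smoothly
 with the weight \<open>sin\<^sup>2 th / (sin\<^sup>2 th + de\<^sup>2)\<close>, where \<open>de\<^sup>2\<close> is the inverse frequency.\<close>
lemma norm_bessel0_le_inverse_sqrt:
 assumes t: "t > 0"
 shows "norm (bessel0 t) <= 100 / sqrt t"
proof (cases "2 * pi * t >= 1")
 case False
 have "t <= 2 * pi * t" using t pi_gt3 by simp
 then have "sqrt t <= 1" using False by simp
 then have "sqrt t <= 100" by linarith
 then have "1 <= 100 / sqrt t" using t by (simp add: le_divide_eq)
 then show ?thesis using norm_bessel0_le_1[of t] by simp
next
 case True
 define s where "s = 2 * pi * t"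
 \<comment> \<open>Balances the two error terms: integration by parts yields
   \<open>100 / de / s\<close>, the part cut out around the stationary points yields
   \<open>100 * de\<close>, and both become \<open>100 / sqrt s\<close>.\<close>
 define de where "de = 1 / sqrt s"
 have s: "s >= 1" using True by (simp add: s_def)
 have de: "0 < de" "de <= 1" and de2: "de\<^sup>2 = 1 / s" using s by (auto simp: de_def power_divide)
 define q where "q th = 1 / ((sin th)\<^sup>2 + de\<^sup>2)" for th :: real
 have pos: "(sin th)\<^sup>2 + de\<^sup>2 > 0" for th using de by (simp add: add_nonneg_pos)
 have q: "q th > 0" "q th <= 1 / de\<^sup>2" for th
 using pos[of th] de by (auto simp: q_def intro!: divide_left_mono mult_pos_pos)
 let ?e = "%th. cis (- (s * cos th))"
 let ?I = "%h. \<integral>th. indicator {0..2*pi} th *\<^sub>R (complex_of_real (h th) * ?e th) \<partial>lborel"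
 have int: "integrable lborel (%th. indicator {0..2*pi} th *\<^sub>R (complex_of_real (h th) * ?e th))"
 if "h : bmeas borel" "!!th. \<bar>h th\<bar> <= q th" for h
 using that q(2) by (intro integrable_Icc_bounded[where B="1 / de\<^sup>2"]) (auto simp: norm_mult intro: order_trans)
 have bound: "norm (?I h) <= 100 / de"
 if h: "h : bmeas borel" "!!th. \<bar>h th\<bar> <= q th" for h
 proof -
 have "ennreal (norm (?I h)) <= (\<integral>\<^sup>+th. norm (indicator {0..2*pi} th *\<^sub>R (complex_of_real (h th) * ?e th)) \<partial>lborel)"
 by (rule integral_norm_bound_ennreal[OF int[OF h]])
 also have "... <= (\<integral>\<^sup>+th\<in>{0..2*pi}. ennreal (q th) \<partial>lborel)"
 using h(2) by (intro nn_integral_mono) (auto simp: indicator_def norm_mult ennreal_leI)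
 also have "... <= ennreal (100 / de)"
 unfolding q_def by (rule nn_integral_inverse_sin_sq_le[OF de])
 finally show ?thesis using de by (simp add: ennreal_le_iff)
 qed
 \<comment> \<open>\<open>h1\<close> is the derivative of \<open>sin th * q th\<close>, and
   \<open>w\<close> is the weight that vanishes at the stationary points, so that
   \<open>?e * w\<close> can be integrated by parts against \<open>sin th * q th\<close>.\<close>
 define h1 where "h1 th = cos th * (de\<^sup>2 - (sin th)\<^sup>2) * (q th)\<^sup>2" for th
 define w where "w th = (sin th)\<^sup>2 * q th" for th
 define h2 where "h2 th = de\<^sup>2 * q th" for th
 have [measurable]: "q : bmeas borel" unfolding q_def by measurable
 have meas: "h1 : bmeas borel" "w : bmeas borel" "h2 : bmeas borel"
 unfolding h1_def w_def h2_def by measurable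
 have b1: "\<bar>h1 th\<bar> <= q th" for th
 proof -
 have "\<bar>de\<^sup>2 - (sin th)\<^sup>2\<bar> * q th <= 1"
 proof -
 have "\<bar>de\<^sup>2 - (sin th)\<^sup>2\<bar> <= (sin th)\<^sup>2 + de\<^sup>2" by (smt (verit) zero_le_power2)
 then show ?thesis using pos[of th] by (simp add: q_def divide_le_eq)
 qed
 then have "(\<bar>cos th\<bar> * (\<bar>de\<^sup>2 - (sin th)\<^sup>2\<bar> * q th)) * q th <= (1 * 1) * q th"
 using q(1)[of th] by (intro mult_right_mono mult_mono) auto
 moreover have "\<bar>h1 th\<bar> = (\<bar>cos th\<bar> * (\<bar>de\<^sup>2 - (sin th)\<^sup>2\<bar> * q th)) * q th"
 using q(1)[of th] by (simp add: h1_def abs_mult power2_eq_square)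
 ultimately show ?thesis by simp
 qed
 have b2: "\<bar>w th\<bar> <= q th" for th
 using q(1)[of th] abs_sin_le_one[of th] by (simp add: w_def abs_mult abs_square_le_1)
 have b3: "\<bar>q th\<bar> <= q th" for th using q(1)[of th] by simp
 define Ah Aw Aq where "Ah = ?I h1" and "Aw = ?I w" and "Aq = ?I q"
 have "Ah + (\<i> * s) * Aw = (\<integral>th. indicator {0..2*pi} th *\<^sub>R (of_real (h1 th) * ?e th + (\<i> * s) * (of_real (w th) * ?e th)) \<partial>lborel)"
 proof -
 have "(\<integral>th. indicator {0..2*pi} th *\<^sub>R (of_real (h1 th) * ?e th) + (\<i> * s) * (indicator {0..2*pi} th *\<^sub>R (of_real (w th) * ?e th)) \<partial>lborel)
 = ?I h1 + (\<integral>th. (\<i> * s) * (indicator {0..2*pi} th *\<^sub>R (of_real (w th) * ?e th)) \<partial>lborel)"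
 by (rule BI_integral_add[OF int[OF meas(1) b1] integrable_mult_right[OF int[OF meas(2) b2]]])
 note f1 = this[unfolded integral_mult_right_zero]
 have f2: "(%th. indicator {0..2*pi} th *\<^sub>R (of_real (h1 th) * ?e th + (\<i> * s) * (of_real (w th) * ?e th)))
 = (%th. indicator {0..2*pi} th *\<^sub>R (of_real (h1 th) * ?e th) + (\<i> * s) * (indicator {0..2*pi} th *\<^sub>R (of_real (w th) * ?e th)))"
 by (rule ext) (simp add: scaleR_add_right)
 show ?thesis unfolding Ah_def Aw_def by (rule sym[OF trans[OF arg_cong[OF f2, of "integral\<^sup>L lborel"] f1]])
 qed
 \<comment> \<open>The sine kills both boundary terms, so the term with the large factor
   \<open>s\<close> equals minus the term with \<open>h1\<close>.\<close>
 also have "... = of_real (sin (2*pi) * q (2*pi)) * ?e (2*pi) - of_real (sin 0 * q 0) * ?e 0"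
 proof (rule integral_FTC_Icc)
 fix x :: real
 have ne: "(sin x)\<^sup>2 + de\<^sup>2 ~= 0" "de ~= 0" using pos[of x] de by auto
 have "((%th. sin th * q th) has_real_derivative cos x * q x + sin x * (- (2 * sin x * cos x) * (q x)\<^sup>2)) (at x within {0..2*pi})"
 unfolding q_def using ne by (auto intro!: derivative_eq_intros simp: power2_eq_square divide_inverse)
 also have "cos x * q x + sin x * (- (2 * sin x * cos x) * (q x)\<^sup>2) = h1 x"
 proof -
 have "q x * ((sin x)\<^sup>2 + de\<^sup>2) = 1" using ne by (simp add: q_def)
 then have eq: "cos x * q x = cos x * (((sin x)\<^sup>2 + de\<^sup>2) * (q x)\<^sup>2)" by (simp add: power2_eq_square mult_ac)
 show ?thesis unfolding h1_def eq by (simp add: algebra_simps power2_eq_square)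
 qed
 finally have d1: "((%th. complex_of_real (sin th * q th)) has_vector_derivative of_real (h1 x)) (at x within {0..2*pi})"
 by (rule has_vector_derivative_of_real)
 have d: "((%th. - (s * cos th)) has_real_derivative s * sin x) (at x within {0..2*pi})"
 by (auto intro!: derivative_eq_intros)
 have d2: "(?e has_vector_derivative (\<i> * of_real (s * sin x)) * ?e x) (at x within {0..2*pi})"
 using field_vector_diff_chain_within[OF has_vector_derivative_mult_right[OF has_vector_derivative_of_real[OF d], of \<i>]
 has_field_derivative_at_within[OF DERIV_exp]]
 by (simp add: o_def cis_conv_exp)
 from has_vector_derivative_mult[OF d1 d2]
 show "((%th. of_real (sin th * q th) * ?e th) has_vector_derivative
 of_real (h1 x) * ?e x + (\<i> * s) * (of_real (w x) * ?e x)) (at x within {0..2*pi})"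
 by (simp add: w_def algebra_simps power2_eq_square)
 next
 show "continuous_on {0..2*pi} (%x. of_real (h1 x) * ?e x + (\<i> * s) * (of_real (w x) * ?e x))"
 unfolding h1_def w_def q_def using de by (intro continuous_intros) auto
 qed simp
 finally have "(\<i> * s) * Aw = - Ah" by (simp add: add_eq_0_iff)
 then have "norm ((\<i> * s) * Aw) = norm Ah" by simp
 then have "norm Aw = norm Ah / s" using s by (simp add: norm_mult eq_divide_eq mult.commute)
 moreover have "norm Ah <= 100 / de" unfolding Ah_def by (rule bound[OF meas(1) b1])
 ultimately have nw: "norm Aw <= 100 / de / s" using s by (simp only: divide_right_mono)
 have nq: "norm Aq <= 100 / de" unfolding Aq_def by (rule bound[OF _ b3]) measurable
 have "(\<integral>th. indicator {0..2*pi} th *\<^sub>R ?e th \<partial>lborel) = (\<integral>th. indicator {0..2*pi} th *\<^sub>R (of_real (w th) * ?e th)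
 + of_real (de\<^sup>2) * (indicator {0..2*pi} th *\<^sub>R (of_real (q th) * ?e th)) \<partial>lborel)"
 proof (rule BI_integral_cong[OF refl])
 fix th
 \<comment> \<open>The weight and its complement \<open>de\<^sup>2 * q\<close> form a partition of
   unity.\<close>
 have "w th + de\<^sup>2 * q th = 1" using pos[of th] de by (simp add: w_def q_def add_divide_distrib[symmetric])
 then have "complex_of_real (w th) + of_real (de\<^sup>2) * of_real (q th) = 1" 
 unfolding of_real_mult[symmetric] of_real_add[symmetric] by simp
 then have "?e th = (of_real (w th) + of_real (de\<^sup>2) * of_real (q th)) * ?e th" by simp
 then show "indicator {0..2*pi} th *\<^sub>R ?e th = indicator {0..2*pi} th *\<^sub>R (of_real (w th) * ?e th)
 + of_real (de\<^sup>2) * (indicator {0..2*pi} th *\<^sub>R (of_real (q th) * ?e th))"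
 by (simp add: indicator_def distrib_right mult.assoc)
 qed
 also have "... = Aw + (\<integral>th. of_real (de\<^sup>2) * (indicator {0..2*pi} th *\<^sub>R (of_real (q th) * ?e th)) \<partial>lborel)"
 unfolding Aw_def
 by (rule BI_integral_add[OF int[OF meas(2) b2] integrable_mult_right[OF int[OF _ b3]]]) measurable
 also have "... = Aw + of_real (de\<^sup>2) * Aq"
 unfolding integral_mult_right_zero Aq_def ..
 finally have J: "bessel0 t = (Aw + of_real (de\<^sup>2) * Aq) / (2 * pi)"
 unfolding bessel0_def s_def by simp
 have "norm (Aw + of_real (de\<^sup>2) * Aq) <= norm Aw + de\<^sup>2 * norm Aq"
 by (rule order_trans[OF norm_triangle_ineq]) (simp add: norm_mult norm_power)
 also have "... <= 100 / de / s + de\<^sup>2 * (100 / de)"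
 by (intro add_mono nw mult_left_mono nq) simp
 also have "... = 200 / sqrt s"
 using s by (simp add: de2 de_def real_div_sqrt field_simps)
 finally have *: "norm (Aw + of_real (de\<^sup>2) * Aq) <= 200 / sqrt s" .
 have "norm (bessel0 t) = norm (Aw + of_real (de\<^sup>2) * Aq) / (2 * pi)"
 unfolding J norm_divide by simp
 also have "... <= 200 / sqrt s / (2 * pi)"
 using * by (rule divide_right_mono) simp
 also have "... <= 100 / sqrt t"
 proof -
 have "sqrt t <= sqrt s" using t pi_gt3 by (simp add: s_def)
 moreover have "1 <= pi" using pi_gt3 by simp
 ultimately have "sqrt t * 1 <= sqrt s * pi" using t by (intro mult_mono) auto
 then show ?thesis using t s by (simp add: field_simps)
 qed
 finally show ?thesis .
qed

section \<open>Dilations and translations of plane integrals\<close>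

lemma lborel_scale_complex:
 assumes "R > 0"
 shows "lborel = density (distr lborel borel (%x::complex. of_real R * x)) (%_. ennreal (R\<^sup>2))"
 using lborel_affine[of R "0::complex"] assms by (simp add: scaleR_conv_of_real)

lemma nn_integral_scale_complex:
 fixes f :: "complex => ennreal"
 assumes [measurable]: "f : bmeas borel" and R: "R > 0"
 shows "(\<integral>\<^sup>+x. f x \<partial>lborel) = ennreal (R\<^sup>2) * (\<integral>\<^sup>+x. f (of_real R * x) \<partial>lborel)"
 by (subst lborel_scale_complex[OF R])
 (simp add: nn_integral_density nn_integral_distr nn_integral_cmult)

lemma integral_scale_complex:
 fixes f :: "complex => complex"
 assumes [measurable]: "f : bmeas borel" and R: "R > 0"
 shows "(\<integral>x. f x \<partial>lborel) = of_real (R\<^sup>2) * (\<integral>x. f (of_real R * x) \<partial>lborel)"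
proof -
 have "(\<integral>x. f x \<partial>lborel) = (\<integral>x. f x \<partial>density (distr lborel borel (%x::complex. of_real R * x)) (%_. ennreal (R\<^sup>2)))"
 by (rule arg_cong[OF lborel_scale_complex[OF R], where f="%M. integral\<^sup>L M f"])
 also have "... = (\<integral>x. R\<^sup>2 *\<^sub>R f (of_real R * x) \<partial>lborel)"
 by (subst integral_density) (auto simp: integral_distr)
 also have "... = of_real (R\<^sup>2) * (\<integral>x. f (of_real R * x) \<partial>lborel)"
 by (simp add: scaleR_conv_of_real)
 finally show ?thesis .
qed

lemma integral_lborel_translate:
 fixes f :: "complex => 'b::{banach, second_countable_topology}"
 assumes [measurable]: "f : bmeas borel"
 shows "(\<integral>x. f (a + x) \<partial>lborel) = (\<integral>x. f x \<partial>lborel)"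
proof -
 have "(\<integral>x. f x \<partial>lborel) = (\<integral>x. f x \<partial>distr lborel borel ((+) a))"
 by (simp add: lborel_distr_plus)
 also have "... = (\<integral>x. f (a + x) \<partial>lborel)"
 by (subst integral_distr) auto
 finally show ?thesis by simp
qed

lemma integrable_lborel_translate:
 fixes f :: "complex => complex"
 assumes "integrable lborel f"
 shows "integrable lborel (%x. f (a + x))"
proof -
 have [measurable]: "f : bmeas borel" using assms by auto
 have "integrable (distr lborel borel ((+) a)) f"
 using assms by (simp add: lborel_distr_plus)
 then show ?thesis by (subst (asm) integrable_distr_eq) auto
qed

subsection \<open>Fourier transforms\<close>

lemma integrable_fourier:
 assumes "integrable lborel f"
 shows "integrable lborel (%x. cis (- (2 * pi * (xi \<bullet> x))) * f x)"
 by (rule BI_integrable_bound[OF assms])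
 (use assms in \<open>auto simp: norm_mult\<close>)

lemma fourier_diff:
 assumes "integrable lborel f" "integrable lborel g"
 shows "fourier (%x. f x - g x) xi = fourier f xi - fourier g xi"
 unfolding fourier_cis right_diff_distrib
 by (rule BI_integral_diff) (intro integrable_fourier assms)+

lemma norm_fourier_le:
 assumes "integrable lborel f"
 shows "norm (fourier f xi) <= (\<integral>x. norm (f x) \<partial>lborel)"
 unfolding fourier_cis
 by (rule order_trans[OF integral_norm_bound]) (simp add: norm_mult)

lemma measurable_fourier [measurable]:
 assumes [measurable]: "f : bmeas borel"
 shows "fourier f : bmeas borel"
 unfolding fourier_cis[abs_def] by measurable

lemma fourier_zero: "fourier f 0 = (\<integral>x. f x \<partial>lborel)"
 by (simp add: fourier_cis)

lemma integrable_bounded_supp: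
 fixes f :: "complex => complex"
 assumes [measurable]: "f : bmeas borel" and "!!x. norm (f x) <= B" "!!x. norm x > r ==> f x = 0"
 shows "integrable lborel f"
proof -
 have "integrable lborel (%x. indicator (cball 0 r) x *\<^sub>R f x)"
 by (rule integrableI_bounded_set_indicator[where B=B])
 (use assms emeasure_lborel_cball_finite[of "0::complex" r] in auto)
 moreover have "indicator (cball 0 r) x *\<^sub>R f x = f x" for x
 using assms(3)[of x] by (auto simp: indicator_def)
 ultimately show ?thesis by simp
qed

definition conv :: "(complex => complex) => (complex => complex) => complex => complex" where
 "conv f g x = (\<integral>y. f (x - y) * g y \<partial>lborel)"

lemma measurable_conv [measurable]:
 assumes [measurable]: "f : bmeas borel" "g : bmeas borel"
 shows "conv f g : bmeas borel"
 unfolding conv_def[abs_def] by measurable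

lemma fourier_conv:
 assumes f: "integrable lborel f" and g: "integrable lborel g"
 shows "fourier (conv f g) xi = fourier f xi * fourier g xi"
proof -
 have [measurable]: "f : bmeas borel" "g : bmeas borel"
 using f g by auto
 let ?e = "%x. cis (- (2 * pi * (xi \<bullet> x)))"
 have fy: "integrable lborel (%x. f (x - y))" for y
 using integrable_lborel_translate[OF f, of "-y"] by simp
 have nf: "(\<integral>x. norm (f (x - y)) \<partial>lborel) = (\<integral>x. norm (f x) \<partial>lborel)" for y
 using integral_lborel_translate[of "%x. norm (f x)" "-y"] by simp
 have int: "integrable (lborel \<Otimes>\<^sub>M lborel) (%(y, x). ?e x * (f (x - y) * g y))"
 proof (rule lborel_pair.Fubini_integrable)
 show "integrable lborel (%y. \<integral>x. norm (case (y, x) of (y, x) => ?e x * (f (x - y) * g y)) \<partial>lborel)"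
 using integrable_norm[OF g] by (simp add: norm_mult nf)
 show "AE y in lborel. integrable lborel (%x. case (y, x) of (y, x) => ?e x * (f (x - y) * g y))"
 by (intro AE_I2, simp, intro integrable_fourier integrable_mult_left fy)
 qed measurable
 have "fourier (conv f g) xi = (\<integral>x. (\<integral>y. ?e x * (f (x - y) * g y) \<partial>lborel) \<partial>lborel)"
 unfolding fourier_cis conv_def integral_mult_right_zero ..
 also have "... = (\<integral>y. (\<integral>x. ?e x * (f (x - y) * g y) \<partial>lborel) \<partial>lborel)"
 by (rule lborel_pair.Fubini_integral[OF int])
 also have "... = (\<integral>y. fourier f xi * (?e y * g y) \<partial>lborel)"
 proof (rule BI_integral_cong[OF refl])
 fix y
 have "(\<integral>x. ?e x * (f (x - y) * g y) \<partial>lborel) = (\<integral>x. (?e (x - y) * f (x - y)) * (?e y * g y) \<partial>lborel)"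
 proof (rule BI_integral_cong[OF refl])
 fix x
 have "?e x = ?e (x - y) * ?e y" unfolding cis_mult by (simp add: inner_diff_right algebra_simps)
 then show "?e x * (f (x - y) * g y) = (?e (x - y) * f (x - y)) * (?e y * g y)" by simp
 qed
 also have "... = (\<integral>x. ?e (x - y) * f (x - y) \<partial>lborel) * (?e y * g y)"
 by (rule integral_mult_left_zero)
 also have "(\<integral>x. ?e (x - y) * f (x - y) \<partial>lborel) = fourier f xi"
 unfolding fourier_cis using integral_lborel_translate[of "%x. ?e x * f x" "-y"] by simp
 finally show "(\<integral>x. ?e x * (f (x - y) * g y) \<partial>lborel) = fourier f xi * (?e y * g y)" .
 qed
 also have "... = fourier f xi * fourier g xi"
 unfolding integral_mult_right_zero fourier_cis[symmetric] ..
 finally show ?thesis .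
qed

text \<open>The dilation that keeps the integral. On the Fourier side it only rescales the
  frequency, so that for growing \<open>R\<close> everything concentrates at frequency 0.\<close>

definition rescale :: "real => (complex => complex) => complex => complex" where
 "rescale R g x = g (x / of_real R) / of_real (R\<^sup>2)"

lemma measurable_rescale [measurable]:
 assumes [measurable]: "g : bmeas borel"
 shows "rescale R g : bmeas borel"
 unfolding rescale_def[abs_def] by measurable

lemma fourier_rescale:
 assumes [measurable]: "g : bmeas borel" and R: "R > 0"
 shows "fourier (rescale R g) xi = fourier g (of_real R * xi)"
proof -
 have i: "(of_real R * xi) \<bullet> x = xi \<bullet> (of_real R * x)" for x :: complex
 by (simp add: inner_complex_def algebra_simps)
 show ?thesis
 unfolding fourier_cis by (subst integral_scale_complex[OF _ R]) (use R in \<open>auto simp: i rescale_def\<close>)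
qed

text \<open>Continuity almost everywhere and a bounded support suffice for dominated convergence;
  this admits normalised indicators of discs without an approximation by continuous
  functions.\<close>

lemma tendsto_L1_translate:
 fixes g :: "complex => complex"
 assumes g[measurable]: "g : bmeas borel" and B: "!!x. norm (g x) <= B" and r: "!!x. norm x > r ==> g x = 0"
 and cont: "AE x in lborel. isCont g x" and y: "y ----> 0"
 shows "(%n. \<integral>x. norm (g (x + y n) - g x) \<partial>lborel) ----> (0::real)"
proof -
 obtain Y where Y: "!!n. norm (y n) <= Y" using convergent_imp_Bseq[of y] y by (auto simp: convergent_def Bseq_def)
 have "(%n. \<integral>x. norm (g (x + y n) - g x) \<partial>lborel) ----> (\<integral>x. 0 \<partial>(lborel::complex measure))"
 proof (rule integral_dominated_convergence[where w="%x::complex. 2 * B * indicator (cball 0 (r + Y)) x"])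
 show "integrable lborel (%x::complex. 2 * B * indicator (cball 0 (r + Y)) x)"
 using emeasure_lborel_cball_finite[of "0::complex" "r + Y"]
 by (intro integrable_mult_right integrable_real_indicator) auto
 show "AE x in lborel. (%n. norm (g (x + y n) - g x)) ----> 0"
 using cont
 proof eventually_elim
 case (elim x)
 have "(%n. x + y n) ----> x + 0" by (intro tendsto_intros y)
 then have "(%n. g (x + y n)) ----> g x" using isCont_tendsto_compose[OF elim] by auto
 then show ?case by (intro tendsto_norm_zero) (simp add: LIM_zero)
 qed
 show "AE x in lborel. norm (norm (g (x + y n) - g x)) <= 2 * B * indicator (cball 0 (r + Y)) x" for n
 proof (intro AE_I2)
 fix x
 show "norm (norm (g (x + y n) - g x)) <= 2 * B * indicator (cball 0 (r + Y)) x"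
 proof (cases "norm x <= r + Y")
 case True
 then show ?thesis using norm_triangle_ineq4[of "g (x + y n)" "g x"] B[of "x + y n"] B[of x] by auto
 next
 case False
 then have "norm (x + y n) > r" using Y[of n] norm_triangle_ineq2[of x "- y n"] by simp
 moreover have "norm x > r" using False Y[of n] norm_ge_zero[of "y n"] by linarith
 ultimately show ?thesis using r False by simp
 qed
 qed
 qed measurable
 then show ?thesis by simp
qed

text \<open>Riemann-Lebesgue: a shift by half a period reverses the sign of the character, so twice
  the transform is bounded by the \<open>L1\<close> distance of \<open>g\<close> to its translate,
  and the shift tends to 0 as the frequency grows.\<close>

lemma tendsto_fourier_rescale:
 fixes g :: "complex => complex"
 assumes g[measurable]: "g : bmeas borel" and B: "!!x. norm (g x) <= B" and r: "!!x. norm x > r ==> g x = 0"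
 and cont: "AE x in lborel. isCont g x" and R: "filterlim R at_top sequentially" and xi: "xi ~= 0"
 shows "(%n. fourier g (of_real (R n) * xi)) ----> 0"
proof -
 have gi: "integrable lborel g" by (rule integrable_bounded_supp[OF g B r])
 \<comment> \<open>Chosen so that the inner product of \<open>of_real (R n) * xi\<close> with
   \<open>y n\<close> is 1/2, which is half a period.\<close>
 define y where "y n = (inverse (R n) * (1 / (2 * (xi \<bullet> xi)))) *\<^sub>R xi" for n
 have y: "y ----> 0"
 proof -
 have "y ----> (0 * (1 / (2 * (xi \<bullet> xi)))) *\<^sub>R xi"
 unfolding y_def by (intro tendsto_intros tendsto_inverse_0_at_top R)
 then show ?thesis by simp
 qed
 have bound: "2 * norm (fourier g (of_real (R n) * xi)) <= (\<integral>x. norm (g (x + y n) - g x) \<partial>lborel)" if "R n > 0" for n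
 proof -
 define et where "et = of_real (R n) * xi"
 have "et \<bullet> y n = 1/2"
 proof -
 have "et = R n *\<^sub>R xi" by (simp add: et_def scaleR_conv_of_real)
 moreover have "xi \<bullet> xi ~= 0" using xi by simp
 ultimately show ?thesis using that by (simp add: y_def)
 qed
 then have e: "cis (- (2 * pi * (et \<bullet> (x + y n)))) = - cis (- (2 * pi * (et \<bullet> x)))" for x
 proof -
 assume h: "et \<bullet> y n = 1/2"
 have "cis (- (2 * pi * (et \<bullet> x + 1/2))) = cis (- (2 * pi * (et \<bullet> x))) * cis (- pi)"
 unfolding cis_mult by (simp add: distrib_left)
 moreover have "cis (- pi) = -1" by (simp add: complex_eq_iff)
 ultimately show ?thesis unfolding inner_add_right h by simp
 qed
 have gt: "integrable lborel (%x. g (x + y n))"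
 using integrable_lborel_translate[OF gi, of "y n"] by (simp add: add.commute)
 have "fourier g et = (\<integral>x. cis (- (2 * pi * (et \<bullet> (x + y n)))) * g (x + y n) \<partial>lborel)"
 unfolding fourier_cis using integral_lborel_translate[of "%x. cis (- (2 * pi * (et \<bullet> x))) * g x" "y n"]
 by (simp add: add.commute)
 also have "... = - fourier (%x. g (x + y n)) et"
 unfolding e fourier_cis by simp
 finally have "2 * fourier g et = - fourier (%x. g (x + y n) - g x) et"
 by (simp add: fourier_diff[OF gt gi])
 then have "norm (2 * fourier g et) <= (\<integral>x. norm (g (x + y n) - g x) \<partial>lborel)"
 using norm_fourier_le[of "%x. g (x + y n) - g x" et] gt gi by simp
 then show ?thesis by (simp add: et_def norm_mult)
 qed
 have "(%n. 2 * norm (fourier g (of_real (R n) * xi))) ----> 0"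
 proof (rule tendsto_sandwich[OF _ _ tendsto_const tendsto_L1_translate[OF g B r cont y]])
 have "\<forall>\<^sub>F n in sequentially. R n > 0" using R by (auto simp: filterlim_at_top_dense)
 then show "\<forall>\<^sub>F n in sequentially. 2 * norm (fourier g (of_real (R n) * xi)) <= (\<integral>x. norm (g (x + y n) - g x) \<partial>lborel)"
 by eventually_elim (rule bound)
 qed auto
 from tendsto_mult_left[OF this, of "1/2"] show ?thesis
 by (simp add: tendsto_norm_zero_iff)
qed

subsection \<open>The decay function and the kernel of the zeta function\<close>

text \<open>The exponent 3 is the rate at which \<open>zeta_kernel z l\<close> decays in
  \<open>l\<close>, and it exceeds the dimension, so that the function is integrable.\<close>

definition decay :: "complex => real" where "decay x = 1 / (1 + norm x) ^ 3"

lemma decay_pos: "decay x > 0"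
 by (simp add: decay_def add_pos_nonneg)

lemma measurable_decay [measurable]: "decay : bmeas borel"
 unfolding decay_def[abs_def] by measurable

lemma nn_integral_decay: "(\<integral>\<^sup>+x. ennreal (decay x) \<partial>lborel) < \<infinity>"
proof -
 have "(\<integral>\<^sup>+x. ennreal (decay x) \<partial>lborel) = (\<integral>\<^sup>+r. ennreal (2 * pi * r) * indicator {0..} r * ennreal (1 / (1 + r) ^ 3) \<partial>lborel)"
 unfolding decay_def by (rule nn_integral_radial) measurable
 also have "... <= (\<integral>\<^sup>+r. ennreal (2 * pi / (1 + r)\<^sup>2) * indicator {0..} r \<partial>lborel)"
 proof (rule nn_integral_mono)
 fix r :: real
 show "ennreal (2 * pi * r) * indicator {0..} r * ennreal (1 / (1 + r) ^ 3) <= ennreal (2 * pi / (1 + r)\<^sup>2) * indicator {0..} r"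
 proof (cases "r >= 0")
 case True
 have "2 * pi * r * (1 / (1 + r) ^ 3) <= 2 * pi * (1 + r) * (1 / (1 + r) ^ 3)"
 using True by (intro mult_right_mono mult_left_mono) auto
 also have "... = 2 * pi / (1 + r)\<^sup>2" using True by (simp add: power2_eq_square power3_eq_cube)
 finally show ?thesis using True by (simp add: ennreal_mult[symmetric] ennreal_leI)
 qed simp
 qed
 also have "... = ennreal (0 - (- (2 * pi) / (1 + 0)))"
 proof (rule nn_integral_FTC_atLeast)
 show "((%r. - (2 * pi) / (1 + r)) has_real_derivative 2 * pi / (1 + x)\<^sup>2) (at x)" if "0 <= x" for x
 using that by (auto intro!: derivative_eq_intros simp: power2_eq_square)
 show "((%r. - (2 * pi) / (1 + r)) \<longlongrightarrow> 0) at_top" by real_asymp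
 qed auto
 finally show ?thesis by (simp add: le_less_trans)
qed

text \<open>Moving by distance at most 1 changes \<open>1 + norm x\<close> by a factor at most 2,
  hence 8 for the cube. Bounds on unit discs that are uniform in the centre thereby pass to
  integrals of \<open>decay\<close>, both against configurations and against the spectral
  measure.\<close>

lemma decay_le_convolution:
 "ennreal (decay x) * ennreal pi <= 8 * (\<integral>\<^sup>+a. ennreal (decay a) * indicator (cball a 1) x \<partial>lborel)"
proof -
 have "ennreal (decay x) * ennreal pi = (\<integral>\<^sup>+a. ennreal (decay x) * indicator (cball x 1) a \<partial>lborel)"
 using emeasure_disc[of 1 x] by (simp add: nn_integral_cmult_indicator)
 also have "... <= (\<integral>\<^sup>+a. 8 * (ennreal (decay a) * indicator (cball a 1) x) \<partial>lborel)"
 proof (rule nn_integral_mono)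
 fix a
 show "ennreal (decay x) * indicator (cball x 1) a <= 8 * (ennreal (decay a) * indicator (cball a 1) x)"
 proof (cases "dist x a <= 1")
 case True
 have "norm a <= norm x + 1" using True norm_triangle_ineq2[of a x] by (simp add: dist_norm norm_minus_commute)
 then have "1 + norm a <= 2 + 2 * norm x" using norm_ge_zero[of x] by linarith
 then have "1 + norm a <= 2 * (1 + norm x)" by simp
 then have "(1 + norm a) ^ 3 <= (2 * (1 + norm x)) ^ 3" by (intro power_mono) auto
 also have "... = 8 * (1 + norm x) ^ 3" by (simp only: power_mult_distrib) simp
 finally have "(1 + norm a) ^ 3 <= 8 * (1 + norm x) ^ 3" .
 moreover have "(1 + norm a) ^ 3 > 0" "(1 + norm x) ^ 3 > 0" by (simp_all add: add_pos_nonneg)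
 ultimately have "decay x <= 8 * decay a" by (simp add: decay_def field_simps)
 then have "ennreal (decay x) <= 8 * ennreal (decay a)"
 using decay_pos[of a] by (metis ennreal_leI ennreal_mult' ennreal_numeral zero_le_numeral)
 then show ?thesis using True by (simp add: dist_commute)
 qed simp
 qed
 also have "... = 8 * (\<integral>\<^sup>+a. ennreal (decay a) * indicator (cball a 1) x \<partial>lborel)"
 by (rule nn_integral_cmult) (simp add: indicator_def, measurable)
 finally show ?thesis .
qed

definition zeta_kernel :: "complex => complex => complex" where
 "zeta_kernel z l = (if norm l < 1 then 1 / (z - l) else 1 / (z - l) + 1 / l + z / l\<^sup>2)"

lemma measurable_zeta_kernel [measurable]:
 assumes [measurable]: "f : bmeas M" "g : bmeas M"
 shows "(%x. zeta_kernel (f x) (g x)) : bmeas M"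
 unfolding zeta_kernel_def by measurable

text \<open>Near the pole the three terms are estimated one by one and the pole is kept; beyond
  \<open>2 * R\<close> they cancel to third order. The factor 2 guarantees that \<open>l - z\<close>
  has at least half the modulus of \<open>l\<close>.\<close>

lemma norm_zeta_kernel_le:
 assumes "norm z <= R" "R >= 1"
 shows "norm (zeta_kernel z l) <= indicator (cball 0 (2 * R)) l * (1 / norm (z - l) + (1 + R)) + 16 * R\<^sup>2 * decay l"
proof (cases "norm l <= 2 * R")
 case True
 have "norm (zeta_kernel z l) <= 1 / norm (z - l) + (1 + R)"
 proof (cases "norm l < 1")
 case True
 then show ?thesis using assms by (simp add: zeta_kernel_def norm_divide)
 next
 case False
 have "norm (1 / l) <= 1" using False by (simp add: norm_divide divide_le_eq_1)
 moreover have "norm (z / l\<^sup>2) <= R / 1" unfolding norm_divide norm_power using False assms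
 by (intro frac_le) auto
 moreover have "norm (1 / (z - l) + 1 / l + z / l\<^sup>2) <= norm (1 / (z - l)) + norm (1 / l) + norm (z / l\<^sup>2)"
 by (intro order_trans[OF norm_triangle_ineq] add_mono norm_triangle_ineq order_refl)
 ultimately have "norm (1 / (z - l) + 1 / l + z / l\<^sup>2) <= 1 / norm (z - l) + (1 + R)"
 using norm_divide[of 1 "z - l"] by simp
 then show ?thesis unfolding zeta_kernel_def using False by simp
 qed
 then show ?thesis using True decay_pos[of l] by (simp add: add_increasing2)
next
 case False
 have l: "norm l > 0" "norm l >= 1" "l ~= 0" using False assms by auto
 have zl: "norm (l - z) >= norm l / 2" using False assms norm_triangle_ineq2[of l z] by linarith
 then have zl0: "l - z ~= 0" "z - l ~= 0" using l by auto
 \<comment> \<open>The compensating terms are those of the expansion of \<open>1 / (z - l)\<close>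
   at \<open>z = 0\<close> with opposite sign; what is left is the remainder of second
   order.\<close>
 have "zeta_kernel z l = - (z\<^sup>2 / (l\<^sup>2 * (l - z)))"
 using l zl0 by (simp add: zeta_kernel_def field_simps power2_eq_square)
 then have "norm (zeta_kernel z l) = (norm z)\<^sup>2 / ((norm l)\<^sup>2 * norm (l - z))"
 by (simp add: norm_divide norm_mult norm_power)
 also have "... <= R\<^sup>2 / ((norm l)\<^sup>2 * (norm l / 2))"
 using zl l assms by (intro frac_le mult_left_mono power_mono mult_pos_pos) auto
 also have "... = 2 * R\<^sup>2 * (1 / (norm l) ^ 3)" by (simp add: power2_eq_square power3_eq_cube)
 also have "... <= 2 * R\<^sup>2 * (8 * decay l)"
 proof (intro mult_left_mono)
 have "(1 + norm l) ^ 3 <= (2 * norm l) ^ 3" using l by (intro power_mono) auto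
 then have "(1 + norm l) ^ 3 <= 8 * norm l ^ 3" by (simp add: power_mult_distrib)
 moreover have "(1 + norm l) ^ 3 > 0" "norm l ^ 3 > 0" using l by (simp_all add: add_pos_nonneg)
 ultimately show "1 / (norm l) ^ 3 <= 8 * decay l" by (simp add: decay_def field_simps)
 qed auto
 finally show ?thesis using False by simp
qed

lemma indicator_cball_le_decay:
 "R >= 0 ==> indicator (cball 0 R) l <= (1 + R) ^ 3 * decay l"
proof (cases "norm l <= R")
 case True
 assume "R >= 0"
 have "(1 + norm l) ^ 3 <= (1 + R) ^ 3" using True by (intro power_mono) auto
 moreover have "(1 + norm l) ^ 3 > 0" by (simp add: add_pos_nonneg)
 ultimately show ?thesis using True by (simp add: decay_def le_divide_eq)
qed (simp add: decay_def)

text \<open>Integration in \<open>z\<close> removes the pole and leaves a multiple of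
  \<open>decay l\<close>. The sum over the points of the process then has a second moment, which the
  kernel at a fixed \<open>z\<close> would not give because of the pole.\<close>

lemma nn_integral_zeta_kernel_disc:
 assumes R: "R >= 1"
 obtains C where "C >= 0" "!!l. (\<integral>\<^sup>+z\<in>cball 0 R. ennreal (norm (zeta_kernel z l)) \<partial>lborel) <= ennreal (C * decay l)"
proof -
 define A where "A = (2 * pi + pi * R\<^sup>2) + (1 + R) * (pi * R\<^sup>2)"
 define C where "C = (1 + 2 * R) ^ 3 * A + 16 * R\<^sup>2 * (pi * R\<^sup>2)"
 have A0: "A >= 0" using R by (simp add: A_def)
 have "(\<integral>\<^sup>+z\<in>cball 0 R. ennreal (norm (zeta_kernel z l)) \<partial>lborel) <= ennreal (C * decay l)" for l
 proof -
 have d: "decay l >= 0" using decay_pos[of l] by simp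
 let ?i = "indicator (cball 0 (2 * R)) l :: real"
 have "(\<integral>\<^sup>+z\<in>cball 0 R. ennreal (norm (zeta_kernel z l)) \<partial>lborel)
 <= (\<integral>\<^sup>+z. ennreal ?i * (ennreal (1 / norm (z - l)) * indicator (cball 0 R) z)
 + ennreal (?i * (1 + R) + 16 * R\<^sup>2 * decay l) * indicator (cball 0 R) z \<partial>lborel)"
 proof (rule nn_integral_mono)
 fix z
 show "ennreal (norm (zeta_kernel z l)) * indicator (cball 0 R) z
 <= ennreal ?i * (ennreal (1 / norm (z - l)) * indicator (cball 0 R) z)
 + ennreal (?i * (1 + R) + 16 * R\<^sup>2 * decay l) * indicator (cball 0 R) z"
 proof (cases "norm z <= R")
 case True
 have "ennreal (norm (zeta_kernel z l)) <= ennreal (?i * (1 / norm (z - l)) + (?i * (1 + R) + 16 * R\<^sup>2 * decay l))"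
 using norm_zeta_kernel_le[OF True R, of l] by (intro ennreal_leI) (simp add: algebra_simps)
 also have "... = ennreal ?i * ennreal (1 / norm (z - l)) + ennreal (?i * (1 + R) + 16 * R\<^sup>2 * decay l)"
 using R d by (subst ennreal_plus) (auto simp: indicator_def)
 finally show ?thesis using True by simp
 qed simp
 qed
 also have "... = ennreal ?i * (\<integral>\<^sup>+z\<in>cball 0 R. ennreal (1 / norm (z - l)) \<partial>lborel)
 + ennreal (?i * (1 + R) + 16 * R\<^sup>2 * decay l) * ennreal (pi * R\<^sup>2)"
 using R by (simp add: nn_integral_add nn_integral_cmult nn_integral_cmult_indicator emeasure_disc)
 also have "... <= ennreal ?i * ennreal (2 * pi + pi * R\<^sup>2) + ennreal (?i * (1 + R) + 16 * R\<^sup>2 * decay l) * ennreal (pi * R\<^sup>2)"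
 using R by (intro add_right_mono mult_left_mono nn_integral_inverse_dist_disc_le) auto
 also have "... = ennreal (?i * A + 16 * R\<^sup>2 * decay l * (pi * R\<^sup>2))"
 using R d by (simp add: ennreal_mult[symmetric] ennreal_plus[symmetric] A_def algebra_simps del: ennreal_plus)
 also have "... <= ennreal (C * decay l)"
 proof (rule ennreal_leI)
 have "?i * A <= ((1 + 2 * R) ^ 3 * decay l) * A"
 using A0 R by (intro mult_right_mono indicator_cball_le_decay) auto
 then show "?i * A + 16 * R\<^sup>2 * decay l * (pi * R\<^sup>2) <= C * decay l"
 by (simp add: C_def algebra_simps)
 qed
 finally show ?thesis .
 qed
 moreover have "C >= 0" using A0 R by (simp add: C_def)
 ultimately show thesis by (rule that[rotated])
qed

lemma nn_integral_zeta_kernel: "(\<integral>\<^sup>+l. ennreal (norm (zeta_kernel z l)) \<partial>lborel) < \<infinity>"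
proof -
 define R where "R = max 1 (norm z)"
 have R: "norm z <= R" "R >= 1" by (auto simp: R_def)
 have "(\<integral>\<^sup>+l. ennreal (norm (zeta_kernel z l)) \<partial>lborel)
 <= (\<integral>\<^sup>+l. ennreal (1 / norm (l - z)) * indicator (cball 0 (2 * R)) l + ennreal (1 + R) * indicator (cball 0 (2 * R)) l + ennreal (16 * R\<^sup>2) * ennreal (decay l) \<partial>lborel)"
 proof (rule nn_integral_mono)
 fix l
 have d: "decay l >= 0" using decay_pos[of l] by simp
 have "ennreal (norm (zeta_kernel z l)) <= ennreal (indicator (cball 0 (2 * R)) l * (1 / norm (z - l) + (1 + R)) + 16 * R\<^sup>2 * decay l)"
 by (rule ennreal_leI[OF norm_zeta_kernel_le[OF R]])
 also have "... = ennreal (1 / norm (l - z)) * indicator (cball 0 (2 * R)) l + ennreal (1 + R) * indicator (cball 0 (2 * R)) l + ennreal (16 * R\<^sup>2) * ennreal (decay l)"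
 using R d by (auto simp: indicator_def ennreal_mult norm_minus_commute)
 finally show "ennreal (norm (zeta_kernel z l)) <= ..." .
 qed
 also have "... = (\<integral>\<^sup>+l\<in>cball 0 (2 * R). ennreal (1 / norm (l - z)) \<partial>lborel) + ennreal (1 + R) * emeasure lborel (cball (0::complex) (2 * R)) + ennreal (16 * R\<^sup>2) * (\<integral>\<^sup>+l. ennreal (decay l) \<partial>lborel)"
 by (simp add: nn_integral_add nn_integral_cmult nn_integral_cmult_indicator)
 also have "... < \<infinity>"
 using nn_integral_decay R le_less_trans[OF nn_integral_inverse_dist_disc_le[of "2 * R" z]]
 by (auto simp: ennreal_mult_less_top emeasure_disc)
 finally show ?thesis .
qed

subsection \<open>Test functions\<close>

text \<open>The powers of \<open>1 / x\<close> are carried along so that the family is closed under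
  differentiation up to linear combinations.\<close>

definition flat_exp :: "nat => real => real" where
 "flat_exp n x = (if x > 0 then exp (- (1 / x)) / x ^ n else 0)"

lemma flat_exp_tendsto_0: "(flat_exp n \<longlongrightarrow> 0) (at 0)"
proof -
 have r: "(flat_exp n \<longlongrightarrow> 0) (at_right 0)"
 proof -
 have "((%x. (inverse x) ^ n / exp (inverse x)) \<longlongrightarrow> 0) (at_right (0::real))"
 by (rule filterlim_compose[OF tendsto_power_div_exp_0 filterlim_inverse_at_top_right])
 moreover have "\<forall>\<^sub>F x in at_right 0. inverse x ^ n / exp (inverse x) = flat_exp n x"
 using eventually_at_right_less[of 0]
 by eventually_elim (simp add: flat_exp_def exp_minus divide_inverse power_inverse)
 ultimately show ?thesis by (rule Lim_transform_eventually)
 qed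
 have l: "(flat_exp n \<longlongrightarrow> 0) (at_left 0)"
 proof (rule Lim_transform_eventually[OF tendsto_const])
 show "\<forall>\<^sub>F x in at_left 0. 0 = flat_exp n x"
 by (auto simp: eventually_at_filter flat_exp_def)
 qed
 show ?thesis using filterlim_split_at[OF l r] .
qed

lemma DERIV_flat_exp:
 "(flat_exp n has_real_derivative flat_exp (n + 2) x - of_nat n * flat_exp (n + 1) x) (at x)"
proof (cases "x = 0")
 case True
 \<comment> \<open>At 0 the difference quotient is again a member of the family, and every member
   tends to 0 there.\<close>
 have "(%h. flat_exp n h / h) = flat_exp (n + 1)"
 by (auto simp: flat_exp_def fun_eq_iff)
 then have "((%h. (flat_exp n (0 + h) - flat_exp n 0) / h) \<longlongrightarrow> 0) (at 0)"
 using flat_exp_tendsto_0[of "n + 1"] by (simp add: flat_exp_def[of _ 0])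
 then show ?thesis using True by (simp add: DERIV_def flat_exp_def[of _ 0])
next
 case False
 show ?thesis
 proof (cases "x > 0")
 case True
 define y where "y = inverse x"
 have pos: "flat_exp k x = exp (- y) * y ^ k" for k
 using True by (simp add: flat_exp_def y_def divide_inverse power_inverse)
 have "((%x. - inverse x) has_real_derivative y\<^sup>2) (at x)"
 using DERIV_minus[OF DERIV_inverse[of x]] True by (simp add: y_def power2_eq_square)
 from DERIV_fun_exp[OF this]
 have d1: "((%x. exp (- inverse x)) has_real_derivative exp (- y) * y\<^sup>2) (at x)"
 by (simp add: y_def)
 have "(inverse has_real_derivative - (y\<^sup>2)) (at x)"
 using DERIV_inverse[of x] True by (simp add: y_def power2_eq_square)
 from DERIV_power[OF this, of n]
 have d2: "((%x. inverse x ^ n) has_real_derivative of_nat n * (- (y\<^sup>2) * y ^ (n - Suc 0))) (at x)"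
 by (simp add: y_def)
 have "exp (- y) * y\<^sup>2 * y ^ n + of_nat n * (- (y\<^sup>2) * y ^ (n - Suc 0)) * exp (- y)
 = flat_exp (n + 2) x - of_nat n * flat_exp (n + 1) x"
 unfolding pos by (cases n) (simp_all add: power2_eq_square algebra_simps)
 then have "((%x. exp (- inverse x) * inverse x ^ n) has_real_derivative flat_exp (n + 2) x - of_nat n * flat_exp (n + 1) x) (at x)"
 using DERIV_mult[OF d1 d2] by (simp add: y_def)
 moreover have "\<forall>\<^sub>F y in nhds x. flat_exp n y = exp (- inverse y) * inverse y ^ n"
 using eventually_nhds_in_open[of "{0<..}" x] True
 by (auto elim!: eventually_mono simp: flat_exp_def divide_inverse power_inverse)
 ultimately show ?thesis by (subst DERIV_cong_ev) auto
 next
 case False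
 with \<open>x ~= 0\<close> have x: "x < 0" by simp
 have "((%x::real. 0::real) has_real_derivative 0) (at x)" by simp
 moreover have "\<forall>\<^sub>F y in nhds x. flat_exp n y = 0"
 using eventually_nhds_in_open[of "{..<0}" x] x by (auto elim!: eventually_mono simp: flat_exp_def)
 ultimately have "(flat_exp n has_real_derivative 0) (at x)" by (subst DERIV_cong_ev) auto
 then show ?thesis using x by (simp add: flat_exp_def)
 qed
qed

text \<open>A class of functions that is closed under directional derivatives by construction.\<close>
inductive flat_class :: "(complex => complex) => bool" where
 const: "flat_class (%_. c)"
| flat: "flat_class (%z. of_real (flat_exp n (u \<bullet> z + b)))"
| add: "flat_class f ==> flat_class g ==> flat_class (%z. f z + g z)"
| mult: "flat_class f ==> flat_class g ==> flat_class (%z. f z * g z)"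

lemma flat_class_continuous: "flat_class f ==> continuous_on UNIV f"
proof (induction rule: flat_class.induct)
 case (flat n u b)
 have "continuous_on UNIV (flat_exp n)"
 by (rule DERIV_continuous_on[OF has_field_derivative_at_within[OF DERIV_flat_exp]])
 then have "continuous_on UNIV (%z. flat_exp n (u \<bullet> z + b))"
 by (rule continuous_on_compose2) (auto intro!: continuous_intros)
 then show ?case by (rule continuous_on_of_real)
qed (auto intro: continuous_intros)

lemma flat_class_derivative:
 "flat_class f ==> \<exists>g. flat_class g \<and> (\<forall>x. ((%t::real. f (x + of_real t * v)) has_vector_derivative g x) (at 0))"
proof (induction rule: flat_class.induct)
 case (const c)
 show ?case by (intro exI[of _ "%_. 0"]) (auto intro: flat_class.const)
next
 case (flat n u b)
 define g :: "complex => complex" where "g z = of_real (u \<bullet> v) * (of_real (flat_exp (n + 2) (u \<bullet> z + b)) + (- of_nat n) * of_real (flat_exp (n + 1) (u \<bullet> z + b)))" for z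
 have "flat_class g" unfolding g_def by (intro flat_class.intros)
 moreover have "((%t::real. of_real (flat_exp n (u \<bullet> (x + of_real t * v) + b)) :: complex) has_vector_derivative g x) (at 0)" for x
 proof -
 have "((%t::real. u \<bullet> (x + of_real t * v) + b) has_real_derivative u \<bullet> v) (at 0)"
 by (auto intro!: derivative_eq_intros simp: inner_complex_def algebra_simps)
 from DERIV_chain2[OF DERIV_flat_exp this]
 have "((%t::real. flat_exp n (u \<bullet> (x + of_real t * v) + b)) has_real_derivative
 (flat_exp (n + 2) (u \<bullet> x + b) - of_nat n * flat_exp (n + 1) (u \<bullet> x + b)) * (u \<bullet> v)) (at 0)"
 by simp
 from has_vector_derivative_of_real[OF this] show ?thesis
 by (simp add: g_def algebra_simps)
 qed
 ultimately show ?case by blast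
next
 case (add f g)
 then obtain f' g' where "flat_class f'" "flat_class g'"
 "!!x. ((%t::real. f (x + of_real t * v)) has_vector_derivative f' x) (at 0)"
 "!!x. ((%t::real. g (x + of_real t * v)) has_vector_derivative g' x) (at 0)" by blast
 then show ?case
 by (intro exI[of _ "%x. f' x + g' x"] conjI flat_class.add allI has_vector_derivative_add)
next
 case (mult f g)
 then obtain f' g' where fg: "flat_class f'" "flat_class g'"
 "!!x. ((%t::real. f (x + of_real t * v)) has_vector_derivative f' x) (at 0)"
 "!!x. ((%t::real. g (x + of_real t * v)) has_vector_derivative g' x) (at 0)" by blast
 have "((%t::real. f (x + of_real t * v) * g (x + of_real t * v)) has_vector_derivative f x * g' x + f' x * g x) (at 0)" for x
 using has_vector_derivative_mult[OF fg(3,4), of x x] by simp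
 then show ?case using fg mult.hyps
 by (intro exI[of _ "%x. f x * g' x + f' x * g x"] conjI flat_class.intros allI)
qed

lemma flat_class_iter_pd: "flat_class f ==> flat_class (iter_pd vs f)"
proof (induction vs)
 case (Cons v vs)
 then obtain g where g: "flat_class g"
 "!!x. ((%t::real. iter_pd vs f (x + of_real t * v)) has_vector_derivative g x) (at 0)"
 using flat_class_derivative[of "iter_pd vs f" v] by blast
 then have "iter_pd (v # vs) f = g" by (auto simp: fun_eq_iff vector_derivative_at)
 then show ?case using g by simp
qed simp

lemma flat_class_smooth: "flat_class f ==> smooth_fun f"
 unfolding smooth_fun_def
proof (intro conjI allI impI)
 assume f: "flat_class f"
 fix vs show "continuous_on UNIV (iter_pd vs f)"
 by (rule flat_class_continuous[OF flat_class_iter_pd[OF f]])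
next
 assume f: "flat_class f"
 fix vs v x
 obtain g where g: "!!x. ((%t::real. iter_pd vs f (x + of_real t * v)) has_vector_derivative g x) (at 0)"
 using flat_class_derivative[OF flat_class_iter_pd[OF f, of vs], of v] by blast
 from g[of x] show "((%t::real. iter_pd vs f (x + of_real t * v)) has_vector_derivative iter_pd (v # vs) f x) (at 0)"
 by (simp add: vector_derivative_at)
qed

text \<open>As \<open>j\<close> grows, each factor tends to 1 on its open half-plane and is 0 off
  it, so the products tend boundedly to the indicator of the open box.\<close>

definition bump :: "real => complex => complex => complex => complex" where
 "bump j a b z = of_real (flat_exp 0 (j * (Re z - Re a))) * of_real (flat_exp 0 (j * (Re b - Re z)))
 * of_real (flat_exp 0 (j * (Im z - Im a))) * of_real (flat_exp 0 (j * (Im b - Im z)))"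

lemma flat_class_bump: "flat_class (bump j a b)"
proof -
 have "flat_class (%z. of_real (flat_exp 0 (j * (Re z - Re a))))"
 using flat_class.flat[of 0 "of_real j" "- j * Re a"] by (simp add: inner_complex_def algebra_simps)
 moreover have "flat_class (%z. of_real (flat_exp 0 (j * (Re b - Re z))))"
 using flat_class.flat[of 0 "of_real (- j)" "j * Re b"] by (simp add: inner_complex_def algebra_simps)
 moreover have "flat_class (%z. of_real (flat_exp 0 (j * (Im z - Im a))))"
 using flat_class.flat[of 0 "Complex 0 j" "- j * Im a"] by (simp add: inner_complex_def algebra_simps)
 moreover have "flat_class (%z. of_real (flat_exp 0 (j * (Im b - Im z))))"
 using flat_class.flat[of 0 "Complex 0 (- j)" "j * Im b"] by (simp add: inner_complex_def algebra_simps)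
 ultimately show ?thesis unfolding bump_def[abs_def] by (intro flat_class.mult)
qed

lemma flat_exp_0_bounds: "0 <= flat_exp 0 x" "flat_exp 0 x <= 1"
 by (auto simp: flat_exp_def)

lemma norm_bump_le_1: "norm (bump j a b z) <= 1"
 unfolding bump_def norm_mult norm_of_real
 by (intro mult_le_one mult_nonneg_nonneg) (auto simp: flat_exp_0_bounds)

lemma bump_outside: "j > 0 ==> z \<notin> box a b ==> bump j a b z = 0"
 by (auto simp: bump_def flat_exp_def in_box_complex_iff zero_less_mult_iff)

lemma flat_exp_0_tendsto: "y > 0 ==> (%j. flat_exp 0 (real (Suc j) * y)) ----> 1"
proof -
 assume y: "y > 0"
 have "(%j. exp (- (inverse (real (Suc j)) * inverse y))) ----> exp (- (0 * inverse y))"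
 by (intro tendsto_intros LIMSEQ_inverse_real_of_nat)
 moreover have "flat_exp 0 (real (Suc j) * y) = exp (- (inverse (real (Suc j)) * inverse y))" for j
 using y by (simp add: flat_exp_def divide_inverse del: of_nat_Suc)
 ultimately show ?thesis by simp
qed

lemma bump_tendsto: "(%j. bump (real (Suc j)) a b z) ----> indicator (box a b) z"
proof (cases "z : box a b")
 case True
 then have "(%j. bump (real (Suc j)) a b z) ----> of_real 1 * of_real 1 * of_real 1 * of_real 1"
 unfolding bump_def in_box_complex_iff
 by (intro tendsto_mult tendsto_of_real flat_exp_0_tendsto) auto
 then show ?thesis using True by simp
qed (auto simp: bump_outside)

lemma test_fun_bump: "test_fun (bump (real (Suc j)) a b)"
 unfolding test_fun_def
proof
 show "bounded {x. bump (real (Suc j)) a b x ~= 0}"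
 by (rule bounded_subset[OF bounded_box[of a b]]) (use bump_outside[of "real (Suc j)" _ a b] in auto)
qed (rule flat_class_smooth[OF flat_class_bump])

subsection \<open>Configurations as measures\<close>

text \<open>The image under the identity moves the weighted counting measure to the Borel sets. For
  locally finite configurations it is sigma-finite, so that Fubini with Lebesgue measure
  applies.\<close>

definition pm :: "(complex => nat) => complex measure" where
 "pm mu = distr (density (count_space UNIV) (%z. ennreal (real (mu z)))) borel (%x. x)"

lemma sets_pm [simp, measurable_cong]: "sets (pm mu) = sets borel" and space_pm [simp]: "space (pm mu) = UNIV"
 by (simp_all add: pm_def)

lemma nn_integral_pm:
 assumes [measurable]: "f : bmeas borel"
 shows "(\<integral>\<^sup>+z. f z \<partial>pm mu) = (\<integral>\<^sup>+z. ennreal (real (mu z)) * f z \<partial>count_space UNIV)"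
 unfolding pm_def by (subst nn_integral_distr) (auto simp: nn_integral_density)

lemma finite_supp_bounded:
 "locally_finite_cfg mu ==> bounded B ==> finite (supp_cfg mu \<inter> B)"
proof -
 assume lf: "locally_finite_cfg mu" and "bounded B"
 then obtain r where "\<forall>x\<in>B. norm x <= r" by (auto simp: bounded_iff)
 then have "supp_cfg mu \<inter> B \<subseteq> supp_cfg mu \<inter> cball 0 r" by (auto simp: dist_norm)
 then show ?thesis using lf finite_subset unfolding locally_finite_cfg_def by blast
qed

lemma emeasure_pm:
 assumes B: "B : sets borel" and lf: "locally_finite_cfg mu" and bd: "bounded B"
 shows "emeasure (pm mu) B = ennreal (real (cnt mu B))"
proof -
 have fin: "finite (supp_cfg mu \<inter> B)" by (rule finite_supp_bounded[OF lf bd])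
 have "emeasure (pm mu) B = (\<integral>\<^sup>+z. indicator B z \<partial>pm mu)" using B by simp
 also have "... = (\<integral>\<^sup>+z. ennreal (real (mu z)) * indicator B z \<partial>count_space UNIV)"
 using B by (intro nn_integral_pm) simp
 also have "... = (\<Sum>z\<in>supp_cfg mu \<inter> B. ennreal (real (mu z)) * indicator B z)"
 by (rule nn_integral_count_space'[OF fin]) (auto simp: supp_cfg_def indicator_def)
 also have "... = (\<Sum>z\<in>supp_cfg mu \<inter> B. ennreal (real (mu z)))"
 by (intro sum.cong) auto
 also have "... = ennreal (real (cnt mu B))"
 by (simp add: cnt_def sum_ennreal)
 finally show ?thesis .
qed

lemma sigma_finite_pm: "locally_finite_cfg mu ==> sigma_finite_measure (pm mu)"
 by (rule sigma_finite_cballs) (auto simp: emeasure_pm)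

lemma nn_integral_pm_bounded_supp:
 assumes "f : bmeas borel" "locally_finite_cfg mu" "!!x. norm x > r ==> f x = 0" "!!x. f x < \<top>"
 shows "(\<integral>\<^sup>+z. f z \<partial>pm mu) < \<infinity>"
proof -
 have fin: "finite (supp_cfg mu \<inter> cball 0 r)" by (rule finite_supp_bounded) (use assms in auto)
 have "(\<integral>\<^sup>+z. f z \<partial>pm mu) = (\<Sum>z\<in>supp_cfg mu \<inter> cball 0 r. ennreal (real (mu z)) * f z)"
 unfolding nn_integral_pm[OF assms(1)]
 by (rule nn_integral_count_space'[OF fin]) (use assms(3) in \<open>auto simp: supp_cfg_def not_le\<close>)
 also have "... < \<infinity>" using fin assms(4) by (auto simp: ennreal_mult_less_top)
 finally show ?thesis .
qed

lemma integrable_pm_bounded_supp: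
 fixes f :: "complex => complex"
 assumes [measurable]: "f : bmeas borel" and "locally_finite_cfg mu" "!!x. norm x > r ==> f x = 0"
 shows "integrable (pm mu) f"
proof (rule integrableI_bounded)
 show "(\<integral>\<^sup>+x. ennreal (norm (f x)) \<partial>pm mu) < \<infinity>"
 by (rule nn_integral_pm_bounded_supp[where r=r]) (use assms in auto)
qed measurable

text \<open>Off the integrable case both sides may differ: the sum is then \<open>0\<close> because its index set is infinite.\<close>
lemma lin_stat_eq_integral:
 assumes [measurable]: "f : bmeas borel" and "locally_finite_cfg mu" "!!x. norm x > r ==> f x = 0"
 shows "lin_stat mu f = (\<integral>z. f z \<partial>pm mu)"
proof -
 have "(\<integral>z. f z \<partial>pm mu) = (\<integral>z. f z \<partial>density (count_space UNIV) (%z. ennreal (real (mu z))))"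
 unfolding pm_def by (subst integral_distr) auto
 also have "... = (\<integral>z. real (mu z) *\<^sub>R f z \<partial>count_space UNIV)"
 by (subst integral_density) auto
 also have "... = (\<Sum>z | z : UNIV \<and> real (mu z) *\<^sub>R f z ~= 0. real (mu z) *\<^sub>R f z)"
 proof (rule lebesgue_integral_count_space_finite_support)
 have "finite (supp_cfg mu \<inter> cball 0 r)" by (rule finite_supp_bounded) (use assms in auto)
 moreover have "z : supp_cfg mu \<inter> cball 0 r" if "real (mu z) *\<^sub>R f z ~= 0" for z
 using that assms(3)[of z] by (cases "norm z > r") (auto simp: supp_cfg_def)
 ultimately show "finite {z : UNIV. real (mu z) *\<^sub>R f z ~= 0}"
 by (elim rev_finite_subset) blast
 qed
 also have "... = lin_stat mu f"
 unfolding lin_stat_def by (rule sum.cong) (auto simp: supp_cfg_def scaleR_conv_of_real)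
 finally show ?thesis by simp
qed

definition LF :: "(complex => nat) set" where "LF = Collect locally_finite_cfg"

text \<open>Restricted to locally finite configurations, where \<open>cnt\<close> is the true number
  of points; on an infinite set of points the finite sum in \<open>cnt\<close> would have the value
  0.\<close>

definition LCFG :: "(complex => nat) measure" where
 "LCFG = sigma LF {{mu : LF. cnt mu B = k} | B k. B : sets borel \<and> bounded B}"

lemma space_LCFG: "space LCFG = LF"
 unfolding LCFG_def by (rule space_measure_of) auto

lemma sets_LCFG: "sets LCFG = sigma_sets LF {{mu : LF. cnt mu B = k} | B k. B : sets borel \<and> bounded B}"
 unfolding LCFG_def by (rule sets_measure_of) auto

lemma measurable_cnt:
 assumes "B : sets borel" "bounded B"
 shows "(%mu. cnt mu B) : measurable LCFG (count_space UNIV)"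
proof (subst measurable_count_space_eq2_countable, intro conjI)
 show "\<forall>a\<in>UNIV. (%mu. cnt mu B) -` {a} \<inter> space LCFG : sets LCFG"
 proof
 fix a
 have "(%mu. cnt mu B) -` {a} \<inter> space LCFG = {mu : LF. cnt mu B = a}" by (auto simp: space_LCFG)
 also have "... : sets LCFG" unfolding sets_LCFG using assms by (intro sigma_sets.Basic) auto
 finally show "(%mu. cnt mu B) -` {a} \<inter> space LCFG : sets LCFG" .
 qed
qed auto

lemma cnt_mono:
 assumes "locally_finite_cfg mu" "bounded B" "A \<subseteq> B"
 shows "cnt mu A <= cnt mu B"
 unfolding cnt_def using assms by (intro sum_mono2 finite_supp_bounded) auto

lemma LF_locally_finite: "K : measurable P LCFG ==> p : space P ==> locally_finite_cfg (K p)"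
 by (drule measurable_space) (auto simp: space_LCFG LF_def)

text \<open>Joint measurability is reduced to subprobability kernels: on every disc the counting
 measure is normalised by its mass.\<close>
lemma measurable_nn_integral_pm:
 assumes f[measurable]: "(%x. f (fst x) (snd x)) : bmeas (P \<Otimes>\<^sub>M borel)" and K[measurable]: "K : measurable P LCFG"
 shows "(%p. \<integral>\<^sup>+l. f p l \<partial>pm (K p)) : bmeas P"
proof -
 have lf: "locally_finite_cfg (K p)" if "p : space P" for p by (rule LF_locally_finite[OF K that])
 \<comment> \<open>The summand 1 avoids a division by zero and makes the normalised measures
   subprobabilities.\<close>
 define c where "c r p = 1 / (1 + real (cnt (K p) (cball 0 (real r))))" for r p
 define L where "L r p = density (pm (K p)) (%l. ennreal (c r p) * indicator (cball 0 (real r)) l)" for r p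
 have c0: "c r p > 0" for r p by (simp add: c_def add_pos_nonneg)
 have cntm[measurable]: "(%p. real (cnt (K p) B)) : bmeas P" if "B : sets borel" "bounded B" for B
 using measurable_compose[OF measurable_compose[OF K measurable_cnt[OF that]], of real borel] by simp
 have cm[measurable]: "c r : bmeas P" for r
 unfolding c_def by measurable
 have emL: "emeasure (L r p) A = ennreal (c r p * real (cnt (K p) (A \<inter> cball 0 (real r))))" if "p : space P" "A : sets borel" for r p A
 proof -
 have "emeasure (L r p) A = (\<integral>\<^sup>+l. ennreal (c r p) * indicator (A \<inter> cball 0 (real r)) l \<partial>pm (K p))"
 unfolding L_def using that by (subst emeasure_density) (auto intro!: nn_integral_cong simp: indicator_def)
 also have "... = ennreal (c r p) * emeasure (pm (K p)) (A \<inter> cball 0 (real r))"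
 using that by (intro nn_integral_cmult_indicator) auto
 also have "... = ennreal (c r p * real (cnt (K p) (A \<inter> cball 0 (real r))))"
 using that c0[of r p] by (subst emeasure_pm) (auto intro!: lf bounded_Int simp: ennreal_mult)
 finally show ?thesis .
 qed
 have Lm[measurable]: "L r : measurable P (subprob_algebra borel)" for r
 proof (rule measurable_subprob_algebra)
 fix p assume p: "p : space P"
 show "subprob_space (L r p)"
 proof
 have "emeasure (L r p) (space (L r p)) = ennreal (c r p * real (cnt (K p) (UNIV \<inter> cball 0 (real r))))"
 using emL[OF p, of UNIV] by (simp add: L_def)
 also have "... <= 1" by (simp add: c_def ennreal_le_1 divide_le_eq_1 add_pos_nonneg)
 finally show "emeasure (L r p) (space (L r p)) <= 1" .
 qed (simp add: L_def)
 show "sets (L r p) = sets borel" by (simp add: L_def)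
 next
 fix A :: "complex set" assume A: "A : sets borel"
 have "(%p. ennreal (c r p * real (cnt (K p) (A \<inter> cball 0 (real r))))) : bmeas P"
 using A by (intro measurable_compose[OF borel_measurable_times[OF cm]] measurable_ennreal) (auto intro!: cntm bounded_Int)
 then show "(%p. emeasure (L r p) A) : bmeas P"
 by (rule measurable_cong[THEN iffD1, rotated]) (simp add: emL A)
 qed
 have fp[measurable]: "f p : bmeas borel" if "p : space P" for p
 using measurable_compose[OF measurable_Pair1'[OF that] f] by simp
 \<comment> \<open>The normalisation is undone on every disc, and the discs exhaust the plane
   monotonically.\<close>
 have "(%p. SUP r. ennreal (1 + real (cnt (K p) (cball 0 (real r)))) * (\<integral>\<^sup>+l. f p l \<partial>L r p)) : bmeas P"
 proof -
 have "(%p. \<integral>\<^sup>+l. f p l \<partial>L r p) : bmeas P" for r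
 by (rule nn_integral_measurable_subprob_algebra2[OF _ Lm]) (use f in \<open>simp add: case_prod_unfold\<close>)
 then show ?thesis by measurable
 qed
 moreover have "(SUP r. ennreal (1 + real (cnt (K p) (cball 0 (real r)))) * (\<integral>\<^sup>+l. f p l \<partial>L r p)) = (\<integral>\<^sup>+l. f p l \<partial>pm (K p))"
 if p: "p : space P" for p
 proof -
 note [measurable] = fp[OF p]
 have "ennreal (1 + real (cnt (K p) (cball 0 (real r)))) * (\<integral>\<^sup>+l. f p l \<partial>L r p) = (\<integral>\<^sup>+l. f p l * indicator (cball 0 (real r)) l \<partial>pm (K p))" for r
 proof -
 have "(\<integral>\<^sup>+l. f p l \<partial>L r p) = ennreal (c r p) * (\<integral>\<^sup>+l. f p l * indicator (cball 0 (real r)) l \<partial>pm (K p))"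
 unfolding L_def by (subst nn_integral_density, measurable, subst nn_integral_cmult[symmetric], measurable)
 (auto intro!: nn_integral_cong simp: mult_ac)
 moreover have "ennreal (1 + real (cnt (K p) (cball 0 (real r)))) * ennreal (c r p) = 1"
 by (simp add: c_def ennreal_mult[symmetric] add_pos_nonneg del: ennreal_plus)
 ultimately show ?thesis by (simp add: mult.assoc[symmetric])
 qed
 moreover have "(SUP r. \<integral>\<^sup>+l. f p l * indicator (cball 0 (real r)) l \<partial>pm (K p)) = (\<integral>\<^sup>+l. (SUP r. f p l * indicator (cball 0 (real r)) l) \<partial>pm (K p))"
 proof (rule nn_integral_monotone_convergence_SUP[symmetric])
 show "incseq (%r l. f p l * indicator (cball 0 (real r)) l)"
 by (auto simp: incseq_def le_fun_def indicator_def)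
 qed measurable
 moreover have "(SUP r. f p l * indicator (cball 0 (real r)) l) = f p l" for l
 proof (rule antisym)
 show "(SUP r. f p l * indicator (cball 0 (real r)) l) <= f p l"
 by (rule SUP_least) (auto simp: indicator_def)
 obtain r where "norm l <= real r" using real_arch_simple by blast
 then show "f p l <= (SUP r. f p l * indicator (cball 0 (real r)) l)"
 by (intro SUP_upper2[of r]) auto
 qed
 ultimately show ?thesis by simp
 qed
 ultimately show ?thesis by (rule measurable_cong[THEN iffD1, rotated])
qed

lemma measurable_integral_pm_real:
 fixes f :: "'p => complex => real"
 assumes f[measurable]: "(%x. f (fst x) (snd x)) : bmeas (P \<Otimes>\<^sub>M borel)" and K[measurable]: "K : measurable P LCFG"
 shows "(%p. \<integral>l. f p l \<partial>pm (K p)) : bmeas P"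
proof -
 have [measurable]: "(%p. \<integral>\<^sup>+l. ennreal (norm (f p l)) \<partial>pm (K p)) : bmeas P"
 "(%p. \<integral>\<^sup>+l. ennreal (f p l) \<partial>pm (K p)) : bmeas P"
 "(%p. \<integral>\<^sup>+l. ennreal (- f p l) \<partial>pm (K p)) : bmeas P"
 by (rule measurable_nn_integral_pm[OF _ K]; measurable)+
 \<comment> \<open>The case distinction reproduces the default value 0 of the Bochner integral of a
   non-integrable function.\<close>
 have "(%p. if (\<integral>\<^sup>+l. ennreal (norm (f p l)) \<partial>pm (K p)) < \<infinity>
 then enn2real (\<integral>\<^sup>+l. ennreal (f p l) \<partial>pm (K p)) - enn2real (\<integral>\<^sup>+l. ennreal (- f p l) \<partial>pm (K p)) else 0) : bmeas P"
 by measurable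
 moreover have "(if (\<integral>\<^sup>+l. ennreal (norm (f p l)) \<partial>pm (K p)) < \<infinity>
 then enn2real (\<integral>\<^sup>+l. ennreal (f p l) \<partial>pm (K p)) - enn2real (\<integral>\<^sup>+l. ennreal (- f p l) \<partial>pm (K p)) else 0)
 = (\<integral>l. f p l \<partial>pm (K p))" if p: "p : space P" for p
 proof -
 have [measurable]: "f p : bmeas borel"
 using measurable_compose[OF measurable_Pair1'[OF p] f] by simp
 show ?thesis
 by (cases "integrable (pm (K p)) (f p)")
 (auto simp: real_lebesgue_integral_def integrable_iff_bounded not_integrable_integral_eq)
 qed
 ultimately show ?thesis by (rule measurable_cong[THEN iffD1, rotated])
qed

lemma measurable_integral_pm:
 fixes f :: "'p => complex => complex"
 assumes f[measurable]: "(%x. f (fst x) (snd x)) : bmeas (P \<Otimes>\<^sub>M borel)" and K[measurable]: "K : measurable P LCFG"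
 shows "(%p. \<integral>l. f p l \<partial>pm (K p)) : bmeas P"
proof -
 have [measurable]: "(%p. \<integral>\<^sup>+l. ennreal (norm (f p l)) \<partial>pm (K p)) : bmeas P"
 by (rule measurable_nn_integral_pm[OF _ K]; measurable)
 have [measurable]: "(%p. \<integral>l. Re (f p l) \<partial>pm (K p)) : bmeas P"
 "(%p. \<integral>l. Im (f p l) \<partial>pm (K p)) : bmeas P"
 by (rule measurable_integral_pm_real[OF _ K]; measurable)+
 have "(%p. if (\<integral>\<^sup>+l. ennreal (norm (f p l)) \<partial>pm (K p)) < \<infinity>
 then of_real (\<integral>l. Re (f p l) \<partial>pm (K p)) + \<i> * of_real (\<integral>l. Im (f p l) \<partial>pm (K p)) else 0) : bmeas P"
 by measurable
 moreover have "(if (\<integral>\<^sup>+l. ennreal (norm (f p l)) \<partial>pm (K p)) < \<infinity>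
 then of_real (\<integral>l. Re (f p l) \<partial>pm (K p)) + \<i> * of_real (\<integral>l. Im (f p l) \<partial>pm (K p)) else 0)
 = (\<integral>l. f p l \<partial>pm (K p))" if p: "p : space P" for p
 proof -
 have [measurable]: "f p : bmeas borel"
 using measurable_compose[OF measurable_Pair1'[OF p] f] by simp
 show ?thesis
 proof (cases "integrable (pm (K p)) (f p)")
 case True
 then show ?thesis by (auto simp: integrable_iff_bounded complex_eq_iff)
 qed (auto simp: integrable_iff_bounded not_integrable_integral_eq)
 qed
 ultimately show ?thesis by (rule measurable_cong[THEN iffD1, rotated])
qed

lemma shift_cfg_LF: "locally_finite_cfg (shift_cfg w mu) \<longleftrightarrow> locally_finite_cfg mu"
proof -
 have *: "locally_finite_cfg (shift_cfg w mu)" if "locally_finite_cfg mu" for w mu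
 unfolding locally_finite_cfg_def
 proof
 fix r
 have "supp_cfg (shift_cfg w mu) \<inter> cball 0 r = (+) w ` (supp_cfg mu \<inter> cball (- w) r)"
 by (auto simp: supp_cfg_def shift_cfg_def dist_norm norm_minus_commute algebra_simps intro!: image_eqI[where x="_ - w"])
 then show "finite (supp_cfg (shift_cfg w mu) \<inter> cball 0 r)"
 using finite_supp_bounded[OF that, of "cball (- w) r"] by simp
 qed
 have "shift_cfg (- w) (shift_cfg w mu) = mu" by (simp add: shift_cfg_def)
 then show ?thesis using *[of mu w] *[of "shift_cfg w mu" "- w"] by auto
qed

lemma cnt_shift_cfg: "cnt (shift_cfg w mu) B = cnt mu ((+) (- w) ` B)"
 unfolding cnt_def
 by (rule sum.reindex_bij_witness[where i="(+) w" and j="(+) (- w)"]) (auto simp: supp_cfg_def shift_cfg_def)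

lemma borel_translate:
 assumes "B : sets (borel :: complex measure)" shows "(+) w ` B : sets borel"
proof -
 have "(%x. x - w) -` B : sets borel"
 using measurable_sets_borel[OF _ assms, of "%x. x - w"] by simp
 moreover have "(%x. x - w) -` B = (+) w ` B"
 by (auto intro!: image_eqI[where x="_ - w"])
 ultimately show ?thesis by simp
qed

lemma measurable_shift_cfg [measurable]: "shift_cfg w : measurable LCFG LCFG"
proof (rule measurableI)
 have "shift_cfg w : measurable LCFG (sigma LF {{mu : LF. cnt mu B = k} | B k. B : sets borel \<and> bounded B})"
 proof (rule measurable_measure_of)
 show "shift_cfg w : space LCFG \<rightarrow> LF" by (auto simp: space_LCFG LF_def shift_cfg_LF)
 fix Y assume "Y : {{mu : LF. cnt mu B = k} | B k. B : sets borel \<and> bounded B}"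
 then obtain B k where Y: "Y = {mu : LF. cnt mu B = k}" "B : sets borel" "bounded B" by auto
 have "shift_cfg w -` Y \<inter> space LCFG = {mu : space LCFG. cnt mu ((+) (- w) ` B) = k}"
 by (auto simp: Y space_LCFG LF_def shift_cfg_LF cnt_shift_cfg)
 also have "... = (%mu. cnt mu ((+) (- w) ` B)) -` {k} \<inter> space LCFG" by auto
 also have "... : sets LCFG"
 using Y by (intro measurable_sets[OF measurable_cnt] borel_translate bounded_translation) auto
 finally show "shift_cfg w -` Y \<inter> space LCFG : sets LCFG" .
 qed auto
 then have m: "shift_cfg w : measurable LCFG LCFG" by (subst (2) LCFG_def)
 show "shift_cfg w x : space LCFG" if "x : space LCFG" for x using measurable_space[OF m that] .
 show "shift_cfg w -` A \<inter> space LCFG : sets LCFG" if "A : sets LCFG" for A using measurable_sets[OF m that] .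
qed

lemma pm_shift_cfg: "pm (shift_cfg w mu) = distr (pm mu) borel ((+) w)"
proof (rule measure_eqI)
 fix A assume "A : sets (pm (shift_cfg w mu))"
 then have A[measurable]: "A : sets borel" by simp
 have "emeasure (pm (shift_cfg w mu)) A = (\<integral>\<^sup>+z. indicator A z \<partial>pm (shift_cfg w mu))" by simp
 also have "... = (\<integral>\<^sup>+z. ennreal (real (mu (z - w))) * indicator A z \<partial>count_space UNIV)"
 by (subst nn_integral_pm) (auto simp: shift_cfg_def)
 also have "... = (\<integral>\<^sup>+z. ennreal (real (mu (w + z - w))) * indicator A (w + z) \<partial>count_space UNIV)"
 by (rule nn_integral_bij_count_space[symmetric, of "(+) w" UNIV UNIV "%z. ennreal (real (mu (z - w))) * indicator A z"])
 (rule bij_plus)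
 also have "... = (\<integral>\<^sup>+z. indicator A (w + z) \<partial>pm mu)"
 by (subst nn_integral_pm) auto
 also have "... = (\<integral>\<^sup>+z. indicator A z \<partial>distr (pm mu) borel ((+) w))"
 by (subst nn_integral_distr) auto
 finally show "emeasure (pm (shift_cfg w mu)) A = emeasure (distr (pm mu) borel ((+) w)) A" by simp
qed simp

lemma nn_integral_pm_shift:
 "f : bmeas borel ==> (\<integral>\<^sup>+l. f l \<partial>pm (shift_cfg w mu)) = (\<integral>\<^sup>+l. f (w + l) \<partial>pm mu)"
 unfolding pm_shift_cfg by (subst nn_integral_distr) auto

lemma integral_pm_shift:
 fixes f :: "complex => complex"
 shows "f : bmeas borel ==> (\<integral>l. f l \<partial>pm (shift_cfg w mu)) = (\<integral>l. f (w + l) \<partial>pm mu)"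
 unfolding pm_shift_cfg by (subst integral_distr) auto

section \<open>Stationary point processes: invariance of the law and Campbell's formula\<close>

locale stat_pp =
 fixes M :: "'w measure" and N :: "'w => complex => nat"
 assumes pp: "point_process M N" and stat: "stationary_pp M N" and fsm: "finite_second_moment M N"
begin

sublocale prob_space M using pp by (simp add: point_process_def)

lemma lfN: "om : space M ==> locally_finite_cfg (N om)"
 using pp by (simp add: point_process_def)

lemma measurable_cnt_N: "B : sets borel ==> bounded B ==> (%om. cnt (N om) B) : measurable M (count_space UNIV)"
 using pp by (simp add: point_process_def)

lemma measurable_N [measurable]: "N : measurable M LCFG"
 unfolding LCFG_def
proof (rule measurable_measure_of)
 show "N : space M \<rightarrow> LF" using lfN by (auto simp: LF_def)
 fix Y assume "Y : {{mu : LF. cnt mu B = k} | B k. B : sets borel \<and> bounded B}"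
 then obtain B k where Y: "Y = {mu : LF. cnt mu B = k}" "B : sets borel" "bounded B" by auto
 have "N -` Y \<inter> space M = (%om. cnt (N om) B) -` {k} \<inter> space M"
 using lfN by (auto simp: Y LF_def)
 also have "... : sets M" using Y by (intro measurable_sets[OF measurable_cnt_N]) auto
 finally show "N -` Y \<inter> space M : sets M" .
qed auto

text \<open>Stationarity speaks of finitely many counts at a time. The sets prescribing finitely
  many counts generate the configurations and are stable under intersection, so the whole law is
  invariant.\<close>

lemma law_shift: "distr M LCFG N = distr M LCFG (%om. shift_cfg w (N om))" (is "?mu = ?\<nu>")
proof -
 define E where "E = {{mu : LF. \<forall>i<k. cnt mu (B i) = m i} | (k::nat) B m. \<forall>i<k. B i : sets borel \<and> bounded (B i)}"
 have E_sets: "E \<subseteq> sets LCFG"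
 proof
 fix X assume "X : E"
 then obtain k B m where X: "X = {mu : LF. \<forall>i<(k::nat). cnt mu (B i) = m i}" "!!i. i < k ==> B i : sets borel \<and> bounded (B i)"
 unfolding E_def by blast
 have "X = space LCFG \<inter> (\<Inter>i\<in>{..<k}. (%mu. cnt mu (B i)) -` {m i} \<inter> space LCFG)" if "k > 0"
 using that by (auto simp: X space_LCFG)
 moreover have "(\<Inter>i\<in>{..<k}. (%mu. cnt mu (B i)) -` {m i} \<inter> space LCFG) : sets LCFG" if "k > 0"
 using that X(2) by (intro sets.finite_INT measurable_sets[OF measurable_cnt]) auto
 ultimately show "X : sets LCFG"
 by (cases "k = 0") (auto simp: X space_LCFG[symmetric])
 qed
 show ?thesis
 proof (rule measure_eqI_generator_eq[where E=E and \<Omega>=LF and A="%_. LF"])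
 show "Int_stable E"
 unfolding Int_stable_def
 proof (intro ballI)
 fix X Y assume "X : E" "Y : E"
 then obtain k B m k' B' m' where X: "X = {mu : LF. \<forall>i<(k::nat). cnt mu (B i) = m i}" "!!i. i < k ==> B i : sets borel \<and> bounded (B i)"
 and Y: "Y = {mu : LF. \<forall>i<(k'::nat). cnt mu (B' i) = m' i}" "!!i. i < k' ==> B' i : sets borel \<and> bounded (B' i)"
 unfolding E_def by blast
 have "X \<inter> Y = {mu : LF. \<forall>i<k + k'. cnt mu (if i < k then B i else B' (i - k)) = (if i < k then m i else m' (i - k))}"
 (is "_ = ?Z")
 proof (intro equalityI subsetI)
 fix mu assume "mu : X \<inter> Y" then show "mu : ?Z" by (auto simp: X Y)
 next
 fix mu assume Z: "mu : ?Z"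
 have "cnt mu (B i) = m i" if "i < k" for i using Z that by (auto dest: spec[of _ i])
 moreover have "cnt mu (B' i) = m' i" if "i < k'" for i using Z that by (auto dest: spec[of _ "i + k"])
 ultimately show "mu : X \<inter> Y" using Z by (auto simp: X Y)
 qed
 then show "X \<inter> Y : E" unfolding E_def using X(2) Y(2)
 by (intro CollectI exI[of _ "k + k'"] exI[of _ "%i. if i < k then B i else B' (i - k)"]
 exI[of _ "%i. if i < k then m i else m' (i - k)"]) auto
 qed
 show "E \<subseteq> Pow LF" unfolding E_def by auto
 have sE: "sets LCFG = sigma_sets LF E"
 proof
 show "sets LCFG \<subseteq> sigma_sets LF E"
 unfolding sets_LCFG
 proof (rule sigma_sets_mono', safe)
 fix B :: "complex set" and k assume "B : sets borel" "bounded B"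
 then show "{mu : LF. cnt mu B = k} : E"
 unfolding E_def by (intro CollectI exI[of _ 1] exI[of _ "%_. B"] exI[of _ "%_. k"]) auto
 qed
 show "sigma_sets LF E \<subseteq> sets LCFG"
 using sets.sigma_sets_subset[OF E_sets] by (simp add: space_LCFG)
 qed
 then show "sets ?mu = sigma_sets LF E" "sets ?\<nu> = sigma_sets LF E" by auto
 \<comment> \<open>With \<open>k = 0\<close> no count is prescribed, which gives the whole
   space.\<close>
 show "range (%_. LF) \<subseteq> E" unfolding E_def by (auto intro!: exI[of _ "0::nat"])
 show "!!i. emeasure ?mu LF ~= \<infinity>" by (subst emeasure_distr) (auto simp: space_LCFG[symmetric])
 fix X assume "X : E"
 then obtain k B m where X: "X = {mu : LF. \<forall>i<(k::nat). cnt mu (B i) = m i}" and B: "!!i. i < k ==> B i : sets borel \<and> bounded (B i)"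
 unfolding E_def by blast
 have XS: "X : sets LCFG" using \<open>X : E\<close> E_sets by auto
 let ?P = "PiM {..<k} (%_. count_space UNIV)"
 have S: "(\<Pi>\<^sub>E i\<in>{..<k}. {m i}) : sets ?P" by (rule sets_PiM_I_finite) auto
 have m1: "(%om. \<lambda>i\<in>{..<k}. cnt (N om) (B i)) : measurable M ?P"
 using B by (intro measurable_restrict measurable_cnt_N) auto
 have m2: "(%om. \<lambda>i\<in>{..<k}. cnt (N om) ((+) (- w) ` B i)) : measurable M ?P"
 using B by (intro measurable_restrict measurable_cnt_N borel_translate bounded_translation) auto
 have "emeasure ?mu X = emeasure M (N -` X \<inter> space M)"
 using XS by (subst emeasure_distr) auto
 also have "N -` X \<inter> space M = (%om. \<lambda>i\<in>{..<k}. cnt (N om) (B i)) -` (\<Pi>\<^sub>E i\<in>{..<k}. {m i}) \<inter> space M"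
 using lfN by (auto simp: X LF_def PiE_def Pi_def)
 also have "emeasure M ... = emeasure (distr M ?P (%om. \<lambda>i\<in>{..<k}. cnt (N om) (B i))) (\<Pi>\<^sub>E i\<in>{..<k}. {m i})"
 using S m1 by (subst emeasure_distr) auto
 also have "distr M ?P (%om. \<lambda>i\<in>{..<k}. cnt (N om) (B i)) = distr M ?P (%om. \<lambda>i\<in>{..<k}. cnt (N om) ((+) (- w) ` B i))"
 using stat B unfolding stationary_pp_def by blast
 also have "emeasure ... (\<Pi>\<^sub>E i\<in>{..<k}. {m i}) = emeasure M ((%om. \<lambda>i\<in>{..<k}. cnt (N om) ((+) (- w) ` B i)) -` (\<Pi>\<^sub>E i\<in>{..<k}. {m i}) \<inter> space M)"
 using S m2 by (subst emeasure_distr) auto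
 also have "(%om. \<lambda>i\<in>{..<k}. cnt (N om) ((+) (- w) ` B i)) -` (\<Pi>\<^sub>E i\<in>{..<k}. {m i}) \<inter> space M = (%om. shift_cfg w (N om)) -` X \<inter> space M"
 using lfN by (auto simp: X LF_def PiE_def Pi_def shift_cfg_LF cnt_shift_cfg)
 also have "emeasure M ... = emeasure ?\<nu> X"
 using XS by (subst emeasure_distr) auto
 finally show "emeasure ?mu X = emeasure ?\<nu> X" .
 qed auto
qed

lemma nn_integral_law_shift:
 assumes [measurable]: "\<Phi> : bmeas LCFG"
 shows "(\<integral>\<^sup>+om. \<Phi> (N om) \<partial>M) = (\<integral>\<^sup>+om. \<Phi> (shift_cfg w (N om)) \<partial>M)"
proof -
 have "(\<integral>\<^sup>+om. \<Phi> (N om) \<partial>M) = (\<integral>\<^sup>+mu. \<Phi> mu \<partial>distr M LCFG N)" by (subst nn_integral_distr) auto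
 also have "... = (\<integral>\<^sup>+om. \<Phi> (shift_cfg w (N om)) \<partial>M)"
 unfolding law_shift[of w] by (subst nn_integral_distr) auto
 finally show ?thesis .
qed

text \<open>Campbell's formula, restricted to an invariant event (or weighted by an invariant functional).\<close>
lemma campbell_invariant:
 assumes a[measurable]: "a : bmeas LCFG" and inv: "!!w mu. mu : LF ==> a (shift_cfg w mu) = a mu"
 and [measurable]: "f : bmeas borel" "g : bmeas borel"
 shows "(\<integral>\<^sup>+om. a (N om) * (\<integral>\<^sup>+l. f l \<partial>pm (N om)) \<partial>M) * (\<integral>\<^sup>+x. g x \<partial>lborel)
 = (\<integral>\<^sup>+om. a (N om) * (\<integral>\<^sup>+l. g l \<partial>pm (N om)) \<partial>M) * (\<integral>\<^sup>+x. f x \<partial>lborel)"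
proof -
 interpret MP: pair_sigma_finite M "lborel :: complex measure" ..
 have [measurable]: "(%om. \<integral>\<^sup>+l. h l \<partial>pm (N om)) : bmeas M" if [measurable]: "h : bmeas borel" for h
 by (rule measurable_nn_integral_pm) measurable
 have jm[measurable]: "(%z. \<integral>\<^sup>+x. h x (snd z) \<partial>pm (N (fst z))) : bmeas (M \<Otimes>\<^sub>M lborel)"
 if [measurable]: "(%z. h (fst z) (snd z)) : bmeas (borel \<Otimes>\<^sub>M borel)" for h :: "complex => complex => ennreal"
 proof (rule measurable_nn_integral_pm)
 have "(%x. (%z. h (fst z) (snd z)) (snd x, snd (fst x))) : bmeas ((M \<Otimes>\<^sub>M lborel) \<Otimes>\<^sub>M borel)"
 by measurable
 then show "(%x. h (snd x) (snd (fst x))) : bmeas ((M \<Otimes>\<^sub>M lborel) \<Otimes>\<^sub>M borel)" by simp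
 qed measurable
 have "(\<integral>\<^sup>+om. a (N om) * (\<integral>\<^sup>+l. f l \<partial>pm (N om)) \<partial>M) * (\<integral>\<^sup>+x. g x \<partial>lborel)
 = (\<integral>\<^sup>+om. (\<integral>\<^sup>+y. a (N om) * (\<integral>\<^sup>+x. f x * g (x + y) \<partial>pm (N om)) \<partial>lborel) \<partial>M)"
 proof (subst nn_integral_multc[symmetric], measurable, rule nn_integral_cong)
 fix om assume "om : space M"
 then interpret pn: sigma_finite_measure "pm (N om)" by (intro sigma_finite_pm lfN)
 interpret pair_sigma_finite "pm (N om)" "lborel :: complex measure" ..
 have "(\<integral>\<^sup>+y. a (N om) * (\<integral>\<^sup>+x. f x * g (x + y) \<partial>pm (N om)) \<partial>lborel)
 = a (N om) * (\<integral>\<^sup>+y. (\<integral>\<^sup>+x. f x * g (x + y) \<partial>pm (N om)) \<partial>lborel)"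
 by (rule nn_integral_cmult) measurable
 also have "(\<integral>\<^sup>+y. (\<integral>\<^sup>+x. f x * g (x + y) \<partial>pm (N om)) \<partial>lborel) = (\<integral>\<^sup>+x. (\<integral>\<^sup>+y. f x * g (x + y) \<partial>lborel) \<partial>pm (N om))"
 by (rule Fubini') measurable
 also have "... = (\<integral>\<^sup>+x. f x * (\<integral>\<^sup>+y. g y \<partial>lborel) \<partial>pm (N om))"
 by (intro nn_integral_cong) (simp add: nn_integral_cmult nn_integral_lborel_translate)
 also have "... = (\<integral>\<^sup>+x. f x \<partial>pm (N om)) * (\<integral>\<^sup>+y. g y \<partial>lborel)"
 by (rule nn_integral_multc) measurable
 finally show "a (N om) * (\<integral>\<^sup>+l. f l \<partial>pm (N om)) * (\<integral>\<^sup>+x. g x \<partial>lborel)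
 = (\<integral>\<^sup>+y. a (N om) * (\<integral>\<^sup>+x. f x * g (x + y) \<partial>pm (N om)) \<partial>lborel)"
 by (simp add: mult.assoc)
 qed
 also have "... = (\<integral>\<^sup>+y. (\<integral>\<^sup>+om. a (N om) * (\<integral>\<^sup>+x. f x * g (x + y) \<partial>pm (N om)) \<partial>M) \<partial>lborel)"
 proof (rule MP.Fubini'[symmetric])
 have "(%z. a (N (fst z)) * (\<integral>\<^sup>+x. f x * g (x + snd z) \<partial>pm (N (fst z)))) : bmeas (M \<Otimes>\<^sub>M lborel)"
 by (intro borel_measurable_times_ennreal jm) measurable
 then show "(%(x, y). a (N x) * (\<integral>\<^sup>+xa. f xa * g (xa + y) \<partial>pm (N x))) : bmeas (M \<Otimes>\<^sub>M lborel)"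
 by (simp add: case_prod_unfold)
 qed
 \<comment> \<open>As for the uniqueness of Lebesgue measure, but the translation is now moved by
   the invariance of the law, and the functional \<open>a\<close> is not affected by it.\<close>
 also have "... = (\<integral>\<^sup>+y. (\<integral>\<^sup>+om. a (N om) * (\<integral>\<^sup>+x. f (x - y) * g x \<partial>pm (N om)) \<partial>M) \<partial>lborel)"
 proof (rule nn_integral_cong)
 fix y :: complex
 have [measurable]: "(%mu. \<integral>\<^sup>+x. f x * g (x + y) \<partial>pm mu) : bmeas LCFG"
 by (rule measurable_nn_integral_pm) measurable
 have "(\<integral>\<^sup>+om. a (N om) * (\<integral>\<^sup>+x. f x * g (x + y) \<partial>pm (N om)) \<partial>M)
 = (\<integral>\<^sup>+om. a (shift_cfg (- y) (N om)) * (\<integral>\<^sup>+x. f x * g (x + y) \<partial>pm (shift_cfg (- y) (N om))) \<partial>M)"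
 by (rule nn_integral_law_shift[of "%mu. a mu * (\<integral>\<^sup>+x. f x * g (x + y) \<partial>pm mu)"]) measurable
 also have "... = (\<integral>\<^sup>+om. a (N om) * (\<integral>\<^sup>+x. f (x - y) * g x \<partial>pm (N om)) \<partial>M)"
 by (rule nn_integral_cong) (simp add: inv LF_def lfN nn_integral_pm_shift algebra_simps)
 finally show "(\<integral>\<^sup>+om. a (N om) * (\<integral>\<^sup>+x. f x * g (x + y) \<partial>pm (N om)) \<partial>M) = ..." .
 qed
 also have "... = (\<integral>\<^sup>+om. (\<integral>\<^sup>+y. a (N om) * (\<integral>\<^sup>+x. f (x - y) * g x \<partial>pm (N om)) \<partial>lborel) \<partial>M)"
 proof (rule MP.Fubini')
 have "(%z. a (N (fst z)) * (\<integral>\<^sup>+x. f (x - snd z) * g x \<partial>pm (N (fst z)))) : bmeas (M \<Otimes>\<^sub>M lborel)"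
 by (intro borel_measurable_times_ennreal jm) measurable
 then show "(%(x, y). a (N x) * (\<integral>\<^sup>+xa. f (xa - y) * g xa \<partial>pm (N x))) : bmeas (M \<Otimes>\<^sub>M lborel)"
 by (simp add: case_prod_unfold)
 qed
 also have "... = (\<integral>\<^sup>+om. a (N om) * (\<integral>\<^sup>+l. g l \<partial>pm (N om)) \<partial>M) * (\<integral>\<^sup>+x. f x \<partial>lborel)"
 proof (subst nn_integral_multc[symmetric], measurable, rule nn_integral_cong)
 fix om assume "om : space M"
 then interpret pn: sigma_finite_measure "pm (N om)" by (intro sigma_finite_pm lfN)
 interpret pair_sigma_finite "pm (N om)" "lborel :: complex measure" ..
 have "(\<integral>\<^sup>+y. a (N om) * (\<integral>\<^sup>+x. f (x - y) * g x \<partial>pm (N om)) \<partial>lborel)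
 = a (N om) * (\<integral>\<^sup>+y. (\<integral>\<^sup>+x. f (x - y) * g x \<partial>pm (N om)) \<partial>lborel)"
 by (rule nn_integral_cmult) measurable
 also have "(\<integral>\<^sup>+y. (\<integral>\<^sup>+x. f (x - y) * g x \<partial>pm (N om)) \<partial>lborel) = (\<integral>\<^sup>+x. (\<integral>\<^sup>+y. f (x - y) * g x \<partial>lborel) \<partial>pm (N om))"
 by (rule Fubini') measurable
 also have "... = (\<integral>\<^sup>+x. (\<integral>\<^sup>+y. f y \<partial>lborel) * g x \<partial>pm (N om))"
 by (intro nn_integral_cong) (simp add: nn_integral_multc nn_integral_lborel_reflect)
 also have "... = (\<integral>\<^sup>+y. f y \<partial>lborel) * (\<integral>\<^sup>+x. g x \<partial>pm (N om))"
 by (rule nn_integral_cmult) measurable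
 finally show "(\<integral>\<^sup>+y. a (N om) * (\<integral>\<^sup>+x. f (x - y) * g x \<partial>pm (N om)) \<partial>lborel)
 = a (N om) * (\<integral>\<^sup>+l. g l \<partial>pm (N om)) * (\<integral>\<^sup>+x. f x \<partial>lborel)"
 by (simp add: mult_ac)
 qed
 finally show ?thesis .
qed

end

subsection \<open>Squared norms\<close>

definition nsq :: "'a measure => ('a => complex) => ennreal" where
 "nsq K f = (\<integral>\<^sup>+x. ennreal ((norm (f x))\<^sup>2) \<partial>K)"

text \<open>Young's inequality. The free weight allows a factor arbitrarily close to 1 in front of
  the main term, which the passage to the limit in \<open>spectral\<close> needs.\<close>

lemma norm_add_sq_le:
 fixes a b :: "'b::real_normed_vector"
 assumes e: "e > 0"
 shows "(norm (a + b))\<^sup>2 <= (1 + e) * (norm a)\<^sup>2 + (1 + 1 / e) * (norm b)\<^sup>2"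
proof -
 have "(norm (a + b))\<^sup>2 <= (norm a + norm b)\<^sup>2"
 by (intro power_mono norm_triangle_ineq) simp
 also have "... = (norm a)\<^sup>2 + (norm b)\<^sup>2 + 2 * (norm a * norm b)"
 by (simp add: power2_eq_square algebra_simps)
 also have "2 * (norm a * norm b) <= e * (norm a)\<^sup>2 + (1 / e) * (norm b)\<^sup>2"
 proof -
 have "0 <= (e * norm a - norm b)\<^sup>2" by simp
 then have "2 * (e * (norm a * norm b)) <= e\<^sup>2 * (norm a)\<^sup>2 + (norm b)\<^sup>2"
 by (simp add: power2_eq_square algebra_simps)
 then have "(2 * (e * (norm a * norm b))) / e <= (e\<^sup>2 * (norm a)\<^sup>2 + (norm b)\<^sup>2) / e"
 using e by (intro divide_right_mono) auto
 then show ?thesis using e by (simp add: add_divide_distrib power2_eq_square)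
 qed
 finally show ?thesis by (simp add: algebra_simps)
qed

lemma nsq_add:
 assumes [measurable]: "f : bmeas K" "g : bmeas K" and e: "e > 0"
 shows "nsq K (%x. f x + g x) <= ennreal (1 + e) * nsq K f + ennreal (1 + 1 / e) * nsq K g"
proof -
 have "nsq K (%x. f x + g x) <= (\<integral>\<^sup>+x. ennreal (1 + e) * ennreal ((norm (f x))\<^sup>2) + ennreal (1 + 1 / e) * ennreal ((norm (g x))\<^sup>2) \<partial>K)"
 unfolding nsq_def
 proof (rule nn_integral_mono)
 fix x
 have "ennreal ((norm (f x + g x))\<^sup>2) <= ennreal ((1 + e) * (norm (f x))\<^sup>2 + (1 + 1 / e) * (norm (g x))\<^sup>2)"
 by (rule ennreal_leI[OF norm_add_sq_le[OF e]])
 also have "... = ennreal (1 + e) * ennreal ((norm (f x))\<^sup>2) + ennreal (1 + 1 / e) * ennreal ((norm (g x))\<^sup>2)"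
 using e by (subst ennreal_plus) (auto simp: ennreal_mult)
 finally show "ennreal ((norm (f x + g x))\<^sup>2) <= ..." .
 qed
 also have "... = ennreal (1 + e) * nsq K f + ennreal (1 + 1 / e) * nsq K g"
 unfolding nsq_def by (simp add: nn_integral_add nn_integral_cmult)
 finally show ?thesis .
qed

lemma nsq_add_2:
 assumes "f : bmeas K" "g : bmeas K"
 shows "nsq K (%x. f x + g x) <= 2 * nsq K f + 2 * nsq K g"
 using nsq_add[OF assms, of 1] by simp

lemma nsq_uminus: "nsq K (%x. - f x) = nsq K f"
 and nsq_minus_commute: "nsq K (%x. f x - g x) = nsq K (%x. g x - f x)"
 by (simp_all add: nsq_def norm_minus_commute)

lemma nsq_cmult:
 assumes [measurable]: "f : bmeas K"
 shows "nsq K (%x. c * f x) = ennreal ((norm c)\<^sup>2) * nsq K f"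
 unfolding nsq_def by (simp add: norm_mult power_mult_distrib ennreal_mult nn_integral_cmult)

lemma nsq_cong: "(!!x. x : space K ==> f x = g x) ==> nsq K f = nsq K g"
 unfolding nsq_def by (intro nn_integral_cong) simp

lemma ennreal_le_mult_one_plus:
 fixes a b :: ennreal
 assumes "!!e::real. e > 0 ==> a <= ennreal (1 + e) * b"
 shows "a <= b"
proof (cases b)
 case (real r)
 have *: "a <= b + ennreal d" if "d > 0" for d
 proof -
 have "a <= ennreal (1 + d / (r + 1)) * b" using that real by (intro assms) (auto intro!: divide_pos_pos)
 also have "... = ennreal ((1 + d / (r + 1)) * r)" using real that by (simp add: ennreal_mult')
 also have "... <= ennreal (r + d)"
 using real that by (intro ennreal_leI) (simp add: field_simps)
 finally show ?thesis using real that by simp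
 qed
 show ?thesis by (rule ennreal_le_epsilon) (rule *)
qed simp

lemma (in prob_space) nsq_centered_le:
 assumes [measurable]: "X : bmeas M"
 shows "nsq M (%om. X om - expectation X) <= nsq M X"
proof (cases "nsq M X < \<infinity>")
 case True
 have i2: "integrable M (%om. (norm (X om))\<^sup>2)"
 using True by (intro integrableI_nonneg) (auto simp: nsq_def)
 have i1: "integrable M X"
 proof (rule BI_integrable_bound[of M "%om. 1 + (norm (X om))\<^sup>2"])
 have "norm (X om) <= 1 + (norm (X om))\<^sup>2" for om
 proof -
 have "0 <= (norm (X om) - 1)\<^sup>2" by simp
 then have "2 * norm (X om) <= 1 + (norm (X om))\<^sup>2" by (simp add: power2_eq_square algebra_simps)
 then show ?thesis using norm_ge_zero[of "X om"] by linarith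
 qed
 then show "AE om in M. norm (X om) <= norm (1 + (norm (X om))\<^sup>2)" by simp
 qed (use i2 in auto)
 define m where "m = expectation X"
 have eq: "(norm (X om - m))\<^sup>2 = (norm (X om))\<^sup>2 + (norm m)\<^sup>2 - 2 * Re (cnj m * X om)" for om
 unfolding cmod_power2 by (simp add: power2_eq_square algebra_simps)
 then have "(\<integral>om. (norm (X om - m))\<^sup>2 \<partial>M) = (\<integral>om. (norm (X om))\<^sup>2 + (norm m)\<^sup>2 - 2 * Re (cnj m * X om) \<partial>M)" by simp
 also have "... = (\<integral>om. (norm (X om))\<^sup>2 \<partial>M) + (norm m)\<^sup>2 - 2 * Re (cnj m * m)"
 using i1 i2 by (simp add: prob_space m_def)
 also have "... <= (\<integral>om. (norm (X om))\<^sup>2 \<partial>M)"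
 unfolding cmod_power2 by (simp add: power2_eq_square)
 finally have le: "(\<integral>om. (norm (X om - m))\<^sup>2 \<partial>M) <= (\<integral>om. (norm (X om))\<^sup>2 \<partial>M)" .
 have i3: "integrable M (%om. (norm (X om - m))\<^sup>2)"
 unfolding eq using i1 i2 by simp
 show ?thesis unfolding nsq_def m_def[symmetric]
 using le by (simp add: nn_integral_eq_integral i2 i3 ennreal_leI)
qed (simp add: not_less top.extremum_unique)

section \<open>Linear statistics and their first moments\<close>

context stat_pp
begin

text \<open>The integral form of \<open>lin_stat\<close>. Unlike a finite sum it also makes sense
  for kernels of unbounded support, for which it converges absolutely almost surely when the kernel
  is integrable; where it diverges the value is 0.\<close>

definition lin :: "(complex => complex) => 'w => complex" where
 "lin f om = (\<integral>l. f l \<partial>pm (N om))"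

lemma measurable_lin [measurable]:
 assumes [measurable]: "f : bmeas borel"
 shows "lin f : bmeas M"
 unfolding lin_def[abs_def] by (rule measurable_integral_pm) measurable

lemma measurable_nn_lin [measurable]:
 assumes [measurable]: "f : bmeas borel"
 shows "(%om. \<integral>\<^sup>+l. f l \<partial>pm (N om)) : bmeas M"
 by (rule measurable_nn_integral_pm) measurable

definition mass :: "real => 'w => real" where "mass r om = real (cnt (N om) (cball 0 r))"

lemma measurable_mass [measurable]: "mass r : bmeas M"
 unfolding mass_def[abs_def]
 by (rule measurable_compose[OF measurable_cnt_N]) auto

lemma emeasure_pm_mass: "om : space M ==> emeasure (pm (N om)) (cball 0 r) = ennreal (mass r om)"
 unfolding mass_def by (rule emeasure_pm) (auto intro: lfN)

lemma integrable_mass_sq: "integrable M (%om. (mass r om)\<^sup>2)"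
 using fsm unfolding finite_second_moment_def mass_def by auto

lemma nn_integral_mass_sq: "(\<integral>\<^sup>+om. ennreal ((mass r om)\<^sup>2) \<partial>M) < \<infinity>"
 using integrable_mass_sq[of r] by (simp add: integrable_iff_bounded)

lemma integrable_mass: "integrable M (mass r)"
proof (rule BI_integrable_bound[OF integrable_mass_sq[of r]])
 have "real n <= (real n)\<^sup>2" for n by (cases n) (auto simp: power2_eq_square)
 then show "AE om in M. norm (mass r om) <= norm ((mass r om)\<^sup>2)" by (auto simp: mass_def)
qed measurable

text \<open>The intensity: the mean number of points per unit area.\<close>

definition c0 :: real where "c0 = expectation (mass 1) / pi"

lemma c0_nonneg: "c0 >= 0"
 by (auto simp: c0_def mass_def intro!: divide_nonneg_pos integral_nonneg)

lemma campbell: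
 assumes [measurable]: "f : bmeas borel"
 shows "(\<integral>\<^sup>+om. (\<integral>\<^sup>+l. f l \<partial>pm (N om)) \<partial>M) = ennreal c0 * (\<integral>\<^sup>+x. f x \<partial>lborel)"
proof -
 have "(\<integral>\<^sup>+om. 1 * (\<integral>\<^sup>+l. f l \<partial>pm (N om)) \<partial>M) * (\<integral>\<^sup>+x. indicator (cball (0::complex) 1) x \<partial>lborel)
 = (\<integral>\<^sup>+om. 1 * (\<integral>\<^sup>+l. indicator (cball 0 1) l \<partial>pm (N om)) \<partial>M) * (\<integral>\<^sup>+x. f x \<partial>lborel)"
 by (rule campbell_invariant) auto
 also have "(\<integral>\<^sup>+om. 1 * (\<integral>\<^sup>+l. indicator (cball 0 1) l \<partial>pm (N om)) \<partial>M) = (\<integral>\<^sup>+om. ennreal (mass 1 om) \<partial>M)"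
 by (intro nn_integral_cong) (simp add: emeasure_pm_mass)
 also have "... = ennreal (expectation (mass 1))"
 by (rule nn_integral_eq_integral[OF integrable_mass]) (auto simp: mass_def)
 also have "... = ennreal pi * ennreal c0" by (simp add: c0_def ennreal_mult'[symmetric])
 finally have "ennreal pi * (\<integral>\<^sup>+om. (\<integral>\<^sup>+l. f l \<partial>pm (N om)) \<partial>M) = ennreal pi * (ennreal c0 * (\<integral>\<^sup>+x. f x \<partial>lborel))"
 by (simp add: emeasure_disc mult_ac)
 then show ?thesis by (simp add: ennreal_mult_cancel_left)
qed

lemma AE_nn_lin_finite:
 assumes [measurable]: "f : bmeas borel" and "(\<integral>\<^sup>+x. f x \<partial>lborel) < \<infinity>"
 shows "AE om in M. (\<integral>\<^sup>+l. f l \<partial>pm (N om)) < \<infinity>"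
proof -
 have "AE om in M. (\<integral>\<^sup>+l. f l \<partial>pm (N om)) ~= \<infinity>"
 by (rule nn_integral_PInf_AE) (use assms(2) in \<open>auto simp: campbell ennreal_mult_eq_top_iff\<close>)
 then show ?thesis by (simp add: less_top)
qed

lemma AE_integrable_pm:
 assumes f: "integrable lborel f"
 shows "AE om in M. integrable (pm (N om)) (f :: complex => complex)"
proof -
 have [measurable]: "f : bmeas borel" using f by auto
 have "AE om in M. (\<integral>\<^sup>+l. ennreal (norm (f l)) \<partial>pm (N om)) < \<infinity>"
 using f by (intro AE_nn_lin_finite) (auto simp: integrable_iff_bounded)
 then show ?thesis by eventually_elim (simp add: integrable_iff_bounded)
qed

lemma nn_integral_norm_lin_le:
 assumes [measurable]: "f : bmeas borel"
 shows "(\<integral>\<^sup>+om. ennreal (norm (lin f om)) \<partial>M) <= ennreal c0 * (\<integral>\<^sup>+x. ennreal (norm (f x)) \<partial>lborel)"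
proof -
 have "(\<integral>\<^sup>+om. ennreal (norm (lin f om)) \<partial>M) <= (\<integral>\<^sup>+om. (\<integral>\<^sup>+l. ennreal (norm (f l)) \<partial>pm (N om)) \<partial>M)"
 proof (rule nn_integral_mono)
 fix om
 show "ennreal (norm (lin f om)) <= (\<integral>\<^sup>+l. ennreal (norm (f l)) \<partial>pm (N om))"
 by (cases "integrable (pm (N om)) f")
 (auto simp: lin_def not_integrable_integral_eq intro: integral_norm_bound_ennreal)
 qed
 also have "... = ennreal c0 * (\<integral>\<^sup>+x. ennreal (norm (f x)) \<partial>lborel)"
 by (rule campbell) measurable
 finally show ?thesis .
qed

lemma integrable_lin: "integrable lborel f ==> integrable M (lin f)"
proof -
 assume f: "integrable lborel f"
 then have [measurable]: "f : bmeas borel" by auto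
 have "(\<integral>\<^sup>+om. ennreal (norm (lin f om)) \<partial>M) < \<infinity>"
 using f by (intro le_less_trans[OF nn_integral_norm_lin_le]) (auto simp: integrable_iff_bounded ennreal_mult_less_top)
 then show ?thesis by (intro integrableI_bounded) auto
qed

lemma enn2real_nn_lin:
 assumes [measurable]: "f : bmeas borel" and fin: "(\<integral>\<^sup>+x. f x \<partial>lborel) < \<infinity>"
 shows "has_bochner_integral M (%om. enn2real (\<integral>\<^sup>+l. f l \<partial>pm (N om))) (c0 * enn2real (\<integral>\<^sup>+x. f x \<partial>lborel))"
proof (rule has_bochner_integral_nn_integral)
 have "(\<integral>\<^sup>+om. ennreal (enn2real (\<integral>\<^sup>+l. f l \<partial>pm (N om))) \<partial>M) = (\<integral>\<^sup>+om. (\<integral>\<^sup>+l. f l \<partial>pm (N om)) \<partial>M)"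
 by (rule nn_integral_cong_AE) (use AE_nn_lin_finite[OF assms] in \<open>eventually_elim; auto\<close>)
 also have "... = ennreal c0 * (\<integral>\<^sup>+x. f x \<partial>lborel)" by (rule campbell) measurable
 also have "... = ennreal (c0 * enn2real (\<integral>\<^sup>+x. f x \<partial>lborel))"
 using fin c0_nonneg by (cases "\<integral>\<^sup>+x. f x \<partial>lborel") (auto simp: ennreal_mult)
 finally show "(\<integral>\<^sup>+om. ennreal (enn2real (\<integral>\<^sup>+l. f l \<partial>pm (N om))) \<partial>M) = ennreal (c0 * enn2real (\<integral>\<^sup>+x. f x \<partial>lborel))" .
qed (use c0_nonneg in \<open>auto intro!: mult_nonneg_nonneg\<close>)

lemma expectation_lin_real:
 fixes f :: "complex => real"
 assumes f: "integrable lborel f"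
 shows "has_bochner_integral M (%om. \<integral>l. f l \<partial>pm (N om)) (c0 * (\<integral>x. f x \<partial>lborel))"
proof -
 have [measurable]: "f : bmeas borel" using f by auto
 have fin: "(\<integral>\<^sup>+x. ennreal (norm (f x)) \<partial>lborel) < \<infinity>" using f by (auto simp: integrable_iff_bounded)
 have fin': "AE om in M. (\<integral>\<^sup>+l. ennreal (norm (f l)) \<partial>pm (N om)) < \<infinity>"
 by (rule AE_nn_lin_finite[OF _ fin]) measurable
 have p: "(\<integral>\<^sup>+x. ennreal (f x) \<partial>lborel) < \<infinity>" and m: "(\<integral>\<^sup>+x. ennreal (- f x) \<partial>lborel) < \<infinity>"
 by (rule le_less_trans[OF nn_integral_mono fin]; simp add: ennreal_leI)+
 have "has_bochner_integral M (%om. enn2real (\<integral>\<^sup>+l. ennreal (f l) \<partial>pm (N om)) - enn2real (\<integral>\<^sup>+l. ennreal (- f l) \<partial>pm (N om)))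
 (c0 * enn2real (\<integral>\<^sup>+x. ennreal (f x) \<partial>lborel) - c0 * enn2real (\<integral>\<^sup>+x. ennreal (- f x) \<partial>lborel))"
 by (intro has_bochner_integral_diff enn2real_nn_lin p m) auto
 also have "c0 * enn2real (\<integral>\<^sup>+x. ennreal (f x) \<partial>lborel) - c0 * enn2real (\<integral>\<^sup>+x. ennreal (- f x) \<partial>lborel) = c0 * (\<integral>x. f x \<partial>lborel)"
 by (simp add: real_lebesgue_integral_def[OF f] right_diff_distrib)
 finally have *: "has_bochner_integral M (%om. enn2real (\<integral>\<^sup>+l. ennreal (f l) \<partial>pm (N om)) - enn2real (\<integral>\<^sup>+l. ennreal (- f l) \<partial>pm (N om)))
 (c0 * (\<integral>x. f x \<partial>lborel))" .
 have [measurable]: "(%om. \<integral>l. f l \<partial>pm (N om)) : bmeas M"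
 by (rule measurable_integral_pm_real) measurable
 have "AE om in M. enn2real (\<integral>\<^sup>+l. ennreal (f l) \<partial>pm (N om)) - enn2real (\<integral>\<^sup>+l. ennreal (- f l) \<partial>pm (N om)) = (\<integral>l. f l \<partial>pm (N om))"
 using fin' by eventually_elim (auto simp: real_lebesgue_integral_def integrable_iff_bounded)
 with * show ?thesis
 by (subst has_bochner_integral_cong_AE[symmetric, where f="%om. enn2real (\<integral>\<^sup>+l. ennreal (f l) \<partial>pm (N om)) - enn2real (\<integral>\<^sup>+l. ennreal (- f l) \<partial>pm (N om))"]) auto
qed

lemma expectation_lin:
 assumes f: "integrable lborel f"
 shows "expectation (lin f) = of_real c0 * (\<integral>x. f x \<partial>lborel)"
proof -
 have [measurable]: "f : bmeas borel" using f by auto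
 have "expectation (%om. Re (lin f om)) = c0 * (\<integral>x. Re (f x) \<partial>lborel)"
 proof -
 have "expectation (%om. Re (lin f om)) = expectation (%om. \<integral>l. Re (f l) \<partial>pm (N om))"
 proof (rule integral_cong_AE)
 show "AE om in M. Re (lin f om) = (\<integral>l. Re (f l) \<partial>pm (N om))"
 using AE_integrable_pm[OF f] by eventually_elim (simp add: lin_def)
 show "(%om. \<integral>l. Re (f l) \<partial>pm (N om)) : bmeas M"
 by (rule measurable_integral_pm_real) measurable
 qed measurable
 then show ?thesis using expectation_lin_real[of "%x. Re (f x)"] f by (simp add: has_bochner_integral_iff)
 qed
 moreover have "expectation (%om. Im (lin f om)) = c0 * (\<integral>x. Im (f x) \<partial>lborel)"
 proof -
 have "expectation (%om. Im (lin f om)) = expectation (%om. \<integral>l. Im (f l) \<partial>pm (N om))"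
 proof (rule integral_cong_AE)
 show "AE om in M. Im (lin f om) = (\<integral>l. Im (f l) \<partial>pm (N om))"
 using AE_integrable_pm[OF f] by eventually_elim (simp add: lin_def)
 show "(%om. \<integral>l. Im (f l) \<partial>pm (N om)) : bmeas M"
 by (rule measurable_integral_pm_real) measurable
 qed measurable
 then show ?thesis using expectation_lin_real[of "%x. Im (f x)"] f by (simp add: has_bochner_integral_iff)
 qed
 ultimately show ?thesis using integrable_lin[OF f] f by (simp add: complex_eq_iff)
qed

text \<open>Linear statistics of bounded functions with bounded support; here no null sets are involved.\<close>
definition bbs :: "(complex => complex) => bool" where
 "bbs f \<longleftrightarrow> f : bmeas borel \<and> (\<exists>B. \<forall>x. norm (f x) <= B) \<and> (\<exists>r. \<forall>x. norm x > r \<longrightarrow> f x = 0)"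

lemma bbs_measurable [measurable_dest]: "bbs f ==> f : bmeas borel"
 by (simp add: bbs_def)

lemma bbsE:
 assumes "bbs f" obtains B r where "B >= 0" "r >= 0" "!!x. norm (f x) <= B" "!!x. norm x > r ==> f x = 0"
proof -
 from assms obtain B r where B: "!!x. norm (f x) <= B" and r: "!!x. norm x > r ==> f x = 0" by (auto simp: bbs_def)
 show thesis
 by (rule that[of "max B 0" "max r 0"]) (use B r in \<open>auto simp: le_max_iff_disj\<close>)
qed

lemma bbs_integrable: "bbs f ==> integrable lborel f"
 by (frule bbs_measurable, erule bbsE) (rule integrable_bounded_supp)

lemma bbs_integrable_pm: "bbs f ==> om : space M ==> integrable (pm (N om)) f"
 by (frule bbs_measurable, erule bbsE) (rule integrable_pm_bounded_supp, auto intro: lfN)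

lemma bbs_add:
 assumes "bbs f" "bbs g" shows "bbs (%x. f x + g x)"
proof -
 obtain B r where f: "B >= 0" "r >= 0" "!!x. norm (f x) <= B" "!!x. norm x > r ==> f x = 0" using bbsE[OF assms(1)] by blast
 obtain B' r' where g: "B' >= 0" "r' >= 0" "!!x. norm (g x) <= B'" "!!x. norm x > r' ==> g x = 0" using bbsE[OF assms(2)] by blast
 show ?thesis unfolding bbs_def
 proof (intro conjI)
 show "\<exists>B. \<forall>x. norm (f x + g x) <= B"
 by (intro exI[of _ "B + B'"] allI order_trans[OF norm_triangle_ineq] add_mono f g)
 show "\<exists>r. \<forall>x. norm x > r \<longrightarrow> f x + g x = 0"
 by (intro exI[of _ "max r r'"]) (auto simp: f g)
 qed (use assms in measurable)
qed

lemma bbs_cmult: "bbs f ==> bbs (%x. c * f x)"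
proof -
 assume f: "bbs f"
 obtain B r where f': "B >= 0" "r >= 0" "!!x. norm (f x) <= B" "!!x. norm x > r ==> f x = 0" using bbsE[OF f] by blast
 show ?thesis unfolding bbs_def
 proof (intro conjI)
 show "\<exists>B. \<forall>x. norm (c * f x) <= B"
 by (intro exI[of _ "norm c * B"] allI) (auto simp: norm_mult intro!: mult_left_mono f')
 show "\<exists>r. \<forall>x. norm x > r \<longrightarrow> c * f x = 0"
 by (intro exI[of _ r]) (auto simp: f')
 qed (use f in measurable)
qed

lemma bbs_diff: "bbs f ==> bbs g ==> bbs (%x. f x - g x)"
 using bbs_add[of f "%x. (-1) * g x"] bbs_cmult[of g "-1"] by simp

lemma lin_add: "bbs f ==> bbs g ==> om : space M ==> lin (%x. f x + g x) om = lin f om + lin g om"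
 unfolding lin_def by (intro BI_integral_add bbs_integrable_pm)

lemma lin_diff: "bbs f ==> bbs g ==> om : space M ==> lin (%x. f x - g x) om = lin f om - lin g om"
 unfolding lin_def by (intro BI_integral_diff bbs_integrable_pm)

lemma lin_cmult: "lin (%x. c * f x) om = c * lin f om"
 unfolding lin_def by (rule integral_mult_right_zero)

lemma norm_lin_le:
 assumes f: "bbs f" and B: "!!x. norm (f x) <= B" and r: "!!x. norm x > r ==> f x = 0" and om: "om : space M"
 shows "norm (lin f om) <= B * mass r om"
proof -
 have B0: "0 <= B" using B[of 0] norm_ge_zero[of "f 0"] by linarith
 have "ennreal (norm (lin f om)) <= (\<integral>\<^sup>+l. ennreal (norm (f l)) \<partial>pm (N om))"
 unfolding lin_def by (rule integral_norm_bound_ennreal[OF bbs_integrable_pm[OF f om]])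
 also have "... <= (\<integral>\<^sup>+l. ennreal B * indicator (cball 0 r) l \<partial>pm (N om))"
 using B r by (intro nn_integral_mono) (auto simp: indicator_def not_le intro!: ennreal_leI)
 also have "... = ennreal (B * mass r om)"
 using B0 om by (simp add: nn_integral_cmult_indicator emeasure_pm_mass ennreal_mult mass_def)
 finally show ?thesis using B0 by (simp add: ennreal_le_iff mass_def)
qed

lemma nsq_lin_finite: "bbs f ==> nsq M (lin f) < \<infinity>"
proof -
 assume f: "bbs f"
 obtain B r where f': "B >= 0" "r >= 0" "!!x. norm (f x) <= B" "!!x. norm x > r ==> f x = 0" using bbsE[OF f] by blast
 have "nsq M (lin f) <= (\<integral>\<^sup>+om. ennreal (B\<^sup>2) * ennreal ((mass r om)\<^sup>2) \<partial>M)"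
 unfolding nsq_def
 proof (rule nn_integral_mono)
 fix om assume "om : space M"
 then have "(norm (lin f om))\<^sup>2 <= (B * mass r om)\<^sup>2"
 by (intro power_mono norm_lin_le f f') auto
 then show "ennreal ((norm (lin f om))\<^sup>2) <= ennreal (B\<^sup>2) * ennreal ((mass r om)\<^sup>2)"
 by (simp add: ennreal_mult[symmetric] power_mult_distrib ennreal_leI)
 qed
 also have "... = ennreal (B\<^sup>2) * (\<integral>\<^sup>+om. ennreal ((mass r om)\<^sup>2) \<partial>M)" by (rule nn_integral_cmult) measurable
 also have "... < \<infinity>" using nn_integral_mass_sq by (simp add: ennreal_mult_less_top)
 finally show ?thesis .
qed

end

section \<open>Completeness of L2 and second moments of averages\<close>

lemma AE_tendsto_complete:
 fixes X :: "nat => 'a => complex"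
 assumes [measurable]: "!!k. X k : bmeas K"
 and P: "prob_space K" and small: "!!k. nsq K (%x. X (Suc k) x - X k x) <= ennreal ((1/4) ^ k)"
 shows "AE x in K. convergent (%k. X k x)"
proof -
 interpret prob_space K by fact
 have "(\<integral>\<^sup>+x. (\<Sum>k. ennreal (norm (X (Suc k) x - X k x))) \<partial>K) = (\<Sum>k. \<integral>\<^sup>+x. ennreal (norm (X (Suc k) x - X k x)) \<partial>K)"
 by (rule nn_integral_suminf) measurable
 also have "... <= (\<Sum>k. ennreal (2 * (1/2) ^ k))"
 proof (rule suminf_le)
 fix k
 have "(\<integral>\<^sup>+x. ennreal (norm (X (Suc k) x - X k x)) \<partial>K) <= (\<integral>\<^sup>+x. ennreal ((1/2) ^ k) + ennreal (2 ^ k) * ennreal ((norm (X (Suc k) x - X k x))\<^sup>2) \<partial>K)"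
 proof (rule nn_integral_mono)
 fix x
 define y where "y = norm (X (Suc k) x - X k x)"
 \<comment> \<open>Either \<open>y\<close> is below the threshold \<open>(1/2) ^ k\<close>, or
   \<open>2 ^ k * y\<close> is at least 1. The threshold is chosen so that both terms, with the
   second moment \<open>(1/4) ^ k\<close>, are summable.\<close>
 have "y <= (1/2) ^ k + 2 ^ k * y\<^sup>2"
 proof (cases "y <= (1/2) ^ k")
 case False
 then have "2 ^ k * y >= 1" by (simp add: power_divide field_simps)
 then have "y * 1 <= y * (2 ^ k * y)" by (intro mult_left_mono) (auto simp: y_def)
 then show ?thesis by (simp add: power2_eq_square mult_ac add_increasing)
 qed (simp add: add_increasing2)
 then have "ennreal y <= ennreal ((1/2) ^ k + 2 ^ k * y\<^sup>2)" by (rule ennreal_leI)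
 then show "ennreal (norm (X (Suc k) x - X k x)) <= ennreal ((1/2) ^ k) + ennreal (2 ^ k) * ennreal ((norm (X (Suc k) x - X k x))\<^sup>2)"
 by (simp add: y_def ennreal_mult)
 qed
 also have "... = ennreal ((1/2) ^ k) + ennreal (2 ^ k) * nsq K (%x. X (Suc k) x - X k x)"
 by (simp add: nn_integral_add nn_integral_cmult nsq_def emeasure_space_1)
 also have "... <= ennreal ((1/2) ^ k) + ennreal (2 ^ k) * ennreal ((1/4) ^ k)"
 by (intro add_left_mono mult_left_mono small) simp
 also have "... = ennreal (2 * (1/2) ^ k)"
 proof -
 have "(2::real) ^ k * (1/4) ^ k = (1/2) ^ k" by (simp add: power_mult_distrib[symmetric])
 then show ?thesis by (simp add: ennreal_mult[symmetric] ennreal_plus[symmetric] del: ennreal_plus)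
 qed
 finally show "(\<integral>\<^sup>+x. ennreal (norm (X (Suc k) x - X k x)) \<partial>K) <= ennreal (2 * (1/2) ^ k)" .
 qed auto
 also have "... < \<infinity>"
 by (subst suminf_ennreal2) (auto intro!: summable_mult summable_geometric)
 finally have "AE x in K. (\<Sum>k. ennreal (norm (X (Suc k) x - X k x))) ~= \<infinity>"
 by (intro nn_integral_PInf_AE) auto
 then show ?thesis
 proof eventually_elim
 case (elim x)
 then have "summable (%k. norm (X (Suc k) x - X k x))"
 by (intro summable_suminf_not_top) auto
 then have "summable (%k. X (Suc k) x - X k x)" by (rule summable_norm_cancel)
 then have "convergent (%n. \<Sum>k<n. X (Suc k) x - X k x)" by (simp add: summable_iff_convergent)
 then have "convergent (%n. X n x - X 0 x)" by (simp only: sum_lessThan_telescope[of "%n. X n x"])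
 from convergent_add[OF this convergent_const[of "X 0 x"]] show ?case by simp
 qed
qed

text \<open>Almost sure convergence is obtained along one sequence only; Fatou then transfers the
  Cauchy bound between \<open>X R\<close> and that sequence to the limit, for every real
  \<open>R\<close>.\<close>

lemma (in prob_space) L2_complete:
 fixes X :: "real => 'a => complex"
 assumes m[measurable]: "!!R. X R : bmeas M" and fin: "!!R. nsq M (X R) < \<infinity>"
 and cauchy: "!!e::real. e > 0 ==> \<exists>R0. \<forall>R\<ge>R0. \<forall>S\<ge>R0. nsq M (%om. X R om - X S om) <= ennreal e"
 obtains Y where "Y : bmeas M" "nsq M Y < \<infinity>"
 "((%R. nsq M (%om. X R om - Y om)) \<longlongrightarrow> 0) at_top"
proof -
 obtain R0 where R0: "!!k R S. R >= R0 k ==> S >= R0 k ==> nsq M (%om. X R om - X S om) <= ennreal ((1/4) ^ k)"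
 using cauchy[of "(1/4) ^ k" for k] by (simp add: choice_iff) metis
 \<comment> \<open>Summing the absolute values makes \<open>r\<close> increasing and at least every
   \<open>R0 i\<close> with \<open>i\<close> up to \<open>k\<close>.\<close>
 define r where "r k = (\<Sum>i\<le>k. \<bar>R0 i\<bar>)" for k
 have r_ge: "r j >= R0 k" if "k <= j" for j k
 proof -
 have "\<bar>R0 k\<bar> <= r j" unfolding r_def using that by (intro member_le_sum) auto
 then show ?thesis by simp
 qed
 define Y where "Y om = lim (%k. X (r k) om)" for om
 have [measurable]: "Y : bmeas M" unfolding Y_def by measurable
 have "AE om in M. convergent (%k. X (r k) om)"
 by (rule AE_tendsto_complete) (use R0 r_ge prob_space_axioms in auto)
 then have lim: "AE om in M. (%k. X (r k) om) ----> Y om"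
 by eventually_elim (simp add: Y_def convergent_LIMSEQ_iff)
 \<comment> \<open>Fatou along the sequence \<open>r\<close>: every \<open>r j\<close> with
   \<open>j\<close> at least \<open>k\<close> lies beyond \<open>R0 k\<close>.\<close>
 have bound: "nsq M (%om. X R om - Y om) <= ennreal ((1/4) ^ k)" if "R >= R0 k" for R k
 proof -
 have "nsq M (%om. X R om - Y om) = (\<integral>\<^sup>+om. liminf (%j. ennreal ((norm (X R om - X (r j) om))\<^sup>2)) \<partial>M)"
 unfolding nsq_def
 proof (rule nn_integral_cong_AE)
 show "AE om in M. ennreal ((norm (X R om - Y om))\<^sup>2) = liminf (%j. ennreal ((norm (X R om - X (r j) om))\<^sup>2))"
 using lim
 proof eventually_elim
 case (elim om)
 then have "(%j. ennreal ((norm (X R om - X (r j) om))\<^sup>2)) ----> ennreal ((norm (X R om - Y om))\<^sup>2)"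
 by (intro tendsto_ennrealI tendsto_intros)
 from lim_imp_Liminf[OF trivial_limit_sequentially this] show ?case by (rule sym)
 qed
 qed
 also have "... <= liminf (%j. nsq M (%om. X R om - X (r j) om))"
 unfolding nsq_def by (rule nn_integral_liminf) measurable
 also have "... <= ennreal ((1/4) ^ k)"
 proof (rule Liminf_le)
 show "\<forall>\<^sub>F j in sequentially. nsq M (%om. X R om - X (r j) om) <= ennreal ((1/4) ^ k)"
 using eventually_ge_at_top[of k] by eventually_elim (use that R0 r_ge in auto)
 qed simp
 finally show ?thesis .
 qed
 have "nsq M Y = nsq M (%om. X (R0 0) om + - (X (R0 0) om - Y om))" by simp
 also have "... <= 2 * nsq M (X (R0 0)) + 2 * nsq M (%om. - (X (R0 0) om - Y om))" by (rule nsq_add_2) measurable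
 also have "... < \<infinity>"
 using fin[of "R0 0"] bound[of 0 "R0 0"] unfolding nsq_uminus
 by (auto simp: ennreal_mult_less_top intro: le_less_trans)
 finally have "nsq M Y < \<infinity>" .
 moreover have "((%R. nsq M (%om. X R om - Y om)) \<longlongrightarrow> 0) at_top"
 proof (rule order_tendstoI)
 fix a :: ennreal assume "0 < a"
 have "(%k. ennreal ((1/4) ^ k)) ----> ennreal 0" by (intro tendsto_ennrealI LIMSEQ_power_zero) simp
 then have "\<forall>\<^sub>F k in sequentially. ennreal ((1/4) ^ k) < a" using \<open>0 < a\<close> by (auto simp: order_tendsto_iff)
 then obtain k where k: "ennreal ((1/4) ^ k) < a" by (auto simp: eventually_sequentially)
 show "\<forall>\<^sub>F R in at_top. nsq M (%om. X R om - Y om) < a"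
 using eventually_ge_at_top[of "R0 k"] by eventually_elim (rule le_less_trans[OF bound k])
 qed simp
 ultimately show thesis by (intro that[of Y]) auto
qed

text \<open>Cauchy-Schwarz with respect to the measure of density \<open>w\<close>, followed by an
  exchange of integrals: averaging does not enlarge a uniform bound on second moments.\<close>

lemma nn_integral_weighted_sq_le:
 fixes X :: "complex => 'a => ennreal"
 assumes "sigma_finite_measure K"
 and X[measurable]: "(%z. X (snd z) (fst z)) : bmeas (K \<Otimes>\<^sub>M borel)" and [measurable]: "w : bmeas borel"
 and C: "!!a. (\<integral>\<^sup>+om. (X a om)\<^sup>2 \<partial>K) <= C"
 shows "(\<integral>\<^sup>+om. (\<integral>\<^sup>+a. w a * X a om \<partial>lborel)\<^sup>2 \<partial>K) <= (\<integral>\<^sup>+a. w a \<partial>lborel)\<^sup>2 * C"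
proof -
 interpret sigma_finite_measure K by fact
 interpret pair_sigma_finite K "lborel :: complex measure" ..
 let ?W = "\<integral>\<^sup>+a. w a \<partial>lborel"
 have "(\<integral>\<^sup>+om. (\<integral>\<^sup>+a. w a * X a om \<partial>lborel)\<^sup>2 \<partial>K) <= (\<integral>\<^sup>+om. ?W * (\<integral>\<^sup>+a. w a * (X a om)\<^sup>2 \<partial>lborel) \<partial>K)"
 proof (rule nn_integral_mono)
 fix om assume om: "om : space K"
 have [measurable]: "(%a. X a om) : bmeas borel"
 using measurable_compose[OF measurable_Pair1'[OF om] X] by simp
 have "(\<integral>\<^sup>+a. 1 * X a om \<partial>density lborel w)\<^sup>2 <= (\<integral>\<^sup>+a. 1\<^sup>2 \<partial>density lborel w) * (\<integral>\<^sup>+a. (X a om)\<^sup>2 \<partial>density lborel w)"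
 by (rule Cauchy_Schwarz_nn_integral) measurable
 moreover have "(\<integral>\<^sup>+a. h a \<partial>density lborel w) = (\<integral>\<^sup>+a. w a * h a \<partial>lborel)" if "h : bmeas borel" for h
 using that by (subst nn_integral_density) auto
 moreover have "emeasure (density lborel w) UNIV = ?W" by (subst emeasure_density) auto
 ultimately show "(\<integral>\<^sup>+a. w a * X a om \<partial>lborel)\<^sup>2 <= ?W * (\<integral>\<^sup>+a. w a * (X a om)\<^sup>2 \<partial>lborel)" by simp
 qed
 also have "... = ?W * (\<integral>\<^sup>+om. (\<integral>\<^sup>+a. w a * (X a om)\<^sup>2 \<partial>lborel) \<partial>K)"
 by (rule nn_integral_cmult) measurable
 also have "(\<integral>\<^sup>+om. (\<integral>\<^sup>+a. w a * (X a om)\<^sup>2 \<partial>lborel) \<partial>K) = (\<integral>\<^sup>+a. (\<integral>\<^sup>+om. w a * (X a om)\<^sup>2 \<partial>K) \<partial>lborel)"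
 by (rule Fubini'[symmetric]) (simp add: case_prod_unfold)
 also have "... <= (\<integral>\<^sup>+a. w a * C \<partial>lborel)"
 proof (rule nn_integral_mono)
 fix a :: complex
 have [measurable]: "(%om. X a om) : bmeas K"
 using measurable_compose[OF measurable_Pair2'[of a] X] by simp
 have "(\<integral>\<^sup>+om. w a * (X a om)\<^sup>2 \<partial>K) = w a * (\<integral>\<^sup>+om. (X a om)\<^sup>2 \<partial>K)"
 by (rule nn_integral_cmult) measurable
 also have "... <= w a * C" by (intro mult_left_mono C) simp
 finally show "(\<integral>\<^sup>+om. w a * (X a om)\<^sup>2 \<partial>K) <= w a * C" .
 qed
 also have "... = ?W * C" by (rule nn_integral_multc) measurable
 finally show ?thesis by (simp add: power2_eq_square mult.assoc mult_left_mono)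
qed

context stat_pp
begin

text \<open>The hypothesis on second moments concerns bounded sets. A sum over all points with
  weight \<open>decay\<close> is dominated by a weighted average of counts in unit discs, and by
  stationarity all these counts have the second moment of \<open>mass 1\<close>.\<close>

lemma nn_integral_decay_sq: "(\<integral>\<^sup>+om. (\<integral>\<^sup>+l. ennreal (decay l) \<partial>pm (N om))\<^sup>2 \<partial>M) < \<infinity>"
proof -
 define X where "X a om = (\<integral>\<^sup>+l. indicator {..1} (dist a l) \<partial>pm (N om))" for a om
 have ind: "indicator (cball a 1) l = (indicator {..1} (dist a l) :: ennreal)" for a l :: complex
 by (simp add: indicator_def)
 have Xm[measurable]: "(%z. X (snd z) (fst z)) : bmeas (M \<Otimes>\<^sub>M borel)"
 unfolding X_def by (rule measurable_nn_integral_pm) measurable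
 have XC: "(\<integral>\<^sup>+om. (X a om)\<^sup>2 \<partial>M) = (\<integral>\<^sup>+om. ennreal ((mass 1 om)\<^sup>2) \<partial>M)" for a
 proof -
 have [measurable]: "(%mu. \<integral>\<^sup>+l. indicator {..1} (dist a l) \<partial>pm mu) : bmeas LCFG"
 by (rule measurable_nn_integral_pm) measurable
 have "(\<integral>\<^sup>+om. (X a om)\<^sup>2 \<partial>M) = (\<integral>\<^sup>+om. (\<integral>\<^sup>+l. indicator {..1} (dist a l) \<partial>pm (shift_cfg a (N om)))\<^sup>2 \<partial>M)"
 unfolding X_def by (rule nn_integral_law_shift[of "%mu. (\<integral>\<^sup>+l. indicator {..1} (dist a l) \<partial>pm mu)\<^sup>2"]) measurable
 also have "... = (\<integral>\<^sup>+om. ennreal ((mass 1 om)\<^sup>2) \<partial>M)"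
 proof (rule nn_integral_cong)
 fix om assume om: "om : space M"
 have "(\<integral>\<^sup>+l. indicator {..1} (dist a l) \<partial>pm (shift_cfg a (N om))) = (\<integral>\<^sup>+l. indicator {..1} (dist a (a + l)) \<partial>pm (N om))"
 by (rule nn_integral_pm_shift) measurable
 also have "... = (\<integral>\<^sup>+l. indicator (cball 0 1) l \<partial>pm (N om))"
 by (intro nn_integral_cong) (simp add: dist_norm indicator_def)
 finally have "(\<integral>\<^sup>+l. indicator {..1} (dist a l) \<partial>pm (shift_cfg a (N om))) = (\<integral>\<^sup>+l. indicator (cball 0 1) l \<partial>pm (N om))" .
 then show "(\<integral>\<^sup>+l. indicator {..1} (dist a l) \<partial>pm (shift_cfg a (N om)))\<^sup>2 = ennreal ((mass 1 om)\<^sup>2)"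
 using emeasure_pm_mass[OF om, of 1] by (simp add: ennreal_power mass_def)
 qed
 finally show ?thesis .
 qed
 define D where "D = (\<integral>\<^sup>+a. ennreal (decay a) \<partial>lborel)"
 have le: "(\<integral>\<^sup>+l. ennreal (decay l) \<partial>pm (N om)) <= ennreal (8 / pi) * (\<integral>\<^sup>+a. ennreal (decay a) * X a om \<partial>lborel)"
 if om: "om : space M" for om
 proof -
 interpret pn: sigma_finite_measure "pm (N om)" using om by (intro sigma_finite_pm lfN)
 interpret pair_sigma_finite "pm (N om)" "lborel :: complex measure" ..
 have "(\<integral>\<^sup>+l. ennreal (decay l) \<partial>pm (N om)) = (\<integral>\<^sup>+l. ennreal (1 / pi) * (ennreal (decay l) * ennreal pi) \<partial>pm (N om))"
 by (intro nn_integral_cong) (simp add: ennreal_mult'[symmetric] mult_ac)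
 also have "... <= (\<integral>\<^sup>+l. ennreal (1 / pi) * (8 * (\<integral>\<^sup>+a. ennreal (decay a) * indicator {..1} (dist a l) \<partial>lborel)) \<partial>pm (N om))"
 using decay_le_convolution unfolding ind by (intro nn_integral_mono mult_left_mono) auto
 also have "... = ennreal (1 / pi) * (8 * (\<integral>\<^sup>+l. (\<integral>\<^sup>+a. ennreal (decay a) * indicator {..1} (dist a l) \<partial>lborel) \<partial>pm (N om)))"
 by (simp add: nn_integral_cmult)
 also have "(\<integral>\<^sup>+l. (\<integral>\<^sup>+a. ennreal (decay a) * indicator {..1} (dist a l) \<partial>lborel) \<partial>pm (N om))
 = (\<integral>\<^sup>+a. (\<integral>\<^sup>+l. ennreal (decay a) * indicator {..1} (dist a l) \<partial>pm (N om)) \<partial>lborel)"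
 by (rule Fubini'[symmetric]) measurable
 also have "... = (\<integral>\<^sup>+a. ennreal (decay a) * X a om \<partial>lborel)"
 unfolding X_def by (intro nn_integral_cong nn_integral_cmult) measurable
 also have "ennreal (1 / pi) * (8 * (\<integral>\<^sup>+a. ennreal (decay a) * X a om \<partial>lborel)) = ennreal (8 / pi) * (\<integral>\<^sup>+a. ennreal (decay a) * X a om \<partial>lborel)"
 proof -
 have "ennreal (8 / pi) = ennreal (1 / pi) * 8"
 using ennreal_mult'[of "8" "1 / pi"] by (simp add: mult.commute)
 then show ?thesis by (simp add: mult.assoc)
 qed
 finally show ?thesis .
 qed
 have "(\<integral>\<^sup>+om. (\<integral>\<^sup>+l. ennreal (decay l) \<partial>pm (N om))\<^sup>2 \<partial>M)
 <= (\<integral>\<^sup>+om. (ennreal (8 / pi))\<^sup>2 * (\<integral>\<^sup>+a. ennreal (decay a) * X a om \<partial>lborel)\<^sup>2 \<partial>M)"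
 using le by (intro nn_integral_mono) (auto simp: power_mult_distrib[symmetric] intro!: power_mono)
 also have "... = (ennreal (8 / pi))\<^sup>2 * (\<integral>\<^sup>+om. (\<integral>\<^sup>+a. ennreal (decay a) * X a om \<partial>lborel)\<^sup>2 \<partial>M)"
 by (rule nn_integral_cmult) measurable
 also have "... <= (ennreal (8 / pi))\<^sup>2 * (D\<^sup>2 * (\<integral>\<^sup>+om. ennreal ((mass 1 om)\<^sup>2) \<partial>M))"
 unfolding D_def by (intro mult_left_mono nn_integral_weighted_sq_le) (auto simp: XC sigma_finite_measure_axioms)
 also have "... < \<infinity>"
 using nn_integral_decay nn_integral_mass_sq by (simp add: D_def ennreal_mult_less_top power2_eq_square)
 finally show ?thesis .
qed

end

section \<open>Density of test functions among bounded functions of bounded support\<close>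

context stat_pp
begin

text \<open>Smoothness is recorded through \<open>flat_class\<close>, whose closure under sums and
  multiples is immediate from its rules.\<close>

definition test_class :: "(complex => complex) => bool" where
 "test_class f \<longleftrightarrow> flat_class f \<and> bounded {x. f x ~= 0}"

lemma test_class_test_fun: "test_class f ==> test_fun f"
 by (simp add: test_class_def test_fun_def flat_class_smooth)

lemma test_class_bbs: "test_class f ==> bbs f"
proof -
 assume f: "test_class f"
 then have c: "continuous_on UNIV f" by (simp add: test_class_def flat_class_continuous)
 obtain r where r: "!!x. f x ~= 0 ==> norm x <= r" using f by (auto simp: test_class_def bounded_iff)
 have "bounded (f ` cball 0 r)"
 by (intro compact_imp_bounded compact_continuous_image continuous_on_subset[OF c]) auto
 then obtain B where "\<forall>x\<in>cball 0 r. norm (f x) <= B" by (auto simp: bounded_iff)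
 then have B: "norm (f x) <= B" if "norm x <= r" for x using that by simp
 have "norm (f x) <= max B 0" for x using B[of x] r[of x] by (cases "f x = 0") auto
 moreover have "f x = 0" if "norm x > r" for x using r[of x] that by force
 ultimately show ?thesis using c unfolding bbs_def
 by (auto intro: borel_measurable_continuous_onI)
qed

lemma test_class_add: "test_class f ==> test_class g ==> test_class (%x. f x + g x)"
 unfolding test_class_def
proof
 assume fg: "flat_class f \<and> bounded {x. f x ~= 0}" "flat_class g \<and> bounded {x. g x ~= 0}"
 then show "flat_class (%x. f x + g x)" by (intro flat_class.add) auto
 from fg have "bounded ({x. f x ~= 0} \<union> {x. g x ~= 0})" by simp
 then show "bounded {x. f x + g x ~= 0}" by (rule bounded_subset) auto
qed

lemma test_class_cmult: "test_class f ==> test_class (%x. c * f x)"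
 unfolding test_class_def
proof
 assume f: "flat_class f \<and> bounded {x. f x ~= 0}"
 then show "flat_class (%x. c * f x)" by (intro flat_class.mult flat_class.const) auto
 from f have "bounded {x. f x ~= 0}" by simp
 then show "bounded {x. c * f x ~= 0}" by (rule bounded_subset) auto
qed

lemma test_class_bump: "test_class (bump (real (Suc j)) a b)"
 using test_fun_bump[of j a b] flat_class_bump by (simp add: test_class_def test_fun_def)

text \<open>The distance in which test functions are dense: variance of linear statistics plus the
 \<open>L\<^sup>1\<close> norm.\<close>
definition gap :: "(complex => complex) => ennreal" where
 "gap f = nsq M (lin f) + (\<integral>\<^sup>+x. ennreal (norm (f x)) \<partial>lborel)"

lemma gap_add:
 assumes f: "bbs f" and g: "bbs g"
 shows "gap (%x. f x + g x) <= 2 * gap f + 2 * gap g"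
proof -
 note [measurable] = bbs_measurable[OF f] bbs_measurable[OF g]
 have "nsq M (lin (%x. f x + g x)) = nsq M (%om. lin f om + lin g om)"
 by (rule nsq_cong) (simp add: lin_add f g)
 also have "... <= 2 * nsq M (lin f) + 2 * nsq M (lin g)" by (rule nsq_add_2) measurable
 finally have 1: "nsq M (lin (%x. f x + g x)) <= 2 * nsq M (lin f) + 2 * nsq M (lin g)" .
 have "(\<integral>\<^sup>+x. ennreal (norm (f x + g x)) \<partial>lborel) <= (\<integral>\<^sup>+x. 2 * ennreal (norm (f x)) + 2 * ennreal (norm (g x)) \<partial>lborel)"
 proof (rule nn_integral_mono)
 fix x
 have "norm (f x + g x) <= 2 * norm (f x) + 2 * norm (g x)"
 using norm_triangle_ineq[of "f x" "g x"] norm_ge_zero[of "f x"] norm_ge_zero[of "g x"] by linarith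
 then show "ennreal (norm (f x + g x)) <= 2 * ennreal (norm (f x)) + 2 * ennreal (norm (g x))"
 proof -
 assume "norm (f x + g x) <= 2 * norm (f x) + 2 * norm (g x)"
 then have "ennreal (norm (f x + g x)) <= ennreal (2 * norm (f x) + 2 * norm (g x))" by (rule ennreal_leI)
 then show ?thesis by (simp add: ennreal_mult')
 qed
 qed
 also have "... = 2 * (\<integral>\<^sup>+x. ennreal (norm (f x)) \<partial>lborel) + 2 * (\<integral>\<^sup>+x. ennreal (norm (g x)) \<partial>lborel)"
 by (simp add: nn_integral_add nn_integral_cmult)
 finally have 2: "(\<integral>\<^sup>+x. ennreal (norm (f x + g x)) \<partial>lborel) <= ..." .
 show ?thesis unfolding gap_def using add_mono[OF 1 2] by (simp add: distrib_left add_ac)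
qed

text \<open>Both parts converge by domination: the linear statistics by a multiple of
  \<open>mass r\<close>, which is square integrable, and the \<open>L1\<close> norms by the bounded
  support.\<close>

lemma gap_tendsto:
 assumes f: "bbs f" and \<phi>: "!!j. bbs (\<phi> j)" and B: "!!j x. norm (\<phi> j x) <= B"
 and r: "!!j x. norm x > r ==> \<phi> j x = 0" and lim: "!!x. (%j. \<phi> j x) ----> f x"
 shows "(%j. gap (%x. f x - \<phi> j x)) ----> 0"
proof -
 note [measurable] = bbs_measurable[OF f] bbs_measurable[OF \<phi>]
 have B0: "0 <= B" using B[of 0 0] norm_ge_zero[of "\<phi> 0 0"] by linarith
 have fB: "norm (f x) <= B" for x by (rule LIMSEQ_le_const2[OF tendsto_norm[OF lim]]) (use B in auto)
 have fr: "f x = 0" if "norm x > r" for x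
 using lim[of x] r[OF that] by (simp add: LIMSEQ_const_iff)
 have dB: "norm (f x - \<phi> j x) <= 2 * B" for j x
 using norm_triangle_ineq4[of "f x" "\<phi> j x"] fB[of x] B[of j x] by linarith
 have dbbs: "bbs (%x. f x - \<phi> j x)" for j by (intro bbs_diff f \<phi>)
 have lin0: "(%j. lin (%x. f x - \<phi> j x) om) ----> 0" if om: "om : space M" for om
 proof -
 have "(%j. \<integral>l. f l - \<phi> j l \<partial>pm (N om)) ----> (\<integral>l. 0 \<partial>pm (N om))"
 proof (rule integral_dominated_convergence[where w="%x. 2 * B * indicator (cball 0 r) x"])
 show "integrable (pm (N om)) (%x. 2 * B * indicator (cball 0 r) x)"
 using emeasure_pm_mass[OF om, of r] by (intro integrable_mult_right integrable_real_indicator) auto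
 show "AE x in pm (N om). (%j. f x - \<phi> j x) ----> 0"
 proof (rule AE_I2)
 fix x show "(%j. f x - \<phi> j x) ----> 0"
 using tendsto_diff[OF tendsto_const[of "f x"] lim[of x]] by simp
 qed
 show "AE x in pm (N om). norm (f x - \<phi> j x) <= 2 * B * indicator (cball 0 r) x" for j
 using dB fr r by (intro AE_I2) (auto simp: indicator_def)
 qed measurable
 then show ?thesis by (simp add: lin_def)
 qed
 have "(%j. nsq M (lin (%x. f x - \<phi> j x))) ----> (\<integral>\<^sup>+om. 0 \<partial>M)"
 unfolding nsq_def
 proof (rule nn_integral_dominated_convergence[where w="%om. ennreal ((2 * B)\<^sup>2) * ennreal ((mass r om)\<^sup>2)"])
 show "AE om in M. ennreal ((norm (lin (%x. f x - \<phi> j x) om))\<^sup>2) <= ennreal ((2 * B)\<^sup>2) * ennreal ((mass r om)\<^sup>2)" for j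
 proof (rule AE_I2)
 fix om assume "om : space M"
 then have "norm (lin (%x. f x - \<phi> j x) om) <= 2 * B * mass r om"
 by (intro norm_lin_le[OF dbbs dB]) (auto simp: fr r)
 then have "(norm (lin (%x. f x - \<phi> j x) om))\<^sup>2 <= (2 * B * mass r om)\<^sup>2" by (intro power_mono) auto
 then show "ennreal ((norm (lin (%x. f x - \<phi> j x) om))\<^sup>2) <= ennreal ((2 * B)\<^sup>2) * ennreal ((mass r om)\<^sup>2)"
 by (simp add: ennreal_mult[symmetric] power_mult_distrib ennreal_leI)
 qed
 show "(\<integral>\<^sup>+om. ennreal ((2 * B)\<^sup>2) * ennreal ((mass r om)\<^sup>2) \<partial>M) < \<infinity>"
 using nn_integral_mass_sq[of r] by (simp add: nn_integral_cmult ennreal_mult_less_top)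
 show "AE om in M. (%j. ennreal ((norm (lin (%x. f x - \<phi> j x) om))\<^sup>2)) ----> 0"
 proof (rule AE_I2)
 fix om assume "om : space M"
 from tendsto_power[OF tendsto_norm[OF lin0[OF this]], of 2]
 have "(%j. (norm (lin (%x. f x - \<phi> j x) om))\<^sup>2) ----> 0" by simp
 from tendsto_ennrealI[OF this] show "(%j. ennreal ((norm (lin (%x. f x - \<phi> j x) om))\<^sup>2)) ----> 0" by simp
 qed
 qed measurable
 moreover have "(%j. \<integral>\<^sup>+x. ennreal (norm (f x - \<phi> j x)) \<partial>lborel) ----> (\<integral>\<^sup>+x. 0 \<partial>(lborel :: complex measure))"
 proof (rule nn_integral_dominated_convergence[where w="%x::complex. ennreal (2 * B) * indicator (cball 0 r) x"])
 show "AE x in lborel. ennreal (norm (f x - \<phi> j x)) <= ennreal (2 * B) * indicator (cball (0::complex) r) x" for j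
 using dB fr r by (intro AE_I2) (auto simp: indicator_def intro!: ennreal_leI)
 show "(\<integral>\<^sup>+x. ennreal (2 * B) * indicator (cball (0::complex) r) x \<partial>lborel) < \<infinity>"
 using emeasure_lborel_cball_finite[of "0::complex" r] by (simp add: nn_integral_cmult_indicator ennreal_mult_less_top)
 show "AE x in lborel. (%j. ennreal (norm (f x - \<phi> j x))) ----> 0"
 proof (rule AE_I2)
 fix x
 from tendsto_norm[OF tendsto_diff[OF tendsto_const[of "f x"] lim[of x]]]
 have "(%j. norm (f x - \<phi> j x)) ----> 0" by simp
 from tendsto_ennrealI[OF this] show "(%j. ennreal (norm (f x - \<phi> j x))) ----> 0" by simp
 qed
 qed measurable
 ultimately have "(%j. gap (%x. f x - \<phi> j x)) ----> 0 + 0"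
 unfolding gap_def by (intro tendsto_add) simp_all
 then show ?thesis by simp
qed

definition approx :: "(complex => complex) => bool" where
 "approx f \<longleftrightarrow> bbs f \<and> (\<forall>e>0. \<exists>g. test_class g \<and> gap (%x. f x - g x) < e)"

lemma approx_bbs: "approx f ==> bbs f" by (simp add: approx_def)

lemma approx_test_class: "test_class f ==> approx f"
 unfolding approx_def by (auto simp: test_class_bbs gap_def nsq_def lin_def intro!: exI[of _ f])

lemma quarter_ennreal:
 fixes e :: ennreal assumes "e > 0"
 obtains d where "d > 0" "!!a b. a < d ==> b < d ==> 2 * a + 2 * b < e"
proof (cases e)
 case (real r)
 show thesis
 proof (rule that[of "ennreal (r / 4)"])
 show "ennreal (r / 4) > 0" using assms real by simp
 fix a b assume ab: "a < ennreal (r / 4)" "b < ennreal (r / 4)"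
 obtain a' b' where "a = ennreal a'" "b = ennreal b'" "a' >= 0" "b' >= 0"
 using ab by (metis ennreal_cases ennreal_less_top less_trans top.not_eq_extremum)
 moreover from this ab have "a' < r / 4" "b' < r / 4" by (simp_all add: ennreal_less_iff)
 ultimately have "2 * a + 2 * b = ennreal (2 * a' + 2 * b')" "2 * a' + 2 * b' < r"
 by (simp_all add: ennreal_mult')
 then show "2 * a + 2 * b < e" using real \<open>a' >= 0\<close> \<open>b' >= 0\<close>
 by (simp add: ennreal_less_iff del: ennreal_plus)
 qed
next
 case top
 show thesis
 by (rule that[of 1]) (auto simp: top ennreal_mult_less_top intro: less_trans[of _ 1])
qed

text \<open>Bounded pointwise limits with a common support are the limits met in a monotone class
  argument.\<close>

lemma approx_limit:
 assumes f: "bbs f" and \<phi>: "!!j. approx (\<phi> j)" and "!!j x. norm (\<phi> j x) <= B"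
 and "!!j x. norm x > r ==> \<phi> j x = 0" and "!!x. (%j. \<phi> j x) ----> f x"
 shows "approx f"
 unfolding approx_def
proof (intro conjI allI impI f)
 fix e :: ennreal assume "e > 0"
 then obtain d where d: "d > 0" "!!a b. a < d ==> b < d ==> 2 * a + 2 * b < e" using quarter_ennreal[of e] by blast
 have "(%j. gap (%x. f x - \<phi> j x)) ----> 0"
 by (rule gap_tendsto[OF f approx_bbs[OF \<phi>]]) (use assms in auto)
 then have "\<forall>\<^sub>F j in sequentially. gap (%x. f x - \<phi> j x) < d" using d(1) by (auto simp: order_tendsto_iff)
 then obtain j where j: "gap (%x. f x - \<phi> j x) < d" by (auto simp: eventually_sequentially)
 obtain g where g: "test_class g" "gap (%x. \<phi> j x - g x) < d" using \<phi>[of j] d(1) unfolding approx_def by blast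
 have "gap (%x. (f x - \<phi> j x) + (\<phi> j x - g x)) <= 2 * gap (%x. f x - \<phi> j x) + 2 * gap (%x. \<phi> j x - g x)"
 by (intro gap_add bbs_diff f approx_bbs \<phi> test_class_bbs g)
 also have "... < e" by (rule d(2)[OF j g(2)])
 finally show "\<exists>g. test_class g \<and> gap (%x. f x - g x) < e" using g(1) by auto
qed

lemma approx_add: "approx f ==> approx g ==> approx (%x. f x + g x)"
 unfolding approx_def
proof (intro conjI allI impI, use bbs_add in blast)
 fix e :: ennreal assume fg: "bbs f \<and> (\<forall>e>0. \<exists>h. test_class h \<and> gap (%x. f x - h x) < e)"
 "bbs g \<and> (\<forall>e>0. \<exists>h. test_class h \<and> gap (%x. g x - h x) < e)" and "e > 0"
 then obtain d where d: "d > 0" "!!a b. a < d ==> b < d ==> 2 * a + 2 * b < e" using quarter_ennreal[of e] by blast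
 from fg d(1) obtain f' g' where h: "test_class f'" "gap (%x. f x - f' x) < d" "test_class g'" "gap (%x. g x - g' x) < d"
 by blast
 have "gap (%x. (f x - f' x) + (g x - g' x)) <= 2 * gap (%x. f x - f' x) + 2 * gap (%x. g x - g' x)"
 by (intro gap_add bbs_diff test_class_bbs h fg[THEN conjunct1])
 also have "... < e" by (rule d(2)[OF h(2,4)])
 finally have "gap (%x. (f x + g x) - (f' x + g' x)) < e" by (simp add: algebra_simps)
 then show "\<exists>h. test_class h \<and> gap (%x. f x + g x - h x) < e" using test_class_add[OF h(1,3)] by blast
qed

lemma gap_cmult:
 assumes f: "bbs f" shows "gap (%x. c * f x) <= ennreal ((norm c)\<^sup>2 + norm c) * gap f"
proof -
 note [measurable] = bbs_measurable[OF f]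
 have "lin (%x. c * f x) = (%om. c * lin f om)" by (auto simp: lin_cmult)
 then have "gap (%x. c * f x) = ennreal ((norm c)\<^sup>2) * nsq M (lin f) + ennreal (norm c) * (\<integral>\<^sup>+x. ennreal (norm (f x)) \<partial>lborel)"
 unfolding gap_def by (simp add: nsq_cmult norm_mult ennreal_mult nn_integral_cmult)
 also have "... <= ennreal ((norm c)\<^sup>2 + norm c) * nsq M (lin f) + ennreal ((norm c)\<^sup>2 + norm c) * (\<integral>\<^sup>+x. ennreal (norm (f x)) \<partial>lborel)"
 by (intro add_mono mult_right_mono ennreal_leI) auto
 finally show ?thesis by (simp add: gap_def distrib_left)
qed

lemma approx_cmult:
 assumes f: "approx f" shows "approx (%x. c * f x)"
 unfolding approx_def
proof (intro conjI allI impI bbs_cmult approx_bbs f)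
 fix e :: ennreal assume e: "e > 0"
 define K where "K = (norm c)\<^sup>2 + norm c + 1"
 have K: "K > 0" by (simp add: K_def add_nonneg_pos)
 obtain d where d: "d > 0" "!!a. a < d ==> ennreal K * a < e"
 proof (cases e)
 case (real r)
 have "ennreal K * a < e" if a: "a < ennreal (r / K)" for a
 proof -
 obtain a' where "a = ennreal a'" "a' >= 0" using a by (cases a) auto
 moreover from this a have "a' < r / K" by (simp add: ennreal_less_iff)
 ultimately show ?thesis using real K by (simp add: ennreal_mult[symmetric] ennreal_less_iff field_simps)
 qed
 then show thesis using real e K by (intro that[of "ennreal (r / K)"]) auto
 next
 case top
 then show thesis by (intro that[of 1]) (auto simp: ennreal_mult_less_top intro: less_trans[of _ 1])
 qed
 then obtain g where g: "test_class g" "gap (%x. f x - g x) < d" using f unfolding approx_def by blast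
 have "gap (%x. c * (f x - g x)) <= ennreal ((norm c)\<^sup>2 + norm c) * gap (%x. f x - g x)"
 by (intro gap_cmult bbs_diff approx_bbs f test_class_bbs g)
 also have "... <= ennreal K * gap (%x. f x - g x)" by (intro mult_right_mono ennreal_leI) (auto simp: K_def)
 also have "... < e"
 by (rule d(2)[OF g(2)])
 finally have "gap (%x. c * f x - c * g x) < e" by (simp add: algebra_simps)
 then show "\<exists>h. test_class h \<and> gap (%x. c * f x - h x) < e" using test_class_cmult[OF g(1)] by blast
qed

lemma bbs_indicator: "A : sets borel ==> bounded A ==> bbs (indicator A)"
proof -
 assume A: "A : sets borel" "bounded A"
 then obtain r where r: "\<forall>x\<in>A. norm x <= r" by (auto simp: bounded_iff)
 have "\<forall>x. norm (indicator A x :: complex) <= 1" by (simp add: indicator_def)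
 moreover have "\<forall>x. norm x > r \<longrightarrow> indicator A x = (0 :: complex)" using r by (auto simp: indicator_def)
 moreover have "indicator A : bmeas borel" using A by (intro borel_measurable_indicator) auto
 ultimately show ?thesis unfolding bbs_def by blast
qed

lemma approx_box: "approx (indicator (box a b))"
proof -
 obtain r where r: "!!x. x : box a b ==> norm x <= r" using bounded_box[of a b] by (auto simp: bounded_iff)
 show ?thesis
 proof (rule approx_limit[where \<phi>="%j. bump (real (Suc j)) a b" and B=1 and r=r])
 show "bump (real (Suc j)) a b x = 0" if "norm x > r" for j x
 using r[of x] that bump_outside[of "real (Suc j)" x a b] by force
 qed (auto simp: norm_bump_le_1 bump_tendsto approx_test_class[OF test_class_bump] bbs_indicator simp del: of_nat_Suc)
qed

text \<open>Dynkin's argument is run inside a fixed box, because complements in the plane are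
  unbounded. Disjoint unions are bounded limits of their partial sums.\<close>

lemma approx_borel_in_box:
 assumes "A : sets borel"
 shows "approx (indicator (A \<inter> box a b))"
proof -
 have gen: "sets (borel :: complex measure) = sigma_sets UNIV (range (%(a, b). box a b))"
 by (subst borel_eq_box) (auto intro!: sets_measure_of)
 have bb: "bbs (indicator (A \<inter> box a b))" if "A : sets borel" for A
 using that by (intro bbs_indicator bounded_Int) auto
 have As: "A : sigma_sets UNIV (range (%(a, b). box a (b::complex)))" using assms gen by simp
 have Is: "Int_stable (range (%(a, b). box a (b::complex)))"
 unfolding Int_stable_def
 proof safe
 fix a b c d :: complex
 show "box a b \<inter> box c d : range (%(a, b). box a b)"
 unfolding box_Int_box by (rule range_eqI[where x="(_, _)"]) simp
 qed
 have Pw: "range (%(a, b). box a (b::complex)) \<subseteq> Pow UNIV" by simp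
 from Is Pw As show ?thesis
 proof (induction rule: sigma_sets_induct_disjoint)
 case (basic A)
 then obtain c d where "A = box c d" by auto
 then show ?case using approx_box by (simp add: box_Int_box)
 next
 case empty
 show ?case using approx_cmult[OF approx_box, of 0] by (simp add: indicator_def[abs_def])
 next
 case (compl A)
 have "approx (%x. indicator (box a b) x + (-1) * indicator (A \<inter> box a b) x)"
 by (intro approx_add approx_cmult approx_box compl(2))
 moreover have "(%x. indicator (box a b) x + (-1) * indicator (A \<inter> box a b) x :: complex) = indicator ((UNIV - A) \<inter> box a b)"
 by (auto simp: indicator_def fun_eq_iff)
 ultimately show ?case by simp
 next
 case (union A)
 obtain r where r: "!!x. x : box a b ==> norm x <= r" using bounded_box[of a b] by (auto simp: bounded_iff)
 have A: "A i : sets borel" for i using union(2) gen by auto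
 have dis: "i = j" if "x : A i" "x : A j" for x i j
 using union(1) that unfolding disjoint_family_on_def by blast
 have part: "(\<Sum>i<n. indicator (A i \<inter> box a b) x) = (indicator ((\<Union>i<n. A i) \<inter> box a b) x :: complex)" for n x
 proof (induction n)
 case (Suc n)
 have "(indicator ((\<Union>i<Suc n. A i) \<inter> box a b) x :: complex) = indicator ((\<Union>i<n. A i) \<inter> box a b) x + indicator (A n \<inter> box a b) x"
 proof (cases "x : A n")
 case True
 then have "x \<notin> A i" if "i < n" for i using dis[of x i n] that by blast
 then have "x \<notin> (\<Union>i<n. A i)" by blast
 then show ?thesis using True by (simp add: indicator_def lessThan_Suc)
 qed (simp add: indicator_def lessThan_Suc)
 then show ?case using Suc by simp
 qed simp
 have ap: "approx (%x. \<Sum>i<n. indicator (A i \<inter> box a b) x)" for n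
 proof (induction n)
 case 0 show ?case using approx_cmult[OF approx_box, of 0] by simp
 qed (auto intro!: approx_add union(3) simp: add.commute)
 show ?case
 proof (rule approx_limit[where \<phi>="%n x. \<Sum>i<n. indicator (A i \<inter> box a b) x" and B=1 and r=r])
 show "bbs (indicator (\<Union> (range A) \<inter> box a b))" using A by (intro bb) auto
 show "(%n. \<Sum>i<n. indicator (A i \<inter> box a b) x) ----> (indicator (\<Union> (range A) \<inter> box a b) x :: complex)" for x
 proof (cases "x : \<Union> (range A)")
 case True
 then obtain i where "x : A i" by auto
 have "\<forall>\<^sub>F n in sequentially. (\<Sum>i<n. indicator (A i \<inter> box a b) x) = (indicator (\<Union> (range A) \<inter> box a b) x :: complex)"
 unfolding part using eventually_gt_at_top[of i]
 proof eventually_elim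
 case (elim n)
 then show ?case using \<open>x : A i\<close> by (auto simp: indicator_def)
 qed
 then show ?thesis by (rule tendsto_eventually)
 qed (auto simp: part)
 show "norm (\<Sum>i<j. indicator (A i \<inter> box a b) x :: complex) <= 1" for j x unfolding part by (simp add: indicator_def)
 show "(\<Sum>i<j. indicator (A i \<inter> box a b) x :: complex) = 0" if "norm x > r" for j x
 unfolding part using r[of x] that by (auto simp: indicator_def)
 qed (rule ap)
 qed
qed

lemma approx_bbs_all:
 assumes f: "bbs f" shows "approx f"
proof -
 note [measurable] = bbs_measurable[OF f]
 obtain B r where B: "B >= 0" "r >= 0" "!!x. norm (f x) <= B" "!!x. norm x > r ==> f x = 0" using bbsE[OF f] by blast
 obtain b where b: "cball 0 r \<subseteq> box (- b) (b::complex)"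
 using bounded_subset_box_symmetric[of "cball (0::complex) r"] by auto
 obtain F where F: "!!i. simple_function borel (F i)" "!!x. (%i. F i x) ----> f x" "!!i x. dist (F i x) 0 <= 2 * dist (f x) 0"
 using borel_measurable_implies_sequence_metric[of f borel 0] by auto
 have F0: "F i x = 0" if "norm x > r" for i x using F(3)[of i x] B(4)[OF that] by simp
 have ap: "approx (F i)" for i
 proof -
 have fin: "finite (range (F i))" using F(1)[of i] by (simp add: simple_function_def)
 have mF: "F i -` {y} : sets borel" if "y : range (F i)" for y using F(1)[of i] that by (auto simp: simple_function_def)
 \<comment> \<open>Level sets, notably that of the value 0, may be unbounded. Cutting with the box
   makes every term admissible and leaves the sum unchanged, as \<open>F i\<close> vanishes outside
   the box.\<close>
 have rep: "F i = (%x. \<Sum>y\<in>range (F i). y * indicator (F i -` {y} \<inter> box (- b) b) x)"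
 proof
 fix x
 show "F i x = (\<Sum>y\<in>range (F i). y * indicator (F i -` {y} \<inter> box (- b) b) x)"
 proof (cases "x : box (- b) b")
 case True
 have "(\<Sum>y\<in>range (F i). y * indicator (F i -` {y} \<inter> box (- b) b) x) = (\<Sum>y\<in>range (F i). if y = F i x then y else 0)"
 using True by (intro sum.cong) (auto simp: indicator_def)
 then show ?thesis using fin by simp
 next
 case False
 then have "x \<notin> cball 0 r" using b by blast
 then have "norm x > r" by simp
 then show ?thesis using False F0 by (simp add: indicator_def)
 qed
 qed
 have sum: "approx (%x. \<Sum>y\<in>Y. y * indicator (F i -` {y} \<inter> box (- b) b) x)" if "finite Y" "Y \<subseteq> range (F i)" for Y
 using that
 proof (induction Y)
 case empty show ?case using approx_cmult[OF approx_box, of 0] by simp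
 next
 case (insert y Y)
 have "approx (%x. y * indicator (F i -` {y} \<inter> box (- b) b) x + (\<Sum>y\<in>Y. y * indicator (F i -` {y} \<inter> box (- b) b) x))"
 using insert.prems by (intro approx_add approx_cmult approx_borel_in_box mF insert.IH) auto
 then show ?case unfolding sum.insert[OF insert.hyps] .
 qed
 show ?thesis by (subst rep) (rule sum[OF fin order_refl])
 qed
 show ?thesis
 proof (rule approx_limit[OF f ap])
 show "norm (F j x) <= 2 * B" for j x using F(3)[of j x] B(3)[of x] by simp
 qed (use F F0 in auto)
qed

definition vsq :: "(complex => complex) => ennreal" where
 "vsq f = nsq M (%om. lin f om - expectation (lin f))"

lemma vsq_le: "bbs f ==> vsq f <= nsq M (lin f)"
 unfolding vsq_def by (rule nsq_centered_le[OF measurable_lin[OF bbs_measurable]])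

lemma vsq_add:
 assumes f: "bbs f" and g: "bbs g" and e: "e > 0"
 shows "vsq (%x. f x + g x) <= ennreal (1 + e) * vsq f + ennreal (1 + 1 / e) * vsq g"
proof -
 note [measurable] = bbs_measurable[OF f] bbs_measurable[OF g]
 have "expectation (lin (%x. f x + g x)) = expectation (%om. lin f om + lin g om)"
 by (rule BI_integral_cong) (auto simp: lin_add f g)
 also have "... = expectation (lin f) + expectation (lin g)"
 by (intro BI_integral_add integrable_lin bbs_integrable f g)
 finally have "vsq (%x. f x + g x) = nsq M (%om. (lin f om - expectation (lin f)) + (lin g om - expectation (lin g)))"
 unfolding vsq_def by (intro nsq_cong) (simp add: lin_add f g)
 also have "... <= ennreal (1 + e) * vsq f + ennreal (1 + 1 / e) * vsq g"
 unfolding vsq_def by (rule nsq_add[OF _ _ e]) measurable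
 finally show ?thesis .
qed

end

section \<open>The spectral identity for bounded functions of bounded support\<close>

locale spec_pp = stat_pp +
 fixes rh :: "complex measure"
 assumes spec: "spectral_measure M N rh"
begin

lemma sets_rho [simp, measurable_cong]: "sets rh = sets borel"
 using spec by (simp add: spectral_measure_def)

lemma emeasure_rho_compact: "compact K ==> emeasure rh K < \<infinity>"
 using spec by (simp add: spectral_measure_def)

lemma sigma_finite_rho: "sigma_finite_measure rh"
proof (rule sigma_finite_cballs)
 show "emeasure rh (cball 0 r) ~= \<infinity>" for r using emeasure_rho_compact[of "cball 0 r"] by auto
qed simp

lemma spectral_test_class:
 assumes f: "test_class f"
 shows "vsq f = nsq rh (fourier f)"
proof -
 note fb = test_class_bbs[OF f]
 note [measurable] = bbs_measurable[OF fb]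
 obtain r where r: "!!x. norm x > r ==> f x = 0" using fb unfolding bbs_def by blast
 have ls: "lin_stat (N om) f = lin f om" if "om : space M" for om
 unfolding lin_def by (rule lin_stat_eq_integral) (use that r lfN in auto)
 define Y where "Y om = lin f om - expectation (lin f)" for om
 have [measurable]: "Y : bmeas M" unfolding Y_def by measurable
 have "nsq M Y < \<infinity>"
 using vsq_le[OF fb] nsq_lin_finite[OF fb] unfolding vsq_def Y_def by (rule le_less_trans)
 then have iY: "integrable M (%om. (norm (Y om))\<^sup>2)"
 by (intro integrableI_nonneg) (auto simp: nsq_def)
 have E: "(\<integral>om. lin_stat (N om) f \<partial>M) = expectation (lin f)"
 by (rule BI_integral_cong) (auto simp: ls)
 have "ccov M (%om. lin_stat (N om) f) (%om. lin_stat (N om) f) = (\<integral>om. of_real ((norm (Y om))\<^sup>2) \<partial>M)"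
 unfolding ccov_def E
 by (rule BI_integral_cong) (auto simp: ls Y_def complex_norm_square simp del: of_real_power)
 also have "... = of_real (\<integral>om. (norm (Y om))\<^sup>2 \<partial>M)" by (rule integral_of_real[OF iY])
 finally have 1: "ccov M (%om. lin_stat (N om) f) (%om. lin_stat (N om) f) = of_real (\<integral>om. (norm (Y om))\<^sup>2 \<partial>M)" .
 have sp: "integrable rh (%xi. fourier f xi * cnj (fourier f xi))"
 "ccov M (%om. lin_stat (N om) f) (%om. lin_stat (N om) f) = (\<integral>xi. fourier f xi * cnj (fourier f xi) \<partial>rh)"
 using spec test_class_test_fun[OF f] unfolding spectral_measure_def by blast+
 have "(%xi. fourier f xi * cnj (fourier f xi)) = (%xi. of_real ((norm (fourier f xi))\<^sup>2))"
 by (auto simp: complex_norm_square simp del: of_real_power)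
 note sp = sp[unfolded this]
 have irh: "integrable rh (%xi. (norm (fourier f xi))\<^sup>2)"
 using integrable_Re[OF sp(1)] by (simp del: of_real_power)
 have eq: "(\<integral>om. (norm (Y om))\<^sup>2 \<partial>M) = (\<integral>xi. (norm (fourier f xi))\<^sup>2 \<partial>rh)"
 using 1 sp(2) unfolding integral_of_real[OF irh] by (simp only: of_real_eq_iff)
 have "vsq f = ennreal (\<integral>om. (norm (Y om))\<^sup>2 \<partial>M)"
 using iY unfolding vsq_def nsq_def Y_def by (intro nn_integral_eq_integral) auto
 also have "... = nsq rh (fourier f)"
 unfolding nsq_def eq by (intro nn_integral_eq_integral[symmetric] irh) auto
 finally show ?thesis .
qed

lemma approx_sequence:
 assumes "bbs f"
 obtains g where "!!j. test_class (g j)" "!!j. gap (%x. f x - g j x) <= ennreal (1 / real (Suc j))"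
proof -
 have "\<exists>h. test_class h \<and> gap (%x. f x - h x) < ennreal (1 / real (Suc j))" for j
 using approx_bbs_all[OF assms] unfolding approx_def by (simp add: ennreal_less_zero_iff del: of_nat_Suc)
 then have "\<forall>j. \<exists>h. test_class h \<and> gap (%x. f x - h x) < ennreal (1 / real (Suc j))" by blast
 from choice[OF this] obtain g where "\<forall>j. test_class (g j) \<and> gap (%x. f x - g j x) < ennreal (1 / real (Suc j))" by blast
 then show thesis by (intro that[of g]) (auto intro: less_imp_le simp del: of_nat_Suc)
qed

text \<open>The \<open>L1\<close> part of \<open>gap\<close> makes the Fourier transforms of the
  \<open>g j\<close> converge at every frequency; no convergence in the square norm of
  \<open>rh\<close> is known yet, so Fatou is used.\<close>

lemma fatou_fourier:
 assumes f: "bbs f" and g: "!!j. test_class (g j)" and gap: "!!j. gap (%x. f x - g j x) <= ennreal (1 / real (Suc j))"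
 shows "nsq rh (fourier f) <= liminf (%j. vsq (g j))"
proof -
 note [measurable] = bbs_measurable[OF f] bbs_measurable[OF test_class_bbs[OF g]]
 have lim: "(%j. fourier (g j) xi) ----> fourier f xi" for xi
 proof (rule metric_tendsto_imp_tendsto)
 show "(%j. 1 / real (Suc j)) ----> 0" using LIMSEQ_inverse_real_of_nat by (simp add: inverse_eq_divide)
 show "\<forall>\<^sub>F j in sequentially. dist (fourier (g j) xi) (fourier f xi) <= dist (1 / real (Suc j)) 0"
 proof (intro always_eventually allI)
 fix j
 have d: "bbs (%x. f x - g j x)" by (intro bbs_diff f test_class_bbs g)
 have "dist (fourier (g j) xi) (fourier f xi) = norm (fourier (%x. f x - g j x) xi)"
 using f g by (subst fourier_diff) (auto intro: bbs_integrable test_class_bbs simp: dist_norm norm_minus_commute)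
 also have "... <= (\<integral>x. norm (f x - g j x) \<partial>lborel)" by (rule norm_fourier_le[OF bbs_integrable[OF d]])
 also have "... <= 1 / real (Suc j)"
 proof -
 have "ennreal (\<integral>x. norm (f x - g j x) \<partial>lborel) = (\<integral>\<^sup>+x. ennreal (norm (f x - g j x)) \<partial>lborel)"
 using bbs_integrable[OF d] by (intro nn_integral_eq_integral[symmetric]) auto
 also have "... <= gap (%x. f x - g j x)" by (simp add: gap_def)
 also have "... <= ennreal (1 / real (Suc j))" by (rule gap)
 finally show ?thesis by (simp add: ennreal_le_iff del: of_nat_Suc)
 qed
 finally show "dist (fourier (g j) xi) (fourier f xi) <= dist (1 / real (Suc j)) 0" by (simp del: of_nat_Suc)
 qed
 qed
 have "nsq rh (fourier f) = (\<integral>\<^sup>+xi. liminf (%j. ennreal ((norm (fourier (g j) xi))\<^sup>2)) \<partial>rh)"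
 unfolding nsq_def
 proof (rule nn_integral_cong)
 fix xi
 have "(%j. ennreal ((norm (fourier (g j) xi))\<^sup>2)) ----> ennreal ((norm (fourier f xi))\<^sup>2)"
 by (intro tendsto_ennrealI tendsto_power tendsto_norm lim)
 from lim_imp_Liminf[OF trivial_limit_sequentially this]
 show "ennreal ((norm (fourier f xi))\<^sup>2) = liminf (%j. ennreal ((norm (fourier (g j) xi))\<^sup>2))" by (rule sym)
 qed
 also have "... <= liminf (%j. nsq rh (fourier (g j)))"
 unfolding nsq_def by (rule nn_integral_liminf) measurable
 finally show ?thesis using spectral_test_class[OF g] by simp
qed

lemma liminf_le_of_eventually_le:
 fixes x :: "nat => ennreal"
 assumes "!!j. x j <= c + K * ennreal (1 / real (Suc j))" "K < \<infinity>"
 shows "liminf x <= c"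
proof (rule ennreal_le_epsilon)
 fix e :: real assume e: "0 < e"
 obtain k where k: "K = ennreal k" "k >= 0" using assms(2) by (cases K) auto
 have "(%j. k * inverse (real (Suc j))) ----> k * 0" by (intro tendsto_intros LIMSEQ_inverse_real_of_nat)
 then have "\<forall>\<^sub>F j in sequentially. k * inverse (real (Suc j)) < e" using e by (auto simp: order_tendsto_iff)
 then have "\<forall>\<^sub>F j in sequentially. x j <= c + ennreal e"
 proof eventually_elim
 case (elim j)
 have "ennreal (k * (1 / real (Suc j))) = K * ennreal (1 / real (Suc j))"
 unfolding k(1) by (rule ennreal_mult) (use k in auto)
 then have "x j <= c + ennreal (k * (1 / real (Suc j)))" using assms(1)[of j] by simp
 also have "... <= c + ennreal e" using elim by (intro add_left_mono ennreal_leI) (simp add: divide_inverse)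
 finally show ?case .
 qed
 then show "liminf x <= c + ennreal e" by (intro Liminf_le) auto
qed

lemma nsq_fourier_le_vsq:
 assumes f: "bbs f" shows "nsq rh (fourier f) <= vsq f"
proof (rule ennreal_le_mult_one_plus)
 fix e :: real assume e: "e > 0"
 obtain g where g: "!!j. test_class (g j)" "!!j. gap (%x. f x - g j x) <= ennreal (1 / real (Suc j))"
 using approx_sequence[OF f] by blast
 have "vsq (g j) <= ennreal (1 + e) * vsq f + ennreal (1 + 1 / e) * ennreal (1 / real (Suc j))" for j
 proof -
 have d: "bbs (%x. (-1) * (f x - g j x))" by (intro bbs_cmult bbs_diff f test_class_bbs g)
 have "vsq (%x. f x + (-1) * (f x - g j x)) <= ennreal (1 + e) * vsq f + ennreal (1 + 1 / e) * vsq (%x. (-1) * (f x - g j x))"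
 by (rule vsq_add[OF f d e])
 also have "vsq (%x. (-1) * (f x - g j x)) <= nsq M (lin (%x. (-1) * (f x - g j x)))" by (rule vsq_le[OF d])
 also have "lin (%x. (-1) * (f x - g j x)) = (%om. (-1) * lin (%x. f x - g j x) om)" by (rule ext) (rule lin_cmult)
 also have "nsq M ... = nsq M (lin (%x. f x - g j x))" by (simp add: nsq_def)
 also have "... <= gap (%x. f x - g j x)" by (simp add: gap_def)
 also have "... <= ennreal (1 / real (Suc j))" by (rule g)
 finally show ?thesis by (simp add: mult_left_mono add_left_mono)
 qed
 then have "liminf (%j. vsq (g j)) <= ennreal (1 + e) * vsq f"
 by (rule liminf_le_of_eventually_le) simp
 then show "nsq rh (fourier f) <= ennreal (1 + e) * vsq f"
 using fatou_fourier[OF f g] by (rule order_trans[rotated])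
qed

text \<open>Fatou gives one inequality for every function of the class. Applied to the differences
  \<open>f - g j\<close>, it shows that their Fourier transforms are small in the square norm of
  \<open>rh\<close>, and this yields the reverse inequality.\<close>

theorem spectral:
 assumes f: "bbs f" shows "vsq f = nsq rh (fourier f)"
proof (rule antisym[OF _ nsq_fourier_le_vsq[OF f]])
 note [measurable] = bbs_measurable[OF f]
 obtain g where g: "!!j. test_class (g j)" "!!j. gap (%x. f x - g j x) <= ennreal (1 / real (Suc j))"
 using approx_sequence[OF f] by blast
 note gb = test_class_bbs[OF g(1)]
 have d: "bbs (%x. f x - g j x)" for j by (intro bbs_diff f gb)
 have dv: "vsq (%x. f x - g j x) <= ennreal (1 / real (Suc j))" for j
 proof -
 have "vsq (%x. f x - g j x) <= nsq M (lin (%x. f x - g j x))" by (rule vsq_le[OF d])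
 also have "... <= gap (%x. f x - g j x)" by (simp add: gap_def)
 also have "... <= ennreal (1 / real (Suc j))" by (rule g)
 finally show ?thesis .
 qed
 have "vsq f <= ennreal (1 + e) * (ennreal (1 + e) * nsq rh (fourier f))" if e: "e > 0" for e :: real
 proof -
 let ?E = "ennreal (1 + e)" and ?E' = "ennreal (1 + 1 / e)"
 have "vsq f <= ?E * (?E * nsq rh (fourier f)) + (?E * ?E' + ?E') * ennreal (1 / real (Suc j))" for j
 proof -
 have "vsq (%x. g j x + (f x - g j x)) <= ?E * vsq (g j) + ?E' * vsq (%x. f x - g j x)"
 by (rule vsq_add[OF gb d e])
 also have "... <= ?E * vsq (g j) + ?E' * ennreal (1 / real (Suc j))" by (intro add_left_mono mult_left_mono dv) simp
 also have "vsq (g j) = nsq rh (fourier (g j))" by (rule spectral_test_class[OF g(1)])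
 also have "... = nsq rh (%xi. fourier f xi + - fourier (%x. f x - g j x) xi)"
 by (rule nsq_cong) (simp add: fourier_diff bbs_integrable f gb)
 also have "... <= ?E * nsq rh (fourier f) + ?E' * nsq rh (%xi. - fourier (%x. f x - g j x) xi)"
 proof (rule nsq_add[OF _ _ e])
 note [measurable] = bbs_measurable[OF d[of j]]
 show "(%xi. - fourier (%x. f x - g j x) xi) : bmeas rh" by measurable
 qed measurable
 also have "nsq rh (%xi. - fourier (%x. f x - g j x) xi) <= ennreal (1 / real (Suc j))"
 unfolding nsq_uminus by (rule order_trans[OF nsq_fourier_le_vsq[OF d] dv])
 finally have "vsq (%x. g j x + (f x - g j x)) <= ?E * (?E * nsq rh (fourier f) + ?E' * ennreal (1 / real (Suc j))) + ?E' * ennreal (1 / real (Suc j))"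
 by (simp add: mult_left_mono add_left_mono add_right_mono)
 then show ?thesis by (simp add: distrib_left distrib_right mult.assoc add.assoc)
 qed
 from liminf_le_of_eventually_le[of "%_. vsq f", OF this] show ?thesis
 by (simp add: Liminf_const ennreal_mult_less_top)
 qed
 note * = this
 show "vsq f <= nsq rh (fourier f)"
 proof (rule ennreal_le_mult_one_plus)
 fix e :: real assume e: "e > 0"
 \<comment> \<open>The factor \<open>1 + d\<close> occurs twice; with \<open>d\<close> at most 1 its
   square is at most \<open>1 + 3 * d\<close>, hence at most \<open>1 + e\<close>.\<close>
 define d where "d = min 1 (e / 3)"
 have d0: "d > 0" "d <= 1" "d <= e / 3" using e by (auto simp: d_def)
 have "d * d <= d" using mult_left_mono[of d 1 d] d0 by simp
 moreover have "(1 + d) * (1 + d) = 1 + 2 * d + d * d" by (simp add: algebra_simps)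
 ultimately have "(1 + d) * (1 + d) <= 1 + e" using d0 by linarith
 then have "ennreal (1 + d) * ennreal (1 + d) <= ennreal (1 + e)" using d0 by (simp add: ennreal_mult[symmetric] ennreal_leI del: ennreal_plus)
 then show "vsq f <= ennreal (1 + e) * nsq rh (fourier f)"
 using order_trans[OF *[OF d0(1)], of "ennreal (1 + e) * nsq rh (fourier f)"] mult_right_mono[of "ennreal (1 + d) * ennreal (1 + d)" "ennreal (1 + e)" "nsq rh (fourier f)"]
 by (simp add: mult.assoc)
 qed
qed

end

section \<open>Convergence of Psi_1 from the behaviour of the spectral measure near the
  origin\<close>

lemma bessel0_tendsto_0:
 assumes Y: "filterlim Y at_top sequentially" and "c > 0"
 shows "(%n. bessel0 (Y n * c)) ----> 0"
proof (rule Lim_null_comparison)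
 have Yc: "filterlim (%n. c * Y n) at_top sequentially"
 by (rule filterlim_tendsto_pos_mult_at_top[OF tendsto_const \<open>c > 0\<close> Y])
 have "(%n. 100 * inverse (sqrt (c * Y n))) ----> 100 * 0"
 by (intro tendsto_intros tendsto_inverse_0_at_top filterlim_compose[OF sqrt_at_top Yc])
 then show "(%n. 100 / sqrt (c * Y n)) ----> 0" by (simp add: divide_inverse)
 have "\<forall>\<^sub>F n in sequentially. c * Y n > 0" using Yc by (auto simp: filterlim_at_top_dense)
 then show "\<forall>\<^sub>F n in sequentially. norm (bessel0 (Y n * c)) <= 100 / sqrt (c * Y n)"
 by eventually_elim (use norm_bessel0_le_inverse_sqrt in \<open>simp add: mult.commute\<close>)
qed

context prob_space
begin

lemma integral_norm_sq_eq_nsq: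
 assumes [measurable]: "f : bmeas M"
 shows "(\<integral>x. (norm (f x))\<^sup>2 \<partial>M) = enn2real (nsq M f)"
 unfolding nsq_def by (rule integral_eq_nn_integral) auto

lemma L2_iff_nsq: "L2 M Y \<longleftrightarrow> Y : bmeas M \<and> nsq M Y < \<infinity>"
proof -
 have "integrable M (%om. (norm (Y om))\<^sup>2) \<longleftrightarrow> nsq M Y < \<infinity>" if [measurable]: "Y : bmeas M"
 by (simp add: integrable_iff_bounded nsq_def)
 then show ?thesis by (auto simp: L2_def)
qed

lemma nsq_diff_finite:
 assumes [measurable]: "f : bmeas M" "g : bmeas M" and "nsq M f < \<infinity>" "nsq M g < \<infinity>"
 shows "nsq M (%x. f x - g x) < \<infinity>"
proof -
 have "nsq M (%x. f x + - g x) <= 2 * nsq M f + 2 * nsq M (%x. - g x)" by (rule nsq_add_2) measurable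
 also have "... < \<infinity>" using assms by (simp add: nsq_uminus ennreal_mult_less_top)
 finally show ?thesis by simp
qed

lemma L2_tendstoI:
 assumes X: "!!R. L2 M (X R)" and Y: "L2 M Y" and lim: "((%R. nsq M (%om. X R om - Y om)) \<longlongrightarrow> 0) at_top"
 shows "L2_tendsto M X Y"
proof -
 have [measurable]: "X R : bmeas M" "Y : bmeas M" for R using X Y by (auto simp: L2_def)
 have "((%R. enn2real (nsq M (%om. X R om - Y om))) \<longlongrightarrow> enn2real 0) at_top"
 using tendsto_enn2real[of "%R. nsq M (%om. X R om - Y om)" 0] lim by simp
 then show ?thesis unfolding L2_tendsto_def using X Y by (simp add: integral_norm_sq_eq_nsq)
qed

lemma L2_tendstoD:
 assumes X: "!!R. L2 M (X R)" and lim: "L2_tendsto M X Y"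
 shows "L2 M Y" "((%R. nsq M (%om. X R om - Y om)) \<longlongrightarrow> 0) at_top"
proof -
 show Y: "L2 M Y" using lim by (simp add: L2_tendsto_def)
 have [measurable]: "X R : bmeas M" "Y : bmeas M" for R using X Y by (auto simp: L2_def)
 have fin: "nsq M (%om. X R om - Y om) < \<infinity>" for R
 using X[of R] Y by (intro nsq_diff_finite) (auto simp: L2_iff_nsq)
 have "((%R. ennreal (\<integral>om. (norm (X R om - Y om))\<^sup>2 \<partial>M)) \<longlongrightarrow> ennreal 0) at_top"
 using lim by (intro tendsto_ennrealI) (simp add: L2_tendsto_def)
 then show "((%R. nsq M (%om. X R om - Y om)) \<longlongrightarrow> 0) at_top"
 using fin by (simp add: integral_norm_sq_eq_nsq)
qed

end

context stat_pp
begin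

definition psi_kernel :: "nat => real => complex => complex" where
 "psi_kernel k R x = (if 1 <= norm x \<and> norm x <= R then 1 / x ^ k else 0)"

lemma measurable_psi_kernel [measurable]:
 assumes [measurable]: "f : bmeas K" "g : bmeas K"
 shows "(%z. psi_kernel k (f z) (g z)) : bmeas K"
 unfolding psi_kernel_def by measurable

lemma norm_psi_kernel_le: "norm (psi_kernel k R x) <= 1"
proof -
 have "1 <= norm x ==> 1 <= norm x ^ k" by (rule one_le_power)
 then show ?thesis by (auto simp: psi_kernel_def norm_divide norm_power divide_le_eq_1 intro: order.strict_trans1 dest: order.strict_trans2[OF zero_less_one])
qed

lemma bbs_psi_kernel: "bbs (psi_kernel k R)"
 unfolding bbs_def
 by (intro conjI exI[of _ "1::real"] exI[of _ R] allI norm_psi_kernel_le impI) (measurable, auto simp: psi_kernel_def)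

lemma Psi_eq_lin: "om : space M ==> Psi k N R om = lin (psi_kernel k R) om"
proof -
 assume om: "om : space M"
 have "lin (psi_kernel k R) om = lin_stat (N om) (psi_kernel k R)"
 unfolding lin_def by (rule lin_stat_eq_integral[symmetric, where r=R]) (auto simp: psi_kernel_def lfN om)
 also have "... = Psi k N R om"
 unfolding lin_stat_def Psi_def by (rule sum.cong) (auto simp: psi_kernel_def split: if_splits)
 finally show ?thesis by simp
qed

lemma measurable_Psi [measurable]: "Psi k N R : bmeas M"
proof -
 have "lin (psi_kernel k R) : bmeas M" by measurable
 then show ?thesis by (rule measurable_cong[THEN iffD1, rotated]) (simp add: Psi_eq_lin)
qed

lemma L2_Psi: "L2 M (Psi k N R)"
proof -
 have "nsq M (Psi k N R) = nsq M (lin (psi_kernel k R))" by (rule nsq_cong) (simp add: Psi_eq_lin)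
 then show ?thesis using nsq_lin_finite[OF bbs_psi_kernel] by (simp add: L2_iff_nsq)
qed

lemma bbs_annulus_kernel: "S > 0 ==> bbs (annulus_kernel S R)"
 unfolding bbs_def
proof (intro conjI)
 assume S: "S > 0"
 show "\<exists>B. \<forall>x. norm (annulus_kernel S R x) <= B"
 by (rule exI[of _ "1 / S"]) (use S in \<open>auto simp: annulus_kernel_def norm_divide intro!: divide_left_mono mult_pos_pos\<close>)
 show "\<exists>r. \<forall>x. norm x > r \<longrightarrow> annulus_kernel S R x = 0"
 by (rule exI[of _ R]) (auto simp: annulus_kernel_def)
qed measurable

lemma Psi_diff: "1 <= S ==> S <= R ==> om : space M ==> Psi 1 N R om - Psi 1 N S om = lin (annulus_kernel S R) om"
 unfolding Psi_eq_lin lin_diff[symmetric, OF bbs_psi_kernel bbs_psi_kernel]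
 by (rule arg_cong[where f="%f. lin f om"]) (auto simp: fun_eq_iff psi_kernel_def annulus_kernel_def)

lemma integral_odd_zero:
 fixes f :: "complex => complex"
 assumes [measurable]: "f : bmeas borel" and odd: "!!x. f (- x) = - f x"
 shows "(\<integral>x. f x \<partial>lborel) = 0"
proof -
 have "(\<integral>x. f x \<partial>lborel) = (\<integral>x. f (- 1 * x) \<partial>lborel)" by (rule integral_lborel_rotate[symmetric]) auto
 also have "... = - (\<integral>x. f x \<partial>lborel)" by (simp add: odd)
 finally have "2 * (\<integral>x. f x \<partial>lborel) = 0" by simp
 then show ?thesis by simp
qed

lemma integral_annulus_kernel: "(\<integral>x. annulus_kernel S R x \<partial>lborel) = 0"
 by (rule integral_odd_zero) (auto simp: annulus_kernel_def)

end

context spec_pp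
begin

text \<open>The indicator of a small disc, multiplied by the character of frequency
  \<open>a\<close>, has a Fourier transform bounded below on the unit disc about \<open>a\<close>.
  Its linear statistic is bounded by a count, whatever \<open>a\<close> is, so the spectral identity
  gives a uniform bound.\<close>

lemma rho_unit_disc_bounded: obtains C where "C < \<infinity>" "!!a. emeasure rh (cball a 1) <= C"
proof -
 \<comment> \<open>Keeps the phase \<open>2 * pi * r\<close> below 1/2, since \<open>pi\<close> is
   less than 4; the cosine is then at least 1/2 on the disc.\<close>
 define r :: real where "r = 1 / 16"
 define A where "A = pi * r\<^sup>2"
 define K where "K = (\<integral>\<^sup>+om. ennreal ((mass r om)\<^sup>2) \<partial>M)"
 have A: "A > 0" by (simp add: A_def r_def)
 have "ennreal ((A / 2)\<^sup>2) * emeasure rh (cball a 1) <= K" for a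
 proof -
 define f where "f x = indicator (cball 0 r) x *\<^sub>R cis (2 * pi * (a \<bullet> x))" for x
 have fm[measurable]: "f : bmeas borel" unfolding f_def by measurable
 have f1: "norm (f x) <= 1" for x by (simp add: f_def indicator_def)
 have f0: "f x = 0" if "norm x > r" for x using that by (simp add: f_def)
 have fb: "bbs f" unfolding bbs_def using fm f1 f0 by blast
 have far: "A / 2 <= norm (fourier f xi)" if "xi : cball a 1" for xi
 proof -
 have i: "integrable lborel (%x. indicator (cball 0 r) x *\<^sub>R cis (2 * pi * ((a - xi) \<bullet> x)))"
 by (rule integrable_bounded_supp[where B=1 and r=r]) (auto simp: indicator_def)
 have "fourier f xi = (\<integral>x. indicator (cball 0 r) x *\<^sub>R cis (2 * pi * ((a - xi) \<bullet> x)) \<partial>lborel)"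
 unfolding fourier_cis f_def by (rule BI_integral_cong)
 (auto simp: cis_mult inner_diff_left algebra_simps)
 then have "Re (fourier f xi) = (\<integral>x. Re (indicator (cball 0 r) x *\<^sub>R cis (2 * pi * ((a - xi) \<bullet> x))) \<partial>lborel)"
 unfolding integral_Re[OF i] by simp
 also have "... >= (\<integral>x. (1/2) * indicator (cball 0 r) x \<partial>(lborel :: complex measure))"
 proof (rule integral_mono)
 show "integrable lborel (%x::complex. (1/2) * indicator (cball 0 r) x :: real)"
 using emeasure_lborel_cball_finite[of "0::complex" r] by (intro integrable_mult_right integrable_real_indicator) auto
 show "integrable lborel (%x. Re (indicator (cball 0 r) x *\<^sub>R cis (2 * pi * ((a - xi) \<bullet> x))))" using i by (rule integrable_Re)
 fix x :: complex
 have "1/2 <= cos (2 * pi * ((a - xi) \<bullet> x))" if x: "norm x <= r"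
 proof -
 have "\<bar>(a - xi) \<bullet> x\<bar> <= norm (a - xi) * norm x" by (rule Cauchy_Schwarz_ineq2)
 also have "... <= 1 * r" using x \<open>xi : cball a 1\<close> by (intro mult_mono) (auto simp: dist_norm)
 finally have "2 * pi * \<bar>(a - xi) \<bullet> x\<bar> <= 2 * pi * r" by simp
 also have "... <= 1/2" using pi_less_4 by (simp add: r_def)
 finally have "\<bar>2 * pi * ((a - xi) \<bullet> x)\<bar> <= 1/2" by (simp add: abs_mult)
 moreover have "1 - cos (2 * pi * ((a - xi) \<bullet> x)) <= norm (cis (2 * pi * ((a - xi) \<bullet> x)) - 1)"
 using abs_Re_le_cmod[of "cis (2 * pi * ((a - xi) \<bullet> x)) - 1"] by simp
 ultimately show ?thesis using norm_cis_minus_1_le[of "2 * pi * ((a - xi) \<bullet> x)"] by linarith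
 qed
 then show "1/2 * indicator (cball 0 r) x <= Re (indicator (cball 0 r) x *\<^sub>R cis (2 * pi * ((a - xi) \<bullet> x)))"
 by (simp add: indicator_def)
 qed
 also have "(\<integral>x. (1/2) * indicator (cball 0 r) x \<partial>(lborel :: complex measure)) = A / 2"
 by (simp add: A_def measure_def emeasure_disc r_def)
 finally show ?thesis using complex_Re_le_cmod[of "fourier f xi"] by linarith
 qed
 have "ennreal ((A / 2)\<^sup>2) * emeasure rh (cball a 1) = (\<integral>\<^sup>+xi. ennreal ((A / 2)\<^sup>2) * indicator (cball a 1) xi \<partial>rh)"
 by (simp add: nn_integral_cmult_indicator)
 also have "... <= nsq rh (fourier f)"
 unfolding nsq_def using far A by (intro nn_integral_mono) (auto simp: indicator_def intro!: ennreal_leI power_mono)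
 also have "... = vsq f" by (rule spectral[OF fb, symmetric])
 also have "... <= nsq M (lin f)" by (rule vsq_le[OF fb])
 also have "... <= K" unfolding nsq_def K_def
 proof (rule nn_integral_mono)
 fix om assume "om : space M"
 then have "norm (lin f om) <= 1 * mass r om" by (intro norm_lin_le fb f1 f0)
 then show "ennreal ((norm (lin f om))\<^sup>2) <= ennreal ((mass r om)\<^sup>2)" by (intro ennreal_leI power_mono) auto
 qed
 finally show ?thesis .
 qed
 note * = this
 have "emeasure rh (cball a 1) <= ennreal (1 / (A / 2)\<^sup>2) * K" for a
 proof -
 have "emeasure rh (cball a 1) = ennreal (1 / (A / 2)\<^sup>2) * (ennreal ((A / 2)\<^sup>2) * emeasure rh (cball a 1))"
 using A by (simp add: mult.assoc[symmetric] ennreal_mult[symmetric])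
 also have "... <= ennreal (1 / (A / 2)\<^sup>2) * K" by (intro mult_left_mono *) simp
 finally show ?thesis .
 qed
 moreover have "ennreal (1 / (A / 2)\<^sup>2) * K < \<infinity>" using nn_integral_mass_sq by (simp add: K_def ennreal_mult_less_top)
 ultimately show thesis by (rule that[rotated])
qed

text \<open>Supplies the majorant at high frequencies.\<close>

lemma nn_integral_decay_rho: "(\<integral>\<^sup>+xi. ennreal (decay xi) \<partial>rh) < \<infinity>"
proof -
 obtain C where C: "C < \<infinity>" "!!a. emeasure rh (cball a 1) <= C" using rho_unit_disc_bounded by blast
 interpret r: sigma_finite_measure rh by (rule sigma_finite_rho)
 interpret pair_sigma_finite rh "lborel :: complex measure" ..
 have ind: "indicator (cball a 1) l = (indicator {..1} (dist a l) :: ennreal)" for a l :: complex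
 by (simp add: indicator_def)
 have "ennreal pi * (\<integral>\<^sup>+xi. ennreal (decay xi) \<partial>rh) = (\<integral>\<^sup>+xi. ennreal (decay xi) * ennreal pi \<partial>rh)"
 by (subst nn_integral_multc) (auto simp: mult.commute)
 also have "... <= (\<integral>\<^sup>+xi. 8 * (\<integral>\<^sup>+a. ennreal (decay a) * indicator {..1} (dist a xi) \<partial>lborel) \<partial>rh)"
 using decay_le_convolution unfolding ind by (intro nn_integral_mono) auto
 also have "... = 8 * (\<integral>\<^sup>+xi. (\<integral>\<^sup>+a. ennreal (decay a) * indicator {..1} (dist a xi) \<partial>lborel) \<partial>rh)"
 by (rule nn_integral_cmult) measurable
 also have "(\<integral>\<^sup>+xi. (\<integral>\<^sup>+a. ennreal (decay a) * indicator {..1} (dist a xi) \<partial>lborel) \<partial>rh)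
 = (\<integral>\<^sup>+a. (\<integral>\<^sup>+xi. ennreal (decay a) * indicator {..1} (dist a xi) \<partial>rh) \<partial>lborel)"
 by (rule Fubini'[symmetric]) measurable
 also have "... <= (\<integral>\<^sup>+a. ennreal (decay a) * C \<partial>lborel)"
 proof (rule nn_integral_mono)
 fix a :: complex
 have "(\<integral>\<^sup>+xi. ennreal (decay a) * indicator {..1} (dist a xi) \<partial>rh) = ennreal (decay a) * emeasure rh (cball a 1)"
 unfolding ind[symmetric] by (simp add: nn_integral_cmult_indicator)
 then show "(\<integral>\<^sup>+xi. ennreal (decay a) * indicator {..1} (dist a xi) \<partial>rh) <= ennreal (decay a) * C"
 using C(2)[of a] by (simp add: mult_left_mono)
 qed
 also have "... = (\<integral>\<^sup>+a. ennreal (decay a) \<partial>lborel) * C" by (rule nn_integral_multc) measurable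
 finally have "ennreal pi * (\<integral>\<^sup>+xi. ennreal (decay xi) \<partial>rh) <= 8 * ((\<integral>\<^sup>+a. ennreal (decay a) \<partial>lborel) * C)"
 by (simp add: mult_left_mono)
 also have "... < \<infinity>" using nn_integral_decay C by (simp add: ennreal_mult_less_top)
 finally show ?thesis by (auto simp: ennreal_mult_less_top)
qed

abbreviation condA :: bool where
 "condA \<equiv> (\<integral>\<^sup>+xi\<in>{xi. 0 < norm xi \<and> norm xi <= 1}. ennreal (1 / (norm xi)\<^sup>2) \<partial>rh) < \<infinity>"

text \<open>The squared norm of \<open>\<i> / xi * bessel0 (R * norm xi)\<close> for the spectral
  measure. An atom at the origin is left out because the kernels on annuli have integral 0, so their
  transforms vanish there.\<close>

definition bessel_tail :: "real => ennreal" where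
 "bessel_tail R = (\<integral>\<^sup>+xi. ennreal ((norm (bessel0 (R * norm xi)))\<^sup>2 / (norm xi)\<^sup>2) * indicator (- {0}) xi \<partial>rh)"

text \<open>On the unit disc the bound 1 for \<open>bessel0\<close> leaves the integrand of
  condition (a). Outside, the decay of \<open>bessel0\<close> adds one power to the inverse square,
  and third powers are integrable for the spectral measure. The integrand tends to 0
  pointwise.\<close>

lemma bessel_tail_tendsto_0:
 assumes condA
 shows "(bessel_tail \<longlongrightarrow> 0) at_top"
proof (rule tendsto_at_topI_sequentially)
 fix X :: "nat => real" assume X: "filterlim X at_top sequentially"
 \<comment> \<open>Radii at least 1 are needed for a majorant that is the same for all
   \<open>n\<close>; the limit is not changed.\<close>
 define Y where "Y n = max 1 (X n)" for n
 have "\<forall>\<^sub>F n in sequentially. X n >= 1" using X by (auto simp: filterlim_at_top)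
 then have XY: "\<forall>\<^sub>F n in sequentially. bessel_tail (Y n) = bessel_tail (X n)" by eventually_elim (simp add: Y_def max_def)
 have Y: "filterlim Y at_top sequentially"
 by (rule filterlim_at_top_mono[OF X]) (auto simp: Y_def)
 have "(%n. bessel_tail (Y n)) ----> (\<integral>\<^sup>+xi. 0 \<partial>rh)"
 unfolding bessel_tail_def
 proof (rule nn_integral_dominated_convergence[where w="%xi. ennreal (1 / (norm xi)\<^sup>2) * indicator {xi. 0 < norm xi \<and> norm xi <= 1} xi + ennreal 80000 * ennreal (decay xi)"])
 show "(\<integral>\<^sup>+xi. ennreal (1 / (norm xi)\<^sup>2) * indicator {xi. 0 < norm xi \<and> norm xi <= 1} xi + ennreal 80000 * ennreal (decay xi) \<partial>rh) < \<infinity>"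
 using assms nn_integral_decay_rho by (simp add: nn_integral_add nn_integral_cmult ennreal_mult_less_top)
 \<comment> \<open>The constant 80000 is the square of the 100 in the decay of
   \<open>bessel0\<close>, times 8 for comparing the inverse cube with \<open>decay\<close>.\<close>
 show "AE xi in rh. ennreal ((norm (bessel0 (Y n * norm xi)))\<^sup>2 / (norm xi)\<^sup>2) * indicator (- {0}) xi
 <= ennreal (1 / (norm xi)\<^sup>2) * indicator {xi. 0 < norm xi \<and> norm xi <= 1} xi + ennreal 80000 * ennreal (decay xi)" for n
 proof (rule AE_I2)
 fix xi :: complex
 have J1: "(norm (bessel0 (Y n * norm xi)))\<^sup>2 <= 1" using norm_bessel0_le_1 by (simp add: abs_square_le_1)
 consider "xi = 0" | "xi ~= 0" "norm xi <= 1" | "norm xi > 1" by fastforce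
 then show "ennreal ((norm (bessel0 (Y n * norm xi)))\<^sup>2 / (norm xi)\<^sup>2) * indicator (- {0}) xi
 <= ennreal (1 / (norm xi)\<^sup>2) * indicator {xi. 0 < norm xi \<and> norm xi <= 1} xi + ennreal 80000 * ennreal (decay xi)"
 proof cases
 case 2
 have "ennreal ((norm (bessel0 (Y n * norm xi)))\<^sup>2 / (norm xi)\<^sup>2) <= ennreal (1 / (norm xi)\<^sup>2)"
 using J1 by (intro ennreal_leI divide_right_mono) auto
 then show ?thesis using 2 by (simp add: add_increasing2)
 next
 case 3
 then have x0: "xi ~= 0" "norm xi > 0" by auto
 have "1 * norm xi <= Y n * norm xi" by (intro mult_right_mono) (auto simp: Y_def)
 then have Yx: "norm xi <= Y n * norm xi" by simp
 have "norm (bessel0 (Y n * norm xi)) <= 100 / sqrt (Y n * norm xi)"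
 using Yx x0 by (intro norm_bessel0_le_inverse_sqrt) linarith
 also have "... <= 100 / sqrt (norm xi)" using Yx x0 by (intro divide_left_mono) auto
 finally have "(norm (bessel0 (Y n * norm xi)))\<^sup>2 <= (100 / sqrt (norm xi))\<^sup>2" by (intro power_mono) auto
 also have "... = 10000 / norm xi" by (simp add: power_divide)
 finally have "(norm (bessel0 (Y n * norm xi)))\<^sup>2 / (norm xi)\<^sup>2 <= 10000 / norm xi / (norm xi)\<^sup>2" by (intro divide_right_mono) auto
 also have "... = 10000 * (1 / norm xi ^ 3)" by (simp add: power2_eq_square power3_eq_cube)
 also have "... <= 10000 * (8 * decay xi)"
 proof (rule mult_left_mono)
 have "(1 + norm xi) ^ 3 <= (2 * norm xi) ^ 3" using 3 by (intro power_mono) auto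
 also have "... = 8 * norm xi ^ 3" by (simp only: power_mult_distrib) simp
 finally have "(1 + norm xi) ^ 3 <= 8 * norm xi ^ 3" .
 moreover have "(1 + norm xi) ^ 3 > 0" "norm xi ^ 3 > 0" using x0 by (simp_all add: add_pos_nonneg)
 ultimately show "1 / norm xi ^ 3 <= 8 * decay xi" by (simp add: decay_def field_simps)
 qed simp
 finally have "ennreal ((norm (bessel0 (Y n * norm xi)))\<^sup>2 / (norm xi)\<^sup>2) <= ennreal (80000 * decay xi)" by (intro ennreal_leI) simp
 also have "... = ennreal 80000 * ennreal (decay xi)" by (rule ennreal_mult') simp
 finally show ?thesis using 3 x0 by simp
 qed simp
 qed
 show "AE xi in rh. (%n. ennreal ((norm (bessel0 (Y n * norm xi)))\<^sup>2 / (norm xi)\<^sup>2) * indicator (- {0}) xi) ----> 0"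
 proof (rule AE_I2)
 fix xi :: complex
 show "(%n. ennreal ((norm (bessel0 (Y n * norm xi)))\<^sup>2 / (norm xi)\<^sup>2) * indicator (- {0}) xi) ----> 0"
 proof (cases "xi = 0")
 case False
 have "(%n. bessel0 (Y n * norm xi)) ----> 0"
 using bessel0_tendsto_0[OF Y, of "norm xi"] False by simp
 from tendsto_divide[OF tendsto_power[OF tendsto_norm[OF this], of 2] tendsto_const[of "(norm xi)\<^sup>2"]] False
 have "(%n. (norm (bessel0 (Y n * norm xi)))\<^sup>2 / (norm xi)\<^sup>2) ----> 0" by simp
 from tendsto_ennrealI[OF this] show ?thesis using False by simp
 qed simp
 qed
 qed measurable
 then show "(%n. bessel_tail (X n)) ----> 0"
 using XY by (simp add: Lim_transform_eventually)
qed

lemma nsq_lin_annulus_kernel: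
 assumes SR: "1 <= S" "S <= R"
 shows "nsq M (lin (annulus_kernel S R)) = nsq rh (%xi. if xi = 0 then 0 else \<i> / xi * (bessel0 (R * norm xi) - bessel0 (S * norm xi)))"
proof -
 have b: "bbs (annulus_kernel S R)" using SR by (intro bbs_annulus_kernel) simp
 have "expectation (lin (annulus_kernel S R)) = 0"
 by (simp add: expectation_lin[OF bbs_integrable[OF b]] integral_annulus_kernel)
 then have "nsq M (lin (annulus_kernel S R)) = vsq (annulus_kernel S R)" by (simp add: vsq_def)
 also have "... = nsq rh (fourier (annulus_kernel S R))" by (rule spectral[OF b])
 also have "... = nsq rh (%xi. if xi = 0 then 0 else \<i> / xi * (bessel0 (R * norm xi) - bessel0 (S * norm xi)))"
 by (rule nsq_cong) (use SR in \<open>auto simp: fourier_zero integral_annulus_kernel fourier_annulus_kernel\<close>)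
 finally show ?thesis .
qed

lemma nsq_Psi_diff_le:
 assumes SR: "1 <= S" "S <= R"
 shows "nsq M (%om. Psi 1 N R om - Psi 1 N S om) <= 2 * bessel_tail R + 2 * bessel_tail S"
proof -
 have "nsq M (%om. Psi 1 N R om - Psi 1 N S om) = nsq M (lin (annulus_kernel S R))"
 by (rule nsq_cong) (use Psi_diff[OF SR] in simp)
 also have "... = nsq rh (%xi. if xi = 0 then 0 else \<i> / xi * (bessel0 (R * norm xi) - bessel0 (S * norm xi)))"
 by (rule nsq_lin_annulus_kernel[OF SR])
 also have "... = nsq rh (%xi. (if xi = 0 then 0 else \<i> / xi * bessel0 (R * norm xi)) + - (if xi = 0 then 0 else \<i> / xi * bessel0 (S * norm xi)))"
 by (rule nsq_cong) (auto simp: right_diff_distrib diff_divide_distrib)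
 also have "... <= 2 * nsq rh (%xi. if xi = 0 then 0 else \<i> / xi * bessel0 (R * norm xi)) + 2 * nsq rh (%xi. - (if xi = 0 then 0 else \<i> / xi * bessel0 (S * norm xi)))"
 by (rule nsq_add_2) measurable
 also have "nsq rh (%xi. - (if xi = 0 then 0 else \<i> / xi * bessel0 (S * norm xi))) = nsq rh (%xi. if xi = 0 then 0 else \<i> / xi * bessel0 (S * norm xi))"
 by (rule nsq_uminus)
 also have b: "nsq rh (%xi. if xi = 0 then 0 else \<i> / xi * bessel0 (T * norm xi)) = bessel_tail T" for T
 unfolding nsq_def bessel_tail_def
 by (rule nn_integral_cong) (auto simp: norm_mult norm_divide power_mult_distrib power_divide)
 finally show ?thesis unfolding b .
qed

theorem condA_imp_Psi1:
 assumes condA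
 shows "\<exists>Psi1. L2_tendsto M (Psi 1 N) Psi1"
proof -
 have "\<exists>R0. \<forall>R\<ge>R0. \<forall>S\<ge>R0. nsq M (%om. Psi 1 N R om - Psi 1 N S om) <= ennreal e" if e: "e > 0" for e :: real
 proof -
 have "\<forall>\<^sub>F R in at_top. bessel_tail R < ennreal (e / 4)"
 using bessel_tail_tendsto_0[OF assms] e by (auto simp: order_tendsto_iff)
 then obtain R0 where R0: "!!R. R >= R0 ==> bessel_tail R < ennreal (e / 4)" by (auto simp: eventually_at_top_linorder)
 have *: "nsq M (%om. Psi 1 N R om - Psi 1 N S om) <= ennreal e" if "max 1 R0 <= S" "S <= R" for R S
 proof -
 have "nsq M (%om. Psi 1 N R om - Psi 1 N S om) <= 2 * bessel_tail R + 2 * bessel_tail S"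
 using that by (intro nsq_Psi_diff_le) auto
 also have "... <= 2 * ennreal (e / 4) + 2 * ennreal (e / 4)"
 using that by (intro add_mono mult_left_mono less_imp_le[OF R0]) auto
 also have "... = ennreal e"
 proof -
 have "2 * ennreal (e / 4) = ennreal (2 * (e / 4))" using e by (subst ennreal_mult') auto
 then show ?thesis using e by (simp add: ennreal_plus[symmetric] del: ennreal_plus)
 qed
 finally show ?thesis .
 qed
 show ?thesis
 proof (intro exI[of _ "max 1 R0"] allI impI)
 fix R S assume "max 1 R0 <= R" "max 1 R0 <= S"
 then show "nsq M (%om. Psi 1 N R om - Psi 1 N S om) <= ennreal e"
 using *[of S R] *[of R S] nsq_minus_commute[of M "Psi 1 N R" "Psi 1 N S"] by (cases "S <= R") auto
 qed
 qed
 note cauchy = this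
 have fin: "nsq M (Psi 1 N R) < \<infinity>" for R using L2_Psi[of 1 R] by (simp add: L2_iff_nsq)
 obtain Y where "Y : bmeas M" "nsq M Y < \<infinity>" "((%R. nsq M (%om. Psi 1 N R om - Y om)) \<longlongrightarrow> 0) at_top"
 by (rule L2_complete[of "Psi 1 N", OF measurable_Psi fin cauchy]) assumption+
 then show ?thesis
 by (intro exI[of _ Y] L2_tendstoI L2_Psi) (auto simp: L2_iff_nsq)
qed

end

section \<open>First absolute moments and the mean ergodic theorem\<close>

lemma ennreal_tendsto_0I:
 fixes f :: "'a => ennreal"
 assumes "!!e::real. e > 0 ==> \<forall>\<^sub>F x in F. f x <= ennreal e"
 shows "(f \<longlongrightarrow> 0) F"
proof (rule order_tendstoI)
 fix a :: ennreal assume "0 < a"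
 then obtain e :: real where e: "e > 0" "ennreal e < a"
 proof (cases a)
 case (real r)
 then show ?thesis using that[of "r / 2"] \<open>0 < a\<close> by (auto simp: ennreal_less_iff)
 next
 case top
 then show ?thesis using that[of 1] by auto
 qed
 show "\<forall>\<^sub>F x in F. f x < a"
 using assms[OF e(1)] by eventually_elim (use e in auto)
qed auto

text \<open>Campbell's formula bounds the first absolute moment of a linear statistic by the
  \<open>L1\<close> norm of its kernel. This norm tolerates the pole of the Cauchy kernel, which the
  second moment would not.\<close>

definition n1 :: "'a measure => ('a => complex) => ennreal" where
 "n1 K f = (\<integral>\<^sup>+x. ennreal (norm (f x)) \<partial>K)"

lemma n1_add:
 assumes [measurable]: "f : bmeas K" "g : bmeas K"
 shows "n1 K (%x. f x + g x) <= n1 K f + n1 K g"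
proof -
 have "n1 K (%x. f x + g x) <= (\<integral>\<^sup>+x. ennreal (norm (f x)) + ennreal (norm (g x)) \<partial>K)"
 unfolding n1_def
 by (rule nn_integral_mono) (simp add: ennreal_plus[symmetric] norm_triangle_ineq ennreal_leI del: ennreal_plus)
 also have "... = n1 K f + n1 K g" unfolding n1_def by (rule nn_integral_add) measurable
 finally show ?thesis .
qed

lemma n1_triangle:
 assumes "f : bmeas K" "g : bmeas K" "h : bmeas K"
 shows "n1 K (%x. f x - h x) <= n1 K (%x. f x - g x) + n1 K (%x. g x - h x)"
 using n1_add[of "%x. f x - g x" K "%x. g x - h x"] assms by simp

lemma n1_minus_commute: "n1 K (%x. f x - g x) = n1 K (%x. g x - f x)"
 by (simp add: n1_def norm_minus_commute)

lemma n1_cmult: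
 assumes [measurable]: "f : bmeas K"
 shows "n1 K (%x. c * f x) = ennreal (norm c) * n1 K f"
 unfolding n1_def by (simp add: norm_mult ennreal_mult nn_integral_cmult)

lemma n1_cong: "(!!x. x : space K ==> f x = g x) ==> n1 K f = n1 K g"
 unfolding n1_def by (rule nn_integral_cong) simp

lemma n1_cong_AE: "AE x in K. f x = g x ==> n1 K f = n1 K g"
 unfolding n1_def by (rule nn_integral_cong_AE) auto

lemma (in prob_space) n1_le_nsq:
 assumes [measurable]: "Z : bmeas M" and e: "e > 0"
 shows "n1 M Z <= ennreal e + ennreal (1 / e) * nsq M Z"
proof -
 have p: "y <= e + 1 / e * y\<^sup>2" if "y >= 0" for y :: real
 proof (cases "y <= e")
 case False
 then have "1 * y <= (y / e) * y" using that e by (intro mult_right_mono) (auto simp: field_simps)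
 then show ?thesis using e by (simp add: power2_eq_square)
 qed (use e in \<open>simp add: add_increasing2\<close>)
 have "n1 M Z <= (\<integral>\<^sup>+om. ennreal e + ennreal (1 / e) * ennreal ((norm (Z om))\<^sup>2) \<partial>M)"
 unfolding n1_def
 proof (rule nn_integral_mono)
 fix om
 have "ennreal (norm (Z om)) <= ennreal (e + 1 / e * (norm (Z om))\<^sup>2)" by (rule ennreal_leI[OF p]) simp
 also have "... = ennreal e + ennreal (1 / e * (norm (Z om))\<^sup>2)" using e by (intro ennreal_plus) auto
 also have "ennreal (1 / e * (norm (Z om))\<^sup>2) = ennreal (1 / e) * ennreal ((norm (Z om))\<^sup>2)" using e by (intro ennreal_mult) auto
 finally show "ennreal (norm (Z om)) <= ennreal e + ennreal (1 / e) * ennreal ((norm (Z om))\<^sup>2)" .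
 qed
 also have "... = ennreal e + ennreal (1 / e) * nsq M Z"
 unfolding nsq_def by (simp add: nn_integral_add nn_integral_cmult emeasure_space_1)
 finally show ?thesis .
qed

lemma (in prob_space) n1_tendsto_of_nsq:
 assumes m: "!!n. Z n : bmeas M" and Z: "((%n. nsq M (Z n)) \<longlongrightarrow> 0) F"
 shows "((%n. n1 M (Z n)) \<longlongrightarrow> 0) F"
proof (rule ennreal_tendsto_0I)
 fix e :: real assume e: "e > 0"
 have "\<forall>\<^sub>F n in F. nsq M (Z n) < ennreal ((e/2)\<^sup>2)" using Z e by (auto simp: order_tendsto_iff)
 then show "\<forall>\<^sub>F n in F. n1 M (Z n) <= ennreal e"
 proof eventually_elim
 case (elim n)
 have "n1 M (Z n) <= ennreal (e/2) + ennreal (1 / (e/2)) * nsq M (Z n)" using e by (intro n1_le_nsq m) auto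
 also have "... <= ennreal (e/2) + ennreal (1 / (e/2)) * ennreal ((e/2)\<^sup>2)"
 using elim by (intro add_left_mono mult_left_mono) auto
 also have "... = ennreal e" using e
 by (simp add: ennreal_mult[symmetric] ennreal_plus[symmetric] power2_eq_square field_simps del: ennreal_plus)
 finally show ?case .
 qed
qed

lemma AE_norm_neq_1: "AE x in lborel. norm (x::complex) ~= 1"
proof -
 have "sphere (0::complex) 1 : null_sets lebesgue"
 using negligible_sphere[of "0::complex" 1] by (simp add: negligible_iff_null_sets)
 then have "sphere (0::complex) 1 : null_sets lborel"
 by (subst (asm) null_sets_completion_iff) auto
 then have "AE x in lborel. x \<notin> sphere (0::complex) 1" by (rule AE_not_in)
 then show ?thesis by eventually_elim (auto simp: dist_norm)
qed

lemma tendsto_divide_of_real_at_top: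
 assumes "filterlim R at_top sequentially"
 shows "(%n. (y::complex) / of_real (R n)) ----> 0"
proof -
 have "(%n. inverse (R n) *\<^sub>R y) ----> 0 *\<^sub>R y" by (intro tendsto_intros tendsto_inverse_0_at_top assms)
 then show ?thesis by (simp add: scaleR_conv_of_real divide_inverse mult.commute)
qed

context stat_pp
begin

text \<open>It plays two parts: dilated, it gives the averages over large discs; undilated, it is a
  mollifier whose Fourier transform is square integrable for the spectral measure.\<close>

definition chi :: "complex => complex" where
 "chi x = indicator (cball 0 1) x *\<^sub>R of_real (1 / pi)"

lemma bbs_chi: "bbs chi"
 unfolding bbs_def
proof (intro conjI)
 show "chi : bmeas borel" unfolding chi_def by measurable
 show "\<exists>B. \<forall>x. norm (chi x) <= B" by (rule exI[of _ "1/pi"]) (auto simp: chi_def indicator_def norm_divide)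
 show "\<exists>r. \<forall>x. norm x > r \<longrightarrow> chi x = 0" by (rule exI[of _ 1]) (auto simp: chi_def)
qed

lemma measure_lborel_cball: "r >= 0 ==> measure lborel (cball (0::complex) r) = pi * r\<^sup>2"
 by (simp add: measure_def emeasure_disc)

lemma integral_chi: "(\<integral>x. chi x \<partial>lborel) = 1"
proof -
 have "integrable lborel (indicator (cball (0::complex) 1) :: complex => real)"
 by (rule integrable_real_indicator) (auto simp: emeasure_disc)
 then show ?thesis unfolding chi_def by (simp add: measure_lborel_cball scaleR_conv_of_real)
qed

lemma isCont_chi: "AE x in lborel. isCont chi x"
 using AE_norm_neq_1
proof eventually_elim
 case (elim x)
 show ?case
 proof (cases "norm x < 1")
 case True
 have "\<forall>\<^sub>F y in nhds x. chi y = of_real (1 / pi)"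
 unfolding eventually_nhds
 by (rule exI[of _ "ball 0 1"]) (use True in \<open>auto simp: chi_def\<close>)
 then show ?thesis by (subst isCont_cong) auto
 next
 case False
 then have "\<forall>\<^sub>F y in nhds x. chi y = 0"
 unfolding eventually_nhds
 by (intro exI[of _ "- cball 0 1"]) (use elim in \<open>auto simp: chi_def\<close>)
 then show ?thesis by (subst isCont_cong) auto
 qed
qed

lemma bbs_conv:
 assumes f: "bbs f" and g: "bbs g"
 shows "bbs (conv f g)"
proof -
 note [measurable] = bbs_measurable[OF f] bbs_measurable[OF g]
 obtain B r where B: "B >= 0" "r >= 0" "!!x. norm (f x) <= B" "!!x. norm x > r ==> f x = 0"
 using bbsE[OF f] by blast
 obtain C s where C: "C >= 0" "s >= 0" "!!x. norm (g x) <= C" "!!x. norm x > s ==> g x = 0"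
 using bbsE[OF g] by blast
 have gi: "integrable lborel (%y. norm (g y))" using bbs_integrable[OF g] by simp
 have 1: "norm (conv f g x) <= B * (\<integral>y. norm (g y) \<partial>lborel)" for x
 proof -
 have "norm (conv f g x) <= (\<integral>y. norm (f (x - y) * g y) \<partial>lborel)" unfolding conv_def by (rule integral_norm_bound)
 also have "... <= (\<integral>y. B * norm (g y) \<partial>lborel)"
 by (rule integral_mono') (use gi B in \<open>auto simp: norm_mult intro!: mult_right_mono\<close>)
 finally show ?thesis by simp
 qed
 have 2: "conv f g x = 0" if x: "norm x > r + s" for x
 proof -
 have z: "f (x - y) * g y = 0" for y
 proof (cases "norm y > s")
 case False
 then have "norm (x - y) > r" using x norm_triangle_ineq2[of x y] by linarith
 then show ?thesis using B by simp
 qed (simp add: C)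
 show ?thesis unfolding conv_def z by simp
 qed
 have 3: "conv f g : bmeas borel" by measurable
 show ?thesis unfolding bbs_def using 1 2 3 by blast
qed

lemma bbs_rescale:
 assumes g: "bbs g" and R: "R > 0"
 shows "bbs (rescale R g)"
proof -
 note [measurable] = bbs_measurable[OF g]
 obtain B r where B: "B >= 0" "r >= 0" "!!x. norm (g x) <= B" "!!x. norm x > r ==> g x = 0"
 using bbsE[OF g] by blast
 have 1: "norm (rescale R g x) <= B / R\<^sup>2" for x
 unfolding rescale_def using B R by (simp add: norm_divide norm_power divide_right_mono)
 have 2: "rescale R g x = 0" if "norm x > r * R" for x
 using that R by (simp add: rescale_def B(4) norm_divide field_simps)
 have 3: "rescale R g : bmeas borel" by measurable
 show ?thesis unfolding bbs_def using 1 2 3 by blast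
qed

lemma nn_integral_rescale_translate:
 assumes g: "bbs g" and R: "R > 0"
 shows "(\<integral>\<^sup>+x. ennreal (norm (rescale R g x - rescale R g (x - y))) \<partial>lborel)
 = ennreal (\<integral>u. norm (g (u + (- y) / of_real R) - g u) \<partial>lborel)"
proof -
 note [measurable] = bbs_measurable[OF g]
 have gi: "integrable lborel (%u. norm (g (u + (- y) / of_real R) - g u))"
 using integrable_lborel_translate[OF bbs_integrable[OF g], of "(- y) / of_real R"] bbs_integrable[OF g]
 by (intro integrable_norm BI_integrable_diff) (simp_all add: add.commute)
 have e: "(of_real R * u - y) / of_real R = u + (- y) / of_real R" for u
 using R by (simp add: field_simps)
 have "(\<integral>\<^sup>+x. ennreal (norm (rescale R g x - rescale R g (x - y))) \<partial>lborel)
 = ennreal (R\<^sup>2) * (\<integral>\<^sup>+u. ennreal (norm (rescale R g (of_real R * u) - rescale R g (of_real R * u - y))) \<partial>lborel)"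
 by (rule nn_integral_scale_complex[OF _ R]) measurable
 also have "(\<integral>\<^sup>+u. ennreal (norm (rescale R g (of_real R * u) - rescale R g (of_real R * u - y))) \<partial>lborel)
 = (\<integral>\<^sup>+u. ennreal (1 / R\<^sup>2) * ennreal (norm (g (u + (- y) / of_real R) - g u)) \<partial>lborel)"
 proof (rule nn_integral_cong)
 fix u
 have "rescale R g (of_real R * u) - rescale R g (of_real R * u - y) = (g u - g (u + (- y) / of_real R)) / of_real (R\<^sup>2)"
 unfolding rescale_def e using R by (simp add: diff_divide_distrib)
 then show "ennreal (norm (rescale R g (of_real R * u) - rescale R g (of_real R * u - y)))
 = ennreal (1 / R\<^sup>2) * ennreal (norm (g (u + (- y) / of_real R) - g u))"
 using R by (simp add: norm_divide norm_power norm_minus_commute ennreal_mult[symmetric])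
 qed
 also have "... = ennreal (1 / R\<^sup>2) * ennreal (\<integral>u. norm (g (u + (- y) / of_real R) - g u) \<partial>lborel)"
 by (subst nn_integral_cmult, measurable, subst nn_integral_eq_integral[OF gi]) auto
 also have "ennreal (R\<^sup>2) * ... = ennreal (\<integral>u. norm (g (u + (- y) / of_real R) - g u) \<partial>lborel)"
 using R by (simp add: mult.assoc[symmetric] ennreal_mult[symmetric])
 finally show ?thesis .
qed

text \<open>Convolution with the fixed \<open>chi\<close> averages over shifts by at most 1. Seen
  from the dilated kernel these are shifts by \<open>y / R\<close>, so they are negligible in
  \<open>L1\<close>.\<close>

lemma L1_conv_rescale:
 assumes g: "bbs g" and cont: "AE x in lborel. isCont g x" and R: "filterlim R at_top sequentially"
 shows "(%n. n1 lborel (%x. rescale (R n) g x - conv (rescale (R n) g) chi x)) ----> 0"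
proof -
 note [measurable] = bbs_measurable[OF g] bbs_measurable[OF bbs_chi]
 define h where "h n y = (\<integral>u. norm (g (u + (- y) / of_real (R n)) - g u) \<partial>lborel)" for n y
 have hm[measurable]: "h n : bmeas borel" for n unfolding h_def by measurable
 obtain B r where B: "B >= 0" "r >= 0" "!!x. norm (g x) <= B" "!!x. norm x > r ==> g x = 0"
 using bbsE[OF g] by blast
 have h0: "(%n. h n y) ----> 0" for y
 unfolding h_def by (rule tendsto_L1_translate[OF _ B(3,4) cont tendsto_divide_of_real_at_top[OF R]]) measurable
 have gi: "integrable lborel (%u. norm (g u))" using bbs_integrable[OF g] by simp
 have hb: "h n y <= 2 * (\<integral>u. norm (g u) \<partial>lborel)" for n y
 proof -
 have i: "integrable lborel (%u. norm (g (u + (- y) / of_real (R n))))"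
 using integrable_lborel_translate[OF bbs_integrable[OF g], of "(- y) / of_real (R n)"]
 by (intro integrable_norm) (simp add: add.commute)
 have "h n y <= (\<integral>u. norm (g (u + (- y) / of_real (R n))) + norm (g u) \<partial>lborel)"
 unfolding h_def by (rule integral_mono') (use i gi in \<open>auto intro: norm_triangle_ineq4\<close>)
 also have "... = (\<integral>u. norm (g (u + (- y) / of_real (R n))) \<partial>lborel) + (\<integral>u. norm (g u) \<partial>lborel)"
 by (rule BI_integral_add[OF i gi])
 also have "(\<integral>u. norm (g (u + (- y) / of_real (R n))) \<partial>lborel) = (\<integral>u. norm (g u) \<partial>lborel)"
 using integral_lborel_translate[of "%u. norm (g u)" "(- y) / of_real (R n)"] by (simp add: add.commute)
 finally show ?thesis by simp
 qed
 have lim: "(%n. \<integral>\<^sup>+y. ennreal (norm (chi y)) * ennreal (h n y) \<partial>lborel) ----> (\<integral>\<^sup>+(y::complex). 0 \<partial>lborel)"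
 proof (rule nn_integral_dominated_convergence[where w="%y. ennreal (norm (chi y)) * ennreal (2 * (\<integral>u. norm (g u) \<partial>lborel))"])
 show "AE y in lborel. ennreal (norm (chi y)) * ennreal (h n y) <= ennreal (norm (chi y)) * ennreal (2 * (\<integral>u. norm (g u) \<partial>lborel))" for n
 by (intro AE_I2 mult_left_mono ennreal_leI hb) auto
 have "(\<integral>\<^sup>+y. ennreal (norm (chi y)) \<partial>lborel) < \<infinity>"
 using bbs_integrable[OF bbs_chi] by (simp add: integrable_iff_bounded)
 then show "(\<integral>\<^sup>+y. ennreal (norm (chi y)) * ennreal (2 * (\<integral>u. norm (g u) \<partial>lborel)) \<partial>lborel) < \<infinity>"
 by (simp add: nn_integral_multc ennreal_mult_less_top)
 show "AE y in lborel. (%n. ennreal (norm (chi y)) * ennreal (h n y)) ----> 0"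
 proof (rule AE_I2)
 fix y
 have "(%n. ennreal (norm (chi y) * h n y)) ----> ennreal (norm (chi y) * 0)"
 by (intro tendsto_ennrealI tendsto_mult h0 tendsto_const)
 then show "(%n. ennreal (norm (chi y)) * ennreal (h n y)) ----> 0"
 by (simp add: ennreal_mult h_def)
 qed
 qed measurable
 have ev: "\<forall>\<^sub>F n in sequentially. R n > 0" using R by (auto simp: filterlim_at_top_dense)
 have le: "\<forall>\<^sub>F n in sequentially. n1 lborel (%x. rescale (R n) g x - conv (rescale (R n) g) chi x)
 <= (\<integral>\<^sup>+y. ennreal (norm (chi y)) * ennreal (h n y) \<partial>lborel)"
 using ev
 proof eventually_elim
 case (elim n)
 define f where "f = rescale (R n) g"
 have f: "bbs f" unfolding f_def by (rule bbs_rescale[OF g elim])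
 note [measurable] = bbs_measurable[OF f]
 obtain C s where C: "C >= 0" "s >= 0" "!!x. norm (f x) <= C" "!!x. norm x > s ==> f x = 0"
 using bbsE[OF f] by blast
 have "ennreal (norm (f x - conv f chi x)) <= (\<integral>\<^sup>+y. ennreal (norm ((f x - f (x - y)) * chi y)) \<partial>lborel)" for x
 proof -
 have i1: "integrable lborel (%y. f x * chi y)" using bbs_integrable[OF bbs_chi] by simp
 have i2: "integrable lborel (%y. f (x - y) * chi y)"
 proof (rule BI_integrable_bound[where f="%y. C * norm (chi y)"])
 show "integrable lborel (%y. C * norm (chi y))" using bbs_integrable[OF bbs_chi] by simp
 show "AE y in lborel. norm (f (x - y) * chi y) <= norm (C * norm (chi y))"
 using C by (auto simp: norm_mult intro!: mult_right_mono)
 qed measurable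
 have "f x - conv f chi x = (\<integral>y. f x * chi y \<partial>lborel) - (\<integral>y. f (x - y) * chi y \<partial>lborel)"
 by (simp add: conv_def integral_chi)
 also have "... = (\<integral>y. (f x - f (x - y)) * chi y \<partial>lborel)"
 by (subst BI_integral_diff[OF i1 i2, symmetric]) (simp add: algebra_simps)
 also have "ennreal (norm ...) <= (\<integral>\<^sup>+y. ennreal (norm ((f x - f (x - y)) * chi y)) \<partial>lborel)"
 by (rule integral_norm_bound_ennreal) (use BI_integrable_diff[OF i1 i2] in \<open>simp add: algebra_simps\<close>)
 finally show ?thesis .
 qed
 then have "n1 lborel (%x. f x - conv f chi x)
 <= (\<integral>\<^sup>+x. (\<integral>\<^sup>+y. ennreal (norm ((f x - f (x - y)) * chi y)) \<partial>lborel) \<partial>lborel)"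
 unfolding n1_def by (intro nn_integral_mono) auto
 also have "... = (\<integral>\<^sup>+y. (\<integral>\<^sup>+x. ennreal (norm ((f x - f (x - y)) * chi y)) \<partial>lborel) \<partial>lborel)"
 by (rule lborel_pair.Fubini'[symmetric]) measurable
 also have "... = (\<integral>\<^sup>+y. ennreal (norm (chi y)) * ennreal (h n y) \<partial>lborel)"
 proof (rule nn_integral_cong)
 fix y
 have "(\<integral>\<^sup>+x. ennreal (norm ((f x - f (x - y)) * chi y)) \<partial>lborel)
 = (\<integral>\<^sup>+x. ennreal (norm (chi y)) * ennreal (norm (f x - f (x - y))) \<partial>lborel)"
 by (simp add: norm_mult ennreal_mult mult.commute)
 also have "... = ennreal (norm (chi y)) * (\<integral>\<^sup>+x. ennreal (norm (f x - f (x - y))) \<partial>lborel)"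
 by (rule nn_integral_cmult) measurable
 also have "(\<integral>\<^sup>+x. ennreal (norm (f x - f (x - y))) \<partial>lborel) = ennreal (h n y)"
 unfolding f_def h_def by (rule nn_integral_rescale_translate[OF g elim])
 finally show "(\<integral>\<^sup>+x. ennreal (norm ((f x - f (x - y)) * chi y)) \<partial>lborel) = ennreal (norm (chi y)) * ennreal (h n y)" .
 qed
 finally show ?case by (simp add: f_def)
 qed
 show ?thesis
 by (rule tendsto_sandwich[OF _ le tendsto_const]) (use lim in auto)
qed

end

context spec_pp
begin

text \<open>The mollifier contributes the factor \<open>fourier chi\<close>, a majorant for the
  spectral measure. Away from 0 both dilated transforms tend to 0, and at 0 they agree because the
  integrals do; hence the limit can depend on the integral of the kernel only.\<close>

lemma conv_stat_tendsto:
 assumes g: "bbs g" and gc: "AE x in lborel. isCont g x" and R: "filterlim R at_top sequentially"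
 and g': "bbs g'" and gc': "AE x in lborel. isCont g' x" and S: "filterlim S at_top sequentially"
 and eq: "(\<integral>x. g x \<partial>lborel) = (\<integral>x. g' x \<partial>lborel)"
 shows "(%n. nsq M (%om. lin (conv (rescale (R n) g) chi) om - lin (conv (rescale (S n) g') chi) om)) ----> 0"
proof -
 note [measurable] = bbs_measurable[OF g] bbs_measurable[OF g'] bbs_measurable[OF bbs_chi]
 obtain B r where B: "B >= 0" "r >= 0" "!!x. norm (g x) <= B" "!!x. norm x > r ==> g x = 0"
 using bbsE[OF g] by blast
 obtain B' r' where B': "B' >= 0" "r' >= 0" "!!x. norm (g' x) <= B'" "!!x. norm x > r' ==> g' x = 0"
 using bbsE[OF g'] by blast
 define F where "F n xi = fourier g (of_real (R n) * xi) - fourier g' (of_real (S n) * xi)" for n xi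
 have Fm[measurable]: "F n : bmeas borel" for n unfolding F_def by measurable
 have F0: "(%n. F n xi) ----> 0" for xi
 proof (cases "xi = 0")
 case True
 then show ?thesis by (simp add: F_def fourier_zero eq)
 next
 case False
 have "(%n. F n xi) ----> 0 - 0" unfolding F_def
 by (intro tendsto_diff tendsto_fourier_rescale[OF _ B(3,4) gc R False] tendsto_fourier_rescale[OF _ B'(3,4) gc' S False]) measurable
 then show ?thesis by simp
 qed
 define C where "C = (\<integral>x. norm (g x) \<partial>lborel) + (\<integral>x. norm (g' x) \<partial>lborel)"
 have FC: "norm (F n xi) <= C" for n xi
 unfolding F_def C_def
 by (intro order_trans[OF norm_triangle_ineq4] add_mono norm_fourier_le bbs_integrable g g')
 have "(%n. \<integral>\<^sup>+xi. ennreal ((norm (F n xi * fourier chi xi))\<^sup>2) \<partial>rh) ----> (\<integral>\<^sup>+(xi::complex). 0 \<partial>rh)"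
 proof (rule nn_integral_dominated_convergence[where w="%xi. ennreal (C\<^sup>2) * ennreal ((norm (fourier chi xi))\<^sup>2)"])
 show "AE xi in rh. ennreal ((norm (F n xi * fourier chi xi))\<^sup>2) <= ennreal (C\<^sup>2) * ennreal ((norm (fourier chi xi))\<^sup>2)" for n
 by (rule AE_I2) (auto simp: norm_mult power_mult_distrib ennreal_mult[symmetric] intro!: ennreal_leI mult_right_mono power_mono FC)
 have "nsq rh (fourier chi) = vsq chi" by (rule spectral[OF bbs_chi, symmetric])
 also have "... <= nsq M (lin chi)" by (rule vsq_le[OF bbs_chi])
 also have "... < \<infinity>" by (rule nsq_lin_finite[OF bbs_chi])
 finally show "(\<integral>\<^sup>+xi. ennreal (C\<^sup>2) * ennreal ((norm (fourier chi xi))\<^sup>2) \<partial>rh) < \<infinity>"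
 by (simp add: nsq_def nn_integral_cmult ennreal_mult_less_top)
 show "AE xi in rh. (%n. ennreal ((norm (F n xi * fourier chi xi))\<^sup>2)) ----> 0"
 proof (rule AE_I2)
 fix xi
 have "(%n. ennreal ((norm (F n xi * fourier chi xi))\<^sup>2)) ----> ennreal ((norm (0 * fourier chi xi))\<^sup>2)"
 by (intro tendsto_ennrealI tendsto_power tendsto_norm tendsto_mult F0 tendsto_const)
 then show "(%n. ennreal ((norm (F n xi * fourier chi xi))\<^sup>2)) ----> 0" by simp
 qed
 qed measurable
 then have lim: "(%n. nsq rh (%xi. F n xi * fourier chi xi)) ----> 0" by (simp add: nsq_def)
 have ev: "\<forall>\<^sub>F n in sequentially. R n > 0 \<and> S n > 0"
 using R S by (auto simp: filterlim_at_top_dense intro: eventually_conj)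
 show ?thesis
 proof (rule Lim_transform_eventually[OF lim])
 show "\<forall>\<^sub>F n in sequentially. nsq rh (%xi. F n xi * fourier chi xi)
 = nsq M (%om. lin (conv (rescale (R n) g) chi) om - lin (conv (rescale (S n) g') chi) om)"
 using ev
 proof eventually_elim
 case (elim n)
 define f where "f = rescale (R n) g"
 define f' where "f' = rescale (S n) g'"
 have f: "bbs f" "bbs f'" unfolding f_def f'_def using elim by (auto intro: bbs_rescale g g')
 have c: "bbs (conv f chi)" "bbs (conv f' chi)" using f by (auto intro: bbs_conv bbs_chi)
 have d: "bbs (%x. conv f chi x - conv f' chi x)" using c by (rule bbs_diff)
 have ff: "fourier (%x. conv f chi x - conv f' chi x) xi = F n xi * fourier chi xi" for xi
 proof -
 have "fourier (%x. conv f chi x - conv f' chi x) xi = fourier f xi * fourier chi xi - fourier f' xi * fourier chi xi"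
 using f c by (simp add: fourier_diff fourier_conv bbs_integrable bbs_chi)
 also have "fourier f xi = fourier g (of_real (R n) * xi)" unfolding f_def using elim by (intro fourier_rescale) auto
 also have "fourier f' xi = fourier g' (of_real (S n) * xi)" unfolding f'_def using elim by (intro fourier_rescale) auto
 finally show ?thesis by (simp add: F_def algebra_simps)
 qed
 have "expectation (lin (%x. conv f chi x - conv f' chi x)) = of_real c0 * fourier (%x. conv f chi x - conv f' chi x) 0"
 unfolding fourier_zero by (rule expectation_lin[OF bbs_integrable[OF d]])
 also have "... = 0" unfolding ff by (simp add: F_def fourier_zero eq)
 finally have "vsq (%x. conv f chi x - conv f' chi x) = nsq M (lin (%x. conv f chi x - conv f' chi x))"
 by (simp add: vsq_def)
 then have "nsq rh (%xi. F n xi * fourier chi xi) = nsq M (lin (%x. conv f chi x - conv f' chi x))"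
 using spectral[OF d] by (simp add: ff[abs_def])
 also have "... = nsq M (%om. lin (conv f chi) om - lin (conv f' chi) om)"
 by (rule nsq_cong) (rule lin_diff[OF c])
 finally show ?case by (simp add: f_def f'_def)
 qed
 qed
qed

text \<open>The mollified averages are Cauchy in the second moment, and every other kernel is
  compared with them. Removing the mollifier is possible in the first moment only, through
  Campbell's formula. The limit \<open>X\<close> is the same for all kernels and all sequences of
  radii; it is identified later.\<close>

lemma ergodic_limit:
 obtains X where "X : bmeas M" "nsq M X < \<infinity>"
 "!!g R. bbs g ==> AE x in lborel. isCont g x ==> filterlim R at_top sequentially
 ==> (%n. n1 M (%om. lin (rescale (R n) g) om - (\<integral>x. g x \<partial>lborel) * X om)) ----> 0"
proof -
 note [measurable] = bbs_measurable[OF bbs_chi]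
 define W where "W R = lin (conv (rescale (max 1 R) chi) chi)" for R
 have Wm[measurable]: "W R : bmeas M" for R unfolding W_def by measurable
 have Wf: "nsq M (W R) < \<infinity>" for R
 unfolding W_def by (intro nsq_lin_finite bbs_conv bbs_rescale bbs_chi) auto
 have cauchy: "\<exists>R0. \<forall>R\<ge>R0. \<forall>S\<ge>R0. nsq M (%om. W R om - W S om) <= ennreal e" if e: "e > 0" for e :: real
 proof (rule ccontr)
 assume "\<not> ?thesis"
 \<comment> \<open>\<open>conv_stat_tendsto\<close> speaks of sequences, so a failure of the Cauchy
   property is turned into two sequences of radii that contradict it.\<close>
 then have "\<forall>n::nat. \<exists>R S. R >= real n \<and> S >= real n \<and> \<not> nsq M (%om. W R om - W S om) <= ennreal e" by blast
 then obtain R S where RS: "!!n::nat. R n >= real n" "!!n::nat. S n >= real n" "!!n. \<not> nsq M (%om. W (R n) om - W (S n) om) <= ennreal e"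
 by metis
 have t: "filterlim (%n. max 1 (R n)) at_top sequentially" "filterlim (%n. max 1 (S n)) at_top sequentially"
 by (rule filterlim_at_top_mono[OF filterlim_real_sequentially], use RS in \<open>auto simp: le_max_iff_disj\<close>)+
 have "(%n. nsq M (%om. W (R n) om - W (S n) om)) ----> 0"
 unfolding W_def by (rule conv_stat_tendsto[OF bbs_chi isCont_chi t(1) bbs_chi isCont_chi t(2) refl])
 then have "\<forall>\<^sub>F n in sequentially. nsq M (%om. W (R n) om - W (S n) om) < ennreal e"
 using e by (auto simp: order_tendsto_iff)
 then have "\<forall>\<^sub>F n in sequentially. False" by eventually_elim (use RS(3) in \<open>auto dest: less_imp_le\<close>)
 then show False by simp
 qed
 obtain X where X[measurable]: "X : bmeas M" and Xf: "nsq M X < \<infinity>"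
 and XW: "((%R. nsq M (%om. W R om - X om)) \<longlongrightarrow> 0) at_top"
 by (rule L2_complete[of W, OF Wm Wf cauchy]) assumption+
 have "(%n. n1 M (%om. lin (rescale (R n) g) om - (\<integral>x. g x \<partial>lborel) * X om)) ----> 0"
 if g: "bbs g" and gc: "AE x in lborel. isCont g x" and R: "filterlim R at_top sequentially" for g R
 proof -
 note [measurable] = bbs_measurable[OF g]
 define I where "I = (\<integral>x. g x \<partial>lborel)"
 define Y where "Y n = lin (conv (rescale (R n) g) chi)" for n
 have Ym[measurable]: "Y n : bmeas M" for n unfolding Y_def by measurable
 have ev: "\<forall>\<^sub>F n in sequentially. R n >= 1" using R by (auto simp: filterlim_at_top)
 have a: "(%n. ennreal c0 * n1 lborel (%x. rescale (R n) g x - conv (rescale (R n) g) chi x)) ----> 0"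
 using tendsto_mult_ennreal[OF tendsto_const[of "ennreal c0"] L1_conv_rescale[OF g gc R]] by simp
 have b: "(%n. n1 M (%om. Y n om - I * W (R n) om)) ----> 0"
 proof (rule n1_tendsto_of_nsq)
 have gI: "bbs (%x. I * chi x)" by (intro bbs_cmult bbs_chi)
 have "(%n. nsq M (%om. lin (conv (rescale (R n) g) chi) om - lin (conv (rescale (R n) (%x. I * chi x)) chi) om)) ----> 0"
 proof (rule conv_stat_tendsto[OF g gc R gI _ R])
 show "AE x in lborel. isCont (%x. I * chi x) x" using isCont_chi by eventually_elim auto
 show "(\<integral>x. g x \<partial>lborel) = (\<integral>x. I * chi x \<partial>lborel)" by (simp add: integral_chi I_def)
 qed
 then show "(%n. nsq M (%om. Y n om - I * W (R n) om)) ----> 0"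
 proof (rule Lim_transform_eventually)
 show "\<forall>\<^sub>F n in sequentially. nsq M (%om. lin (conv (rescale (R n) g) chi) om - lin (conv (rescale (R n) (%x. I * chi x)) chi) om)
 = nsq M (%om. Y n om - I * W (R n) om)"
 using ev
 proof eventually_elim
 case (elim n)
 have "conv (rescale (R n) (%x. I * chi x)) chi = (%x. I * conv (rescale (R n) chi) chi x)"
 by (simp add: fun_eq_iff conv_def rescale_def mult.assoc flip: times_divide_eq_right)
 then show ?case using elim by (simp add: Y_def W_def lin_cmult max_def)
 qed
 qed
 qed measurable
 have "(%n. n1 M (%om. W (R n) om - X om)) ----> 0"
 by (rule n1_tendsto_of_nsq[OF _ filterlim_compose[OF XW R]]) measurable
 from tendsto_mult_ennreal[OF tendsto_const[of "ennreal (norm I)"] this]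
 have c: "(%n. ennreal (norm I) * n1 M (%om. W (R n) om - X om)) ----> 0" by simp
 have s: "(%n. ennreal c0 * n1 lborel (%x. rescale (R n) g x - conv (rescale (R n) g) chi x)
 + n1 M (%om. Y n om - I * W (R n) om) + ennreal (norm I) * n1 M (%om. W (R n) om - X om)) ----> 0"
 using tendsto_add[OF tendsto_add[OF a b] c] by simp
 have le: "\<forall>\<^sub>F n in sequentially. n1 M (%om. lin (rescale (R n) g) om - I * X om)
 <= ennreal c0 * n1 lborel (%x. rescale (R n) g x - conv (rescale (R n) g) chi x)
 + n1 M (%om. Y n om - I * W (R n) om) + ennreal (norm I) * n1 M (%om. W (R n) om - X om)"
 using ev
 proof eventually_elim
 case (elim n)
 have r: "bbs (rescale (R n) g)" using elim by (intro bbs_rescale g) auto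
 have cv: "bbs (conv (rescale (R n) g) chi)" by (intro bbs_conv r bbs_chi)
 have "n1 M (%om. lin (rescale (R n) g) om - Y n om) = n1 M (lin (%x. rescale (R n) g x - conv (rescale (R n) g) chi x))"
 unfolding Y_def by (rule n1_cong) (rule lin_diff[OF r cv, symmetric])
 also have "... <= ennreal c0 * n1 lborel (%x. rescale (R n) g x - conv (rescale (R n) g) chi x)"
 unfolding n1_def by (rule nn_integral_norm_lin_le) measurable
 finally have 1: "n1 M (%om. lin (rescale (R n) g) om - Y n om) <= ..." .
 have "(%om. I * W (R n) om - I * X om) = (%om. I * (W (R n) om - X om))" by (simp add: right_diff_distrib)
 then have 2: "n1 M (%om. I * W (R n) om - I * X om) = ennreal (norm I) * n1 M (%om. W (R n) om - X om)"
 by (simp add: n1_cmult)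
 have "n1 M (%om. lin (rescale (R n) g) om - I * X om) <= n1 M (%om. lin (rescale (R n) g) om - Y n om) + n1 M (%om. Y n om - I * X om)"
 by (rule n1_triangle) measurable
 also have "n1 M (%om. Y n om - I * X om) <= n1 M (%om. Y n om - I * W (R n) om) + n1 M (%om. I * W (R n) om - I * X om)"
 by (rule n1_triangle) measurable
 finally show ?case using 1 unfolding 2 by (auto intro: order_trans add_mono simp: add.assoc)
 qed
 show ?thesis unfolding I_def[symmetric]
 by (rule tendsto_sandwich[OF _ le tendsto_const s]) auto
 qed
 then show ?thesis using that X Xf by blast
qed

end

section \<open>The ergodic limit is the conditional intensity\<close>

definition CFG :: "(complex => nat) measure" where
 "CFG = sigma UNIV {{mu. cnt mu B = k} | B k. B : sets borel \<and> bounded B}"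

lemma sets_CFG: "sets CFG = cfg_sets"
 unfolding CFG_def cfg_sets_def by (rule sets_measure_of) auto

lemma space_CFG [simp]: "space CFG = UNIV"
 unfolding CFG_def by (rule space_measure_of) auto

lemma measurable_cnt_CFG:
 assumes "B : sets borel" "bounded B"
 shows "(%mu. cnt mu B) : measurable CFG (count_space UNIV)"
proof (subst measurable_count_space_eq2_countable, intro conjI)
 show "\<forall>a\<in>UNIV. (%mu. cnt mu B) -` {a} \<inter> space CFG : sets CFG"
 proof
 fix a
 have "(%mu. cnt mu B) -` {a} \<inter> space CFG = {mu. cnt mu B = a}" by auto
 also have "... : sets CFG" unfolding sets_CFG cfg_sets_def using assms by (intro sigma_sets.Basic) auto
 finally show "(%mu. cnt mu B) -` {a} \<inter> space CFG : sets CFG" .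
 qed
qed auto

lemma measurable_CFG_I:
 assumes "!!B. B : sets borel ==> bounded B ==> (%x. cnt (f x) B) : measurable K (count_space UNIV)"
 shows "f : measurable K CFG"
 unfolding CFG_def
proof (rule measurable_measure_of)
 fix Y assume "Y : {{mu. cnt mu B = k} | B k. B : sets borel \<and> bounded B}"
 then obtain B k where Y: "Y = {mu. cnt mu B = k}" "B : sets borel" "bounded B" by auto
 have "f -` Y \<inter> space K = (%x. cnt (f x) B) -` {k} \<inter> space K" by (auto simp: Y)
 also have "... : sets K" using Y by (intro measurable_sets[OF assms]) auto
 finally show "f -` Y \<inter> space K : sets K" .
qed auto

lemma measurable_LCFG_CFG: "(%mu. mu) : measurable LCFG CFG"
 by (rule measurable_CFG_I) (rule measurable_cnt)

lemma shift_cfg_inverse: "shift_cfg (- w) (shift_cfg w mu) = mu"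
 by (simp add: shift_cfg_def)

text \<open>Enlarging the discs by an arbitrary integer \<open>m\<close> makes this upper density invariant under
 every translation and not only almost surely so; on configurations that are not locally finite
 all counts of large discs take the junk value 0.\<close>

definition upper_density :: "(nat => real) => (complex => nat) => ennreal" where
 "upper_density R mu = (SUP m::nat. limsup (%k. ennreal (real (cnt mu (cball 0 (R k + real m))) / (pi * (R k)\<^sup>2))))"

lemma measurable_upper_density: "upper_density R : bmeas CFG"
proof -
 have "(%mu. ennreal (real (cnt mu (cball 0 r)) / c)) : bmeas CFG" for r c
 using measurable_compose[OF measurable_cnt_CFG[of "cball 0 r"], of "%n. ennreal (real n / c)" borel] by simp
 then show ?thesis unfolding upper_density_def[abs_def] by measurable
qed

lemma upper_density_not_LF:
 assumes "\<not> locally_finite_cfg mu" and R: "filterlim R at_top sequentially"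
 shows "upper_density R mu = 0"
proof -
 obtain r where r: "infinite (supp_cfg mu \<inter> cball 0 r)" using assms by (auto simp: locally_finite_cfg_def)
 have "limsup (%k. ennreal (real (cnt mu (cball 0 (R k + real m))) / (pi * (R k)\<^sup>2))) = 0" for m :: nat
 proof (rule lim_imp_Limsup)
 have "\<forall>\<^sub>F k in sequentially. R k >= r" using R by (auto simp: filterlim_at_top)
 then have "\<forall>\<^sub>F k in sequentially. ennreal (real (cnt mu (cball 0 (R k + real m))) / (pi * (R k)\<^sup>2)) = 0"
 proof eventually_elim
 case (elim k)
 have "infinite (supp_cfg mu \<inter> cball 0 (R k + real m))"
 by (rule infinite_super[OF _ r]) (use elim in auto)
 then show ?case by (simp add: cnt_def)
 qed
 then show "(%k. ennreal (real (cnt mu (cball 0 (R k + real m))) / (pi * (R k)\<^sup>2))) ----> 0"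
 by (rule tendsto_eventually)
 qed simp
 then show ?thesis unfolding upper_density_def by (simp add: SUP_constant)
qed

lemma upper_density_shift_le:
 assumes R: "filterlim R at_top sequentially"
 shows "upper_density R (shift_cfg w mu) <= upper_density R mu"
proof (cases "locally_finite_cfg mu")
 case False
 then show ?thesis using upper_density_not_LF[OF _ R, of "shift_cfg w mu"] by (simp add: shift_cfg_LF)
next
 case True
 show ?thesis unfolding upper_density_def
 proof (rule SUP_least)
 fix m :: nat
 \<comment> \<open>A disc shifted by \<open>w\<close> lies in the concentric disc enlarged by
   \<open>norm w\<close>; rounding up stays within the integers over which the supremum
   runs.\<close>
 define m' where "m' = m + nat \<lceil>norm w\<rceil>"
 have m': "real m' >= real m + norm w" unfolding m'_def of_nat_add by (intro add_left_mono) linarith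
 have "cnt (shift_cfg w mu) (cball 0 (R k + real m)) <= cnt mu (cball 0 (R k + real m'))" for k
 unfolding cnt_shift_cfg
 proof (rule cnt_mono[OF True])
 show "(+) (- w) ` cball 0 (R k + real m) \<subseteq> cball 0 (R k + real m')"
 proof
 fix y assume "y : (+) (- w) ` cball 0 (R k + real m)"
 then obtain x where "y = - w + x" "norm x <= R k + real m" by auto
 then show "y : cball 0 (R k + real m')" using m' norm_triangle_ineq[of "- w" x] by simp
 qed
 qed simp
 then have "limsup (%k. ennreal (real (cnt (shift_cfg w mu) (cball 0 (R k + real m))) / (pi * (R k)\<^sup>2)))
 <= limsup (%k. ennreal (real (cnt mu (cball 0 (R k + real m'))) / (pi * (R k)\<^sup>2)))"
 by (intro Limsup_mono always_eventually allI ennreal_leI divide_right_mono) auto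
 also have "... <= (SUP m::nat. limsup (%k. ennreal (real (cnt mu (cball 0 (R k + real m))) / (pi * (R k)\<^sup>2))))"
 by (rule SUP_upper) simp
 finally show "limsup (%k. ennreal (real (cnt (shift_cfg w mu) (cball 0 (R k + real m))) / (pi * (R k)\<^sup>2))) <= ..." .
 qed
qed

lemma upper_density_shift:
 assumes "filterlim R at_top sequentially"
 shows "upper_density R (shift_cfg w mu) = upper_density R mu"
 using upper_density_shift_le[OF assms, of w mu] upper_density_shift_le[OF assms, of "- w" "shift_cfg w mu"]
 by (simp add: shift_cfg_inverse)

context stat_pp
begin

lemma measurable_N_CFG: "N : measurable M CFG"
 by (rule measurable_CFG_I) (rule measurable_cnt_N)

lemma space_F_inv: "space (F_inv M N) = space M"
 unfolding F_inv_def by (rule space_measure_of) auto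

text \<open>Invariant configuration sets are closed under complements and countable unions, so
  generating the sigma-algebra adds no new sets. Thus every event to be tested has an invariant
  indicator, as Campbell's formula requires.\<close>

lemma sets_F_inv_E:
 assumes "B : sets (F_inv M N)"
 obtains A where "A : cfg_sets" "!!w mu. shift_cfg w mu : A \<longleftrightarrow> mu : A" "B = {om : space M. N om : A}"
proof -
 define P where "P B A \<longleftrightarrow> A : cfg_sets \<and> (\<forall>w mu. shift_cfg w mu : A \<longleftrightarrow> mu : A) \<and> B = {om : space M. N om : A}" for B A
 have "sets (F_inv M N) = sigma_sets (space M) {{om\<in>space M. N om : A} | A. A : cfg_sets \<and> (\<forall>w mu. shift_cfg w mu : A \<longleftrightarrow> mu : A)}"
 unfolding F_inv_def by (rule sets_measure_of) auto
 then have "B : sigma_sets (space M) {{om\<in>space M. N om : A} | A. A : cfg_sets \<and> (\<forall>w mu. shift_cfg w mu : A \<longleftrightarrow> mu : A)}"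
 using assms by simp
 then have "\<exists>A. P B A"
 proof induct
 case (Basic a)
 then show ?case by (auto simp: P_def)
 next
 case Empty
 show ?case by (rule exI[of _ "{}"]) (auto simp: P_def cfg_sets_def intro: sigma_sets.Empty)
 next
 case (Compl a)
 then obtain A where A: "P a A" by auto
 then have "UNIV - A : cfg_sets" unfolding P_def cfg_sets_def by (intro sigma_sets.Compl) auto
 then have "P (space M - a) (UNIV - A)" using A by (auto simp: P_def)
 then show ?case by blast
 next
 case (Union a)
 then obtain A where A: "!!i::nat. P (a i) (A i)" by metis
 then have "(\<Union>i. A i) : cfg_sets" unfolding P_def cfg_sets_def by (intro sigma_sets.Union) auto
 then have "P (\<Union>i. a i) (\<Union>i. A i)" using A by (auto simp: P_def)
 then show ?case by blast
 qed
 then show ?thesis using that by (auto simp: P_def)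
qed

lemma subalgebra_F_inv: "subalgebra M (F_inv M N)"
 unfolding subalgebra_def
proof (intro conjI space_F_inv subsetI)
 fix B assume "B : sets (F_inv M N)"
 then obtain A where A: "A : cfg_sets" "B = {om : space M. N om : A}" by (rule sets_F_inv_E)
 have "B = N -` A \<inter> space M" by (auto simp: A)
 also have "... : sets M" using A by (intro measurable_sets[OF measurable_N_CFG]) (simp add: sets_CFG)
 finally show "B : sets M" .
qed

lemma sigma_finite_subalgebra_F_inv: "sigma_finite_subalgebra M (F_inv M N)"
proof -
 have "finite_measure_subalgebra M (F_inv M N)"
 unfolding finite_measure_subalgebra_def finite_measure_subalgebra_axioms_def
 using subalgebra_F_inv finite_measure_axioms by simp
 then show ?thesis by (rule finite_measure_subalgebra_is_sigma_finite)
qed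

lemma measurable_cond_intensity [measurable]: "cond_intensity M N : bmeas M"
proof -
 interpret sigma_finite_subalgebra M "F_inv M N" by (rule sigma_finite_subalgebra_F_inv)
 show ?thesis unfolding cond_intensity_def[abs_def] by measurable
qed

lemma measurable_F_inv_invariant:
 fixes f :: "(complex => nat) => real"
 assumes f: "f : bmeas CFG" and inv: "!!w mu. f (shift_cfg w mu) = f mu"
 shows "(%om. f (N om)) : bmeas (F_inv M N)"
proof (rule measurableI)
 fix B :: "real set" assume B: "B : sets borel"
 have A: "f -` B : cfg_sets" using measurable_sets[OF f B] by (simp add: sets_CFG)
 have "(%om. f (N om)) -` B \<inter> space (F_inv M N) = {om\<in>space M. N om : f -` B}" by (auto simp: space_F_inv)
 also have "... : sets (F_inv M N)"
 proof -
 have "sets (F_inv M N) = sigma_sets (space M) {{om\<in>space M. N om : A} | A. A : cfg_sets \<and> (\<forall>w mu. shift_cfg w mu : A \<longleftrightarrow> mu : A)}"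
 unfolding F_inv_def by (rule sets_measure_of) auto
 then show ?thesis using A inv by (auto intro!: sigma_sets.Basic exI[of _ "f -` B"])
 qed
 finally show "(%om. f (N om)) -` B \<inter> space (F_inv M N) : sets (F_inv M N)" .
qed auto

definition avg :: "real => 'w => real" where "avg R om = mass R om / (pi * R\<^sup>2)"

lemma measurable_avg [measurable]: "avg R : bmeas M"
 unfolding avg_def[abs_def] by measurable

lemma avg_nonneg: "avg R om >= 0" by (simp add: avg_def mass_def)

lemma integrable_avg: "integrable M (avg R)"
 unfolding avg_def[abs_def] by (intro integrable_divide integrable_mass)

lemma lin_rescale_chi:
 assumes R: "R > 0" and om: "om : space M"
 shows "lin (rescale R chi) om = of_real (avg R om)"
proof -
 have e: "rescale R chi = (%x. indicator (cball 0 R) x *\<^sub>R (of_real (1 / (pi * R\<^sup>2)) :: complex))"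
 using R by (auto simp: fun_eq_iff rescale_def chi_def indicator_def norm_divide field_simps)
 have m: "measure (pm (N om)) (cball 0 R) = mass R om"
 using emeasure_pm_mass[OF om, of R] by (simp add: measure_def mass_def)
 have "integrable (pm (N om)) (indicator (cball 0 R) :: complex => real)"
 by (rule integrable_real_indicator) (auto simp: emeasure_pm_mass om)
 then show ?thesis unfolding lin_def e by (simp add: m avg_def scaleR_conv_of_real)
qed

text \<open>Campbell's formula weighted by the indicator of the invariant event compares the unit
  disc with the disc of radius \<open>R\<close>: on invariant events the mean density does not
  depend on the radius.\<close>

lemma nn_integral_invariant_count:
 assumes A: "A : cfg_sets" and inv: "!!w mu. shift_cfg w mu : A \<longleftrightarrow> mu : A" and R: "R > 0"
 shows "(\<integral>om. indicator A (N om) * real (cnt (N om) (ball 0 1)) \<partial>M) = pi * (\<integral>om. indicator A (N om) * avg R om \<partial>M)"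
proof -
 have am[measurable]: "(indicator A :: _ => ennreal) : bmeas LCFG"
 by (rule measurable_compose[OF measurable_LCFG_CFG borel_measurable_indicator]) (use A in \<open>simp add: sets_CFG\<close>)
 have AN[measurable]: "(%om. indicator A (N om) :: real) : bmeas M"
 by (rule measurable_compose[OF measurable_N_CFG borel_measurable_indicator]) (use A in \<open>simp add: sets_CFG\<close>)
 have bm[measurable]: "(%om. real (cnt (N om) (ball 0 1))) : bmeas M"
 using measurable_compose[OF measurable_cnt_N[of "ball 0 1"], of real borel] by simp
 have ble: "real (cnt (N om) (ball 0 1)) <= mass 1 om" if "om : space M" for om
 unfolding mass_def using cnt_mono[OF lfN[OF that], of "cball 0 1" "ball 0 1"] by auto
 have i1: "integrable M (%om. indicator A (N om) * real (cnt (N om) (ball 0 1)))"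
 by (rule BI_integrable_bound[OF integrable_mass[of 1]], measurable)
 (use ble in \<open>auto simp: indicator_def mass_def\<close>)
 have i2: "integrable M (%om. indicator A (N om) * mass R om)"
 by (rule BI_integrable_bound[OF integrable_mass[of R]], measurable)
 (auto simp: indicator_def mass_def)
 \<comment> \<open>The conditional intensity counts in the open unit disc, the averages in closed
   discs; the circle has area 0.\<close>
 have ball: "(\<integral>\<^sup>+x. indicator (ball (0::complex) 1) x \<partial>lborel) = ennreal pi"
 proof -
 have "(\<integral>\<^sup>+x. indicator (ball (0::complex) 1) x \<partial>lborel) = (\<integral>\<^sup>+x. indicator (cball (0::complex) 1) x \<partial>lborel)"
 by (rule nn_integral_cong_AE) (use AE_norm_neq_1 in eventually_elim, auto simp: indicator_def)
 then show ?thesis by (simp add: emeasure_disc)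
 qed
 have "(\<integral>\<^sup>+om. indicator A (N om) * (\<integral>\<^sup>+l. indicator (ball 0 1) l \<partial>pm (N om)) \<partial>M) * (\<integral>\<^sup>+x. indicator (cball (0::complex) R) x \<partial>lborel)
 = (\<integral>\<^sup>+om. indicator A (N om) * (\<integral>\<^sup>+l. indicator (cball 0 R) l \<partial>pm (N om)) \<partial>M) * (\<integral>\<^sup>+x. indicator (ball (0::complex) 1) x \<partial>lborel)"
 by (rule campbell_invariant[OF am]) (auto simp: inv split: split_indicator)
 moreover have "(\<integral>\<^sup>+om. indicator A (N om) * (\<integral>\<^sup>+l. indicator (ball 0 1) l \<partial>pm (N om)) \<partial>M)
 = ennreal (\<integral>om. indicator A (N om) * real (cnt (N om) (ball 0 1)) \<partial>M)"
 by (subst nn_integral_eq_integral[OF i1, symmetric])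
 (auto intro!: nn_integral_cong simp: emeasure_pm lfN indicator_def)
 moreover have "(\<integral>\<^sup>+om. indicator A (N om) * (\<integral>\<^sup>+l. indicator (cball 0 R) l \<partial>pm (N om)) \<partial>M)
 = ennreal (\<integral>om. indicator A (N om) * mass R om \<partial>M)"
 by (subst nn_integral_eq_integral[OF i2, symmetric])
 (auto intro!: nn_integral_cong simp: emeasure_pm_mass indicator_def mass_def)
 moreover have "(\<integral>om. indicator A (N om) * mass R om \<partial>M) >= 0" "(\<integral>om. indicator A (N om) * real (cnt (N om) (ball 0 1)) \<partial>M) >= 0"
 by (auto intro!: integral_nonneg simp: mass_def)
 ultimately have "(\<integral>om. indicator A (N om) * real (cnt (N om) (ball 0 1)) \<partial>M) * (pi * R\<^sup>2) = (\<integral>om. indicator A (N om) * mass R om \<partial>M) * pi"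
 using R by (simp add: ball emeasure_disc ennreal_mult[symmetric])
 moreover have "(\<integral>om. indicator A (N om) * avg R om \<partial>M) = (\<integral>om. indicator A (N om) * mass R om \<partial>M) / (pi * R\<^sup>2)"
 by (simp add: avg_def)
 ultimately have "R\<^sup>2 * (\<integral>om. indicator A (N om) * real (cnt (N om) (ball 0 1)) \<partial>M) = R\<^sup>2 * (pi * (\<integral>om. indicator A (N om) * avg R om \<partial>M))"
 using R by (simp add: field_simps)
 then show ?thesis using R by simp
qed

end

context spec_pp
begin

text \<open>\<open>X\<close> is determined almost surely only, so it need not be measurable for the
  invariant events. It is replaced by the upper density along suitable radii, which is strictly
  invariant; its integrals over invariant events are limits of those of the averages, and these do
  not depend on the radius.\<close>

lemma avg_tendsto_cond_intensity:
 assumes X[measurable]: "X : bmeas M" and XF: "nsq M X < \<infinity>"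
 and lim: "!!R. filterlim R at_top sequentially ==> (%n. n1 M (%om. lin (rescale (R n) chi) om - X om)) ----> 0"
 shows "AE om in M. X om = of_real (cond_intensity M N om)"
proof -
 have lim': "((%R. n1 M (%om. of_real (avg R om) - X om)) \<longlongrightarrow> 0) at_top"
 proof (rule tendsto_at_topI_sequentially)
 fix R :: "nat => real" assume R: "filterlim R at_top sequentially"
 have "\<forall>\<^sub>F n in sequentially. R n > 0" using R by (auto simp: filterlim_at_top_dense)
 then have "\<forall>\<^sub>F n in sequentially. n1 M (%om. lin (rescale (R n) chi) om - X om) = n1 M (%om. of_real (avg (R n) om) - X om)"
 by eventually_elim (rule n1_cong, simp add: lin_rescale_chi)
 then show "(%n. n1 M (%om. of_real (avg (R n) om) - X om)) ----> 0"
 by (rule Lim_transform_eventually[OF lim[OF R]])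
 qed
 \<comment> \<open>The bound is wanted for all radii beyond \<open>r\<close>, so that it also covers
   the discs enlarged by \<open>m\<close>.\<close>
 have "\<exists>r\<ge>real (Suc k). \<forall>R\<ge>r. n1 M (%om. of_real (avg R om) - X om) <= ennreal ((1/2) ^ k)" for k :: nat
 proof -
 have "\<forall>\<^sub>F R in at_top. n1 M (%om. of_real (avg R om) - X om) < ennreal ((1/2) ^ k)"
 using lim' by (auto simp: order_tendsto_iff)
 then obtain r where "!!R. R >= r ==> n1 M (%om. of_real (avg R om) - X om) < ennreal ((1/2) ^ k)"
 by (auto simp: eventually_at_top_linorder)
 then show ?thesis by (intro exI[of _ "max r (real (Suc k))"]) (auto intro: less_imp_le)
 qed
 then obtain R where R: "!!k. R k >= real (Suc k)" "!!k S. S >= R k ==> n1 M (%om. of_real (avg S om) - X om) <= ennreal ((1/2) ^ k)"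
 by metis
 have Rpos: "R k > 0" for k using R(1)[of k] by simp
 have Rtop: "filterlim R at_top sequentially"
 by (rule filterlim_at_top_mono[OF filterlim_real_sequentially]) (use R(1) in \<open>auto intro!: always_eventually order_trans[OF _ R(1)]\<close>)
 have conv: "AE om in M. \<forall>m::nat. (%k. of_real (avg (R k + real m) om)) ----> X om"
 proof (subst AE_all_countable, rule allI)
 fix m :: nat
 have "(\<integral>\<^sup>+om. (\<Sum>k. ennreal (norm (of_real (avg (R k + real m) om) - X om))) \<partial>M) = (\<Sum>k. n1 M (%om. of_real (avg (R k + real m) om) - X om))"
 unfolding n1_def by (rule nn_integral_suminf) measurable
 also have "... <= (\<Sum>k. ennreal ((1/2) ^ k))" by (intro suminf_le R) auto
 also have "... < \<infinity>" by (subst suminf_ennreal2) (auto intro!: summable_geometric)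
 finally have "AE om in M. (\<Sum>k. ennreal (norm (of_real (avg (R k + real m) om) - X om))) ~= \<infinity>"
 by (intro nn_integral_PInf_AE) auto
 then show "AE om in M. (%k. of_real (avg (R k + real m) om)) ----> X om"
 proof eventually_elim
 case (elim om)
 then have "summable (%k. norm (of_real (avg (R k + real m) om) - X om))"
 by (intro summable_suminf_not_top) auto
 from summable_LIMSEQ_zero[OF this] show ?case by (simp add: tendsto_norm_zero_iff LIM_zero_iff)
 qed
 qed
 have dens: "AE om in M. upper_density R (N om) = ennreal (Re (X om)) \<and> Re (X om) >= 0 \<and> X om = of_real (Re (X om))"
 using conv AE_space
 proof eventually_elim
 case (elim om)
 have re: "(%k. avg (R k + real m) om) ----> Re (X om)" for m
 using tendsto_Re[OF elim(1)[rule_format, of m]] by simp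
 have im: "Im (X om) = 0"
 using tendsto_Im[OF elim(1)[rule_format, of 0]] by (simp add: LIMSEQ_const_iff)
 have pos: "Re (X om) >= 0" by (rule LIMSEQ_le_const[OF re[of 0]]) (auto simp: avg_nonneg)
 have "limsup (%k. ennreal (real (cnt (N om) (cball 0 (R k + real m))) / (pi * (R k)\<^sup>2))) = ennreal (Re (X om))" for m :: nat
 proof (rule lim_imp_Limsup)
 \<comment> \<open>The extra factor tends to 1 and changes the normalisation from the area of the
   enlarged disc to that of the disc of radius \<open>R k\<close>.\<close>
 have "(%k. avg (R k + real m) om * (1 + real m * inverse (R k))\<^sup>2) ----> Re (X om) * (1 + real m * 0)\<^sup>2"
 by (intro tendsto_intros re tendsto_inverse_0_at_top Rtop)
 moreover have "avg (R k + real m) om * (1 + real m * inverse (R k))\<^sup>2 = real (cnt (N om) (cball 0 (R k + real m))) / (pi * (R k)\<^sup>2)" for k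
 proof -
 have "1 + real m * inverse (R k) = (R k + real m) / R k" using Rpos[of k] by (simp add: field_simps)
 moreover have "R k + real m > 0" using Rpos[of k] by simp
 ultimately show ?thesis by (simp add: avg_def mass_def power_divide)
 qed
 ultimately show "(%k. ennreal (real (cnt (N om) (cball 0 (R k + real m))) / (pi * (R k)\<^sup>2))) ----> ennreal (Re (X om))"
 by (intro tendsto_ennrealI) simp
 qed simp
 then show ?case using pos im by (simp add: upper_density_def complex_eq_iff)
 qed
 have iX: "integrable M X"
 proof -
 have "n1 M X <= ennreal 1 + ennreal (1 / 1) * nsq M X" by (rule n1_le_nsq) auto
 also have "... < \<infinity>" using XF by simp
 finally show ?thesis unfolding n1_def by (intro integrableI_bounded) auto
 qed
 \<comment> \<open>The factor \<open>pi\<close> returns from a density to the count in the unit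
   disc, which is the variable that is conditioned.\<close>
 define g where "g om = pi * enn2real (upper_density R (N om))" for om
 have gm: "g : bmeas (F_inv M N)"
 proof -
 have "(%mu. pi * enn2real (upper_density R mu)) : bmeas CFG"
 using measurable_upper_density[of R] by measurable
 then show ?thesis unfolding g_def[abs_def]
 by (rule measurable_F_inv_invariant) (simp add: upper_density_shift[OF Rtop])
 qed
 note gm'[measurable] = measurable_from_subalg[OF subalgebra_F_inv gm]
 have gX: "AE om in M. g om = pi * Re (X om)" using dens by eventually_elim (simp add: g_def)
 have gi: "integrable M g"
 by (subst integrable_cong_AE[OF _ _ gX]) (use iX in auto)
 interpret F: sigma_finite_subalgebra M "F_inv M N" by (rule sigma_finite_subalgebra_F_inv)
 have "AE om in M. real_cond_exp M (F_inv M N) (%om. real (cnt (N om) (ball 0 1))) om = g om"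
 proof (rule F.real_cond_exp_charact[OF _ _ gi gm])
 have bm[measurable]: "(%om. real (cnt (N om) (ball 0 1))) : bmeas M"
 using measurable_compose[OF measurable_cnt_N[of "ball 0 1"], of real borel] by simp
 show "integrable M (%om. real (cnt (N om) (ball 0 1)))"
 by (rule BI_integrable_bound[OF integrable_mass[of 1]])
 (auto simp: mass_def intro!: cnt_mono lfN)
 fix B assume "B : sets (F_inv M N)"
 then obtain A where A: "A : cfg_sets" "!!w mu. shift_cfg w mu : A \<longleftrightarrow> mu : A" "B = {om : space M. N om : A}"
 by (rule sets_F_inv_E) blast
 have AN[measurable]: "(%om. indicator A (N om) :: real) : bmeas M"
 by (rule measurable_compose[OF measurable_N_CFG borel_measurable_indicator]) (use A(1) in \<open>simp add: sets_CFG\<close>)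
 have BA: "(\<integral>om\<in>B. f om \<partial>M) = (\<integral>om. indicator A (N om) * f om \<partial>M)" for f :: "_ => real"
 unfolding set_lebesgue_integral_def
 by (rule BI_integral_cong) (auto simp: A(3) indicator_def)
 have iA: "integrable M (%om. indicator A (N om) * Re (X om))" "integrable M (%om. indicator A (N om) * avg S om)" for S
 proof -
 have iR: "integrable M (%om. Re (X om))" using iX by simp
 show "integrable M (%om. indicator A (N om) * Re (X om))"
 by (rule BI_integrable_bound[OF iR], measurable) (auto simp: indicator_def)
 show "integrable M (%om. indicator A (N om) * avg S om)"
 by (rule BI_integrable_bound[OF integrable_avg[of S]], measurable) (auto simp: indicator_def)
 qed
 define V where "V = (\<integral>om. indicator A (N om) * real (cnt (N om) (ball 0 1)) \<partial>M)"
 \<comment> \<open>The mean of the average over radius \<open>R k\<close> on the event is exactly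
   \<open>V / pi\<close>, so only the \<open>L1\<close> distance of that average to \<open>X\<close>
   remains.\<close>
 have est: "\<bar>V / pi - (\<integral>om. indicator A (N om) * Re (X om) \<partial>M)\<bar> <= (1/2) ^ k" for k
 proof -
 have "V / pi - (\<integral>om. indicator A (N om) * Re (X om) \<partial>M)
 = (\<integral>om. indicator A (N om) * avg (R k) om \<partial>M) - (\<integral>om. indicator A (N om) * Re (X om) \<partial>M)"
 using nn_integral_invariant_count[OF A(1,2) Rpos[of k]] by (simp add: V_def)
 also have "... = (\<integral>om. indicator A (N om) * avg (R k) om - indicator A (N om) * Re (X om) \<partial>M)"
 by (rule BI_integral_diff[symmetric, OF iA(2,1)])
 finally have e: "V / pi - (\<integral>om. indicator A (N om) * Re (X om) \<partial>M) = ..." .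
 have "ennreal (norm (\<integral>om. indicator A (N om) * avg (R k) om - indicator A (N om) * Re (X om) \<partial>M))
 <= (\<integral>\<^sup>+om. ennreal (norm (indicator A (N om) * avg (R k) om - indicator A (N om) * Re (X om))) \<partial>M)"
 by (rule integral_norm_bound_ennreal) (intro BI_integrable_diff iA)
 also have "... <= n1 M (%om. of_real (avg (R k) om) - X om)"
 unfolding n1_def
 proof (intro nn_integral_mono ennreal_leI)
 fix om
 have "\<bar>avg (R k) om - Re (X om)\<bar> <= norm (of_real (avg (R k) om) - X om)"
 using abs_Re_le_cmod[of "of_real (avg (R k) om) - X om"] by simp
 then show "norm (indicator A (N om) * avg (R k) om - indicator A (N om) * Re (X om)) <= norm (of_real (avg (R k) om) - X om)"
 by (auto simp: indicator_def)
 qed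
 also have "... <= ennreal ((1/2) ^ k)" by (rule R) simp
 finally show ?thesis unfolding e by simp
 qed
 have "(%k. (1/2::real) ^ k) ----> 0" by (rule LIMSEQ_power_zero) simp
 then have "\<bar>V / pi - (\<integral>om. indicator A (N om) * Re (X om) \<partial>M)\<bar> <= 0"
 by (rule LIMSEQ_le_const) (use est in auto)
 then have "V = pi * (\<integral>om. indicator A (N om) * Re (X om) \<partial>M)" by (simp add: field_simps)
 also have "... = (\<integral>om. indicator A (N om) * (pi * Re (X om)) \<partial>M)"
 by (subst integral_mult_right_zero[symmetric]) (simp add: mult_ac)
 also have "... = (\<integral>om. indicator A (N om) * g om \<partial>M)"
 by (rule integral_cong_AE) (use gX in \<open>measurable, auto\<close>)
 finally show "(\<integral>om\<in>B. real (cnt (N om) (ball 0 1)) \<partial>M) = (\<integral>om\<in>B. g om \<partial>M)"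
 unfolding BA V_def .
 qed
 then show ?thesis
 using dens gX by eventually_elim (auto simp: cond_intensity_def)
qed

lemma ergodic_limit_cond_intensity:
 obtains X where "nsq M X < \<infinity>" "AE om in M. X om = of_real (cond_intensity M N om)"
 "!!g R. bbs g ==> AE x in lborel. isCont g x ==> filterlim R at_top sequentially
 ==> (%n. n1 M (%om. lin (rescale (R n) g) om - (\<integral>x. g x \<partial>lborel) * X om)) ----> 0"
proof -
 obtain X where X: "X : bmeas M" "nsq M X < \<infinity>"
 "!!g R. bbs g ==> AE x in lborel. isCont g x ==> filterlim R at_top sequentially
 ==> (%n. n1 M (%om. lin (rescale (R n) g) om - (\<integral>x. g x \<partial>lborel) * X om)) ----> 0"
 by (rule ergodic_limit) blast
 have "AE om in M. X om = of_real (cond_intensity M N om)"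
 by (rule avg_tendsto_cond_intensity[OF X(1,2)])
 (use X(3)[OF bbs_chi isCont_chi] in \<open>simp add: integral_chi\<close>)
 then show ?thesis using that X by blast
qed

theorem ergodic:
 assumes "bbs g" "AE x in lborel. isCont g x" "filterlim R at_top sequentially"
 shows "(%n. n1 M (%om. lin (rescale (R n) g) om - (\<integral>x. g x \<partial>lborel) * of_real (cond_intensity M N om))) ----> 0"
proof (rule ergodic_limit_cond_intensity)
 fix X assume eq: "AE om in M. X om = of_real (cond_intensity M N om)"
 and X: "!!g R. bbs g ==> AE x in lborel. isCont g x ==> filterlim R at_top sequentially
 ==> (%n. n1 M (%om. lin (rescale (R n) g) om - (\<integral>x. g x \<partial>lborel) * X om)) ----> 0"
 have "n1 M (%om. lin (rescale (R n) g) om - (\<integral>x. g x \<partial>lborel) * of_real (cond_intensity M N om))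
 = n1 M (%om. lin (rescale (R n) g) om - (\<integral>x. g x \<partial>lborel) * X om)" for n
 by (rule n1_cong_AE) (use eq in eventually_elim, simp)
 then show ?thesis using X[OF assms] by simp
qed

lemma nsq_cond_intensity: "nsq M (%om. of_real (cond_intensity M N om)) < \<infinity>"
proof (rule ergodic_limit_cond_intensity)
 fix X assume eq: "AE om in M. X om = of_real (cond_intensity M N om)" and X: "nsq M X < \<infinity>"
 have "nsq M (%om. of_real (cond_intensity M N om)) = nsq M X"
 unfolding nsq_def by (rule nn_integral_cong_AE) (use eq in eventually_elim, simp)
 then show ?thesis using X by simp
qed

end

section \<open>Stationarity of the zeta field after subtraction of its drift\<close>

lemma ennreal_tendsto_0_le:
 fixes f g :: "'a => ennreal"
 assumes "\<forall>\<^sub>F n in F. f n <= g n" "(g \<longlongrightarrow> 0) F"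
 shows "(f \<longlongrightarrow> 0) F"
 by (rule tendsto_sandwich[OF _ assms(1) tendsto_const assms(2)]) simp

lemma measurable_cnj [measurable]:
 "f : bmeas K ==> (%x. cnj (f x)) : bmeas K"
 by (rule measurable_compose[OF _ borel_measurable_continuous_onI]) (auto intro: continuous_intros)

text \<open>Summability of complex families is absolute summability, so both sides exist together;
  otherwise both have the default value 0. Hence no hypothesis of convergence is needed.\<close>

lemma integral_pm_eq_infsum:
 fixes f :: "complex => complex"
 assumes f[measurable]: "f : bmeas borel"
 shows "(\<integral>l. f l \<partial>pm mu) = (\<Sum>\<^sub>\<infinity>l. of_nat (mu l) * f l)"
proof -
 let ?g = "%l. of_nat (mu l) * f l"
 have "(\<integral>l. f l \<partial>pm mu) = (\<integral>l. f l \<partial>density (count_space UNIV) (%z. ennreal (real (mu z))))"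
 unfolding pm_def by (rule integral_distr) auto
 also have "... = (\<integral>l. real (mu l) *\<^sub>R f l \<partial>count_space UNIV)" by (rule integral_density) auto
 also have "... = (\<integral>l. ?g l \<partial>count_space UNIV)" by (simp add: scaleR_conv_of_real)
 also have "... = (\<Sum>\<^sub>\<infinity>l. ?g l)"
 proof (cases "?g summable_on UNIV")
 case True
 then have "Infinite_Set_Sum.abs_summable_on ?g UNIV"
 by (simp add: abs_summable_equivalent[symmetric] summable_on_iff_abs_summable_on_complex[symmetric])
 then show ?thesis by (simp add: infsetsum_infsum[symmetric] infsetsum_def)
 next
 case False
 then have "\<not> Infinite_Set_Sum.abs_summable_on ?g UNIV"
 by (simp add: abs_summable_equivalent[symmetric] summable_on_iff_abs_summable_on_complex[symmetric])
 then have "\<not> integrable (count_space UNIV) ?g" by (simp add: Infinite_Set_Sum.abs_summable_on_def)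
 then show ?thesis using False by (simp add: not_integrable_integral_eq infsum_not_exists)
 qed
 finally show ?thesis .
qed

text \<open>The kernel is split as in the definition of \<open>zeta\<close>: the finite sum over the
  unit disc always exists, while the infinite sum may take its default value. With the two parts
  separate, \<open>zeta_eq\<close> holds at every outcome.\<close>

definition zk1 :: "complex => complex => complex" where
 "zk1 z l = (if norm l < 1 then 1 / (z - l) else 0)"

definition zk2 :: "complex => complex => complex" where
 "zk2 z l = (if norm l < 1 then 0 else 1 / (z - l) + 1 / l + z / l\<^sup>2)"

lemma measurable_zk [measurable]:
 assumes [measurable]: "f : bmeas K" "g : bmeas K"
 shows "(%x. zk1 (f x) (g x)) : bmeas K" "(%x. zk2 (f x) (g x)) : bmeas K"
 unfolding zk1_def zk2_def by measurable

text \<open>The parabolic profile is the one that \<open>integral_pole_disc\<close> produces. It is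
  Lipschitz up to the edge, so that its increments under a translation are of order
  \<open>1 / R\<close>.\<close>

definition theta :: "real => complex => real" where
 "theta R x = max 0 (1 - (norm x)\<^sup>2 / R\<^sup>2)"

lemma measurable_theta [measurable]: "theta R : bmeas borel"
 unfolding theta_def[abs_def] by measurable

lemma theta_nonneg: "0 <= theta R x" and theta_le_1: "theta R x <= 1"
 by (auto simp: theta_def)

lemma theta_eq_0: "R > 0 ==> norm x >= R ==> theta R x = 0"
 by (simp add: theta_def power_mono)

lemma theta_scale: "R > 0 ==> theta R x = theta 1 (x / of_real R)"
 by (simp add: theta_def norm_divide power_divide)

lemma theta_lipschitz: "\<bar>theta 1 a - theta 1 b\<bar> <= 2 * norm (a - b)"
proof -
 define A where "A = min 1 (norm a)"
 define B where "B = min 1 (norm b)"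
 have e: "theta 1 x = 1 - (min 1 (norm x))\<^sup>2" for x
 by (auto simp: theta_def min_def max_def abs_square_le_1 not_le power_le_one)
 have AB: "0 <= A" "A <= 1" "0 <= B" "B <= 1" by (auto simp: A_def B_def)
 have "\<bar>theta 1 a - theta 1 b\<bar> = \<bar>B\<^sup>2 - A\<^sup>2\<bar>" unfolding e A_def B_def by simp
 also have "... = \<bar>A - B\<bar> * (A + B)"
 using AB by (simp add: power2_eq_square square_diff_square_factored abs_mult abs_minus_commute mult.commute add.commute)
 also have "... <= \<bar>A - B\<bar> * 2" using AB by (intro mult_left_mono) auto
 also have "\<bar>A - B\<bar> <= \<bar>norm a - norm b\<bar>" by (auto simp: A_def B_def min_def)
 also have "... <= norm (a - b)" by (rule norm_triangle_ineq3)
 finally show ?thesis by simp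
qed

lemma le_mult_sqrt_iff:
 assumes "R > 0" "a >= 0" "t >= 0"
 shows "a <= R * sqrt t \<longleftrightarrow> a\<^sup>2 / R\<^sup>2 <= t"
proof
 assume "a <= R * sqrt t"
 then have "a\<^sup>2 <= (R * sqrt t)\<^sup>2" using assms by (intro power_mono) auto
 then show "a\<^sup>2 / R\<^sup>2 <= t" using assms by (simp add: power_mult_distrib field_simps)
next
 assume "a\<^sup>2 / R\<^sup>2 <= t"
 then have "(a / R)\<^sup>2 <= t" by (simp add: power_divide)
 then have "a / R <= sqrt t" by (rule real_le_rsqrt)
 then show "a <= R * sqrt t" using assms by (simp add: field_simps)
qed

text \<open>The condition on \<open>t\<close> reads
  \<open>(norm x)\<^sup>2 / R\<^sup>2 <= t\<close>, so the cutoff is the length of an interval.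
  Statements on sharp cutoffs at radius \<open>R * sqrt t\<close> thereby pass to the parabolic
  one.\<close>

lemma theta_layer_cake:
 assumes R: "R > 0"
 shows "(\<integral>t. indicator {0..1} t *\<^sub>R (if norm x <= R * sqrt t then 1 else (0::complex)) \<partial>lborel) = of_real (theta R x)"
proof -
 define s where "s = (norm x)\<^sup>2 / R\<^sup>2"
 have s0: "s >= 0" by (simp add: s_def)
 have "(\<integral>t. indicator {0..1} t *\<^sub>R (if norm x <= R * sqrt t then 1 else (0::complex)) \<partial>lborel) = (\<integral>t. of_real (indicator {s..1} t) \<partial>lborel)"
 proof (rule BI_integral_cong)
 fix t :: real
 show "indicator {0..1} t *\<^sub>R (if norm x <= R * sqrt t then 1 else (0::complex)) = of_real (indicator {s..1} t)"
 proof (cases "0 <= t")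
 case True
 then have "norm x <= R * sqrt t \<longleftrightarrow> s <= t" unfolding s_def by (intro le_mult_sqrt_iff R) auto
 then show ?thesis using True by (auto simp: indicator_def)
 qed (use s0 in \<open>auto simp: indicator_def\<close>)
 qed simp
 also have "... = of_real (\<integral>t. indicator {s..1} t \<partial>lborel)"
 by (rule integral_of_real, rule integrable_real_indicator) (auto simp: emeasure_lborel_Icc_eq)
 also have "(\<integral>t. indicator {s..1} t \<partial>lborel) = theta R x"
 by (cases "s <= 1") (auto simp: theta_def s_def)
 finally show ?thesis .
qed

text \<open>Without compensating terms the kernel depends on \<open>z - x\<close> and the cutoff
  only, so a translation of the configuration together with \<open>z\<close> changes nothing but the
  cutoff.\<close>

definition cauchy_cut :: "real => complex => complex => complex" where
 "cauchy_cut R z x = of_real (theta R x) / (z - x)"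

lemma measurable_cauchy_cut [measurable]: "cauchy_cut R z : bmeas borel"
 unfolding cauchy_cut_def[abs_def] by measurable

text \<open>The scaling limit of the increments of the cutoff divided by the Cauchy kernel; its
 total mass \<open>- \<pi> cnj w\<close> is the origin of the term \<open>\<pi> c cnj z\<close> in the stationary field.\<close>

definition gker :: "complex => complex => complex" where
 "gker w u = - (indicator (cball 0 1) u *\<^sub>R (cnj w + w * cnj u / u))"

lemma measurable_gker [measurable]: "gker w : bmeas borel"
 unfolding gker_def[abs_def] by measurable

lemma norm_gker_le: "norm (gker w u) <= 2 * norm w"
proof -
 have "norm (cnj w + w * cnj u / u) <= norm w + norm w"
 by (rule order_trans[OF norm_triangle_ineq]) (auto simp: norm_mult norm_divide)
 then show ?thesis by (auto simp: gker_def indicator_def)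
qed

lemma integral_gker: "(\<integral>u. gker w u \<partial>lborel) = - (of_real pi * cnj w)"
proof -
 define a where "a u = indicator (cball 0 1) u *\<^sub>R (w * cnj u / u)" for u
 have am[measurable]: "a : bmeas borel" unfolding a_def[abs_def] by measurable
 have ai: "integrable lborel a"
 by (rule integrable_bounded_supp[where B="norm w" and r=1]) (auto simp: a_def indicator_def norm_mult norm_divide)
 have bi: "integrable lborel (indicator (cball (0::complex) 1) :: complex => real)"
 by (rule integrable_real_indicator) (auto simp: emeasure_disc)
 have bi': "integrable lborel (%u::complex. indicator (cball 0 1) u *\<^sub>R cnj w)"
 by (rule integrable_scaleR_left) (use bi in simp)
 \<comment> \<open>Multiplying \<open>u\<close> by \<open>\<i>\<close> reverses the sign of
   \<open>cnj u / u\<close>, so this part has integral 0.\<close>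
 have "(\<integral>u. a u \<partial>lborel) = (\<integral>u. a (\<i> * u) \<partial>lborel)" by (rule integral_lborel_rotate[symmetric]) auto
 also have "... = (\<integral>u. - a u \<partial>lborel)"
 by (rule BI_integral_cong) (auto simp: a_def indicator_def norm_mult)
 finally have a0: "(\<integral>u. a u \<partial>lborel) = 0" by simp
 have "(\<integral>u. gker w u \<partial>lborel) = (\<integral>u. - (indicator (cball 0 1) u *\<^sub>R cnj w + a u) \<partial>lborel)"
 by (rule BI_integral_cong) (auto simp: gker_def a_def scaleR_add_right)
 also have "... = - ((\<integral>(u::complex). indicator (cball 0 1) u *\<^sub>R cnj w \<partial>lborel) + (\<integral>u. a u \<partial>lborel))"
 by (subst integral_minus, subst BI_integral_add[OF bi' ai]) simp
 also have "(\<integral>(u::complex). indicator (cball 0 1) u *\<^sub>R cnj w \<partial>lborel) = of_real pi * cnj w"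
 using bi emeasure_disc[of 1 0] by (simp add: measure_def scaleR_conv_of_real)
 finally show ?thesis by (simp add: a0)
qed

lemma isCont_gker: "AE u in lborel. isCont (gker w) u"
 using AE_norm_neq_1 AE_lborel_singleton[of 0]
proof eventually_elim
 case (elim u)
 show ?case
 proof (cases "norm u < 1")
 case True
 have "\<forall>\<^sub>F y in nhds u. gker w y = - (cnj w + w * cnj y / y)"
 unfolding eventually_nhds
 by (rule exI[of _ "ball 0 1"]) (use True in \<open>auto simp: gker_def\<close>)
 moreover have "isCont (%y. - (cnj w + w * cnj y / y)) u" using elim by (intro continuous_intros) auto
 ultimately show ?thesis by (subst isCont_cong)
 next
 case False
 then have "\<forall>\<^sub>F y in nhds u. gker w y = 0"
 unfolding eventually_nhds
 by (intro exI[of _ "- cball 0 1"]) (use elim in \<open>auto simp: gker_def\<close>)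
 then show ?thesis by (subst isCont_cong) auto
 qed
qed

text \<open>The change of the cut kernel under the translation by \<open>w\<close>, centred at
  \<open>z\<close>, in the variable \<open>u = (x - z) / R\<close> and multiplied by
  \<open>R\<^sup>2\<close>.\<close>

definition theta_quot :: "complex => complex => real => complex => complex" where
 "theta_quot z w R u = of_real (R * (theta 1 (u + (z - w) / of_real R) - theta 1 (u + z / of_real R))) / (- u)"

text \<open>Inside the unit disc the difference of the squared moduli, times \<open>R\<close>, tends
  to \<open>2 * (u \<bullet> w)\<close>, which is \<open>cnj w * u + w * cnj u\<close>; division by
  \<open>- u\<close> gives \<open>gker w u\<close>. Outside both cutoffs vanish eventually.\<close>

lemma theta_quot_tendsto:
 assumes R: "filterlim R at_top sequentially" and u: "u ~= 0" "norm u ~= 1"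
 shows "(%n. theta_quot z w (R n) u) ----> gker w u"
proof -
 define a where "a n = u + (z - w) / of_real (R n)" for n
 define b where "b n = u + z / of_real (R n)" for n
 have a: "a ----> u" and b: "b ----> u"
 using tendsto_add[OF tendsto_const tendsto_divide_of_real_at_top[OF R], of u "z - w"]
 tendsto_add[OF tendsto_const tendsto_divide_of_real_at_top[OF R], of u z] by (simp_all add: a_def[abs_def] b_def[abs_def])
 have Rpos: "\<forall>\<^sub>F n in sequentially. R n > 0" using R by (auto simp: filterlim_at_top_dense)
 show ?thesis
 proof (cases "norm u < 1")
 case True
 have ev: "\<forall>\<^sub>F n in sequentially. norm (a n) < 1" "\<forall>\<^sub>F n in sequentially. norm (b n) < 1"
 using order_tendstoD(2)[OF tendsto_norm[OF a] True] order_tendstoD(2)[OF tendsto_norm[OF b] True] by auto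
 have "(%n. of_real (2 * (b n \<bullet> w) - (norm w)\<^sup>2 * inverse (R n)) / (- u)) ----> of_real (2 * (u \<bullet> w) - (norm w)\<^sup>2 * 0) / (- u)"
 using u by (intro tendsto_intros b tendsto_inverse_0_at_top R) auto
 also have "of_real (2 * (u \<bullet> w) - (norm w)\<^sup>2 * 0) / (- u) = gker w u"
 proof -
 have "of_real (2 * (u \<bullet> w)) = cnj w * u + w * cnj u"
 by (simp add: complex_eq_iff inner_complex_def algebra_simps)
 then show ?thesis using u True by (simp add: gker_def field_simps)
 qed
 finally have lim: "(%n. of_real (2 * (b n \<bullet> w) - (norm w)\<^sup>2 * inverse (R n)) / (- u)) ----> gker w u" .
 show ?thesis
 proof (rule Lim_transform_eventually[OF lim])
 show "\<forall>\<^sub>F n in sequentially. of_real (2 * (b n \<bullet> w) - (norm w)\<^sup>2 * inverse (R n)) / (- u) = theta_quot z w (R n) u"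
 using ev Rpos
 proof eventually_elim
 case (elim n)
 have ab: "a n = b n - inverse (R n) *\<^sub>R w"
 using elim by (simp add: a_def b_def scaleR_conv_of_real field_simps)
 have "(norm (b n))\<^sup>2 - (norm (a n))\<^sup>2 = 2 * inverse (R n) * (b n \<bullet> w) - (inverse (R n))\<^sup>2 * (norm w)\<^sup>2"
 unfolding ab power2_norm_eq_inner inner_diff_left inner_diff_right inner_scaleR_left inner_scaleR_right inner_commute[of w "b n"]
 by (simp add: power2_eq_square algebra_simps)
 moreover have "theta 1 (a n) = 1 - (norm (a n))\<^sup>2" "theta 1 (b n) = 1 - (norm (b n))\<^sup>2"
 using elim by (auto simp: theta_def max_def abs_square_le_1 not_le intro: power_le_one)
 ultimately have "theta 1 (a n) - theta 1 (b n) = 2 * inverse (R n) * (b n \<bullet> w) - (inverse (R n))\<^sup>2 * (norm w)\<^sup>2" by simp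
 then have "R n * (theta 1 (a n) - theta 1 (b n)) = R n * (2 * inverse (R n) * (b n \<bullet> w) - (inverse (R n))\<^sup>2 * (norm w)\<^sup>2)" by simp
 also have "... = 2 * (b n \<bullet> w) - (norm w)\<^sup>2 * inverse (R n)"
 using elim by (simp add: field_simps power2_eq_square)
 finally show ?case by (simp add: theta_quot_def a_def b_def)
 qed
 qed
 next
 case False
 then have u1: "norm u > 1" using u by simp
 have ev: "\<forall>\<^sub>F n in sequentially. norm (a n) > 1" "\<forall>\<^sub>F n in sequentially. norm (b n) > 1"
 using order_tendstoD(1)[OF tendsto_norm[OF a] u1] order_tendstoD(1)[OF tendsto_norm[OF b] u1] by auto
 have "\<forall>\<^sub>F n in sequentially. theta_quot z w (R n) u = gker w u"
 using ev by eventually_elim (use u1 in \<open>simp add: theta_quot_def theta_eq_0 gker_def flip: a_def b_def\<close>)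
 then show ?thesis by (rule tendsto_eventually)
 qed
qed

text \<open>The Lipschitz bound for the cutoff absorbs the factor \<open>R\<close>, and the
  remaining \<open>1 / norm u\<close> is integrable on a disc. The hypothesis on \<open>R n\<close>
  keeps both shifts at most 1, so that beyond modulus 3 everything vanishes.\<close>

lemma theta_quot_L1:
 assumes R: "filterlim R at_top sequentially" and K: "!!n. R n >= 1 + norm z + norm (z - w)"
 shows "(%n. \<integral>\<^sup>+u. ennreal (norm (theta_quot z w (R n) u - gker w u)) \<partial>lborel) ----> 0"
proof -
 have [measurable]: "theta_quot z w r : bmeas borel" for r unfolding theta_quot_def[abs_def] by measurable
 have Rpos: "R n > 0" for n using K[of n] norm_ge_zero[of z] norm_ge_zero[of "z - w"] by linarith
 have bound: "norm (theta_quot z w (R n) u - gker w u) <= 4 * norm w * (1 / norm u) * indicator (cball 0 3) u" if u: "u ~= 0" for n u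
 proof -
 have g: "norm (gker w u) <= 2 * norm w * (1 / norm u)" if "norm u <= 1"
 proof -
 have "2 * norm w * 1 <= 2 * norm w * (1 / norm u)" using that u by (intro mult_left_mono) (auto simp: field_simps)
 then show ?thesis using norm_gker_le[of w u] by simp
 qed
 have q: "norm (theta_quot z w (R n) u) <= 2 * norm w * (1 / norm u)"
 proof -
 have "\<bar>theta 1 (u + (z - w) / of_real (R n)) - theta 1 (u + z / of_real (R n))\<bar> <= 2 * norm ((z - w) / of_real (R n) - z / of_real (R n))"
 using theta_lipschitz[of "u + (z - w) / of_real (R n)" "u + z / of_real (R n)"] by simp
 also have "(z - w) / of_real (R n) - z / of_real (R n) = - w / of_real (R n)" by (simp add: diff_divide_distrib)
 finally have "R n * \<bar>theta 1 (u + (z - w) / of_real (R n)) - theta 1 (u + z / of_real (R n))\<bar> <= 2 * norm w"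
 using Rpos[of n] by (simp add: norm_divide field_simps)
 then have "R n * \<bar>theta 1 (u + (z - w) / of_real (R n)) - theta 1 (u + z / of_real (R n))\<bar> / norm u <= 2 * norm w / norm u"
 by (rule divide_right_mono) simp
 moreover have "norm (theta_quot z w (R n) u) = R n * \<bar>theta 1 (u + (z - w) / of_real (R n)) - theta 1 (u + z / of_real (R n))\<bar> / norm u"
 unfolding theta_quot_def norm_divide norm_of_real norm_minus_cancel abs_mult using Rpos[of n] by simp
 ultimately show ?thesis by simp
 qed
 show ?thesis
 proof (cases "norm u <= 3")
 case True
 have "norm (theta_quot z w (R n) u - gker w u) <= norm (theta_quot z w (R n) u) + norm (gker w u)" by (rule norm_triangle_ineq4)
 also have "... <= 2 * norm w * (1 / norm u) + 2 * norm w * (1 / norm u)"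
 proof (rule add_mono[OF q])
 show "norm (gker w u) <= 2 * norm w * (1 / norm u)"
 proof (cases "norm u <= 1")
 case False
 then show ?thesis by (simp add: gker_def)
 qed (rule g)
 qed
 finally show ?thesis using True by simp
 next
 case False
 have s: "norm (y / of_real (R n)) <= 1" if "norm y <= R n" for y :: complex
 using that Rpos[of n] by (simp add: norm_divide)
 have "norm (z - w) <= R n" "norm z <= R n"
 using K[of n] norm_ge_zero[of z] norm_ge_zero[of "z - w"] by linarith+
 then have "norm (u + (z - w) / of_real (R n)) >= 1" "norm (u + z / of_real (R n)) >= 1"
 using False s[of "z - w"] s[of z] norm_triangle_ineq2[of u "- ((z - w) / of_real (R n))"] norm_triangle_ineq2[of u "- (z / of_real (R n))"]
 by auto
 then have "theta_quot z w (R n) u = 0" by (simp add: theta_quot_def theta_eq_0)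
 then show ?thesis using False by (simp add: gker_def)
 qed
 qed
 have "(%n. \<integral>\<^sup>+u. ennreal (norm (theta_quot z w (R n) u - gker w u)) \<partial>lborel) ----> (\<integral>\<^sup>+(u::complex). 0 \<partial>lborel)"
 proof (rule nn_integral_dominated_convergence[where w="%u. ennreal (4 * norm w) * (ennreal (1 / norm u) * indicator (cball (0::complex) 3) u)"])
 show "AE u in lborel. ennreal (norm (theta_quot z w (R n) u - gker w u)) <= ennreal (4 * norm w) * (ennreal (1 / norm u) * indicator (cball 0 3) u)" for n
 using AE_lborel_singleton[of 0]
 proof eventually_elim
 case (elim u)
 have "ennreal (norm (theta_quot z w (R n) u - gker w u)) <= ennreal (4 * norm w * (1 / norm u) * indicator (cball 0 3) u)"
 by (rule ennreal_leI[OF bound[OF elim]])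
 also have "... = ennreal (4 * norm w) * (ennreal (1 / norm u) * indicator (cball 0 3) u)"
 by (cases "u : cball 0 3") (simp_all add: ennreal_mult[symmetric])
 finally show ?case .
 qed
 show "(\<integral>\<^sup>+u. ennreal (4 * norm w) * (ennreal (1 / norm u) * indicator (cball (0::complex) 3) u) \<partial>lborel) < \<infinity>"
 proof -
 have "(\<integral>\<^sup>+u. ennreal (1 / norm u) * indicator (cball (0::complex) 3) u \<partial>lborel) < \<infinity>"
 by (subst nn_integral_inverse_norm_disc) auto
 then show ?thesis by (subst nn_integral_cmult) (auto simp: ennreal_mult_less_top)
 qed
 show "AE u in lborel. (%n. ennreal (norm (theta_quot z w (R n) u - gker w u))) ----> 0"
 using AE_norm_neq_1 AE_lborel_singleton[of 0]
 proof eventually_elim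
 case (elim u)
 have "(%n. ennreal (norm (theta_quot z w (R n) u - gker w u))) ----> ennreal (norm (gker w u - gker w u))"
 by (intro tendsto_ennrealI tendsto_norm tendsto_diff tendsto_const theta_quot_tendsto R elim)
 then show ?case by simp
 qed
 qed measurable
 then show ?thesis by simp
qed

text \<open>The area factor of the substitution \<open>x = (z + w) + R * u\<close> is exactly the
  one in \<open>theta_quot\<close> and in \<open>rescale\<close>, so the \<open>L1\<close> distance
  is the one of the rescaled problem.\<close>

lemma cauchy_cut_increment_L1:
 assumes R: "filterlim R at_top sequentially"
 shows "(%n. n1 lborel (%x. (cauchy_cut (R n) z (- w + x) - cauchy_cut (R n) (z + w) x) - rescale (R n) (gker w) (x - (z + w)))) ----> 0"
proof -
 \<comment> \<open>The first finitely many radii are raised to meet the lower bound in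
   \<open>theta_quot_L1\<close>.\<close>
 define S where "S n = max (R n) (1 + norm (z + w) + norm (z + w - w))" for n
 have S: "filterlim S at_top sequentially"
 by (rule filterlim_at_top_mono[OF R]) (auto simp: S_def)
 have "(%n. \<integral>\<^sup>+u. ennreal (norm (theta_quot (z + w) w (S n) u - gker w u)) \<partial>lborel) ----> 0"
 by (rule theta_quot_L1[OF S]) (simp add: S_def)
 then show ?thesis
 proof (rule Lim_transform_eventually)
 have "\<forall>\<^sub>F n in sequentially. R n >= 1 + norm (z + w) + norm (z + w - w)" using R by (auto simp: filterlim_at_top)
 then show "\<forall>\<^sub>F n in sequentially. (\<integral>\<^sup>+u. ennreal (norm (theta_quot (z + w) w (S n) u - gker w u)) \<partial>lborel)
 = n1 lborel (%x. (cauchy_cut (R n) z (- w + x) - cauchy_cut (R n) (z + w) x) - rescale (R n) (gker w) (x - (z + w)))"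
 proof eventually_elim
 case (elim n)
 define r where "r = R n"
 have r: "r > 0" "S n = r" using elim norm_ge_zero[of "z + w"] norm_ge_zero[of "z + w - w"] unfolding r_def S_def by linarith+
 define f where "f x = (cauchy_cut r z (- w + x) - cauchy_cut r (z + w) x) - rescale r (gker w) (x - (z + w))" for x
 have fm[measurable]: "f : bmeas borel" unfolding f_def[abs_def] by measurable
 have "n1 lborel f = (\<integral>\<^sup>+x. ennreal (norm (f ((z + w) + x))) \<partial>lborel)"
 unfolding n1_def by (rule nn_integral_lborel_translate[symmetric, of "%x. ennreal (norm (f x))"]) measurable
 also have "... = ennreal (r\<^sup>2) * (\<integral>\<^sup>+u. ennreal (norm (f ((z + w) + of_real r * u))) \<partial>lborel)"
 by (rule nn_integral_scale_complex[OF _ r(1)]) measurable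
 also have "... = (\<integral>\<^sup>+u. ennreal (r\<^sup>2) * ennreal (norm (f ((z + w) + of_real r * u))) \<partial>lborel)"
 by (rule nn_integral_cmult[symmetric]) measurable
 also have "... = (\<integral>\<^sup>+u. ennreal (norm (theta_quot (z + w) w r u - gker w u)) \<partial>lborel)"
 proof (rule nn_integral_cong)
 fix u
 have t1: "theta r (- w + (z + w + of_real r * u)) = theta 1 (u + (z + w - w) / of_real r)"
 and t2: "theta r (z + w + of_real r * u) = theta 1 (u + (z + w) / of_real r)"
 unfolding theta_scale[OF r(1)] using r by (simp_all add: add_divide_distrib add.commute)
 have d: "z - (- w + (z + w + of_real r * u)) = - (of_real r * u)" "z + w - (z + w + of_real r * u) = - (of_real r * u)" by simp_all
 have "of_real (r\<^sup>2) * f ((z + w) + of_real r * u) = theta_quot (z + w) w r u - gker w u"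
 unfolding f_def cauchy_cut_def t1 t2 d rescale_def theta_quot_def using r
 by (cases "u = 0") (simp_all add: field_simps power2_eq_square)
 then have "norm (theta_quot (z + w) w r u - gker w u) = norm (of_real (r\<^sup>2) * f ((z + w) + of_real r * u))" by simp
 also have "... = r\<^sup>2 * norm (f ((z + w) + of_real r * u))" by (simp add: norm_mult norm_power)
 finally show "ennreal (r\<^sup>2) * ennreal (norm (f ((z + w) + of_real r * u))) = ennreal (norm (theta_quot (z + w) w r u - gker w u))"
 by (simp add: ennreal_mult)
 qed
 finally show ?case by (simp add: r f_def[abs_def] r_def[symmetric])
 qed
 qed
qed

context stat_pp
begin

lemma lin_eq_sum:
 assumes [measurable]: "f : bmeas borel" and r: "!!x. norm x > r ==> f x = 0" and om: "om : space M"
 shows "lin f om = (\<Sum>l\<in>supp_cfg (N om) \<inter> cball 0 r. of_nat (N om l) * f l)"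
proof -
 have "lin f om = lin_stat (N om) f"
 unfolding lin_def by (rule lin_stat_eq_integral[symmetric, where r=r]) (auto simp: lfN om r)
 also have "... = (\<Sum>l\<in>supp_cfg (N om) \<inter> cball 0 r. of_nat (N om l) * f l)"
 unfolding lin_stat_def
 by (rule sum.mono_neutral_left) (use r in \<open>force intro: finite_supp_bounded lfN om simp: not_less\<close>)+
 finally show ?thesis .
qed

lemma zeta_eq:
 assumes om: "om : space M"
 shows "zeta N Psi2 z om = lin (zk1 z) om + lin (zk2 z) om - Psi2 om * z"
proof -
 have "lin (zk1 z) om = (\<Sum>l\<in>supp_cfg (N om) \<inter> cball 0 1. of_nat (N om l) * zk1 z l)"
 by (rule lin_eq_sum) (auto simp: zk1_def om)
 also have "... = (\<Sum>l\<in>{l\<in>supp_cfg (N om). norm l < 1}. of_nat (N om l) * zk1 z l)"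
 by (rule sum.mono_neutral_right) (auto simp: zk1_def intro: finite_supp_bounded lfN om)
 also have "... = (\<Sum>l\<in>{l\<in>supp_cfg (N om). norm l < 1}. of_nat (N om l) / (z - l))"
 by (rule sum.cong) (auto simp: zk1_def)
 finally have 1: "lin (zk1 z) om = ..." .
 have "lin (zk2 z) om = (\<Sum>\<^sub>\<infinity>l. of_nat (N om l) * zk2 z l)"
 unfolding lin_def by (rule integral_pm_eq_infsum) measurable
 also have "... = (\<Sum>\<^sub>\<infinity>l\<in>{l. 1 <= norm l}. of_nat (N om l) * (1 / (z - l) + 1 / l + z / l\<^sup>2))"
 by (rule infsum_cong_neutral) (auto simp: zk2_def)
 finally show ?thesis unfolding zeta_def 1 by simp
qed

lemma measurable_zeta [measurable]:
 assumes [measurable]: "Psi2 : bmeas M"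
 shows "zeta N Psi2 z : bmeas M"
proof -
 have "(%om. lin (zk1 z) om + lin (zk2 z) om - Psi2 om * z) : bmeas M" by measurable
 then show ?thesis by (rule measurable_cong[THEN iffD1, rotated]) (simp add: zeta_eq)
qed

lemma integrable_zeta_kernel: "integrable lborel (zeta_kernel z)"
proof (rule integrableI_bounded)
 show "(\<integral>\<^sup>+x. ennreal (norm (zeta_kernel z x)) \<partial>lborel) < \<infinity>" by (rule nn_integral_zeta_kernel)
qed measurable

text \<open>If the whole kernel were not integrable, its integral would be 0 and lose the finite sum
  over the unit disc as well; hence the hypothesis, which holds almost surely for each
  \<open>z\<close>.\<close>

lemma zeta_eq_lin:
 assumes om: "om : space M" and i: "integrable (pm (N om)) (zeta_kernel z)"
 shows "zeta N Psi2 z om = lin (zeta_kernel z) om - Psi2 om * z"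
proof -
 have i1: "integrable (pm (N om)) (zk1 z)"
 by (rule integrable_pm_bounded_supp[where r=1]) (auto simp: lfN om zk1_def)
 have e: "zk2 z = (%l. zeta_kernel z l - zk1 z l)" by (auto simp: fun_eq_iff zk1_def zk2_def zeta_kernel_def)
 have "lin (zk2 z) om = lin (zeta_kernel z) om - lin (zk1 z) om"
 unfolding lin_def e by (rule BI_integral_diff[OF i i1])
 then show ?thesis by (simp add: zeta_eq[OF om])
qed

lemma lin_diff_AE:
 assumes "integrable lborel f" "integrable lborel g"
 shows "AE om in M. lin (%x. f x - g x) om = lin f om - lin g om"
 using AE_integrable_pm[OF assms(1)] AE_integrable_pm[OF assms(2)]
 by eventually_elim (simp add: lin_def)

lemma n1_lin_diff_le:
 assumes f: "integrable lborel f" and g: "integrable lborel g"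
 shows "n1 M (%om. lin f om - lin g om) <= ennreal c0 * n1 lborel (%x. f x - g x)"
proof -
 have [measurable]: "f : bmeas borel" "g : bmeas borel" using f g by auto
 have "n1 M (%om. lin f om - lin g om) = n1 M (lin (%x. f x - g x))"
 by (rule n1_cong_AE) (use lin_diff_AE[OF f g] in eventually_elim, simp)
 also have "... <= ennreal c0 * n1 lborel (%x. f x - g x)"
 unfolding n1_def by (rule nn_integral_norm_lin_le) measurable
 finally show ?thesis .
qed

lemma n1_lin_diff_tendsto:
 assumes "!!n. integrable lborel (f n)" "!!n. integrable lborel (g n)" "(%n. n1 lborel (%x. f n x - g n x)) ----> 0"
 shows "(%n. n1 M (%om. lin (f n) om - lin (g n) om)) ----> 0"
proof (rule ennreal_tendsto_0_le)
 show "\<forall>\<^sub>F n in sequentially. n1 M (%om. lin (f n) om - lin (g n) om) <= ennreal c0 * n1 lborel (%x. f n x - g n x)"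
 by (intro always_eventually allI n1_lin_diff_le assms)
 show "(%n. ennreal c0 * n1 lborel (%x. f n x - g n x)) ----> 0"
 using tendsto_mult_ennreal[OF tendsto_const[of "ennreal c0"] assms(3)] by simp
qed

definition psi_theta :: "nat => real => complex => complex" where
 "psi_theta k R x = of_real (theta R x) * psi_kernel k R x"

lemma bbs_psi_theta: "bbs (psi_theta k R)"
 unfolding bbs_def
proof (intro conjI)
 show "psi_theta k R : bmeas borel" unfolding psi_theta_def[abs_def] by measurable
 have "norm (psi_theta k R x) <= 1 * 1" for x
 unfolding psi_theta_def norm_mult
 by (intro mult_mono norm_psi_kernel_le) (auto simp: theta_nonneg theta_le_1)
 then show "\<exists>B. \<forall>x. norm (psi_theta k R x) <= B" by auto
 show "\<exists>r. \<forall>x. norm x > r \<longrightarrow> psi_theta k R x = 0" by (rule exI[of _ R]) (auto simp: psi_theta_def psi_kernel_def)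
qed

lemma measurable_lin_psi_kernel:
 "(%p. lin (psi_kernel k (R * sqrt (snd p))) (fst p)) : bmeas (M \<Otimes>\<^sub>M lborel)"
 unfolding lin_def by (rule measurable_integral_pm) measurable

lemma measurable_lin_psi_kernel_section:
 assumes "om : space M"
 shows "(%t. lin (psi_kernel k (R * sqrt t)) om) : bmeas borel"
 unfolding lin_def
proof (rule measurable_integral_pm[where K="%_. N om"])
 show "(%_. N om) : borel \<rightarrow>\<^sub>M LCFG" using assms by (intro measurable_const) (simp add: space_LCFG LF_def lfN)
qed measurable

lemma lin_psi_theta:
 assumes R: "R > 0" and om: "om : space M"
 shows "lin (psi_theta k R) om = (\<integral>t. indicator {0..1} t *\<^sub>R lin (psi_kernel k (R * sqrt t)) om \<partial>lborel)"
proof -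
 define S where "S = supp_cfg (N om) \<inter> cball 0 R"
 have Rt: "R * sqrt t <= R" if "t : {0..1}" for t using that R by simp
 have pk: "indicator {0..1} t *\<^sub>R psi_kernel k (R * sqrt t) l = psi_kernel k R l * (indicator {0..1} t *\<^sub>R (if norm l <= R * sqrt t then 1 else 0))" for t l
 using Rt[of t] by (cases "t : {0..1}") (auto simp: psi_kernel_def)
 have i: "integrable lborel (%t. of_nat (N om l) * (indicator {0..1} t *\<^sub>R psi_kernel k (R * sqrt t) l))" for l
 by (intro integrable_mult_right integrable_Icc_bounded[where B=1] norm_psi_kernel_le) measurable
 have "lin (psi_theta k R) om = (\<Sum>l\<in>S. of_nat (N om l) * psi_theta k R l)"
 unfolding S_def by (rule lin_eq_sum) (use om bbs_measurable[OF bbs_psi_theta] in \<open>auto simp: psi_theta_def psi_kernel_def\<close>)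
 also have "... = (\<Sum>l\<in>S. \<integral>t. of_nat (N om l) * (indicator {0..1} t *\<^sub>R psi_kernel k (R * sqrt t) l) \<partial>lborel)"
 unfolding pk integral_mult_right_zero theta_layer_cake[OF R] psi_theta_def by (simp add: mult.commute)
 also have "... = (\<integral>t. (\<Sum>l\<in>S. of_nat (N om l) * (indicator {0..1} t *\<^sub>R psi_kernel k (R * sqrt t) l)) \<partial>lborel)"
 by (rule BI_integral_sum[symmetric]) (rule i)
 also have "... = (\<integral>t. indicator {0..1} t *\<^sub>R lin (psi_kernel k (R * sqrt t)) om \<partial>lborel)"
 proof (rule BI_integral_cong)
 fix t :: real
 show "(\<Sum>l\<in>S. of_nat (N om l) * (indicator {0..1} t *\<^sub>R psi_kernel k (R * sqrt t) l)) = indicator {0..1} t *\<^sub>R lin (psi_kernel k (R * sqrt t)) om"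
 proof (cases "t : {0..1}")
 case True
 have "lin (psi_kernel k (R * sqrt t)) om = (\<Sum>l\<in>S. of_nat (N om l) * psi_kernel k (R * sqrt t) l)"
 unfolding S_def by (rule lin_eq_sum) (use om Rt[OF True] in \<open>auto simp: psi_kernel_def\<close>)
 then show ?thesis using True by simp
 qed simp
 qed simp
 finally show ?thesis .
qed

text \<open>The sum with the parabolic cutoff is the average over \<open>t\<close> of the sharp sums
  at radius \<open>R * sqrt t\<close>. For each positive \<open>t\<close> this radius tends to
  infinity, and dominated convergence in \<open>t\<close> needs only that the error \<open>D\<close>
  is bounded.\<close>

lemma psi_theta_tendsto:
 assumes lim: "L2_tendsto M (Psi k N) Y" and R: "filterlim R at_top sequentially"
 shows "(%n. n1 M (%om. lin (psi_theta k (R n)) om - Y om)) ----> 0"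
proof -
 have Y: "L2 M Y" and L: "((%R. nsq M (%om. Psi k N R om - Y om)) \<longlongrightarrow> 0) at_top"
 using L2_tendstoD[OF L2_Psi lim] by auto
 have Ym[measurable]: "Y : bmeas M" and Yf: "nsq M Y < \<infinity>" using Y by (auto simp: L2_iff_nsq)
 define D where "D r = n1 M (%om. lin (psi_kernel k r) om - Y om)" for r
 have DP: "D r = n1 M (%om. Psi k N r om - Y om)" for r
 unfolding D_def by (rule n1_cong) (simp add: Psi_eq_lin)
 have D0: "(D \<longlongrightarrow> 0) at_top"
 unfolding DP[abs_def] by (rule n1_tendsto_of_nsq[OF _ L]) measurable
 \<comment> \<open>Large radii are covered by the convergence of \<open>D\<close>; below
   \<open>r0\<close> the kernel is bounded by 1 and the count in one disc dominates.\<close>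
 obtain C where C: "C < \<infinity>" "!!r. D r <= C"
 proof -
 have "\<forall>\<^sub>F r in at_top. D r < 1" using D0 by (auto simp: order_tendsto_iff)
 then obtain r0 where r0: "!!r. r >= r0 ==> D r < 1" by (auto simp: eventually_at_top_linorder)
 have yf: "n1 M Y < \<infinity>"
 proof -
 have "n1 M Y <= ennreal 1 + ennreal (1 / 1) * nsq M Y" by (rule n1_le_nsq) auto
 also have "... < \<infinity>" using Yf by simp
 finally show ?thesis .
 qed
 have mf: "(\<integral>\<^sup>+om. ennreal (mass r0 om) \<partial>M) < \<infinity>"
 using integrable_mass[of r0] by (simp add: integrable_iff_bounded mass_def)
 have "D r <= (\<integral>\<^sup>+om. ennreal (mass r0 om) \<partial>M) + n1 M Y" if "r <= r0" for r
 proof -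
 have "D r <= n1 M (lin (psi_kernel k r)) + n1 M (%om. - Y om)"
 using n1_add[of "lin (psi_kernel k r)" M "%om. - Y om"] by (simp add: D_def)
 also have "n1 M (%om. - Y om) = n1 M Y" by (simp add: n1_def)
 also have "n1 M (lin (psi_kernel k r)) <= (\<integral>\<^sup>+om. ennreal (mass r0 om) \<partial>M)"
 unfolding n1_def
 proof (intro nn_integral_mono ennreal_leI)
 fix om assume "om : space M"
 then have "norm (lin (psi_kernel k r) om) <= 1 * mass r0 om"
 by (rule norm_lin_le[OF bbs_psi_kernel norm_psi_kernel_le, rotated]) (use that in \<open>auto simp: psi_kernel_def\<close>)
 then show "norm (lin (psi_kernel k r) om) <= mass r0 om" by simp
 qed
 finally show ?thesis by simp
 qed
 then have "D r <= 1 + ((\<integral>\<^sup>+om. ennreal (mass r0 om) \<partial>M) + n1 M Y)" for r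
 using r0[of r] by (cases "r <= r0") (auto intro: order_trans add_increasing add_increasing2 less_imp_le)
 then show ?thesis using that[of "1 + ((\<integral>\<^sup>+om. ennreal (mass r0 om) \<partial>M) + n1 M Y)"] yf mf by simp
 qed
 have jm[measurable]: "(%p. lin (psi_kernel k (r * sqrt (snd p))) (fst p)) : bmeas (M \<Otimes>\<^sub>M lborel)" for r
 by (rule measurable_lin_psi_kernel)
 interpret L: sigma_finite_measure "lborel :: real measure" by (rule sigma_finite_lborel)
 interpret P: pair_sigma_finite M "lborel :: real measure" ..
 have Dm[measurable]: "(%t. D (r * sqrt t)) : bmeas borel" for r
 proof -
 have "(%q. lin (psi_kernel k (r * sqrt (fst q))) (snd q)) : bmeas (lborel \<Otimes>\<^sub>M M)"
 using measurable_compose[OF measurable_pair_swap' jm[of r]] by (simp add: case_prod_unfold)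
 then have [measurable]: "(%(t, om). lin (psi_kernel k (r * sqrt t)) om) : bmeas (lborel \<Otimes>\<^sub>M M)"
 by (simp add: case_prod_unfold)
 have "(%t. \<integral>\<^sup>+om. ennreal (norm (lin (psi_kernel k (r * sqrt t)) om - Y om)) \<partial>M) : bmeas lborel"
 by measurable
 then show ?thesis by (simp add: D_def[abs_def] n1_def)
 qed
 have main: "n1 M (%om. lin (psi_theta k r) om - Y om) <= (\<integral>\<^sup>+t. indicator {0..1} t * D (r * sqrt t) \<partial>lborel)" if r: "r > 0" for r
 proof -
 have "n1 M (%om. lin (psi_theta k r) om - Y om) <= (\<integral>\<^sup>+om. (\<integral>\<^sup>+t. indicator {0..1} t * ennreal (norm (lin (psi_kernel k (r * sqrt t)) om - Y om)) \<partial>lborel) \<partial>M)"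
 unfolding n1_def
 proof (rule nn_integral_mono)
 fix om assume om: "om : space M"
 note [measurable] = measurable_lin_psi_kernel_section[OF om]
 have i1: "integrable lborel (%t. indicator {0..1} t *\<^sub>R lin (psi_kernel k (r * sqrt t)) om)"
 proof (rule integrableI_bounded_set_indicator[where B="mass r om"])
 show "AE t in lborel. t : {0..1} \<longrightarrow> norm (lin (psi_kernel k (r * sqrt t)) om) <= mass r om"
 proof (intro AE_I2 impI)
 fix t :: real assume "t : {0..1}"
 then have "r * sqrt t <= r" using r by simp
 then have "norm (lin (psi_kernel k (r * sqrt t)) om) <= 1 * mass r om"
 by (intro norm_lin_le[OF bbs_psi_kernel norm_psi_kernel_le _ om]) (auto simp: psi_kernel_def)
 then show "norm (lin (psi_kernel k (r * sqrt t)) om) <= mass r om" by simp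
 qed
 qed auto
 have i2: "integrable lborel (%t::real. indicator {0..1} t *\<^sub>R Y om)"
 by (rule integrable_Icc_bounded[where B="norm (Y om)"]) auto
 have y: "(\<integral>(t::real). indicator {0..1} t *\<^sub>R Y om \<partial>lborel) = Y om" by simp
 have "lin (psi_theta k r) om - Y om = (\<integral>t. indicator {0..1} t *\<^sub>R lin (psi_kernel k (r * sqrt t)) om - indicator {0..1} t *\<^sub>R Y om \<partial>lborel)"
 unfolding BI_integral_diff[OF i1 i2] y lin_psi_theta[OF r om] ..
 also have "ennreal (norm ...) <= (\<integral>\<^sup>+t. ennreal (norm (indicator {0..1} t *\<^sub>R lin (psi_kernel k (r * sqrt t)) om - indicator {0..1} t *\<^sub>R Y om)) \<partial>lborel)"
 by (rule integral_norm_bound_ennreal) (intro BI_integrable_diff i1 i2)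
 also have "... = (\<integral>\<^sup>+t. indicator {0..1} t * ennreal (norm (lin (psi_kernel k (r * sqrt t)) om - Y om)) \<partial>lborel)"
 by (rule nn_integral_cong) (auto simp: indicator_def)
 finally show "ennreal (norm (lin (psi_theta k r) om - Y om)) <= ..." .
 qed
 also have "... = (\<integral>\<^sup>+t. (\<integral>\<^sup>+om. indicator {0..1} t * ennreal (norm (lin (psi_kernel k (r * sqrt t)) om - Y om)) \<partial>M) \<partial>lborel)"
 proof (rule P.Fubini'[symmetric])
 have "(%p. indicator {0..1} (snd p) * ennreal (norm (lin (psi_kernel k (r * sqrt (snd p))) (fst p) - Y (fst p)))) : bmeas (M \<Otimes>\<^sub>M lborel)"
 by measurable
 then show "(%(om, t). indicator {0..1} t * ennreal (norm (lin (psi_kernel k (r * sqrt t)) om - Y om))) : bmeas (M \<Otimes>\<^sub>M lborel)"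
 by (simp add: case_prod_unfold)
 qed
 also have "... = (\<integral>\<^sup>+t. indicator {0..1} t * D (r * sqrt t) \<partial>lborel)"
 unfolding D_def n1_def by (intro nn_integral_cong nn_integral_cmult) measurable
 finally show ?thesis .
 qed
 have "(%n. \<integral>\<^sup>+t. indicator {0..1} t * D (R n * sqrt t) \<partial>lborel) ----> (\<integral>\<^sup>+(t::real). 0 \<partial>lborel)"
 proof (rule nn_integral_dominated_convergence[where w="%t. indicator {0..1} t * C"])
 show "AE t in lborel. indicator {0..1} t * D (R n * sqrt t) <= indicator {0..1} t * C" for n
 by (intro AE_I2 mult_left_mono C) auto
 show "(\<integral>\<^sup>+(t::real). indicator {0..1} t * C \<partial>lborel) < \<infinity>" using C(1) by (simp add: nn_integral_multc)
 show "AE t in lborel. (%n. indicator {0..1} t * D (R n * sqrt t)) ----> 0"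
 using AE_lborel_singleton[of 0]
 proof eventually_elim
 case (elim t)
 show ?case
 proof (cases "t : {0..1}")
 case True
 then have "filterlim (%n. sqrt t * R n) at_top sequentially"
 using elim by (intro filterlim_tendsto_pos_mult_at_top[OF tendsto_const _ R]) auto
 then have "(%n. D (R n * sqrt t)) ----> 0" using filterlim_compose[OF D0] by (simp add: mult.commute)
 then show ?thesis using True by simp
 qed simp
 qed
 qed measurable
 then have lim: "(%n. \<integral>\<^sup>+t. indicator {0..1} t * D (R n * sqrt t) \<partial>lborel) ----> 0" by simp
 have "\<forall>\<^sub>F n in sequentially. R n > 0" using R by (auto simp: filterlim_at_top_dense)
 then show ?thesis
 by (intro ennreal_tendsto_0_le[OF _ lim]) (auto elim!: eventually_mono intro: main)
qed

end

context stat_pp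
begin

text \<open>Under a common cutoff the compensating terms of the zeta kernel can be summed apart,
  where they form the smoothed sums for \<open>Psi_1\<close> and \<open>Psi_2\<close>.\<close>

lemma cauchy_cut_eq:
 assumes R: "R > 0"
 shows "cauchy_cut R z x = (of_real (theta R x) * zeta_kernel z x - psi_theta 1 R x) - z * psi_theta 2 R x"
proof (cases "norm x < 1")
 case True
 then show ?thesis by (simp add: cauchy_cut_def zeta_kernel_def psi_theta_def psi_kernel_def)
next
 case False
 then have x: "x ~= 0" by auto
 show ?thesis
 proof (cases "norm x <= R")
 case True
 then show ?thesis using False by (simp add: cauchy_cut_def zeta_kernel_def psi_theta_def psi_kernel_def ring_distribs power2_eq_square)
 next
 case False
 then have "theta R x = 0" by (intro theta_eq_0 R) simp
 then show ?thesis by (simp add: cauchy_cut_def psi_theta_def)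
 qed
qed

lemma integrable_theta_zeta_kernel: "integrable lborel (%x. of_real (theta R x) * zeta_kernel z x)"
proof (rule BI_integrable_bound[OF integrable_zeta_kernel])
 show "AE x in lborel. norm (of_real (theta R x) * zeta_kernel z x) <= norm (zeta_kernel z x)"
 by (intro AE_I2) (simp add: norm_mult theta_nonneg theta_le_1 mult_left_le_one_le)
qed measurable

lemma integrable_cauchy_cut: "R > 0 ==> integrable lborel (cauchy_cut R z)"
proof -
 assume R: "R > 0"
 have e: "cauchy_cut R z = (%x. (of_real (theta R x) * zeta_kernel z x - psi_theta 1 R x) - z * psi_theta 2 R x)"
 by (rule ext) (rule cauchy_cut_eq[OF R])
 show ?thesis unfolding e
 by (intro BI_integrable_diff integrable_theta_zeta_kernel bbs_integrable bbs_psi_theta integrable_mult_right)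
qed

lemma theta_tendsto_1:
 assumes "filterlim R at_top sequentially"
 shows "(%n. theta (R n) x) ----> 1"
proof -
 have "(%n. max 0 (1 - (norm x)\<^sup>2 * (inverse (R n))\<^sup>2)) ----> max 0 (1 - (norm x)\<^sup>2 * 0\<^sup>2)"
 by (intro tendsto_intros tendsto_inverse_0_at_top assms)
 then show ?thesis by (simp add: theta_def divide_inverse power_inverse)
qed

lemma theta_zeta_kernel_tendsto:
 assumes R: "filterlim R at_top sequentially"
 shows "(%n. n1 lborel (%x. of_real (theta (R n) x) * zeta_kernel z x - zeta_kernel z x)) ----> 0"
proof -
 have "(%n. \<integral>\<^sup>+x. ennreal (norm (of_real (theta (R n) x) * zeta_kernel z x - zeta_kernel z x)) \<partial>lborel) ----> (\<integral>\<^sup>+(x::complex). 0 \<partial>lborel)"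
 proof (rule nn_integral_dominated_convergence[where w="%x. ennreal (norm (zeta_kernel z x))"])
 show "AE x in lborel. ennreal (norm (of_real (theta (R n) x) * zeta_kernel z x - zeta_kernel z x)) <= ennreal (norm (zeta_kernel z x))" for n
 proof (intro AE_I2 ennreal_leI)
 fix x
 have "norm (of_real (theta (R n) x) * zeta_kernel z x - zeta_kernel z x) = norm (of_real (theta (R n) x - 1) * zeta_kernel z x)"
 by (simp add: algebra_simps)
 also have "... = \<bar>theta (R n) x - 1\<bar> * norm (zeta_kernel z x)" by (simp only: norm_mult norm_of_real)
 also have "... <= 1 * norm (zeta_kernel z x)"
 using theta_nonneg[of "R n" x] theta_le_1[of "R n" x] by (intro mult_right_mono) auto
 finally show "norm (of_real (theta (R n) x) * zeta_kernel z x - zeta_kernel z x) <= norm (zeta_kernel z x)" by simp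
 qed
 show "(\<integral>\<^sup>+x. ennreal (norm (zeta_kernel z x)) \<partial>lborel) < \<infinity>" by (rule nn_integral_zeta_kernel)
 show "AE x in lborel. (%n. ennreal (norm (of_real (theta (R n) x) * zeta_kernel z x - zeta_kernel z x))) ----> 0"
 proof (rule AE_I2)
 fix x
 have "(%n. ennreal (norm (of_real (theta (R n) x) * zeta_kernel z x - zeta_kernel z x))) ----> ennreal (norm (of_real 1 * zeta_kernel z x - zeta_kernel z x))"
 by (intro tendsto_ennrealI tendsto_intros theta_tendsto_1 R)
 then show "(%n. ennreal (norm (of_real (theta (R n) x) * zeta_kernel z x - zeta_kernel z x))) ----> 0" by simp
 qed
 qed measurable
 then show ?thesis by (simp add: n1_def)
qed

text \<open>This is where (b) enters: the uncompensated sum converges only because the sums of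
  \<open>1 / l\<close> do. Its limit is \<open>zeta\<close> minus \<open>Psi1\<close>, since the
  term with \<open>Psi2\<close> is already part of \<open>zeta\<close>.\<close>

lemma cauchy_cut_tendsto:
 assumes P1: "L2_tendsto M (Psi 1 N) Psi1" and P2: "L2_tendsto M (Psi 2 N) Psi2"
 and R: "filterlim R at_top sequentially" and pos: "!!n. R n > 0"
 shows "(%n. n1 M (%om. lin (cauchy_cut (R n) z) om - (lin (zeta_kernel z) om - Psi1 om - z * Psi2 om))) ----> 0"
proof -
 have [measurable]: "Psi1 : bmeas M" "Psi2 : bmeas M"
 using P1 P2 by (auto simp: L2_tendsto_def L2_def)
 note [measurable] = bbs_measurable[OF bbs_psi_theta]
 define A where "A n om = lin (%x. of_real (theta (R n) x) * zeta_kernel z x) om - lin (zeta_kernel z) om" for n om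
 define B where "B n om = (- 1) * (lin (psi_theta 1 (R n)) om - Psi1 om)" for n om
 define C where "C n om = (- z) * (lin (psi_theta 2 (R n)) om - Psi2 om)" for n om
 have [measurable]: "A n : bmeas M" "B n : bmeas M" "C n : bmeas M" for n
 unfolding A_def[abs_def] B_def[abs_def] C_def[abs_def] by measurable
 have A0: "(%n. n1 M (A n)) ----> 0"
 unfolding A_def[abs_def] by (intro n1_lin_diff_tendsto integrable_theta_zeta_kernel integrable_zeta_kernel theta_zeta_kernel_tendsto R)
 have m: "(%n. ennreal c * n1 M (X n)) ----> 0" if "(%n. n1 M (X n)) ----> 0" for c X
 using tendsto_mult_ennreal[OF tendsto_const[of "ennreal c"] that] by simp
 have B0: "(%n. n1 M (B n)) ----> 0"
 unfolding B_def[abs_def] by (subst n1_cmult, measurable, rule m, rule psi_theta_tendsto[OF P1 R])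
 have C0: "(%n. n1 M (C n)) ----> 0"
 unfolding C_def[abs_def] by (subst n1_cmult, measurable, rule m, rule psi_theta_tendsto[OF P2 R])
 have le: "n1 M (%om. lin (cauchy_cut (R n) z) om - (lin (zeta_kernel z) om - Psi1 om - z * Psi2 om)) <= n1 M (A n) + (n1 M (B n) + n1 M (C n))" for n
 proof -
 have "AE om in M. lin (cauchy_cut (R n) z) om - (lin (zeta_kernel z) om - Psi1 om - z * Psi2 om) = A n om + (B n om + C n om)"
 using AE_space AE_integrable_pm[OF integrable_theta_zeta_kernel[of "R n" z]]
 proof eventually_elim
 case (elim om)
 have "lin (cauchy_cut (R n) z) om = lin (%x. of_real (theta (R n) x) * zeta_kernel z x) om - lin (psi_theta 1 (R n)) om - z * lin (psi_theta 2 (R n)) om"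
 proof -
 have b: "integrable (pm (N om)) (psi_theta k (R n))" for k by (rule bbs_integrable_pm[OF bbs_psi_theta elim(1)])
 have e: "cauchy_cut (R n) z = (%x. (of_real (theta (R n) x) * zeta_kernel z x - psi_theta 1 (R n) x) - z * psi_theta 2 (R n) x)"
 by (rule ext) (rule cauchy_cut_eq[OF pos])
 show ?thesis unfolding e lin_def
 unfolding BI_integral_diff[OF BI_integrable_diff[OF elim(2) b] integrable_mult_right[OF b]]
 BI_integral_diff[OF elim(2) b] integral_mult_right_zero ..
 qed
 then show ?case by (simp add: A_def B_def C_def algebra_simps)
 qed
 then have "n1 M (%om. lin (cauchy_cut (R n) z) om - (lin (zeta_kernel z) om - Psi1 om - z * Psi2 om)) = n1 M (%om. A n om + (B n om + C n om))"
 by (rule n1_cong_AE)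
 also have "... <= n1 M (A n) + n1 M (%om. B n om + C n om)" by (rule n1_add) measurable
 also have "n1 M (%om. B n om + C n om) <= n1 M (B n) + n1 M (C n)" by (rule n1_add) measurable
 finally show ?thesis by (simp add: add_left_mono)
 qed
 show ?thesis
 by (rule ennreal_tendsto_0_le[OF always_eventually]) (use le tendsto_add[OF A0 tendsto_add[OF B0 C0]] in auto)
qed

text \<open>Along a common almost surely convergent subsequence, \<open>V (z + w)\<close> becomes
  one and the same measurable functional of the configuration shifted by \<open>- w\<close>. Its law
  is then invariant because the law of the configuration is.\<close>

lemma stationary_field_of_limits:
 assumes V[measurable]: "!!z. V z : bmeas M" and u[measurable]: "!!n z. u n z : bmeas LCFG"
 and lim: "!!z w. (%n. n1 M (%om. u n z (shift_cfg (- w) (N om)) - V (z + w) om)) ----> 0"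
 shows "stationary_field M V"
 unfolding stationary_field_def
proof (intro allI)
 fix k :: nat and zs :: "nat => complex" and w :: complex
 define d where "d n i v om = norm (u n (zs i) (shift_cfg (- v) (N om)) - V (zs i + v) om)" for n i v om
 have dm[measurable]: "d n i v : bmeas M" for n i v unfolding d_def[abs_def] by measurable
 \<comment> \<open>All errors, at every point and for both shifts, are collected so that a single
   subsequence serves them all.\<close>
 define X where "X n om = (\<Sum>i<k. d n i 0 om + d n i w om)" for n om
 have Xm[measurable]: "X n : bmeas M" for n unfolding X_def[abs_def] by measurable
 have d0: "d n i v om >= 0" for n i v om by (simp add: d_def)
 have X0: "X n om >= 0" for n om unfolding X_def by (intro sum_nonneg add_nonneg_nonneg d0)
 have dlim: "(%n. \<integral>\<^sup>+om. ennreal (d n i v om) \<partial>M) ----> 0" for i v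
 using lim[of "zs i" v] by (simp add: n1_def d_def)
 define a where "a n = (\<integral>\<^sup>+om. ennreal (X n om) \<partial>M)" for n
 have ae: "a n = (\<Sum>i<k. (\<integral>\<^sup>+om. ennreal (d n i 0 om) \<partial>M) + (\<integral>\<^sup>+om. ennreal (d n i w om) \<partial>M))" for n
 proof -
 have "a n = (\<integral>\<^sup>+om. (\<Sum>i<k. ennreal (d n i 0 om) + ennreal (d n i w om)) \<partial>M)"
 unfolding a_def X_def by (simp add: sum_ennreal[symmetric] d0)
 also have "... = (\<Sum>i<k. (\<integral>\<^sup>+om. ennreal (d n i 0 om) + ennreal (d n i w om) \<partial>M))" by (rule nn_integral_sum) measurable
 also have "... = (\<Sum>i<k. (\<integral>\<^sup>+om. ennreal (d n i 0 om) \<partial>M) + (\<integral>\<^sup>+om. ennreal (d n i w om) \<partial>M))"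
 by (intro sum.cong refl nn_integral_add) measurable
 finally show ?thesis .
 qed
 moreover have "(%n. \<Sum>i<k. (\<integral>\<^sup>+om. ennreal (d n i 0 om) \<partial>M) + (\<integral>\<^sup>+om. ennreal (d n i w om) \<partial>M)) ----> (\<Sum>i<k. 0 + 0)"
 by (intro tendsto_sum tendsto_add dlim)
 ultimately have a0: "a ----> 0" unfolding ae[abs_def] by simp
 have "\<exists>n. a n <= ennreal ((1/2) ^ j)" for j :: nat
 proof -
 have "\<forall>\<^sub>F n in sequentially. a n < ennreal ((1/2) ^ j)" using a0 by (auto simp: order_tendsto_iff)
 then show ?thesis by (auto simp: eventually_sequentially intro: less_imp_le)
 qed
 then obtain r where r: "!!j::nat. a (r j) <= ennreal ((1/2) ^ j)" by metis
 have "(\<integral>\<^sup>+om. (\<Sum>j. ennreal (X (r j) om)) \<partial>M) = (\<Sum>j. a (r j))"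
 unfolding a_def by (rule nn_integral_suminf) measurable
 also have "... <= (\<Sum>j. ennreal ((1/2) ^ j))" by (intro suminf_le r) auto
 also have "... < \<infinity>" by (subst suminf_ennreal2) (auto intro!: summable_geometric)
 finally have "AE om in M. (\<Sum>j. ennreal (X (r j) om)) ~= \<infinity>" by (intro nn_integral_PInf_AE) auto
 then have Xlim: "AE om in M. (%j. X (r j) om) ----> 0"
 proof eventually_elim
 case (elim om)
 then have "summable (%j. X (r j) om)" by (intro summable_suminf_not_top) (auto simp: X0)
 then show ?case by (rule summable_LIMSEQ_zero)
 qed
 \<comment> \<open>The limit is taken on the space of configurations and not on the probability
   space, so that it can be evaluated at shifted configurations.\<close>
 define T where "T i mu = lim (%j. u (r j) (zs i) mu)" for i mu
 have T[measurable]: "T i : bmeas LCFG" for i unfolding T_def[abs_def] by measurable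
 have Tlim: "AE om in M. \<forall>i<k. V (zs i + v) om = T i (shift_cfg (- v) (N om))" if v: "v = 0 \<or> v = w" for v
 using Xlim
 proof eventually_elim
 case (elim om)
 show ?case
 proof (intro allI impI)
 fix i assume i: "i < k"
 have "d (r j) i v om <= X (r j) om" for j
 proof -
 have "d (r j) i v om <= d (r j) i 0 om + d (r j) i w om" using v d0 by (auto intro: add_increasing add_increasing2)
 also have "... <= X (r j) om" unfolding X_def using i
 by (intro member_le_sum[of i "{..<k}" "%i. d (r j) i 0 om + d (r j) i w om"]) (auto intro: add_nonneg_nonneg d0)
 finally show ?thesis .
 qed
 then have "(%j. u (r j) (zs i) (shift_cfg (- v) (N om)) - V (zs i + v) om) ----> 0"
 by (intro Lim_null_comparison[OF always_eventually elim]) (simp add: d_def)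
 then have "(%j. u (r j) (zs i) (shift_cfg (- v) (N om))) ----> V (zs i + v) om" by (simp add: LIM_zero_iff)
 then show "V (zs i + v) om = T i (shift_cfg (- v) (N om))" unfolding T_def by (rule limI[symmetric])
 qed
 qed
 define P where "P = PiM {..<k} (%_. borel :: complex measure)"
 define G where "G mu = (\<lambda>i\<in>{..<k}. T i mu)" for mu
 have G[measurable]: "G : measurable LCFG P" unfolding G_def[abs_def] P_def by measurable
 have VP[measurable]: "(%om. \<lambda>i\<in>{..<k}. V (zs i + v) om) : measurable M P" for v unfolding P_def by measurable
 have V_eq: "distr M P (%om. \<lambda>i\<in>{..<k}. V (zs i + v) om) = distr M P (%om. G (shift_cfg (- v) (N om)))" if v: "v = 0 \<or> v = w" for v
 proof (rule distr_cong_AE)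
 show "AE om in M. (\<lambda>i\<in>{..<k}. V (zs i + v) om) = G (shift_cfg (- v) (N om))"
 using Tlim[OF v] by eventually_elim (auto simp: G_def fun_eq_iff restrict_def)
 qed (auto intro: VP)
 have "distr M P (%om. G (N om)) = distr (distr M LCFG N) P G"
 by (subst distr_distr) (auto simp: comp_def)
 also have "... = distr (distr M LCFG (%om. shift_cfg (- w) (N om))) P G"
 by (subst law_shift[of "- w"]) (rule refl)
 also have "... = distr M P (%om. G (shift_cfg (- w) (N om)))"
 by (subst distr_distr) (auto simp: comp_def)
 finally have "distr M P (%om. G (shift_cfg (- 0) (N om))) = distr M P (%om. G (shift_cfg (- w) (N om)))"
 by (simp add: shift_cfg_def)
 then have "distr M P (%om. \<lambda>i\<in>{..<k}. V (zs i + 0) om) = distr M P (%om. \<lambda>i\<in>{..<k}. V (zs i + w) om)"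
 unfolding V_eq[of 0, simplified] V_eq[of w, simplified] using V_eq[of 0] V_eq[of w] by simp
 then show "distr M (PiM {..<k} (%_. borel)) (%om. \<lambda>i\<in>{..<k}. V (zs i) om)
 = distr M (PiM {..<k} (%_. borel)) (%om. \<lambda>i\<in>{..<k}. V (zs i + w) om)"
 by (simp add: P_def)
qed

lemma bbs_gker: "bbs (gker w)"
 unfolding bbs_def
proof (intro conjI measurable_gker)
 show "\<exists>B. \<forall>x. norm (gker w x) <= B" using norm_gker_le by blast
 show "\<exists>r. \<forall>x. norm x > r \<longrightarrow> gker w x = 0" by (rule exI[of _ 1]) (auto simp: gker_def)
qed

lemma rescale_translate_tendsto:
 assumes g: "bbs g" and cont: "AE x in lborel. isCont g x" and R: "filterlim R at_top sequentially" and pos: "!!n. R n > 0"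
 shows "(%n. n1 lborel (%x. rescale (R n) g x - rescale (R n) g (x - y))) ----> 0"
proof -
 obtain B r where B: "B >= 0" "r >= 0" "!!x. norm (g x) <= B" "!!x. norm x > r ==> g x = 0"
 using bbsE[OF g] by blast
 have "(%n. ennreal (\<integral>u. norm (g (u + (- y) / of_real (R n)) - g u) \<partial>lborel)) ----> ennreal 0"
 by (intro tendsto_ennrealI tendsto_L1_translate[OF bbs_measurable[OF g] B(3,4) cont] tendsto_divide_of_real_at_top R)
 then show ?thesis unfolding n1_def nn_integral_rescale_translate[OF g pos] by simp
qed

end

context spec_pp
begin

text \<open>After the replacement by a dilated fixed kernel, the increment is a spatial average, and
  the ergodic theorem sends it to the conditional intensity times the integral of
  \<open>gker\<close>.\<close>

lemma cauchy_cut_increment_tendsto: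
 assumes R: "filterlim R at_top sequentially" and pos: "!!n. R n > 0"
 shows "(%n. n1 M (%om. (lin (%x. cauchy_cut (R n) z (- w + x)) om - lin (cauchy_cut (R n) (z + w)) om)
 - (- (of_real pi * cnj w)) * of_real (cond_intensity M N om))) ----> 0"
proof -
 define G where "G n = rescale (R n) (gker w)" for n
 have Gb: "bbs (G n)" for n unfolding G_def by (intro bbs_rescale bbs_gker pos)
 note [measurable] = bbs_measurable[OF Gb]
 define D where "D n x = cauchy_cut (R n) z (- w + x) - cauchy_cut (R n) (z + w) x" for n x
 have i1: "integrable lborel (%x. cauchy_cut (R n) z (- w + x))" for n
 by (intro integrable_lborel_translate integrable_cauchy_cut pos)
 have i2: "integrable lborel (cauchy_cut (R n) (z + w))" for n by (intro integrable_cauchy_cut pos)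
 have Di: "integrable lborel (D n)" for n unfolding D_def[abs_def] by (intro BI_integrable_diff i1 i2)
 have [measurable]: "D n : bmeas borel" for n unfolding D_def[abs_def] by measurable
 \<comment> \<open>Moving the centre of the dilated kernel from \<open>z + w\<close> to the origin
   is a shift by a bounded amount, negligible in \<open>L1\<close> after dilation.\<close>
 have 1: "(%n. n1 lborel (%x. D n x - G n x)) ----> 0"
 proof (rule ennreal_tendsto_0_le[OF always_eventually])
 show "\<forall>n. n1 lborel (%x. D n x - G n x) <= n1 lborel (%x. D n x - G n (x - (z + w))) + n1 lborel (%x. G n (x - (z + w)) - G n x)"
 by (intro allI n1_triangle) measurable
 have "(%n. n1 lborel (%x. G n (x - (z + w)) - G n x)) ----> 0"
 unfolding G_def by (subst n1_minus_commute) (rule rescale_translate_tendsto[OF bbs_gker isCont_gker R pos])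
 from tendsto_add[OF cauchy_cut_increment_L1[OF R, of z w] this]
 show "(%n. n1 lborel (%x. D n x - G n (x - (z + w))) + n1 lborel (%x. G n (x - (z + w)) - G n x)) ----> 0"
 by (simp add: D_def G_def)
 qed
 have 2: "(%n. n1 M (%om. lin (D n) om - lin (G n) om)) ----> 0"
 by (intro n1_lin_diff_tendsto Di bbs_integrable Gb 1)
 have 3: "(%n. n1 M (%om. lin (G n) om - (- (of_real pi * cnj w)) * of_real (cond_intensity M N om))) ----> 0"
 using ergodic[OF bbs_gker isCont_gker R, of w] by (simp add: G_def integral_gker)
 show ?thesis
 proof (rule ennreal_tendsto_0_le[OF always_eventually])
 show "\<forall>n. n1 M (%om. (lin (%x. cauchy_cut (R n) z (- w + x)) om - lin (cauchy_cut (R n) (z + w)) om)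
 - (- (of_real pi * cnj w)) * of_real (cond_intensity M N om))
 <= n1 M (%om. lin (D n) om - lin (G n) om) + n1 M (%om. lin (G n) om - (- (of_real pi * cnj w)) * of_real (cond_intensity M N om))"
 proof
 fix n
 have "n1 M (%om. (lin (%x. cauchy_cut (R n) z (- w + x)) om - lin (cauchy_cut (R n) (z + w)) om)
 - (- (of_real pi * cnj w)) * of_real (cond_intensity M N om))
 = n1 M (%om. lin (D n) om - (- (of_real pi * cnj w)) * of_real (cond_intensity M N om))"
 by (rule n1_cong_AE) (use lin_diff_AE[OF i1[of n] i2[of n]] in eventually_elim, simp add: D_def[abs_def])
 also have "... <= n1 M (%om. lin (D n) om - lin (G n) om) + n1 M (%om. lin (G n) om - (- (of_real pi * cnj w)) * of_real (cond_intensity M N om))"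
 by (rule n1_triangle) measurable
 finally show "n1 M (%om. (lin (%x. cauchy_cut (R n) z (- w + x)) om - lin (cauchy_cut (R n) (z + w)) om)
 - (- (of_real pi * cnj w)) * of_real (cond_intensity M N om)) <= ..." .
 qed
 show "(%n. n1 M (%om. lin (D n) om - lin (G n) om)
 + n1 M (%om. lin (G n) om - (- (of_real pi * cnj w)) * of_real (cond_intensity M N om))) ----> 0"
 using tendsto_add[OF 2 3] by simp
 qed
qed

text \<open>The stationary field is approximated by functionals of the configuration. For the
  configuration shifted by \<open>- w\<close> the cut sum acquires \<open>- pi * c * cnj w\<close>,
  and together with \<open>- pi * c * cnj z\<close> this is the drift at
  \<open>z + w\<close>.\<close>

theorem Psi1_imp_stationary_field:
 assumes P1: "L2_tendsto M (Psi 1 N) Psi1" and P2: "L2_tendsto M (Psi 2 N) Psi2"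
 shows "stationary_field M (%z om. zeta N Psi2 z om - Psi1 om - of_real (pi * cond_intensity M N om) * cnj z)"
proof -
 have [measurable]: "Psi1 : bmeas M" "Psi2 : bmeas M"
 using P1 P2 by (auto simp: L2_tendsto_def L2_def)
 define R where "R n = real (Suc n)" for n
 have R: "filterlim R at_top sequentially"
 by (rule filterlim_at_top_mono[OF filterlim_real_sequentially]) (auto simp: R_def)
 have pos: "R n > 0" for n by (simp add: R_def)
 define c :: "_ => complex" where "c om = of_real (cond_intensity M N om)" for om
 have cm[measurable]: "c : bmeas M" unfolding c_def[abs_def] by measurable
 note [measurable] = bbs_measurable[OF bbs_chi]
 \<comment> \<open>The conditional intensity is given on the probability space; its disc average
   takes its place to make the drift at \<open>z\<close> a functional of the configuration.\<close>
 define F where "F n z l = cauchy_cut (R n) z l - of_real pi * cnj z * rescale (R n) chi l" for n z l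
 have Fm[measurable]: "F n z : bmeas borel" for n z unfolding F_def[abs_def] by measurable
 show ?thesis
 proof (rule stationary_field_of_limits)
 show "(%om. zeta N Psi2 z om - Psi1 om - of_real (pi * cond_intensity M N om) * cnj z) : bmeas M" for z by measurable
 show "(%mu. \<integral>l. F n z l \<partial>pm mu) : bmeas LCFG" for n z by (rule measurable_integral_pm) measurable
 fix z w
 define A where "A n om = lin (cauchy_cut (R n) (z + w)) om - (lin (zeta_kernel (z + w)) om - Psi1 om - (z + w) * Psi2 om)" for n om
 define B where "B n om = (lin (%x. cauchy_cut (R n) z (- w + x)) om - lin (cauchy_cut (R n) (z + w)) om) - (- (of_real pi * cnj w)) * c om" for n om
 define E where "E n om = lin (rescale (R n) chi) om - c om" for n om
 define H where "H n om = lin (%x. rescale (R n) chi (- w + x)) om - lin (rescale (R n) chi) om" for n om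
 have [measurable]: "A n : bmeas M" "B n : bmeas M" "E n : bmeas M" "H n : bmeas M" for n
 unfolding A_def[abs_def] B_def[abs_def] E_def[abs_def] H_def[abs_def] by measurable
 have A0: "(%n. n1 M (A n)) ----> 0" unfolding A_def by (rule cauchy_cut_tendsto[OF P1 P2 R pos])
 have B0: "(%n. n1 M (B n)) ----> 0" unfolding B_def c_def by (rule cauchy_cut_increment_tendsto[OF R pos])
 have E0: "(%n. n1 M (E n)) ----> 0"
 unfolding E_def c_def using ergodic[OF bbs_chi isCont_chi R] by (simp add: integral_chi)
 have ri: "integrable lborel (rescale (R n) chi)" for n by (intro bbs_integrable bbs_rescale bbs_chi pos)
 have ri': "integrable lborel (%x. rescale (R n) chi (- w + x))" for n by (intro integrable_lborel_translate ri)
 have ci: "integrable lborel (%x. cauchy_cut (R n) z (- w + x))" for n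
 by (intro integrable_lborel_translate integrable_cauchy_cut pos)
 have H0: "(%n. n1 M (H n)) ----> 0"
 unfolding H_def
 proof (intro n1_lin_diff_tendsto ri ri')
 show "(%n. n1 lborel (%x. rescale (R n) chi (- w + x) - rescale (R n) chi x)) ----> 0"
 using rescale_translate_tendsto[OF bbs_chi isCont_chi R pos, of w] by (subst n1_minus_commute) (simp add: add.commute)
 qed
 \<comment> \<open>The error of the drift term: \<open>H\<close> is the effect of the translation on
   the disc average, \<open>E\<close> the distance of that average to the conditional
   intensity.\<close>
 define J where "J n om = (- (of_real pi * cnj z)) * (H n om + E n om)" for n om
 have [measurable]: "J n : bmeas M" for n unfolding J_def[abs_def] by measurable
 have HE: "(%n. n1 M (%om. H n om + E n om)) ----> 0"
 proof (rule ennreal_tendsto_0_le[OF always_eventually])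
 show "\<forall>n. n1 M (%om. H n om + E n om) <= n1 M (H n) + n1 M (E n)" by (intro allI n1_add) measurable
 show "(%n. n1 M (H n) + n1 M (E n)) ----> 0" using tendsto_add[OF H0 E0] by simp
 qed
 have J0: "(%n. n1 M (J n)) ----> 0"
 proof -
 have "n1 M (J n) = ennreal (norm (- (of_real pi * cnj z))) * n1 M (%om. H n om + E n om)" for n
 unfolding J_def by (rule n1_cmult) measurable
 then show ?thesis using tendsto_mult_ennreal[OF tendsto_const HE] by simp
 qed
 show "(%n. n1 M (%om. (\<integral>l. F n z l \<partial>pm (shift_cfg (- w) (N om)))
 - (zeta N Psi2 (z + w) om - Psi1 om - of_real (pi * cond_intensity M N om) * cnj (z + w)))) ----> 0"
 proof (rule ennreal_tendsto_0_le[OF always_eventually])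
 show "\<forall>n. n1 M (%om. (\<integral>l. F n z l \<partial>pm (shift_cfg (- w) (N om)))
 - (zeta N Psi2 (z + w) om - Psi1 om - of_real (pi * cond_intensity M N om) * cnj (z + w))) <= n1 M (A n) + (n1 M (B n) + n1 M (J n))"
 proof
 fix n
 have "AE om in M. (\<integral>l. F n z l \<partial>pm (shift_cfg (- w) (N om)))
 - (zeta N Psi2 (z + w) om - Psi1 om - of_real (pi * cond_intensity M N om) * cnj (z + w)) = A n om + (B n om + J n om)"
 using AE_space AE_integrable_pm[OF ci[of n]] AE_integrable_pm[OF ri'[of n]] AE_integrable_pm[OF integrable_zeta_kernel[of "z + w"]]
 proof eventually_elim
 case (elim om)
 have zt: "zeta N Psi2 (z + w) om = lin (zeta_kernel (z + w)) om - Psi2 om * (z + w)"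
 by (rule zeta_eq_lin) (use elim in auto)
 have "(\<integral>l. F n z l \<partial>pm (shift_cfg (- w) (N om))) = (\<integral>l. F n z (- w + l) \<partial>pm (N om))"
 by (rule integral_pm_shift) measurable
 also have "... = (\<integral>l. cauchy_cut (R n) z (- w + l) \<partial>pm (N om)) - (\<integral>l. of_real pi * cnj z * rescale (R n) chi (- w + l) \<partial>pm (N om))"
 unfolding F_def by (rule BI_integral_diff) (use elim in \<open>auto intro: integrable_mult_right\<close>)
 also have "... = lin (%x. cauchy_cut (R n) z (- w + x)) om - of_real pi * cnj z * lin (%x. rescale (R n) chi (- w + x)) om"
 unfolding lin_def integral_mult_right_zero ..
 finally show ?case unfolding zt by (simp add: A_def B_def J_def E_def H_def c_def algebra_simps)
 qed
 then have "n1 M (%om. (\<integral>l. F n z l \<partial>pm (shift_cfg (- w) (N om)))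
 - (zeta N Psi2 (z + w) om - Psi1 om - of_real (pi * cond_intensity M N om) * cnj (z + w))) = n1 M (%om. A n om + (B n om + J n om))"
 by (rule n1_cong_AE)
 also have "... <= n1 M (A n) + n1 M (%om. B n om + J n om)" by (rule n1_add) measurable
 also have "... <= n1 M (A n) + (n1 M (B n) + n1 M (J n))" by (intro add_left_mono n1_add) measurable
 finally show "n1 M (%om. (\<integral>l. F n z l \<partial>pm (shift_cfg (- w) (N om)))
 - (zeta N Psi2 (z + w) om - Psi1 om - of_real (pi * cond_intensity M N om) * cnj (z + w))) <= ..." .
 qed
 show "(%n. n1 M (A n) + (n1 M (B n) + n1 M (J n))) ----> 0"
 using tendsto_add[OF A0 tendsto_add[OF B0 J0]] by simp
 qed
 qed
qed

end

section \<open>Disc averages of a stationary field and the spectral measure near the origin\<close>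

lemma norm_integral_le_nn_integral:
 fixes f :: "'a => complex"
 shows "ennreal (norm (\<integral>x. f x \<partial>K)) <= (\<integral>\<^sup>+x. ennreal (norm (f x)) \<partial>K)"
 by (cases "integrable K f") (simp_all add: integral_norm_bound_ennreal not_integrable_integral_eq)

lemma ennreal_add_sq_le: "(x + y)\<^sup>2 <= 4 * x\<^sup>2 + 4 * (y::ennreal)\<^sup>2"
proof (cases "x <= y")
 case True
 then have "(x + y)\<^sup>2 <= (2 * y)\<^sup>2" by (intro power_mono) (auto simp: mult_2 add_right_mono)
 then show ?thesis by (simp add: power_mult_distrib add_increasing)
next
 case False
 then have "(x + y)\<^sup>2 <= (2 * x)\<^sup>2" by (intro power_mono) (auto simp: mult_2 add_left_mono)
 then show ?thesis by (simp add: power_mult_distrib add_increasing2)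
qed

context stat_pp
begin

definition field :: "('w => complex) => ('w => complex) => complex => 'w => complex" where
 "field Psi2 Psi0 z om = zeta N Psi2 z om - Psi0 om - of_real (pi * cond_intensity M N om) * cnj z"

lemma measurable_field [measurable (raw)]:
 assumes [measurable]: "Psi2 : bmeas M" "Psi0 : bmeas M"
 and f[measurable]: "f : measurable K M" and g[measurable]: "g : bmeas K"
 shows "(%x. field Psi2 Psi0 (g x) (f x)) : bmeas K"
proof -
 have 1: "(%x. \<integral>l. zk1 (g x) l \<partial>pm (N (f x))) : bmeas K"
 by (rule measurable_integral_pm) measurable
 have 2: "(%x. \<integral>l. zk2 (g x) l \<partial>pm (N (f x))) : bmeas K"
 by (rule measurable_integral_pm) measurable
 note [measurable] = 1 2
 have "(%x. (\<integral>l. zk1 (g x) l \<partial>pm (N (f x))) + (\<integral>l. zk2 (g x) l \<partial>pm (N (f x))) - Psi2 (f x) * g x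
 - Psi0 (f x) - of_real (pi * cond_intensity M N (f x)) * cnj (g x)) : bmeas K"
 by measurable
 then show ?thesis
 by (rule measurable_cong[THEN iffD1, rotated])
 (simp add: field_def zeta_eq lin_def measurable_space[OF f])
qed

text \<open>The second moment of an integral over a disc is a double integral of such pair
  expectations, so invariance of the laws of pairs is all that is needed from stationarity.\<close>

lemma field_two_point:
 assumes [measurable]: "Psi2 : bmeas M" "Psi0 : bmeas M"
 and st: "stationary_field M (field Psi2 Psi0)"
 shows "(\<integral>\<^sup>+om. ennreal (norm (field Psi2 Psi0 (a + z) om)) * ennreal (norm (field Psi2 Psi0 (a + z') om)) \<partial>M)
 = (\<integral>\<^sup>+om. ennreal (norm (field Psi2 Psi0 z om)) * ennreal (norm (field Psi2 Psi0 z' om)) \<partial>M)"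
proof -
 define P where "P = PiM {..<2::nat} (%_. borel :: complex measure)"
 define zs where "zs i = (if i = 0 then z else z')" for i :: nat
 define g where "g x = ennreal (norm (x 0)) * ennreal (norm (x (1::nat)))" for x :: "nat => complex"
 have c: "(%x. x i) : measurable P borel" if "i < 2" for i
 unfolding P_def by (rule measurable_component_singleton) (use that in auto)
 have g[measurable]: "g : bmeas P"
 unfolding g_def[abs_def]
 by (intro borel_measurable_times_ennreal measurable_compose[OF measurable_compose[OF c borel_measurable_norm] measurable_ennreal]) auto
 have f[measurable]: "(%om. \<lambda>i\<in>{..<2::nat}. field Psi2 Psi0 (zs i + w) om) : measurable M P" for w
 unfolding P_def by measurable
 have "distr M P (%om. \<lambda>i\<in>{..<2}. field Psi2 Psi0 (zs i + 0) om) = distr M P (%om. \<lambda>i\<in>{..<2}. field Psi2 Psi0 (zs i + a) om)"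
 using st unfolding stationary_field_def P_def by simp
 then have eq: "(\<integral>\<^sup>+x. g x \<partial>distr M P (%om. \<lambda>i\<in>{..<2}. field Psi2 Psi0 (zs i + 0) om)) = (\<integral>\<^sup>+x. g x \<partial>distr M P (%om. \<lambda>i\<in>{..<2}. field Psi2 Psi0 (zs i + a) om))"
 by simp
 have nd: "(\<integral>\<^sup>+x. g x \<partial>distr M P (%om. \<lambda>i\<in>{..<2}. field Psi2 Psi0 (zs i + w) om)) = (\<integral>\<^sup>+om. g (\<lambda>i\<in>{..<2}. field Psi2 Psi0 (zs i + w) om) \<partial>M)" for w
 by (rule nn_integral_distr[OF f]) (simp add: g)
 show ?thesis using eq unfolding nd by (simp add: g_def zs_def add.commute)
qed

text \<open>The square of a simple pole is not integrable in the plane, so a pointwise second moment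
  of the field cannot be expected. Integrating the modulus over a unit disc first makes the pole
  harmless.\<close>

definition local_mass :: "('w => complex) => ('w => complex) => complex => 'w => ennreal" where
 "local_mass Psi2 Psi0 a om = (\<integral>\<^sup>+z. indicator (cball 0 1) z * ennreal (norm (field Psi2 Psi0 (a + z) om)) \<partial>lborel)"

lemma measurable_local_mass [measurable (raw)]:
 assumes [measurable]: "Psi2 : bmeas M" "Psi0 : bmeas M"
 "f : measurable K M" "g : bmeas K"
 shows "(%x. local_mass Psi2 Psi0 (g x) (f x)) : bmeas K"
 unfolding local_mass_def by measurable

text \<open>The square of the integral is expanded into a double integral over two points of the
  disc, and each pair expectation is independent of the centre.\<close>

lemma local_mass_sq_const:
 assumes [measurable]: "Psi2 : bmeas M" "Psi0 : bmeas M"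
 and st: "stationary_field M (field Psi2 Psi0)"
 shows "(\<integral>\<^sup>+om. (local_mass Psi2 Psi0 a om)\<^sup>2 \<partial>M) = (\<integral>\<^sup>+om. (local_mass Psi2 Psi0 0 om)\<^sup>2 \<partial>M)"
proof -
 interpret L: sigma_finite_measure "lborel :: complex measure" by (rule sigma_finite_lborel)
 interpret P: pair_sigma_finite M "lborel :: complex measure" ..
 have "(\<integral>\<^sup>+om. (local_mass Psi2 Psi0 a om)\<^sup>2 \<partial>M)
 = (\<integral>\<^sup>+z. (\<integral>\<^sup>+z'. (indicator (cball 0 1) z * indicator (cball 0 1) z') * (\<integral>\<^sup>+om. ennreal (norm (field Psi2 Psi0 z om)) * ennreal (norm (field Psi2 Psi0 z' om)) \<partial>M) \<partial>lborel) \<partial>lborel)" for a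
 proof -
 define h where "h z om = indicator (cball 0 1) z * ennreal (norm (field Psi2 Psi0 (a + z) om))" for z om
 have hm[measurable (raw)]: "(%x. h (g x) (f x)) : bmeas K"
 if [measurable]: "f : measurable K M" "g : bmeas K" for f g and K :: "'k measure"
 unfolding h_def by measurable
 have hm1[measurable]: "(%z. h z om) : bmeas borel" if "om : space M" for om
 unfolding h_def using that by measurable
 have "(\<integral>\<^sup>+om. (local_mass Psi2 Psi0 a om)\<^sup>2 \<partial>M) = (\<integral>\<^sup>+om. (\<integral>\<^sup>+z. h z om * local_mass Psi2 Psi0 a om \<partial>lborel) \<partial>M)"
 proof (rule nn_integral_cong)
 fix om assume om: "om : space M"
 have "(\<integral>\<^sup>+z. h z om * local_mass Psi2 Psi0 a om \<partial>lborel) = (\<integral>\<^sup>+z. h z om \<partial>lborel) * local_mass Psi2 Psi0 a om"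
 by (rule nn_integral_multc) (use hm1[OF om] in simp)
 then show "(local_mass Psi2 Psi0 a om)\<^sup>2 = (\<integral>\<^sup>+z. h z om * local_mass Psi2 Psi0 a om \<partial>lborel)"
 by (simp add: power2_eq_square local_mass_def h_def)
 qed
 also have "... = (\<integral>\<^sup>+z. (\<integral>\<^sup>+om. h z om * local_mass Psi2 Psi0 a om \<partial>M) \<partial>lborel)"
 proof (rule P.Fubini'[symmetric])
 have "(%p. h (snd p) (fst p) * local_mass Psi2 Psi0 a (fst p)) : bmeas (M \<Otimes>\<^sub>M lborel)"
 unfolding h_def by measurable
 then show "(%(om, z). h z om * local_mass Psi2 Psi0 a om) : bmeas (M \<Otimes>\<^sub>M lborel)"
 by (simp add: case_prod_unfold)
 qed
 also have "... = (\<integral>\<^sup>+z. (\<integral>\<^sup>+om. (\<integral>\<^sup>+z'. h z om * h z' om \<partial>lborel) \<partial>M) \<partial>lborel)"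
 proof (intro nn_integral_cong)
 fix z om assume om: "om : space M"
 show "h z om * local_mass Psi2 Psi0 a om = (\<integral>\<^sup>+z'. h z om * h z' om \<partial>lborel)"
 by (subst nn_integral_cmult) (use hm1[OF om] in \<open>simp_all add: local_mass_def h_def\<close>)
 qed
 also have "... = (\<integral>\<^sup>+z. (\<integral>\<^sup>+z'. (\<integral>\<^sup>+om. h z om * h z' om \<partial>M) \<partial>lborel) \<partial>lborel)"
 proof (intro nn_integral_cong P.Fubini'[symmetric])
 fix z :: complex
 have "(%p. h z (fst p) * h (snd p) (fst p)) : bmeas (M \<Otimes>\<^sub>M lborel)" unfolding h_def by measurable
 then show "(%(om, z'). h z om * h z' om) : bmeas (M \<Otimes>\<^sub>M lborel)" by (simp add: case_prod_unfold)
 qed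
 also have "... = (\<integral>\<^sup>+z. (\<integral>\<^sup>+z'. (indicator (cball 0 1) z * indicator (cball 0 1) z') * (\<integral>\<^sup>+om. ennreal (norm (field Psi2 Psi0 z om)) * ennreal (norm (field Psi2 Psi0 z' om)) \<partial>M) \<partial>lborel) \<partial>lborel)"
 proof (intro nn_integral_cong)
 fix z z' :: complex
 have "(\<integral>\<^sup>+om. h z om * h z' om \<partial>M) = (\<integral>\<^sup>+om. (indicator (cball 0 1) z * indicator (cball 0 1) z') * (ennreal (norm (field Psi2 Psi0 (a + z) om)) * ennreal (norm (field Psi2 Psi0 (a + z') om))) \<partial>M)"
 by (rule nn_integral_cong) (simp add: h_def mult_ac)
 also have "... = (indicator (cball 0 1) z * indicator (cball 0 1) z') * (\<integral>\<^sup>+om. ennreal (norm (field Psi2 Psi0 (a + z) om)) * ennreal (norm (field Psi2 Psi0 (a + z') om)) \<partial>M)"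
 by (rule nn_integral_cmult) measurable
 finally show "(\<integral>\<^sup>+om. h z om * h z' om \<partial>M) = (indicator (cball 0 1) z * indicator (cball 0 1) z') * (\<integral>\<^sup>+om. ennreal (norm (field Psi2 Psi0 z om)) * ennreal (norm (field Psi2 Psi0 z' om)) \<partial>M)"
 unfolding field_two_point[OF assms(1,2) st] .
 qed
 finally show ?thesis .
 qed
 from this[of a] this[of 0] show ?thesis by simp
qed

lemma nn_integral_zeta_kernel_disc_pm:
 assumes R: "R >= 1" and om: "om : space M"
 and C: "!!l. (\<integral>\<^sup>+z\<in>cball 0 R. ennreal (norm (zeta_kernel z l)) \<partial>lborel) <= ennreal (C * decay l)"
 shows "(\<integral>\<^sup>+z. indicator (cball 0 R) z * (\<integral>\<^sup>+l. ennreal (norm (zeta_kernel z l)) \<partial>pm (N om)) \<partial>lborel)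
 <= (\<integral>\<^sup>+l. ennreal (C * decay l) \<partial>pm (N om))"
proof -
 interpret L: sigma_finite_measure "lborel :: complex measure" by (rule sigma_finite_lborel)
 interpret p: sigma_finite_measure "pm (N om)" by (rule sigma_finite_pm[OF lfN[OF om]])
 interpret P: pair_sigma_finite "pm (N om)" "lborel :: complex measure" ..
 have "(\<integral>\<^sup>+z. indicator (cball 0 R) z * (\<integral>\<^sup>+l. ennreal (norm (zeta_kernel z l)) \<partial>pm (N om)) \<partial>lborel)
 = (\<integral>\<^sup>+z. (\<integral>\<^sup>+l. ennreal (norm (zeta_kernel z l)) * indicator (cball 0 R) z \<partial>pm (N om)) \<partial>lborel)"
 by (intro nn_integral_cong) (subst nn_integral_multc, auto simp: mult.commute)
 also have "... = (\<integral>\<^sup>+l. (\<integral>\<^sup>+z. ennreal (norm (zeta_kernel z l)) * indicator (cball 0 R) z \<partial>lborel) \<partial>pm (N om))"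
 by (rule P.Fubini') measurable
 also have "... <= (\<integral>\<^sup>+l. ennreal (C * decay l) \<partial>pm (N om))" by (intro nn_integral_mono C)
 finally show ?thesis .
qed

text \<open>Valid without summability: a divergent sum contributes 0 on the left and infinity on the
  right.\<close>

lemma norm_zeta_le:
 assumes om: "om : space M"
 shows "ennreal (norm (lin (zk1 z) om + lin (zk2 z) om)) <= (\<integral>\<^sup>+l. ennreal (norm (zeta_kernel z l)) \<partial>pm (N om))"
proof -
 have "ennreal (norm (lin (zk1 z) om + lin (zk2 z) om)) <= ennreal (norm (lin (zk1 z) om)) + ennreal (norm (lin (zk2 z) om))"
 by (simp add: ennreal_plus[symmetric] norm_triangle_ineq ennreal_leI del: ennreal_plus)
 also have "... <= (\<integral>\<^sup>+l. ennreal (norm (zk1 z l)) \<partial>pm (N om)) + (\<integral>\<^sup>+l. ennreal (norm (zk2 z l)) \<partial>pm (N om))"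
 unfolding lin_def by (intro add_mono norm_integral_le_nn_integral)
 also have "... = (\<integral>\<^sup>+l. ennreal (norm (zk1 z l)) + ennreal (norm (zk2 z l)) \<partial>pm (N om))"
 by (rule nn_integral_add[symmetric]) measurable
 also have "... = (\<integral>\<^sup>+l. ennreal (norm (zeta_kernel z l)) \<partial>pm (N om))"
 by (rule nn_integral_cong) (auto simp: zk1_def zk2_def zeta_kernel_def)
 finally show ?thesis .
qed

lemma local_mass_0_le:
 assumes om: "om : space M"
 and C: "C >= 0" "!!l. (\<integral>\<^sup>+z\<in>cball 0 1. ennreal (norm (zeta_kernel z l)) \<partial>lborel) <= ennreal (C * decay l)"
 shows "local_mass Psi2 Psi0 0 om <= ennreal C * (\<integral>\<^sup>+l. ennreal (decay l) \<partial>pm (N om))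
 + (ennreal pi * ennreal (norm (Psi2 om)) + (ennreal pi * ennreal (norm (Psi0 om)) + ennreal pi * ennreal (norm (of_real (pi * cond_intensity M N om) :: complex))))"
proof -
 define b where "b = norm (Psi2 om) + (norm (Psi0 om) + norm (of_real (pi * cond_intensity M N om) :: complex))"
 define Zt where "Zt z = (\<integral>\<^sup>+l. ennreal (norm (zeta_kernel z l)) \<partial>pm (N om))" for z
 have Zm[measurable]: "Zt : bmeas borel"
 unfolding Zt_def[abs_def]
 proof (rule measurable_nn_integral_pm[where K="%_. N om"])
 show "(%_. N om) : borel \<rightarrow>\<^sub>M LCFG" using om by (intro measurable_const) (simp add: space_LCFG LF_def lfN)
 qed measurable
 have b0: "b >= 0" by (simp add: b_def)
 have "local_mass Psi2 Psi0 0 om <= (\<integral>\<^sup>+z. indicator (cball 0 1) z * Zt z + ennreal b * indicator (cball 0 1) z \<partial>lborel)"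
 unfolding local_mass_def
 proof (rule nn_integral_mono)
 fix z :: complex
 show "indicator (cball 0 1) z * ennreal (norm (field Psi2 Psi0 (0 + z) om)) <= indicator (cball 0 1) z * Zt z + ennreal b * indicator (cball 0 1) z"
 proof (cases "z : cball 0 1")
 case True
 have "norm (field Psi2 Psi0 z om) = norm ((lin (zk1 z) om + lin (zk2 z) om) + (- (Psi2 om * z) + (- Psi0 om + - (of_real (pi * cond_intensity M N om) * cnj z))))"
 by (simp add: field_def zeta_eq[OF om] algebra_simps)
 also have "... <= norm (lin (zk1 z) om + lin (zk2 z) om) + (norm (- (Psi2 om * z)) + (norm (- Psi0 om) + norm (- (of_real (pi * cond_intensity M N om) * cnj z))))"
 by (intro order_trans[OF norm_triangle_ineq] add_left_mono) (rule order_refl)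
 also have "... <= norm (lin (zk1 z) om + lin (zk2 z) om) + b"
 unfolding b_def norm_minus_cancel norm_mult complex_mod_cnj using True
 by (intro add_mono order_refl mult_right_le_one_le) auto
 finally have "ennreal (norm (field Psi2 Psi0 z om)) <= ennreal (norm (lin (zk1 z) om + lin (zk2 z) om) + b)" by (rule ennreal_leI)
 also have "... = ennreal (norm (lin (zk1 z) om + lin (zk2 z) om)) + ennreal b" using b0 by (intro ennreal_plus) auto
 also have "... <= Zt z + ennreal b" unfolding Zt_def by (intro add_right_mono norm_zeta_le om)
 finally show ?thesis using True by simp
 qed simp
 qed
 also have "... = (\<integral>\<^sup>+z. indicator (cball 0 1) z * Zt z \<partial>lborel) + (\<integral>\<^sup>+z. ennreal b * indicator (cball (0::complex) 1) z \<partial>lborel)"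
 by (rule nn_integral_add) measurable
 also have "(\<integral>\<^sup>+z. ennreal b * indicator (cball (0::complex) 1) z \<partial>lborel) = ennreal pi * ennreal b"
 by (simp add: nn_integral_cmult emeasure_disc mult.commute)
 also have "(\<integral>\<^sup>+z. indicator (cball 0 1) z * Zt z \<partial>lborel) <= (\<integral>\<^sup>+l. ennreal (C * decay l) \<partial>pm (N om))"
 unfolding Zt_def by (rule nn_integral_zeta_kernel_disc_pm[OF _ om C(2)]) simp
 also have "... = ennreal C * (\<integral>\<^sup>+l. ennreal (decay l) \<partial>pm (N om))"
 using C(1) less_imp_le[OF decay_pos] by (subst nn_integral_cmult[symmetric]) (auto simp: ennreal_mult)
 finally show ?thesis by (simp add: b_def distrib_left add_right_mono)
qed

end

context spec_pp
begin

text \<open>At the centre 0 the compensating terms are bounded, and the points enter only through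
  the sum of \<open>decay\<close>, which has a second moment. Stationarity then moves the bound to
  every other centre.\<close>

lemma local_mass_sq_finite:
 assumes [measurable]: "Psi2 : bmeas M" "Psi0 : bmeas M"
 and f: "nsq M Psi2 < \<infinity>" "nsq M Psi0 < \<infinity>"
 shows "(\<integral>\<^sup>+om. (local_mass Psi2 Psi0 0 om)\<^sup>2 \<partial>M) < \<infinity>"
proof -
 obtain C where C: "C >= 0" "!!l. (\<integral>\<^sup>+z\<in>cball 0 1. ennreal (norm (zeta_kernel z l)) \<partial>lborel) <= ennreal (C * decay l)"
 using nn_integral_zeta_kernel_disc[of 1] by auto
 define X where "X om = ennreal C * (\<integral>\<^sup>+l. ennreal (decay l) \<partial>pm (N om))" for om
 define Y where "Y f om = ennreal pi * ennreal (norm (f om))" for f :: "'a => complex" and om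
 define c :: "_ => complex" where "c om = of_real (pi * cond_intensity M N om)" for om
 have [measurable]: "X : bmeas M" unfolding X_def by measurable
 have [measurable]: "c : bmeas M" unfolding c_def by measurable
 have Ym[measurable]: "Y f : bmeas M" if [measurable]: "f : bmeas M" for f unfolding Y_def by measurable
 have Xf: "(\<integral>\<^sup>+om. (X om)\<^sup>2 \<partial>M) < \<infinity>"
 proof -
 have "(\<integral>\<^sup>+om. (X om)\<^sup>2 \<partial>M) = (ennreal C)\<^sup>2 * (\<integral>\<^sup>+om. (\<integral>\<^sup>+l. ennreal (decay l) \<partial>pm (N om))\<^sup>2 \<partial>M)"
 unfolding X_def power_mult_distrib by (rule nn_integral_cmult) measurable
 then show ?thesis using nn_integral_decay_sq by (simp add: ennreal_mult_less_top power2_eq_square)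
 qed
 have Yf: "(\<integral>\<^sup>+om. (Y f om)\<^sup>2 \<partial>M) < \<infinity>" if [measurable]: "f : bmeas M" and "nsq M f < \<infinity>" for f
 proof -
 have "(\<integral>\<^sup>+om. (Y f om)\<^sup>2 \<partial>M) = (ennreal pi)\<^sup>2 * nsq M f"
 unfolding Y_def power_mult_distrib nsq_def
 by (subst nn_integral_cmult[symmetric], measurable) (simp add: ennreal_power)
 then show ?thesis using that by (simp add: ennreal_mult_less_top power2_eq_square)
 qed
 have cf: "nsq M c < \<infinity>"
 proof -
 have "nsq M c = ennreal ((norm (of_real pi :: complex))\<^sup>2) * nsq M (%om. of_real (cond_intensity M N om))"
 unfolding c_def of_real_mult by (rule nsq_cmult) measurable
 then show ?thesis using nsq_cond_intensity by (simp add: ennreal_mult_less_top)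
 qed
 have "(\<integral>\<^sup>+om. (local_mass Psi2 Psi0 0 om)\<^sup>2 \<partial>M)
 <= (\<integral>\<^sup>+om. 4 * (X om)\<^sup>2 + 4 * (4 * (Y Psi2 om)\<^sup>2 + 4 * (4 * (Y Psi0 om)\<^sup>2 + 4 * (Y c om)\<^sup>2)) \<partial>M)"
 proof (rule nn_integral_mono)
 fix om assume om: "om : space M"
 have "(local_mass Psi2 Psi0 0 om)\<^sup>2 <= (X om + (Y Psi2 om + (Y Psi0 om + Y c om)))\<^sup>2"
 unfolding X_def Y_def c_def by (intro power_mono local_mass_0_le om C) simp
 also have "... <= 4 * (X om)\<^sup>2 + 4 * (Y Psi2 om + (Y Psi0 om + Y c om))\<^sup>2" by (rule ennreal_add_sq_le)
 also have "... <= 4 * (X om)\<^sup>2 + 4 * (4 * (Y Psi2 om)\<^sup>2 + 4 * (Y Psi0 om + Y c om)\<^sup>2)"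
 by (intro add_left_mono mult_left_mono ennreal_add_sq_le) simp
 also have "... <= 4 * (X om)\<^sup>2 + 4 * (4 * (Y Psi2 om)\<^sup>2 + 4 * (4 * (Y Psi0 om)\<^sup>2 + 4 * (Y c om)\<^sup>2))"
 by (intro add_left_mono mult_left_mono ennreal_add_sq_le) simp_all
 finally show "(local_mass Psi2 Psi0 0 om)\<^sup>2 <= ..." .
 qed
 also have "... = 4 * (\<integral>\<^sup>+om. (X om)\<^sup>2 \<partial>M) + 4 * (4 * (\<integral>\<^sup>+om. (Y Psi2 om)\<^sup>2 \<partial>M) + 4 * (4 * (\<integral>\<^sup>+om. (Y Psi0 om)\<^sup>2 \<partial>M) + 4 * (\<integral>\<^sup>+om. (Y c om)\<^sup>2 \<partial>M)))"
 by (simp add: nn_integral_add nn_integral_cmult)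
 also have "... < \<infinity>"
 using Xf Yf[OF _ f(1)] Yf[OF _ f(2)] Yf[OF _ cf] by (simp add: ennreal_mult_less_top)
 finally show ?thesis .
qed

text \<open>Each point of the disc is covered by the unit discs whose centres lie within distance 1
  of it; these centres form a set of area \<open>pi\<close> inside the disc of radius
  \<open>R + 1\<close>.\<close>

lemma disc_mass_le:
 assumes [measurable]: "Psi2 : bmeas M" "Psi0 : bmeas M" and om: "om : space M" and R: "R >= 0"
 shows "ennreal pi * (\<integral>\<^sup>+z. indicator (cball 0 R) z * ennreal (norm (field Psi2 Psi0 z om)) \<partial>lborel)
 <= (\<integral>\<^sup>+a. indicator (cball 0 (R + 1)) a * local_mass Psi2 Psi0 a om \<partial>lborel)"
proof -
 define v where "v z = ennreal (norm (field Psi2 Psi0 z om))" for z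
 have vm[measurable]: "v : bmeas borel"
 unfolding v_def[abs_def] using om by measurable
 have ind: "indicator (cball 0 1) (y - a) = (indicator {..1} (norm (y - a)) :: ennreal)" for y a :: complex by (simp add: indicator_def)
 have lm: "local_mass Psi2 Psi0 a om = (\<integral>\<^sup>+y. indicator {..1} (norm (y - a)) * v y \<partial>lborel)" for a
 proof -
 have "(\<integral>\<^sup>+y. indicator {..1} (norm (y - a)) * v y \<partial>lborel) = (\<integral>\<^sup>+z. indicator {..1} (norm (a + z - a)) * v (a + z) \<partial>lborel)"
 by (rule nn_integral_lborel_translate[symmetric, of "%y. indicator {..1} (norm (y - a)) * v y"]) measurable
 then show ?thesis by (simp add: local_mass_def v_def indicator_def)
 qed
 have "ennreal pi * (\<integral>\<^sup>+z. indicator (cball 0 R) z * v z \<partial>lborel) = (\<integral>\<^sup>+y. ennreal pi * (indicator (cball 0 R) y * v y) \<partial>lborel)"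
 by (rule nn_integral_cmult[symmetric]) measurable
 also have "... <= (\<integral>\<^sup>+y. (\<integral>\<^sup>+a. indicator (cball 0 (R + 1)) a * (indicator {..1} (norm (y - a)) * v y) \<partial>lborel) \<partial>lborel)"
 proof (rule nn_integral_mono)
 fix y :: complex
 show "ennreal pi * (indicator (cball 0 R) y * v y) <= (\<integral>\<^sup>+a. indicator (cball 0 (R + 1)) a * (indicator {..1} (norm (y - a)) * v y) \<partial>lborel)"
 proof (cases "norm y <= R")
 case True
 have "ennreal pi * v y = (\<integral>\<^sup>+a. indicator (cball y 1) a * v y \<partial>lborel)"
 by (simp add: nn_integral_multc emeasure_disc)
 also have "... <= (\<integral>\<^sup>+a. indicator (cball 0 (R + 1)) a * (indicator {..1} (norm (y - a)) * v y) \<partial>lborel)"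
 proof (rule nn_integral_mono)
 fix a :: complex
 have "norm a <= R + 1" if "norm (y - a) <= 1" using that True norm_triangle_ineq2[of a y] by (simp add: norm_minus_commute)
 then show "indicator (cball y 1) a * v y <= indicator (cball 0 (R + 1)) a * (indicator {..1} (norm (y - a)) * v y)"
 by (auto simp: indicator_def dist_norm)
 qed
 finally show ?thesis using True by simp
 qed simp
 qed
 also have "... = (\<integral>\<^sup>+a. (\<integral>\<^sup>+y. indicator (cball 0 (R + 1)) a * (indicator {..1} (norm (y - a)) * v y) \<partial>lborel) \<partial>lborel)"
 by (rule lborel_pair.Fubini') measurable
 also have "... = (\<integral>\<^sup>+a. indicator (cball 0 (R + 1)) a * local_mass Psi2 Psi0 a om \<partial>lborel)"
 unfolding lm by (intro nn_integral_cong nn_integral_cmult) measurable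
 finally show ?thesis by (simp add: v_def)
qed

definition disc_average :: "(_ => complex) => (_ => complex) => real => _ => complex" where
 "disc_average Psi2 Psi0 R om = (\<integral>z. indicator (cball 0 R) z *\<^sub>R field Psi2 Psi0 z om \<partial>lborel) / of_real (pi * R\<^sup>2)"

lemma measurable_disc_average [measurable]:
 assumes [measurable]: "Psi2 : bmeas M" "Psi0 : bmeas M"
 shows "disc_average Psi2 Psi0 R : bmeas M"
 unfolding disc_average_def[abs_def] by measurable

text \<open>The average over a large disc is dominated by an average of local masses, all of which
  have the same second moment, so the bound does not depend on \<open>R\<close>.\<close>

lemma nsq_disc_average_le:
 assumes [measurable]: "Psi2 : bmeas M" "Psi0 : bmeas M"
 and st: "stationary_field M (field Psi2 Psi0)" and R: "R >= 1"
 shows "nsq M (disc_average Psi2 Psi0 R) <= 16 * (\<integral>\<^sup>+om. (local_mass Psi2 Psi0 0 om)\<^sup>2 \<partial>M)"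
proof -
 define Q where "Q = (\<integral>\<^sup>+om. (local_mass Psi2 Psi0 0 om)\<^sup>2 \<partial>M)"
 define I where "I om = (\<integral>\<^sup>+a. indicator (cball 0 (R + 1)) a * local_mass Psi2 Psi0 a om \<partial>lborel)" for om
 define k where "k = 1 / (pi * (pi * R\<^sup>2))"
 have k: "k > 0" using R by (simp add: k_def)
 have Im[measurable]: "I : bmeas M" unfolding I_def[abs_def] by measurable
 have IQ: "(\<integral>\<^sup>+om. (I om)\<^sup>2 \<partial>M) <= (\<integral>\<^sup>+a. indicator (cball (0::complex) (R + 1)) a \<partial>lborel)\<^sup>2 * Q"
 unfolding I_def
 proof (rule nn_integral_weighted_sq_le)
 show "sigma_finite_measure M" by unfold_locales
 show "(\<integral>\<^sup>+om. (local_mass Psi2 Psi0 a om)\<^sup>2 \<partial>M) <= Q" for a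
 unfolding Q_def local_mass_sq_const[OF assms(1,2) st, of a] by simp
 qed measurable
 have pt: "ennreal (norm (disc_average Psi2 Psi0 R om)) <= ennreal k * I om" if om: "om : space M" for om
 proof -
 have "ennreal (norm (disc_average Psi2 Psi0 R om)) = ennreal (1 / (pi * R\<^sup>2)) * ennreal (norm (\<integral>z. indicator (cball 0 R) z *\<^sub>R field Psi2 Psi0 z om \<partial>lborel))"
 by (simp add: disc_average_def norm_divide norm_mult norm_power ennreal_mult[symmetric])
 also have "... <= ennreal (1 / (pi * R\<^sup>2)) * (\<integral>\<^sup>+z. ennreal (norm (indicator (cball 0 R) z *\<^sub>R field Psi2 Psi0 z om)) \<partial>lborel)"
 by (intro mult_left_mono norm_integral_le_nn_integral) simp
 also have "(\<integral>\<^sup>+z. ennreal (norm (indicator (cball 0 R) z *\<^sub>R field Psi2 Psi0 z om)) \<partial>lborel) = (\<integral>\<^sup>+z. indicator (cball 0 R) z * ennreal (norm (field Psi2 Psi0 z om)) \<partial>lborel)"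
 by (rule nn_integral_cong) (auto simp: indicator_def)
 also have "ennreal (1 / (pi * R\<^sup>2)) * ... = ennreal k * (ennreal pi * ...)"
 by (simp add: mult.assoc[symmetric] ennreal_mult[symmetric] k_def)
 also have "... <= ennreal k * I om"
 unfolding I_def using R by (intro mult_left_mono disc_mass_le om) auto
 finally show ?thesis .
 qed
 have "nsq M (disc_average Psi2 Psi0 R) <= (\<integral>\<^sup>+om. (ennreal k)\<^sup>2 * (I om)\<^sup>2 \<partial>M)"
 unfolding nsq_def
 proof (rule nn_integral_mono)
 fix om assume "om : space M"
 then have "(ennreal (norm (disc_average Psi2 Psi0 R om)))\<^sup>2 <= (ennreal k * I om)\<^sup>2" by (intro power_mono pt) auto
 then show "ennreal ((norm (disc_average Psi2 Psi0 R om))\<^sup>2) <= (ennreal k)\<^sup>2 * (I om)\<^sup>2"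
 by (simp add: ennreal_power power_mult_distrib)
 qed
 also have "... = (ennreal k)\<^sup>2 * (\<integral>\<^sup>+om. (I om)\<^sup>2 \<partial>M)" by (rule nn_integral_cmult) measurable
 also have "... <= (ennreal k)\<^sup>2 * ((\<integral>\<^sup>+a. indicator (cball (0::complex) (R + 1)) a \<partial>lborel)\<^sup>2 * Q)" by (intro mult_left_mono IQ) simp
 also have "(\<integral>\<^sup>+a. indicator (cball (0::complex) (R + 1)) a \<partial>lborel) = ennreal (pi * (R + 1)\<^sup>2)"
 using R by (simp add: emeasure_disc)
 also have "(ennreal k)\<^sup>2 * ((ennreal (pi * (R + 1)\<^sup>2))\<^sup>2 * Q) = (ennreal (k * (pi * (R + 1)\<^sup>2)))\<^sup>2 * Q"
 using k by (simp add: ennreal_mult power_mult_distrib mult.assoc)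
 also have "... <= (ennreal 4)\<^sup>2 * Q"
 proof (intro mult_right_mono power_mono ennreal_leI)
 \<comment> \<open>Replacing \<open>R\<close> by \<open>R + 1\<close> costs at most a factor 4 in
   the area once \<open>R\<close> is at least 1; its square is the 16 in the statement.\<close>
 have "(R + 1)\<^sup>2 <= (2 * R)\<^sup>2" using R by (intro power_mono) auto
 also have "... <= 4 * pi * R\<^sup>2" using pi_gt3 R by (simp add: power_mult_distrib mult_right_mono)
 finally have "(R + 1)\<^sup>2 / (pi * R\<^sup>2) <= 4" using R by (simp add: field_simps)
 moreover have "k * (pi * (R + 1)\<^sup>2) = (R + 1)\<^sup>2 / (pi * R\<^sup>2)" by (simp add: k_def)
 ultimately show "k * (pi * (R + 1)\<^sup>2) <= 4" by simp
 qed auto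
 finally show ?thesis by (simp add: Q_def power2_eq_square)
qed

end

text \<open>The average of \<open>zeta_kernel z l\<close> over \<open>z\<close> in the disc of
  radius \<open>R\<close>: the Cauchy kernel gives the last term, and the linear term averages to
  0.\<close>

definition mean_kernel :: "real => complex => complex" where
 "mean_kernel R l = (if norm l < 1 then 0 else 1 / l) - of_real (1 - theta R l) / l"

text \<open>The difference of the averaged kernels for the radii \<open>R\<close> and 1. The
  compensating \<open>1 / l\<close> cancels, which leaves a bounded function of bounded support, as
  the spectral identity requires.\<close>

definition theta_kernel :: "real => complex => complex" where
 "theta_kernel R x = of_real (theta R x - theta 1 x) / x"

lemma theta_eq_min: "R > 0 ==> 1 - theta R x = (min R (norm x))\<^sup>2 / R\<^sup>2"
 by (cases "norm x <= R") (auto simp: theta_def min_def max_def field_simps power_mono not_le dest: power_strict_mono)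

lemma integral_zeta_kernel_disc:
 assumes R: "R >= 1"
 shows "(\<integral>z. indicator (cball 0 R) z *\<^sub>R zeta_kernel z l \<partial>lborel) = of_real (pi * R\<^sup>2) * mean_kernel R l"
proof -
 have pole: "(\<integral>z. indicator (cball 0 R) z *\<^sub>R (1 / (z - l)) \<partial>lborel) = - (of_real (pi * R\<^sup>2) * (of_real (1 - theta R l) / l))"
 using R by (simp add: integral_pole_disc theta_eq_min)
 show ?thesis
 proof (cases "norm l < 1")
 case True
 then show ?thesis using pole by (simp add: zeta_kernel_def mean_kernel_def)
 next
 case False
 have i1: "integrable lborel (%z. indicator (cball 0 R) z *\<^sub>R (1 / (z - l)))" using R by (intro integrable_pole_disc) auto
 have ii: "integrable lborel (indicator (cball (0::complex) R) :: complex => real)"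
 using R by (intro integrable_real_indicator) (auto simp: emeasure_disc)
 have i2: "integrable lborel (%z::complex. indicator (cball 0 R) z *\<^sub>R (1 / l))"
 by (rule integrable_scaleR_left) (use ii in simp)
 have i3: "integrable lborel (%z::complex. indicator (cball 0 R) z *\<^sub>R (z / l\<^sup>2))"
 proof (rule integrable_bounded_supp[where B="R / (norm l)\<^sup>2" and r=R])
 show "norm (indicator (cball 0 R) z *\<^sub>R (z / l\<^sup>2)) <= R / (norm l)\<^sup>2" for z
 using R by (auto simp: indicator_def norm_divide norm_power divide_right_mono)
 qed (auto simp: indicator_def)
 have "(\<integral>z. indicator (cball 0 R) z *\<^sub>R zeta_kernel z l \<partial>lborel)
 = (\<integral>z. (indicator (cball 0 R) z *\<^sub>R (1 / (z - l)) + indicator (cball 0 R) z *\<^sub>R (1 / l)) + indicator (cball 0 R) z *\<^sub>R (z / l\<^sup>2) \<partial>lborel)"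
 using False by (intro BI_integral_cong) (auto simp: zeta_kernel_def scaleR_add_right)
 also have "... = ((\<integral>z. indicator (cball 0 R) z *\<^sub>R (1 / (z - l)) \<partial>lborel) + (\<integral>(z::complex). indicator (cball 0 R) z *\<^sub>R (1 / l) \<partial>lborel))
 + (\<integral>(z::complex). indicator (cball 0 R) z *\<^sub>R (z / l\<^sup>2) \<partial>lborel)"
 by (subst BI_integral_add[OF BI_integrable_add[OF i1 i2] i3], subst BI_integral_add[OF i1 i2]) simp
 also have "(\<integral>(z::complex). indicator (cball 0 R) z *\<^sub>R (z / l\<^sup>2) \<partial>lborel) = 0"
 proof -
 have "(\<integral>(z::complex). indicator (cball 0 R) z *\<^sub>R (z / l\<^sup>2) \<partial>lborel) = (\<integral>(z::complex). indicator (cball 0 R) (- 1 * z) *\<^sub>R ((- 1 * z) / l\<^sup>2) \<partial>lborel)"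
 by (rule integral_lborel_rotate[symmetric]) auto
 also have "... = (\<integral>(z::complex). - (indicator (cball 0 R) z *\<^sub>R (z / l\<^sup>2)) \<partial>lborel)"
 by (rule BI_integral_cong) (auto simp: indicator_def)
 finally show ?thesis by simp
 qed
 also have "(\<integral>(z::complex). indicator (cball 0 R) z *\<^sub>R (1 / l) \<partial>lborel) = of_real (pi * R\<^sup>2) * (1 / l)"
 using ii R emeasure_disc[of R 0] by (simp add: measure_def scaleR_conv_of_real)
 finally show ?thesis unfolding pole using False by (simp add: mean_kernel_def right_diff_distrib)
 qed
qed

text \<open>The layer formula for both cutoffs at the same \<open>s\<close> leaves the indicator of
  an annulus, whose transform is known.\<close>

lemma theta_kernel_layer:
 assumes R: "R >= 1"
 shows "theta_kernel R x = (\<integral>s. indicator {0..1} s *\<^sub>R annulus_kernel (sqrt s) (R * sqrt s) x \<partial>lborel)"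
proof -
 have i: "integrable lborel (%t. indicator {0..1} t *\<^sub>R (if norm x <= r * sqrt t then 1 else (0::complex)))" for r
 by (rule integrable_Icc_bounded[where B=1]) auto
 have "theta_kernel R x = (1 / x) * (of_real (theta R x) - of_real (theta 1 x))" by (simp add: theta_kernel_def)
 also have "of_real (theta R x) - of_real (theta 1 x)
 = (\<integral>t. indicator {0..1} t *\<^sub>R (if norm x <= R * sqrt t then 1 else (0::complex)) - indicator {0..1} t *\<^sub>R (if norm x <= 1 * sqrt t then 1 else 0) \<partial>lborel)"
 using R by (subst BI_integral_diff[OF i i], subst theta_layer_cake, simp, subst theta_layer_cake) simp_all
 also have "(1 / x) * ... = (\<integral>t. (1 / x) * (indicator {0..1} t *\<^sub>R (if norm x <= R * sqrt t then 1 else (0::complex)) - indicator {0..1} t *\<^sub>R (if norm x <= 1 * sqrt t then 1 else 0)) \<partial>lborel)"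
 by (rule integral_mult_right_zero[symmetric])
 also have "... = (\<integral>s. indicator {0..1} s *\<^sub>R annulus_kernel (sqrt s) (R * sqrt s) x \<partial>lborel)"
 proof (rule BI_integral_cong)
 fix t :: real
 show "(1 / x) * (indicator {0..1} t *\<^sub>R (if norm x <= R * sqrt t then 1 else (0::complex)) - indicator {0..1} t *\<^sub>R (if norm x <= 1 * sqrt t then 1 else 0))
 = indicator {0..1} t *\<^sub>R annulus_kernel (sqrt t) (R * sqrt t) x"
 proof (cases "t : {0..1}")
 case True
 then have "1 * sqrt t <= R * sqrt t" using R by (intro mult_right_mono) auto
 then show ?thesis using True by (auto simp: annulus_kernel_def)
 qed simp
 qed simp
 finally show ?thesis .
qed

text \<open>In terms of the Bessel function of order one this is
  \<open>J_1 (2 * pi * r) / (pi * r)\<close> for positive \<open>r\<close>. Only its behaviour at 0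
  and at infinity matters, and both follow from \<open>bessel0\<close>.\<close>

definition bessel_mean :: "real => complex" where
 "bessel_mean r = (\<integral>s. indicator {0..1} s *\<^sub>R bessel0 (r * sqrt s) \<partial>lborel)"

lemma integrable_bessel_mean: "integrable lborel (%s. indicator {0..1} s *\<^sub>R bessel0 (r * sqrt s))"
 by (rule integrable_Icc_bounded[where B=1]) (auto intro: norm_bessel0_le_1)

lemma norm_bessel_mean_minus_1_le:
 assumes r: "r >= 0"
 shows "norm (bessel_mean r - 1) <= 2 * pi * r"
proof -
 have i: "integrable lborel (%s::real. indicator {0..1} s *\<^sub>R (1::complex))"
 by (rule integrable_Icc_bounded[where B=1]) auto
 have "bessel_mean r - 1 = (\<integral>s. indicator {0..1} s *\<^sub>R bessel0 (r * sqrt s) - indicator {0..1} s *\<^sub>R 1 \<partial>lborel)"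
 by (subst BI_integral_diff[OF integrable_bessel_mean i]) (simp add: bessel_mean_def)
 also have "... = (\<integral>s. indicator {0..1} s *\<^sub>R (bessel0 (r * sqrt s) - 1) \<partial>lborel)"
 by (simp only: scaleR_diff_right)
 also have "norm ... <= (2 * pi * r) * (1 - 0)"
 proof (rule norm_integral_Icc_le)
 fix s :: real assume s: "s : {0..1}"
 have "norm (bessel0 (r * sqrt s) - 1) <= 2 * pi * \<bar>r * sqrt s\<bar>" by (rule norm_bessel0_minus_1_le)
 also have "\<bar>r * sqrt s\<bar> <= r * 1" using s r unfolding abs_mult by (intro mult_mono) auto
 finally show "norm (bessel0 (r * sqrt s) - 1) <= 2 * pi * r" by simp
 qed (use r in auto)
 finally show ?thesis by simp
qed

lemma bessel_mean_tendsto_0: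
 assumes R: "filterlim R at_top sequentially" and c: "c > 0"
 shows "(%n. bessel_mean (R n * c)) ----> 0"
proof -
 have "(%n. \<integral>s. indicator {0..1} s *\<^sub>R bessel0 (R n * c * sqrt s) \<partial>lborel) ----> (\<integral>(s::real). 0 \<partial>lborel)"
 proof (rule integral_dominated_convergence[where w="indicator {0..1}"])
 show "integrable lborel (indicator {0..1::real} :: real => real)" by (rule integrable_real_indicator) auto
 show "AE s in lborel. norm (indicator {0..1} s *\<^sub>R bessel0 (R n * c * sqrt s)) <= indicator {0..1} s" for n
 by (intro AE_I2) (auto simp: indicator_def norm_bessel0_le_1)
 show "AE s in lborel. (%n. indicator {0..1} s *\<^sub>R bessel0 (R n * c * sqrt s)) ----> 0"
 using AE_lborel_singleton[of 0]
 proof eventually_elim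
 case (elim s)
 show ?case
 proof (cases "s : {0..1}")
 case True
 then have "(%n. bessel0 (R n * (c * sqrt s))) ----> 0" using elim c by (intro bessel0_tendsto_0 R) auto
 then show ?thesis using True by (simp add: mult.assoc)
 qed simp
 qed
 qed measurable
 then show ?thesis by (simp add: bessel_mean_def)
qed

lemma fourier_theta_kernel:
 assumes R: "R >= 1" and xi: "xi ~= 0"
 shows "fourier (theta_kernel R) xi = \<i> / xi * (bessel_mean (R * norm xi) - bessel_mean (norm xi))"
proof -
 define f where "f s x = cis (- (2 * pi * (xi \<bullet> x))) * (indicator {0..1} s *\<^sub>R annulus_kernel (sqrt s) (R * sqrt s) x)" for s x
 have fm: "(%p. f (fst p) (snd p)) : bmeas (lborel \<Otimes>\<^sub>M lborel)"
 unfolding f_def annulus_kernel_def by measurable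
 have int: "integrable (lborel \<Otimes>\<^sub>M lborel) (case_prod f)"
 proof (rule integrableI_bounded)
 show "case_prod f : bmeas (lborel \<Otimes>\<^sub>M lborel)" using fm by (simp add: case_prod_unfold)
 note [measurable] = this
 have "(\<integral>\<^sup>+p. ennreal (norm (case_prod f p)) \<partial>(lborel \<Otimes>\<^sub>M lborel)) = (\<integral>\<^sup>+s. (\<integral>\<^sup>+x. ennreal (norm (f s x)) \<partial>lborel) \<partial>lborel)"
 by (subst lborel.nn_integral_fst[symmetric]) auto
 also have "... <= (\<integral>\<^sup>+s. indicator {0..1::real} s * ennreal (2 * pi * R) \<partial>lborel)"
 proof (rule nn_integral_mono)
 fix s :: real
 show "(\<integral>\<^sup>+x. ennreal (norm (f s x)) \<partial>lborel) <= indicator {0..1} s * ennreal (2 * pi * R)"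
 proof (cases "s : {0..1}")
 case True
 have "R * sqrt s <= R" using True R by simp
 then have "(\<integral>\<^sup>+x. ennreal (norm (f s x)) \<partial>lborel) <= (\<integral>\<^sup>+x. ennreal (1 / norm x) * indicator (cball (0::complex) R) x \<partial>lborel)"
 using True by (intro nn_integral_mono) (auto simp: f_def annulus_kernel_def norm_mult norm_divide indicator_def)
 also have "... = ennreal (2 * pi * R)" using R by (intro nn_integral_inverse_norm_disc) auto
 finally show ?thesis using True by simp
 qed (simp add: f_def)
 qed
 also have "... < \<infinity>" by (simp add: nn_integral_multc)
 finally show "(\<integral>\<^sup>+p. ennreal (norm (case_prod f p)) \<partial>(lborel \<Otimes>\<^sub>M lborel)) < \<infinity>" .
 qed
 have "fourier (theta_kernel R) xi = (\<integral>x. (\<integral>s. f s x \<partial>lborel) \<partial>lborel)"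
 unfolding fourier_cis theta_kernel_layer[OF R] f_def integral_mult_right_zero ..
 also have "... = (\<integral>s. (\<integral>x. f s x \<partial>lborel) \<partial>lborel)" by (rule lborel_pair.Fubini_integral[OF int])
 also have "... = (\<integral>s. \<i> / xi * (indicator {0..1} s *\<^sub>R bessel0 (R * norm xi * sqrt s) - indicator {0..1} s *\<^sub>R bessel0 (norm xi * sqrt s)) \<partial>lborel)"
 proof (rule BI_integral_cong)
 fix s :: real
 show "(\<integral>x. f s x \<partial>lborel) = \<i> / xi * (indicator {0..1} s *\<^sub>R bessel0 (R * norm xi * sqrt s) - indicator {0..1} s *\<^sub>R bessel0 (norm xi * sqrt s))"
 proof (cases "s : {0..1}")
 case True
 then have "1 * sqrt s <= R * sqrt s" using R by (intro mult_right_mono) auto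
 then have "fourier (annulus_kernel (sqrt s) (R * sqrt s)) xi = \<i> / xi * (bessel0 (R * sqrt s * norm xi) - bessel0 (sqrt s * norm xi))"
 using True by (intro fourier_annulus_kernel xi) auto
 then show ?thesis using True by (simp add: f_def fourier_cis mult_ac)
 qed (simp add: f_def)
 qed simp
 also have "... = \<i> / xi * (bessel_mean (R * norm xi) - bessel_mean (norm xi))"
 unfolding integral_mult_right_zero BI_integral_diff[OF integrable_bessel_mean integrable_bessel_mean] bessel_mean_def ..
 finally show ?thesis .
qed

context spec_pp
begin

lemma bbs_theta_kernel:
 assumes R: "R >= 1"
 shows "bbs (theta_kernel R)"
 unfolding bbs_def
proof (intro conjI)
 show "theta_kernel R : bmeas borel" unfolding theta_kernel_def[abs_def] by measurable
 have "norm (theta_kernel R x) <= 1" for x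
 proof -
 have "(norm x)\<^sup>2 / R\<^sup>2 <= (norm x)\<^sup>2 / 1" using R by (intro divide_left_mono) auto
 then have 1: "theta 1 x <= theta R x" unfolding theta_def by (intro max.mono) auto
 have 2: "1 - theta 1 x <= norm x"
 proof (cases "norm x <= 1")
 case True
 then have "(norm x)\<^sup>2 <= norm x" by (simp add: power2_eq_square mult_left_le_one_le)
 then show ?thesis by (simp add: theta_def max_def)
 qed (use theta_nonneg[of 1 x] in linarith)
 have "\<bar>theta R x - theta 1 x\<bar> <= norm x" using 1 2 theta_le_1[of R x] by linarith
 then show ?thesis unfolding theta_kernel_def norm_divide norm_of_real by (cases "x = 0") (auto simp: divide_le_eq_1)
 qed
 then show "\<exists>B. \<forall>x. norm (theta_kernel R x) <= B" by blast
 show "\<exists>r. \<forall>x. norm x > r \<longrightarrow> theta_kernel R x = 0"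
 by (rule exI[of _ R]) (use R in \<open>auto simp: theta_kernel_def theta_eq_0\<close>)
qed

text \<open>The sum over the points is exchanged with the integral over the disc, where the pole is
  integrable. The terms in \<open>z\<close> and \<open>cnj z\<close> are odd and drop out, and with
  them \<open>Psi2\<close> and the conditional intensity.\<close>

lemma disc_average_eq:
 assumes [measurable]: "Psi2 : bmeas M" "Psi0 : bmeas M" and R: "R >= 1"
 shows "AE om in M. integrable (pm (N om)) (mean_kernel R) \<and> disc_average Psi2 Psi0 R om = lin (mean_kernel R) om - Psi0 om"
proof -
 obtain C where C: "C >= 0" "!!l. (\<integral>\<^sup>+z\<in>cball 0 R. ennreal (norm (zeta_kernel z l)) \<partial>lborel) <= ennreal (C * decay l)"
 using nn_integral_zeta_kernel_disc[OF R] by auto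
 have "AE om in M. (\<integral>\<^sup>+l. ennreal (decay l) \<partial>pm (N om)) < \<infinity>"
 by (rule AE_nn_lin_finite[OF _ nn_integral_decay]) measurable
 then show ?thesis using AE_space
 proof eventually_elim
 case (elim om)
 then have om: "om : space M" by simp
 have Nm: "(%_. N om) : K \<rightarrow>\<^sub>M LCFG" for K :: "complex measure" using om by (intro measurable_const) (simp add: space_LCFG LF_def lfN)
 have fin: "(\<integral>\<^sup>+l. ennreal (C * decay l) \<partial>pm (N om)) < \<infinity>"
 proof -
 have "(\<integral>\<^sup>+l. ennreal (C * decay l) \<partial>pm (N om)) = ennreal C * (\<integral>\<^sup>+l. ennreal (decay l) \<partial>pm (N om))"
 using C(1) less_imp_le[OF decay_pos] by (subst nn_integral_cmult[symmetric]) (auto simp: ennreal_mult)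
 then show ?thesis using elim by (simp add: ennreal_mult_less_top)
 qed
 interpret L: sigma_finite_measure "lborel :: complex measure" by (rule sigma_finite_lborel)
 interpret p: sigma_finite_measure "pm (N om)" by (rule sigma_finite_pm[OF lfN[OF om]])
 interpret P: pair_sigma_finite "pm (N om)" "lborel :: complex measure" ..
 define f where "f l z = indicator (cball 0 R) z *\<^sub>R zeta_kernel z l" for l z
 have fm[measurable]: "case_prod f : bmeas (pm (N om) \<Otimes>\<^sub>M lborel)"
 unfolding f_def case_prod_unfold by measurable
 have int: "integrable (pm (N om) \<Otimes>\<^sub>M lborel) (case_prod f)"
 proof (rule integrableI_bounded[OF fm])
 have "(\<integral>\<^sup>+q. ennreal (norm (case_prod f q)) \<partial>(pm (N om) \<Otimes>\<^sub>M lborel)) = (\<integral>\<^sup>+l. (\<integral>\<^sup>+z. ennreal (norm (f l z)) \<partial>lborel) \<partial>pm (N om))"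
 by (subst lborel.nn_integral_fst[symmetric]) auto
 also have "... = (\<integral>\<^sup>+l. (\<integral>\<^sup>+z\<in>cball 0 R. ennreal (norm (zeta_kernel z l)) \<partial>lborel) \<partial>pm (N om))"
 by (intro nn_integral_cong) (auto simp: f_def indicator_def)
 also have "... <= (\<integral>\<^sup>+l. ennreal (C * decay l) \<partial>pm (N om))" by (intro nn_integral_mono C)
 finally show "(\<integral>\<^sup>+q. ennreal (norm (case_prod f q)) \<partial>(pm (N om) \<Otimes>\<^sub>M lborel)) < \<infinity>" using fin by (rule order.strict_trans1)
 qed
 have inner: "(\<integral>z. f l z \<partial>lborel) = of_real (pi * R\<^sup>2) * mean_kernel R l" for l
 unfolding f_def by (rule integral_zeta_kernel_disc[OF R])
 have lz: "(\<integral>l. f l z \<partial>pm (N om)) = indicator (cball 0 R) z *\<^sub>R lin (zeta_kernel z) om" for z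
 unfolding f_def lin_def by (rule integral_scaleR_right)
 have "integrable (pm (N om)) (%l. of_real (pi * R\<^sup>2) * mean_kernel R l)"
 using P.integrable_fst[OF int] unfolding inner .
 moreover have "mean_kernel R = (%l. inverse (of_real (pi * R\<^sup>2)) * (of_real (pi * R\<^sup>2) * mean_kernel R l))"
 using R by (simp add: fun_eq_iff mult.assoc[symmetric] left_inverse del: of_real_mult of_real_power)
 ultimately have mi: "integrable (pm (N om)) (mean_kernel R)" by (metis integrable_mult_right)
 have zi: "integrable lborel (%z. indicator (cball 0 R) z *\<^sub>R lin (zeta_kernel z) om)"
 using P.integrable_snd[OF int] unfolding lz .
 have zint: "(\<integral>z. indicator (cball 0 R) z *\<^sub>R lin (zeta_kernel z) om \<partial>lborel) = of_real (pi * R\<^sup>2) * lin (mean_kernel R) om"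
 using P.Fubini_integral[OF int] unfolding lz inner lin_def integral_mult_right_zero .
 define c :: complex where "c = of_real (pi * cond_intensity M N om)"
 define e where "e z = indicator (cball 0 R) z *\<^sub>R (Psi2 om * z + c * cnj z)" for z
 have em[measurable]: "e : bmeas borel" unfolding e_def[abs_def] by measurable
 have ei: "integrable lborel e"
 proof (rule integrable_bounded_supp[where B="norm (Psi2 om) * R + norm c * R" and r=R])
 fix z
 have "norm (Psi2 om * z + c * cnj z) <= norm (Psi2 om) * R + norm c * R" if "norm z <= R"
 using that by (intro order_trans[OF norm_triangle_ineq] add_mono) (auto simp: norm_mult intro!: mult_left_mono)
 then show "norm (e z) <= norm (Psi2 om) * R + norm c * R" using R by (auto simp: e_def indicator_def)
 qed (auto simp: e_def)
 have e0: "(\<integral>z. e z \<partial>lborel) = 0" by (rule integral_odd_zero) (auto simp: e_def indicator_def)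
 have ii: "integrable lborel (indicator (cball (0::complex) R) :: complex => real)"
 using R by (intro integrable_real_indicator) (auto simp: emeasure_disc)
 have pi0: "integrable lborel (%z::complex. indicator (cball 0 R) z *\<^sub>R Psi0 om)"
 by (rule integrable_scaleR_left) (use ii in simp)
 \<comment> \<open>The zeta series need not converge absolutely at every \<open>z\<close>, but it
   does at almost every \<open>z\<close> of the disc, and this is enough under the integral.\<close>
 have zAE: "AE z in lborel. indicator (cball 0 R) z * (\<integral>\<^sup>+l. ennreal (norm (zeta_kernel z l)) \<partial>pm (N om)) ~= \<infinity>"
 proof (rule nn_integral_PInf_AE)
 have [measurable]: "(%z. \<integral>\<^sup>+l. ennreal (norm (zeta_kernel z l)) \<partial>pm (N om)) : bmeas borel"
 by (rule measurable_nn_integral_pm[where K="%_. N om", OF _ Nm]) measurable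
 show "(%z. indicator (cball 0 R) z * (\<integral>\<^sup>+l. ennreal (norm (zeta_kernel z l)) \<partial>pm (N om))) : bmeas lborel" by measurable
 show "(\<integral>\<^sup>+z. indicator (cball 0 R) z * (\<integral>\<^sup>+l. ennreal (norm (zeta_kernel z l)) \<partial>pm (N om)) \<partial>lborel) ~= \<infinity>"
 using order.strict_trans1[OF nn_integral_zeta_kernel_disc_pm[OF R om C(2)] fin] by simp
 qed
 have "(\<integral>z. indicator (cball 0 R) z *\<^sub>R field Psi2 Psi0 z om \<partial>lborel)
 = (\<integral>z. (indicator (cball 0 R) z *\<^sub>R lin (zeta_kernel z) om - e z) - indicator (cball 0 R) z *\<^sub>R Psi0 om \<partial>lborel)"
 proof (rule integral_cong_AE)
 show "(%z. indicator (cball 0 R) z *\<^sub>R field Psi2 Psi0 z om) : bmeas lborel" using om by measurable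
 show "(%z. (indicator (cball 0 R) z *\<^sub>R lin (zeta_kernel z) om - e z) - indicator (cball 0 R) z *\<^sub>R Psi0 om) : bmeas lborel"
 using borel_measurable_integrable[OF zi] by measurable
 show "AE z in lborel. indicator (cball 0 R) z *\<^sub>R field Psi2 Psi0 z om = (indicator (cball 0 R) z *\<^sub>R lin (zeta_kernel z) om - e z) - indicator (cball 0 R) z *\<^sub>R Psi0 om"
 using zAE
 proof eventually_elim
 case (elim z)
 show ?case
 proof (cases "z : cball 0 R")
 case True
 then have "(\<integral>\<^sup>+l. ennreal (norm (zeta_kernel z l)) \<partial>pm (N om)) < \<infinity>" using elim by (simp add: top.not_eq_extremum)
 then have "integrable (pm (N om)) (zeta_kernel z)" by (intro integrableI_bounded) auto
 then have "zeta N Psi2 z om = lin (zeta_kernel z) om - Psi2 om * z" by (rule zeta_eq_lin[OF om])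
 then show ?thesis using True by (simp add: field_def e_def c_def)
 qed (simp add: e_def)
 qed
 qed
 also have "... = (of_real (pi * R\<^sup>2) * lin (mean_kernel R) om - 0) - (\<integral>(z::complex). indicator (cball 0 R) z *\<^sub>R Psi0 om \<partial>lborel)"
 unfolding BI_integral_diff[OF BI_integrable_diff[OF zi ei] pi0] BI_integral_diff[OF zi ei] zint e0 ..
 also have "(\<integral>(z::complex). indicator (cball 0 R) z *\<^sub>R Psi0 om \<partial>lborel) = of_real (pi * R\<^sup>2) * Psi0 om"
 using ii R emeasure_disc[of R 0] by (simp add: measure_def scaleR_conv_of_real)
 finally have "(\<integral>z. indicator (cball 0 R) z *\<^sub>R field Psi2 Psi0 z om \<partial>lborel) = of_real (pi * R\<^sup>2) * (lin (mean_kernel R) om - Psi0 om)"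
 by (simp add: right_diff_distrib)
 then show ?case using mi R by (simp add: disc_average_def)
 qed
qed

text \<open>Subtracting the average over the unit disc removes \<open>Psi0\<close>, about which
  nothing but its second moment is known. Each average contributes \<open>2 * 16\<close>, together
  64.\<close>

lemma nsq_fourier_theta_kernel_le:
 assumes [measurable]: "Psi2 : bmeas M" "Psi0 : bmeas M"
 and st: "stationary_field M (field Psi2 Psi0)" and R: "R >= 1"
 shows "nsq rh (fourier (theta_kernel R)) <= 64 * (\<integral>\<^sup>+om. (local_mass Psi2 Psi0 0 om)\<^sup>2 \<partial>M)"
proof -
 define Q where "Q = (\<integral>\<^sup>+om. (local_mass Psi2 Psi0 0 om)\<^sup>2 \<partial>M)"
 have "AE om in M. lin (theta_kernel R) om = disc_average Psi2 Psi0 R om + - disc_average Psi2 Psi0 1 om"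
 using disc_average_eq[OF assms(1,2) R] disc_average_eq[OF assms(1,2) order_refl]
 proof eventually_elim
 case (elim om)
 have e: "theta_kernel R = (%l. mean_kernel R l - mean_kernel 1 l)"
 by (simp add: fun_eq_iff theta_kernel_def mean_kernel_def diff_divide_distrib)
 have "lin (theta_kernel R) om = lin (mean_kernel R) om - lin (mean_kernel 1) om"
 unfolding lin_def e using elim by (intro BI_integral_diff) auto
 then show ?case using elim by simp
 qed
 then have "nsq M (lin (theta_kernel R)) = nsq M (%om. disc_average Psi2 Psi0 R om + - disc_average Psi2 Psi0 1 om)"
 unfolding nsq_def by (intro nn_integral_cong_AE) (auto elim!: eventually_mono)
 also have "... <= 2 * nsq M (disc_average Psi2 Psi0 R) + 2 * nsq M (%om. - disc_average Psi2 Psi0 1 om)"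
 by (rule nsq_add_2) measurable
 also have "... <= 2 * (16 * Q) + 2 * (16 * Q)"
 unfolding nsq_uminus Q_def by (intro add_mono mult_left_mono nsq_disc_average_le st R) auto
 also have "... = 64 * Q" by (simp add: mult.assoc[symmetric] distrib_right[symmetric])
 finally have "nsq M (lin (theta_kernel R)) <= 64 * Q" .
 moreover have "nsq rh (fourier (theta_kernel R)) <= nsq M (lin (theta_kernel R))"
 using spectral[OF bbs_theta_kernel[OF R]] vsq_le[OF bbs_theta_kernel[OF R]] by simp
 ultimately show ?thesis by (simp add: Q_def)
qed

text \<open>As \<open>R\<close> grows, \<open>bessel_mean (R * norm xi)\<close> vanishes and the
  transform tends to one that behaves like \<open>1 / norm xi\<close> near 0. The bound uniform in
  \<open>R\<close> survives the limit by Fatou.\<close>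

theorem stationary_field_imp_condA:
 assumes P2: "L2 M Psi2" and P0: "L2 M Psi0"
 and st: "stationary_field M (%z om. zeta N Psi2 z om - Psi0 om - of_real (pi * cond_intensity M N om) * cnj z)"
 shows condA
proof -
 have m: "Psi2 : bmeas M" "Psi0 : bmeas M" and f: "nsq M Psi2 < \<infinity>" "nsq M Psi0 < \<infinity>"
 using P2 P0 by (auto simp: L2_iff_nsq)
 have st': "stationary_field M (field Psi2 Psi0)" using st by (simp add: field_def[abs_def])
 define K where "K = 64 * (\<integral>\<^sup>+om. (local_mass Psi2 Psi0 0 om)\<^sup>2 \<partial>M)"
 have K: "K < \<infinity>" unfolding K_def using local_mass_sq_finite[OF m f] by (simp add: ennreal_mult_less_top)
 define R where "R n = real (Suc n)" for n
 have R1: "R n >= 1" for n by (simp add: R_def)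
 have R: "filterlim R at_top sequentially"
 by (rule filterlim_at_top_mono[OF filterlim_real_sequentially]) (auto simp: R_def)
 define g where "g n xi = ennreal ((norm (fourier (theta_kernel (R n)) xi))\<^sup>2)" for n xi
 have gm[measurable]: "g n : bmeas borel" for n
 using measurable_fourier[OF bbs_measurable[OF bbs_theta_kernel[OF R1[of n]]]] unfolding g_def[abs_def] by measurable
 have gK: "(\<integral>\<^sup>+xi. g n xi \<partial>rh) <= K" for n
 using nsq_fourier_theta_kernel_le[OF m st' R1[of n]] by (simp add: g_def nsq_def K_def)
 have "(\<integral>\<^sup>+xi. liminf (%n. g n xi) \<partial>rh) <= liminf (%n. \<integral>\<^sup>+xi. g n xi \<partial>rh)"
 by (rule nn_integral_liminf) measurable
 also have "... <= limsup (%n. \<integral>\<^sup>+xi. g n xi \<partial>rh)" by (rule Liminf_le_Limsup) simp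
 also have "... <= K" by (rule Limsup_bounded) (use gK in auto)
 finally have fatou: "(\<integral>\<^sup>+xi. liminf (%n. g n xi) \<partial>rh) <= K" .
 \<comment> \<open>Makes \<open>2 * pi * d\<close> equal to 1/2, so that \<open>bessel_mean\<close>
   stays at least 1/2 in modulus for frequencies up to \<open>d\<close>; squared, this is the factor
   4 below.\<close>
 define d where "d = 1 / (4 * pi)"
 have d: "d > 0" by (simp add: d_def)
 have low: "ennreal (1 / (norm xi)\<^sup>2) <= 4 * liminf (%n. g n xi)" if xi: "xi ~= 0" "norm xi <= d" for xi
 proof -
 have "(%n. g n xi) ----> ennreal ((norm (\<i> / xi * (0 - bessel_mean (norm xi))))\<^sup>2)"
 unfolding g_def fourier_theta_kernel[OF R1 xi(1)]
 by (intro tendsto_ennrealI tendsto_intros bessel_mean_tendsto_0 R) (use xi in simp)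
 then have l: "liminf (%n. g n xi) = ennreal ((norm (\<i> / xi * (0 - bessel_mean (norm xi))))\<^sup>2)"
 by (intro lim_imp_Liminf) auto
 have "norm (bessel_mean (norm xi) - 1) <= 2 * pi * norm xi" by (rule norm_bessel_mean_minus_1_le) simp
 also have "... <= 2 * pi * d" using xi by (intro mult_left_mono) auto
 also have "... = 1 / 2" by (simp add: d_def)
 finally have "norm (bessel_mean (norm xi)) >= 1 / 2"
 using norm_triangle_ineq2[of 1 "1 - bessel_mean (norm xi)"] by (simp add: norm_minus_commute)
 then have "(1 / 2)\<^sup>2 <= (norm (bessel_mean (norm xi)))\<^sup>2" by (intro power_mono) auto
 then have "1 <= 4 * (norm (bessel_mean (norm xi)))\<^sup>2" by (simp add: power2_eq_square)
 then have "1 / (norm xi)\<^sup>2 <= (4 * (norm (bessel_mean (norm xi)))\<^sup>2) / (norm xi)\<^sup>2" by (intro divide_right_mono) auto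
 also have "... = 4 * (norm (\<i> / xi * (0 - bessel_mean (norm xi))))\<^sup>2"
 by (simp add: norm_mult norm_divide power_mult_distrib power_divide)
 finally have "ennreal (1 / (norm xi)\<^sup>2) <= ennreal (4 * (norm (\<i> / xi * (0 - bessel_mean (norm xi))))\<^sup>2)" by (rule ennreal_leI)
 also have "... = 4 * liminf (%n. g n xi)" unfolding l by (subst ennreal_mult) auto
 finally show ?thesis .
 qed
 \<comment> \<open>Between \<open>d\<close> and 1 the integrand is bounded and local finiteness of
   the spectral measure suffices.\<close>
 have "(\<integral>\<^sup>+xi\<in>{xi. 0 < norm xi \<and> norm xi <= 1}. ennreal (1 / (norm xi)\<^sup>2) \<partial>rh)
 <= (\<integral>\<^sup>+xi. 4 * liminf (%n. g n xi) + ennreal (1 / d\<^sup>2) * indicator (cball 0 1) xi \<partial>rh)"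
 proof (rule nn_integral_mono)
 fix xi :: complex
 show "ennreal (1 / (norm xi)\<^sup>2) * indicator {xi. 0 < norm xi \<and> norm xi <= 1} xi <= 4 * liminf (%n. g n xi) + ennreal (1 / d\<^sup>2) * indicator (cball 0 1) xi"
 proof (cases "0 < norm xi \<and> norm xi <= 1")
 case True
 show ?thesis
 proof (cases "norm xi <= d")
 case True
 then show ?thesis using low[of xi] by (cases "xi = 0") (auto intro!: add_increasing2 simp: indicator_def)
 next
 case False
 then have "1 / (norm xi)\<^sup>2 <= 1 / d\<^sup>2" using d by (intro divide_left_mono power_mono mult_pos_pos) auto
 then show ?thesis using True by (auto intro!: add_increasing ennreal_leI)
 qed
 qed simp
 qed
 also have "... = 4 * (\<integral>\<^sup>+xi. liminf (%n. g n xi) \<partial>rh) + ennreal (1 / d\<^sup>2) * emeasure rh (cball 0 1)"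
 by (subst nn_integral_add, measurable) (simp add: nn_integral_cmult)
 also have "... <= 4 * K + ennreal (1 / d\<^sup>2) * emeasure rh (cball 0 1)"
 by (intro add_right_mono mult_left_mono fatou) simp
 also have "... < \<infinity>"
 using K emeasure_rho_compact[OF compact_cball[of 0 1]] by (simp add: ennreal_mult_less_top)
 finally show ?thesis .
qed

end

theorem theorem2:
  fixes M :: "'w measure" and N :: "'w \<Rightarrow> complex \<Rightarrow> nat"
    and \<rho> :: "complex measure" and Psi2 :: "'w \<Rightarrow> complex"
  assumes "point_process M N"
    and "stationary_pp M N"
    and "finite_second_moment M N"
    and "spectral_measure M N \<rho>"
    and "L2_tendsto M (Psi 2 N) Psi2"
  shows "((\<integral>\<^sup>+\<xi>\<in>{\<xi>. 0 < norm \<xi> \<and> norm \<xi> \<le> 1}. ennreal (1 / (norm \<xi>)\<^sup>2) \<partial>\<rho>) < \<infinity>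
           \<longleftrightarrow> (\<exists>Psi1. L2_tendsto M (Psi 1 N) Psi1))
       \<and> ((\<exists>Psi1. L2_tendsto M (Psi 1 N) Psi1)
           \<longleftrightarrow> (\<exists>Psi0. L2 M Psi0 \<and>
                 stationary_field M (\<lambda>z \<omega>. zeta N Psi2 z \<omega> - Psi0 \<omega>
                    - of_real (pi * cond_intensity M N \<omega>) * cnj z)))"
proof -
 interpret spec_pp M N \<rho> using assms(1-4) by unfold_locales
 have P2: "L2 M Psi2" using assms(5) by (simp add: L2_tendsto_def)
 \<comment> \<open>The random constant is the limit of the sums in (b).\<close>
 have bc: "\<exists>Psi0. L2 M Psi0 \<and> stationary_field M (%z om. zeta N Psi2 z om - Psi0 om - of_real (pi * cond_intensity M N om) * cnj z)"
 if "\<exists>Psi1. L2_tendsto M (Psi 1 N) Psi1"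
 using that Psi1_imp_stationary_field[OF _ assms(5)] by (auto simp: L2_tendsto_def)
 have ca: condA
 if "\<exists>Psi0. L2 M Psi0 \<and> stationary_field M (%z om. zeta N Psi2 z om - Psi0 om - of_real (pi * cond_intensity M N om) * cnj z)"
 using that stationary_field_imp_condA[OF P2] by blast
 from condA_imp_Psi1 bc ca show ?thesis by blast
qed

end
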